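(* Let $\mathcal S=S_1\oplus\cdots\oplus S_n$ be the minimal operator on the star graph described in the context, with adjoint $\mathcal S^*$. (i) The self-adjoint extensions of $\mathcal S$ in $\mathbf L^2(\mathcal G)$ are exactly the operators $\mathcal T_{\mathcal A,\mathcal B}$, i.e. the restrictions of $\mathcal S^*$ to $$\{\boldsymbol f\in\operatorname{dom}\mathcal S^*:\ \mathcal A\,\boldsymbol f_1^\sharp(v)+\mathcal B\,\boldsymbol f_2^\sharp(v)=0\},$$ where $\mathcal A,\mathcal B\in M_n(\mathbb C)$ satisfy $\operatorname{rank}(\mathcal A\ \ \mathcal B)=n$ and $\mathcal A\mathcal B^*=\mathcal B\mathcal A^*$. (ii) For such $\mathcal A,\mathcal B$ and every $z\in\rho(\mathcal T_0)\cap\rho(\mathcal T_{\mathcal A,\mathcal B})$, $$(\mathcal T_{\mathcal A,\mathcal B}-z)^{-1}=(\mathcal T_0-z)^{-1}-\Gamma_z\,(\mathcal B\mathcal M(z)-\mathcal A)^{-1}\mathcal B\,\Gamma_{\bar z}^*.$$ Here $\mathcal T_0=\mathcal T_{I_n,0_n}$ and $\Gamma_z:\mathbb C^n\to\mathbf L^2(\mathcal G)$ is given by $$\Gamma_z c=\boldsymbol Y(\cdot,z)\,\mathbf P^{\rm t}\begin{pmatrix}-c\\ \mathcal M(z)c\end{pmatrix},\qquad c\in\mathbb C^n.$$ Equivalently, $\Gamma_z(c_j)_1^n=\Big(c_j\,Y_j(\cdot,z)\binom{-1}{m_j(z)}\Big)_{j=1}^n$. (iii) Let $\mathcal C,\mathcal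 D\in M_n(\mathbb C)$ satisfy $$\operatorname{rank}(\mathcal C\ \ \mathcal D)=n,\qquad \mathcal C\mathcal D^*-\mathcal D\mathcal C^*=0_n,\qquad \mathcal B\mathcal C^*-\mathcal A\mathcal D^*=I_n.$$ Define $$\mathcal W_{\mathcal A,\mathcal B}(z)=(\mathcal D\mathcal M(z)-\mathcal C)(\mathcal B\mathcal M(z)-\mathcal A)^{-1},\qquad z\in\mathbb C\setminus\mathbb R.$$ Then $\mathcal W_{\mathcal A,\mathcal B}$ is a meromorphic matrix Nevanlinna function. Moreover, for $z\in\mathbb C\setminus\mathbb R$ and $\boldsymbol g\in\mathbf L^2(\mathcal G)$, $$(\mathcal T_{\mathcal A,\mathcal B}-z)^{-1}\boldsymbol g=\boldsymbol Y(\cdot,z)\,\mathbf P^{\rm t}\begin{pmatrix}\mathcal B^*\\-\mathcal A^*\end{pmatrix}\mathcal W_{\mathcal A,\mathcal B}(z)\,\big(\mathcal B\ \ -\mathcal A\big)\,\mathbf P\, I(\boldsymbol g,z)+\mathcal F(z)\boldsymbol g,$$ where $\mathcal F$ is an entire function whose values are bounded linear operators in $\mathbf L^2(\mathcal G)$.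
   Context: Edge data. Let $n\ge1$. For $j=1,\dots,n$ let $v<v_j$ be real numbers and set $e_j=[v,v_j]$. Let $p_j,q_j\in L^1(e_j;\mathbb R)$ and put $$J=\begin{pmatrix}0&-1\\1&0\end{pmatrix},\qquad V_j(x)=\begin{pmatrix}p_j(x)&q_j(x)\\ q_j(x)&-p_j(x)\end{pmatrix}.$$ Let $\mathbf L^2(e_j)=L^2(e_j,\mathbb C)\oplus L^2(e_j,\mathbb C)$ be the space of $\boldsymbol f_j=(f_j\ \widehat f_j)^{\rm t}$, and let $H_j\boldsymbol f_j=-J\boldsymbol f_j'+V_j\boldsymbol f_j$. Fix $\alpha_j\in[0,\pi)$ and define $$\mathcal D_j=\{\boldsymbol f_j\in\mathbf L^2(e_j):\ \boldsymbol f_j \text{ absolutely continuous},\ H_j\boldsymbol f_j\in\mathbf L^2(e_j),\ \cos\alpha_j f_j(v_j)+\sin\alpha_j\widehat f_j(v_j)=0\}.$$ Define $S_j$ by $\operatorname{dom}S_j=\{\boldsymbol f_j\in\mathcal D_j: f_j(v)=\widehat f_j(v)=0\}$ and $T_j$ by $\operatorname{dom}T_j=\{\boldsymbol f_j\in\mathcal D_j: f_j(v)=0\}$; both act by $H_j$. Let $Y_j(x,z)$ be the $2\times2$ matrix solution of $-JY_j'+V_jY_j=zY_j$ on $e_j$ with $Y_j(v,z)=I_2$, with entries $y_{j,kl}$. Set $$b_j(z)=y_{j,11}(v_j,z)\cos\alpha_j+y_{j,21}(v_j,z)\sin\alpha_j,\qquad c_j(z)=y_{j,12}(v_j,z)\cos\alpha_j+y_{j,22}(v_j,z)\sin\alpha_j,$$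 and define the Weyl–Titchmarsh function $m_j=b_j/c_j$. Graph data. The star graph $\mathcal G$ has central vertex $v$ and edges $e_1,\dots,e_n$. Let $\mathbf L^2(\mathcal G)=\bigoplus_{j=1}^n\mathbf L^2(e_j)$ with elements $\boldsymbol f=(\boldsymbol f_j)_1^n$. Write $$\boldsymbol f_1^\sharp(v)=(f_1(v),\dots,f_n(v))^{\rm t},\qquad \boldsymbol f_2^\sharp(v)=(\widehat f_1(v),\dots,\widehat f_n(v))^{\rm t}.$$ Then $\mathcal S=\bigoplus S_j$ and $\mathcal S^*=\bigoplus S_j^*$, where $\operatorname{dom}S_j^*=\mathcal D_j$ and $S_j^*$ acts by $H_j$. Let $\mathcal M(z)=\operatorname{diag}(m_1(z),\dots,m_n(z))$. For $\boldsymbol x=(x_j)_1^n$ with $x_j\in e_j$, let $\boldsymbol Y(\boldsymbol x,z)=\operatorname{diag}(Y_1(x_1,z),\dots,Y_n(x_n,z))\in M_{2n}(\mathbb C)$. A $\mathbb C^{2n}$-valued function of $\boldsymbol x$ of this form is identified with the element of $\mathbf L^2(\mathcal G)$ whose $j$-th component is the $j$-th pair of entries. Let $\mathbf P\in M_{2n}(\mathbb C)$ be the permutation matrix with $$\mathbf P(u_1,\widehat u_1,u_2,\widehat u_2,\dots,u_n,\widehat u_n)^{\rm t}=(u_1,\dots,u_n,\widehat u_1,\dots,\widehat u_n)^{\rm t}.$$ Define $I(\boldsymbol g,z)=\big(\int_v^{v_j}Y_j(\xi,\bar z)^*\boldsymbol g_j(\xi)\,d\xi\big)_{j=1}^n\in\mathbb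 C^{2n}$, stacked edge by edge. A matrix function $\mathcal N$ is a matrix Nevanlinna function if it is holomorphic at least on $\mathbb C\setminus\mathbb R$ and satisfies $$\mathcal N(\bar z)=\mathcal N(z)^*,\qquad \frac{\mathcal N(z)-\mathcal N(z)^*}{2i\,\operatorname{Im}z}\ge0\quad\text{for } z\in\mathbb C\setminus\mathbb R.$$ *)

theory Defs
  imports "HOL-Analysis.Analysis" "HOL-Complex_Analysis.Complex_Analysis"
begin

no_notation fps_nth (infixl \<open>$\<close> 75)

text \<open>Conventions. The edges are indexed by a finite type 'n (so n = CARD('n)).
 An element of L2(G) is represented by a function f :: 'n => real => complex * complex,
 f j x = (f_j(x), hat f_j(x)); only the values on [v, v_j] matter and elements are
 identified up to equality almost everywhere (eqG). Operators are linear relations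
 (sets of pairs (f, Tf)) closed under this identification.\<close>

type_synonym 'n gfun = "'n \<Rightarrow> real \<Rightarrow> complex \<times> complex"

definition cs :: "complex \<Rightarrow> complex \<times> complex \<Rightarrow> complex \<times> complex" where
  "cs z u = (z * fst u, z * snd u)"

definition addp :: "complex \<times> complex \<Rightarrow> complex \<times> complex \<Rightarrow> complex \<times> complex" where
  "addp u w = (fst u + fst w, snd u + snd w)"

definition subp :: "complex \<times> complex \<Rightarrow> complex \<times> complex \<Rightarrow> complex \<times> complex" where
  "subp u w = (fst u - fst w, snd u - snd w)"

definition sqint :: "real \<Rightarrow> real \<Rightarrow> (real \<Rightarrow> complex) \<Rightarrow> bool" where
  "sqint a b g \<longleftrightarrow> (\<lambda>x. indicator {a..b} x *\<^sub>R g x) \<in> borel_measurable lborel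
      \<and> set_integrable lborel {a..b} (\<lambda>x. (cmod (g x))\<^sup>2)"

definition L2G :: "real \<Rightarrow> ('n::finite \<Rightarrow> real) \<Rightarrow> 'n gfun \<Rightarrow> bool" where
  "L2G v vj f \<longleftrightarrow> (\<forall>j. sqint v (vj j) (\<lambda>x. fst (f j x)) \<and> sqint v (vj j) (\<lambda>x. snd (f j x)))"

definition innerG :: "real \<Rightarrow> ('n::finite \<Rightarrow> real) \<Rightarrow> 'n gfun \<Rightarrow> 'n gfun \<Rightarrow> complex" where
  "innerG v vj f g = (\<Sum>j\<in>UNIV. set_lebesgue_integral lborel {v..vj j}
      (\<lambda>x. fst (f j x) * cnj (fst (g j x)) + snd (f j x) * cnj (snd (g j x))))"

definition normG :: "real \<Rightarrow> ('n::finite \<Rightarrow> real) \<Rightarrow> 'n gfun \<Rightarrow> real" where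
  "normG v vj f = sqrt (Re (innerG v vj f f))"

definition eqG :: "real \<Rightarrow> ('n::finite \<Rightarrow> real) \<Rightarrow> 'n gfun \<Rightarrow> 'n gfun \<Rightarrow> bool" where
  "eqG v vj f g \<longleftrightarrow> (\<forall>j. AE x in lborel. x \<in> {v..vj j} \<longrightarrow> f j x = g j x)"

definition abs_cont :: "real \<Rightarrow> real \<Rightarrow> (real \<Rightarrow> complex) \<Rightarrow> bool" where
  "abs_cont a b g \<longleftrightarrow> (\<forall>\<epsilon>>0. \<exists>\<delta>>0. \<forall>I :: (real \<times> real) list.
      (\<forall>(s,t)\<in>set I. a \<le> s \<and> s \<le> t \<and> t \<le> b) \<and> sorted_wrt (\<lambda>I1 I2. snd I1 \<le> fst I2) I
      \<and> (\<Sum>(s,t)\<leftarrow>I. t - s) < \<delta> \<longrightarrow> (\<Sum>(s,t)\<leftarrow>I. cmod (g t - g s)) < \<epsilon>)"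

text \<open>The differential expression H f = -J f' + V f on every edge.\<close>
definition Hop :: "('n \<Rightarrow> real \<Rightarrow> real) \<Rightarrow> ('n \<Rightarrow> real \<Rightarrow> real) \<Rightarrow> 'n gfun \<Rightarrow> 'n gfun" where
  "Hop p q f = (\<lambda>j x.
     (vector_derivative (\<lambda>t. snd (f j t)) (at x)
        + of_real (p j x) * fst (f j x) + of_real (q j x) * snd (f j x),
      - vector_derivative (\<lambda>t. fst (f j t)) (at x)
        + of_real (q j x) * fst (f j x) - of_real (p j x) * snd (f j x)))"

definition Dmax :: "real \<Rightarrow> ('n::finite \<Rightarrow> real) \<Rightarrow> ('n \<Rightarrow> real \<Rightarrow> real) \<Rightarrow> ('n \<Rightarrow> real \<Rightarrow> real)
    \<Rightarrow> ('n \<Rightarrow> real) \<Rightarrow> 'n gfun set" where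
  "Dmax v vj p q \<alpha> = {f. L2G v vj f
      \<and> (\<forall>j. abs_cont v (vj j) (\<lambda>x. fst (f j x)) \<and> abs_cont v (vj j) (\<lambda>x. snd (f j x)))
      \<and> L2G v vj (Hop p q f)
      \<and> (\<forall>j. of_real (cos (\<alpha> j)) * fst (f j (vj j)) + of_real (sin (\<alpha> j)) * snd (f j (vj j)) = 0)}"

definition opRel :: "real \<Rightarrow> ('n::finite \<Rightarrow> real) \<Rightarrow> ('n \<Rightarrow> real \<Rightarrow> real) \<Rightarrow> ('n \<Rightarrow> real \<Rightarrow> real)
    \<Rightarrow> 'n gfun set \<Rightarrow> ('n gfun \<times> 'n gfun) set" where
  "opRel v vj p q D = {(f, g). L2G v vj f \<and> L2G v vj g
      \<and> (\<exists>f0\<in>D. eqG v vj f f0 \<and> eqG v vj g (Hop p q f0))}"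

definition Smin :: "real \<Rightarrow> ('n::finite \<Rightarrow> real) \<Rightarrow> ('n \<Rightarrow> real \<Rightarrow> real) \<Rightarrow> ('n \<Rightarrow> real \<Rightarrow> real)
    \<Rightarrow> ('n \<Rightarrow> real) \<Rightarrow> ('n gfun \<times> 'n gfun) set" where
  "Smin v vj p q \<alpha> = opRel v vj p q
      {f \<in> Dmax v vj p q \<alpha>. \<forall>j. fst (f j v) = 0 \<and> snd (f j v) = 0}"

definition sharp1 :: "real \<Rightarrow> 'n gfun \<Rightarrow> complex ^ 'n" where
  "sharp1 v f = (\<chi> j. fst (f j v))"
definition sharp2 :: "real \<Rightarrow> 'n gfun \<Rightarrow> complex ^ 'n" where
  "sharp2 v f = (\<chi> j. snd (f j v))"

definition TAB :: "real \<Rightarrow> ('n::finite \<Rightarrow> real) \<Rightarrow> ('n \<Rightarrow> real \<Rightarrow> real) \<Rightarrow> ('n \<Rightarrow> real \<Rightarrow> real)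
    \<Rightarrow> ('n \<Rightarrow> real) \<Rightarrow> complex^'n^'n \<Rightarrow> complex^'n^'n \<Rightarrow> ('n gfun \<times> 'n gfun) set" where
  "TAB v vj p q \<alpha> A B = opRel v vj p q
      {f \<in> Dmax v vj p q \<alpha>. A *v sharp1 v f + B *v sharp2 v f = 0}"

definition adjG :: "real \<Rightarrow> ('n::finite \<Rightarrow> real) \<Rightarrow> ('n gfun \<times> 'n gfun) set \<Rightarrow> ('n gfun \<times> 'n gfun) set" where
  "adjG v vj T = {(g, h). L2G v vj g \<and> L2G v vj h
      \<and> (\<forall>(f, k)\<in>T. innerG v vj k g = innerG v vj f h)}"

definition self_adjoint_ext :: "real \<Rightarrow> ('n::finite \<Rightarrow> real) \<Rightarrow> ('n gfun \<times> 'n gfun) set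
    \<Rightarrow> ('n gfun \<times> 'n gfun) set \<Rightarrow> bool" where
  "self_adjoint_ext v vj S T \<longleftrightarrow> S \<subseteq> T \<and> adjG v vj T = T"

definition hcat :: "complex^'n^'m \<Rightarrow> complex^'n^'m \<Rightarrow> complex^('n + 'n)^'m" where
  "hcat A B = (\<chi> i k. case k of Inl a \<Rightarrow> A $ i $ a | Inr b \<Rightarrow> B $ i $ b)"

definition adjm :: "complex^'n^'m \<Rightarrow> complex^'m^'n" where
  "adjm A = (\<chi> i k. cnj (A $ k $ i))"

text \<open>Fundamental matrix Y_j(x,z) on e_j (set to 0 outside e_j so that it is unique).\<close>
definition Yfun :: "real \<Rightarrow> ('n \<Rightarrow> real) \<Rightarrow> ('n \<Rightarrow> real \<Rightarrow> real) \<Rightarrow> ('n \<Rightarrow> real \<Rightarrow> real)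
    \<Rightarrow> 'n \<Rightarrow> complex \<Rightarrow> real \<Rightarrow> complex^2^2" where
  "Yfun v vj p q j z = (THE Y. Y v = mat 1
      \<and> (\<forall>x. x \<notin> {v..vj j} \<longrightarrow> Y x = 0)
      \<and> (\<forall>a b. abs_cont v (vj j) (\<lambda>x. Y x $ a $ b))
      \<and> (AE x in lborel. x \<in> {v..vj j} \<longrightarrow>
           (\<forall>a b. (\<lambda>t. Y t $ a $ b) differentiable (at x))
         \<and> (\<forall>b. vector_derivative (\<lambda>t. Y t $ 2 $ b) (at x)
                  + of_real (p j x) * Y x $ 1 $ b + of_real (q j x) * Y x $ 2 $ b = z * Y x $ 1 $ b
              \<and> - vector_derivative (\<lambda>t. Y t $ 1 $ b) (at x)
                  + of_real (q j x) * Y x $ 1 $ b - of_real (p j x) * Y x $ 2 $ b = z * Y x $ 2 $ b)))"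

definition bfun where
  "bfun v vj p q \<alpha> j z = Yfun v vj p q j z (vj j) $ 1 $ 1 * of_real (cos (\<alpha> j))
      + Yfun v vj p q j z (vj j) $ 2 $ 1 * of_real (sin (\<alpha> j))"

definition cfun where
  "cfun v vj p q \<alpha> j z = Yfun v vj p q j z (vj j) $ 1 $ 2 * of_real (cos (\<alpha> j))
      + Yfun v vj p q j z (vj j) $ 2 $ 2 * of_real (sin (\<alpha> j))"

definition mfun where
  "mfun v vj p q \<alpha> j z = bfun v vj p q \<alpha> j z / cfun v vj p q \<alpha> j z"

definition Mmat :: "real \<Rightarrow> ('n::finite \<Rightarrow> real) \<Rightarrow> ('n \<Rightarrow> real \<Rightarrow> real) \<Rightarrow> ('n \<Rightarrow> real \<Rightarrow> real)
    \<Rightarrow> ('n \<Rightarrow> real) \<Rightarrow> complex \<Rightarrow> complex^'n^'n" where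
  "Mmat v vj p q \<alpha> z = (\<chi> i k. if i = k then mfun v vj p q \<alpha> i z else 0)"

definition GammaZ :: "real \<Rightarrow> ('n::finite \<Rightarrow> real) \<Rightarrow> ('n \<Rightarrow> real \<Rightarrow> real) \<Rightarrow> ('n \<Rightarrow> real \<Rightarrow> real)
    \<Rightarrow> ('n \<Rightarrow> real) \<Rightarrow> complex \<Rightarrow> complex^'n \<Rightarrow> 'n gfun" where
  "GammaZ v vj p q \<alpha> z c = (\<lambda>j x.
     (c $ j * (- Yfun v vj p q j z x $ 1 $ 1 + Yfun v vj p q j z x $ 1 $ 2 * mfun v vj p q \<alpha> j z),
      c $ j * (- Yfun v vj p q j z x $ 2 $ 1 + Yfun v vj p q j z x $ 2 $ 2 * mfun v vj p q \<alpha> j z)))"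

definition Gamma_adj :: "real \<Rightarrow> ('n::finite \<Rightarrow> real) \<Rightarrow> ('n \<Rightarrow> real \<Rightarrow> real) \<Rightarrow> ('n \<Rightarrow> real \<Rightarrow> real)
    \<Rightarrow> ('n \<Rightarrow> real) \<Rightarrow> complex \<Rightarrow> 'n gfun \<Rightarrow> complex^'n" where
  "Gamma_adj v vj p q \<alpha> w g = (THE c. \<forall>d. innerG v vj (GammaZ v vj p q \<alpha> w d) g
      = (\<Sum>j\<in>UNIV. d $ j * cnj (c $ j)))"

text \<open>Resolvent set and resolvent of a relation T: (T - z) f = g iff (f, g + z f) in T.\<close>
definition in_resolvent :: "real \<Rightarrow> ('n::finite \<Rightarrow> real) \<Rightarrow> ('n gfun \<times> 'n gfun) set \<Rightarrow> complex \<Rightarrow> bool" where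
  "in_resolvent v vj T z \<longleftrightarrow>
     (\<forall>g. L2G v vj g \<longrightarrow> (\<exists>f. (f, \<lambda>j x. addp (g j x) (cs z (f j x))) \<in> T))
   \<and> (\<exists>C. \<forall>f g. (f, \<lambda>j x. addp (g j x) (cs z (f j x))) \<in> T \<longrightarrow> normG v vj f \<le> C * normG v vj g)"

definition resolv :: "('n gfun \<times> 'n gfun) set \<Rightarrow> complex \<Rightarrow> 'n gfun \<Rightarrow> 'n gfun" where
  "resolv T z g = (SOME f. (f, \<lambda>j x. addp (g j x) (cs z (f j x))) \<in> T)"

definition mero_nevanlinna :: "(complex \<Rightarrow> complex^'n^'n) \<Rightarrow> bool" where
  "mero_nevanlinna W \<longleftrightarrow>
     (\<forall>i k. (\<lambda>z. W z $ i $ k) meromorphic_on UNIV)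
   \<and> (\<forall>i k. (\<lambda>z. W z $ i $ k) holomorphic_on {z. Im z \<noteq> 0})
   \<and> (\<forall>z. Im z \<noteq> 0 \<longrightarrow> W (cnj z) = adjm (W z))
   \<and> (\<forall>z x. Im z \<noteq> 0 \<longrightarrow>
        (let r = (\<Sum>i\<in>UNIV. \<Sum>k\<in>UNIV. cnj (x $ i) * (W z $ i $ k - cnj (W z $ k $ i)) * x $ k)
                 / (2 * \<i> * of_real (Im z))
         in Im r = 0 \<and> 0 \<le> Re r))"

definition bdd_lin_op :: "real \<Rightarrow> ('n::finite \<Rightarrow> real) \<Rightarrow> ('n gfun \<Rightarrow> 'n gfun) \<Rightarrow> bool" where
  "bdd_lin_op v vj T \<longleftrightarrow>
     (\<forall>f. L2G v vj f \<longrightarrow> L2G v vj (T f))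
   \<and> (\<forall>f g. L2G v vj f \<longrightarrow> L2G v vj g \<longrightarrow> eqG v vj f g \<longrightarrow> eqG v vj (T f) (T g))
   \<and> (\<forall>f g a b. L2G v vj f \<longrightarrow> L2G v vj g \<longrightarrow>
        eqG v vj (T (\<lambda>j x. addp (cs a (f j x)) (cs b (g j x))))
                 (\<lambda>j x. addp (cs a (T f j x)) (cs b (T g j x))))
   \<and> (\<exists>C. \<forall>f. L2G v vj f \<longrightarrow> normG v vj (T f) \<le> C * normG v vj f)"

definition entire_bdd_opfun :: "real \<Rightarrow> ('n::finite \<Rightarrow> real) \<Rightarrow> (complex \<Rightarrow> 'n gfun \<Rightarrow> 'n gfun) \<Rightarrow> bool" where
  "entire_bdd_opfun v vj F \<longleftrightarrow>
     (\<forall>z. bdd_lin_op v vj (F z))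
   \<and> (\<forall>z0. \<exists>F'. bdd_lin_op v vj F' \<and>
        (\<forall>\<epsilon>>0. \<exists>\<delta>>0. \<forall>z. z \<noteq> z0 \<and> cmod (z - z0) < \<delta> \<longrightarrow>
           (\<forall>f. L2G v vj f \<longrightarrow>
              normG v vj (\<lambda>j x. subp (cs (1 / (z - z0)) (subp (F z f j x) (F z0 f j x))) (F' f j x))
                \<le> \<epsilon> * normG v vj f)))"

definition Ivec :: "real \<Rightarrow> ('n::finite \<Rightarrow> real) \<Rightarrow> ('n \<Rightarrow> real \<Rightarrow> real) \<Rightarrow> ('n \<Rightarrow> real \<Rightarrow> real)
    \<Rightarrow> complex \<Rightarrow> 'n gfun \<Rightarrow> 'n \<Rightarrow> complex \<times> complex" where
  "Ivec v vj p q z g j =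
     (set_lebesgue_integral lborel {v..vj j} (\<lambda>\<xi>.
         cnj (Yfun v vj p q j (cnj z) \<xi> $ 1 $ 1) * fst (g j \<xi>)
       + cnj (Yfun v vj p q j (cnj z) \<xi> $ 2 $ 1) * snd (g j \<xi>)),
      set_lebesgue_integral lborel {v..vj j} (\<lambda>\<xi>.
         cnj (Yfun v vj p q j (cnj z) \<xi> $ 1 $ 2) * fst (g j \<xi>)
       + cnj (Yfun v vj p q j (cnj z) \<xi> $ 2 $ 2) * snd (g j \<xi>)))"

text \<open>The term Y(.,z) P^t (B^*; -A^*) W(z) (B  -A) P I(g,z), with the permutation P
 written out: (B -A) P I = B u - A uh where (u_j, uh_j) = I(g,z)_j, and
 P^t (s; sh) places (s_j, sh_j) on edge j.\<close>
definition Wterm :: "real \<Rightarrow> ('n::finite \<Rightarrow> real) \<Rightarrow> ('n \<Rightarrow> real \<Rightarrow> real) \<Rightarrow> ('n \<Rightarrow> real \<Rightarrow> real)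
    \<Rightarrow> complex^'n^'n \<Rightarrow> complex^'n^'n \<Rightarrow> complex^'n^'n \<Rightarrow> complex \<Rightarrow> 'n gfun \<Rightarrow> 'n gfun" where
  "Wterm v vj p q A B W z g =
    (let u = (\<chi> j. fst (Ivec v vj p q z g j));
         uh = (\<chi> j. snd (Ivec v vj p q z g j));
         r = W *v (B *v u - A *v uh);
         s = adjm B *v r;
         sh = - (adjm A *v r)
     in (\<lambda>j x. (Yfun v vj p q j z x $ 1 $ 1 * s $ j + Yfun v vj p q j z x $ 1 $ 2 * sh $ j,
                Yfun v vj p q j z x $ 2 $ 1 * s $ j + Yfun v vj p q j z x $ 2 $ 2 * sh $ j)))"

end

theory Submission
  imports Defs
begin

text \<open>
  Absolutely continuous functions are indefinite integrals: the variation function splits a real one into two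
  monotone ones, whose Stieltjes measures are absolutely continuous, so that Radon-Nikodym applies; the a.e.
  derivative is then Lebesgue's differentiation theorem. Hence solutions of \<open>H f = z f + k\<close> are given on each edge
  by variation of constants from the fundamental matrix, and Green's formula holds on the maximal domain with
  boundary form \<open>\<omega>(f, g) = \<Sum>\<^sub>j fst (f\<^sub>j(v)) cnj (snd (g\<^sub>j(v))) - snd (f\<^sub>j(v)) cnj (fst (g\<^sub>j(v)))\<close>.

  (i) The adjoint of the minimal relation is the maximal one, and all boundary values at \<open>v\<close> occur. Therefore the
  self-adjoint extensions correspond to the subspaces that equal their own \<open>\<omega>\<close>-complement, and these are exactly the
  kernels of \<open>(A B)\<close> with full rank and \<open>A B\<^sup>* = B A\<^sup>*\<close>.

  (ii), (iii) By variation of constants the resolvent is determined by a linear system for the boundary values.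
  Solving it with \<open>(B M - A)\<^sup>-\<^sup>1\<close> gives Krein's formula; replacing \<open>M\<close> by \<open>W\<close> through the symplectic relations between
  \<open>A, B, C, D\<close> leaves a remainder whose kernel is a polynomial in the entries of the fundamental matrix, hence entire.
  The same relations give \<open>W - W\<^sup>* = X\<^sup>* (M - M\<^sup>*) X\<close> with \<open>X = (B M - A)\<^sup>-\<^sup>1\<close>.
\<close>

section \<open>Variation and absolute continuity\<close>

text \<open>Three obstacles shape the proof. Elements of L2(G) are classes modulo null sets, while
  \<open>Hop\<close> uses the two-sided pointwise derivative, which is arbitrary where it does not
  exist, and \<open>L2G\<close> asks for Borel measurability; so the pointwise derivative of a
  continuous function must be shown measurable before \<open>Dmax\<close> can be handled. The
  adjoint of the minimal relation is found without weak derivatives: on every edge the range of the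
  minimal operator is the orthogonal complement of one solution of \<open>H w = 0\<close> with the
  outer boundary condition, so an element of the adjoint differs from a particular solution by a
  multiple of it. The remainder in (iii) must not see the poles of \<open>M\<close> and
  \<open>X = matrix_inv (B ** M - A)\<close>. The symplectic relations give
  \<open>adjm B ** W = adjm D - X\<close> and \<open>adjm A ** W = adjm C - M ** X\<close>, so
  splitting off the W term leaves constant matrices in their place. Differentiability in operator
  norm then follows from pointwise holomorphy and locally uniform bounds, because Cauchy's
  inequality makes the Taylor remainder uniform in the argument.\<close>

definition chain :: "real \<Rightarrow> real \<Rightarrow> (real \<times> real) list \<Rightarrow> bool" where
  "chain a b I \<longleftrightarrow> (\<forall>(s,t)\<in>set I. a \<le> s \<and> s \<le> t \<and> t \<le> b)
     \<and> sorted_wrt (\<lambda>I1 I2. snd I1 \<le> fst I2) I"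

definition chain_len :: "(real \<times> real) list \<Rightarrow> real" where
  "chain_len I = (\<Sum>(s,t)\<leftarrow>I. t - s)"

definition vsum :: "(real \<Rightarrow> complex) \<Rightarrow> (real \<times> real) list \<Rightarrow> real" where
  "vsum g I = (\<Sum>(s,t)\<leftarrow>I. cmod (g t - g s))"

definition variation :: "(real \<Rightarrow> complex) \<Rightarrow> real \<Rightarrow> real \<Rightarrow> real" where
  "variation g a b = Sup (vsum g ` {I. chain a b I})"

lemma abs_cont_chain:
  "abs_cont a b g \<longleftrightarrow> (\<forall>\<epsilon>>0. \<exists>\<delta>>0. \<forall>I. chain a b I \<and> chain_len I < \<delta> \<longrightarrow> vsum g I < \<epsilon>)"
  unfolding abs_cont_def chain_def chain_len_def vsum_def by (simp add: conj_assoc)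

lemma chain_Nil [simp]: "chain a b []"
  by (simp add: chain_def)

lemma chain_Cons: "chain a b ((s,t) # I) \<longleftrightarrow> a \<le> s \<and> s \<le> t \<and> t \<le> b \<and> chain t b I"
  unfolding chain_def by force

lemma chain_mono: "chain a b I \<Longrightarrow> c \<le> a \<Longrightarrow> b \<le> d \<Longrightarrow> chain c d I"
  unfolding chain_def by force

lemma chain_append:
  assumes "chain a x I" "chain x b J" "a \<le> x" "x \<le> b"
  shows "chain a b (I @ J)"
  using assms
proof (induction I arbitrary: a)
  case Nil
  then show ?case by (auto intro: chain_mono)
next
  case (Cons st I)
  obtain s t where st: "st = (s,t)" by force
  with Cons show ?case by (auto simp: chain_Cons)
qed

lemma chain_len_simps [simp]:
  "chain_len [] = 0" "chain_len ((s,t) # I) = (t - s) + chain_len I"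
  "chain_len (I @ J) = chain_len I + chain_len J"
  by (simp_all add: chain_len_def)

lemma vsum_simps [simp]:
  "vsum g [] = 0" "vsum g ((s,t) # I) = cmod (g t - g s) + vsum g I"
  "vsum g (I @ J) = vsum g I + vsum g J"
  by (simp_all add: vsum_def)

lemma chain_len_le: "chain a b I \<Longrightarrow> a \<le> b \<Longrightarrow> chain_len I \<le> b - a"
proof (induction I arbitrary: a)
  case (Cons st I)
  obtain s t where st: "st = (s,t)" by force
  with Cons.prems have "a \<le> s" "s \<le> t" "t \<le> b" "chain t b I" by (auto simp: chain_Cons)
  with Cons.IH[of t] show ?case by (simp add: st)
qed simp

text \<open>Applied to truncations \<open>min _ x\<close> and \<open>max _ x\<close>, which cut a
  chain at a point, and later to the clamp onto an interval.\<close>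

lemma chain_map:
  assumes "chain a b I" "\<And>x y. a \<le> x \<Longrightarrow> x \<le> y \<Longrightarrow> y \<le> b \<Longrightarrow> \<phi> x \<le> \<phi> y"
    and "\<And>x. a \<le> x \<Longrightarrow> x \<le> b \<Longrightarrow> c \<le> \<phi> x \<and> \<phi> x \<le> d"
  shows "chain c d (map (map_prod \<phi> \<phi>) I)"
proof -
  \<comment> \<open>The left ends are generalised because the tail of a chain starts at
    \<open>t\<close> and its image at \<open>\<phi> t\<close>.\<close>
  have "chain c' d (map (map_prod \<phi> \<phi>) I)" if "chain a' b I" "a \<le> a'"
    "\<And>x. a' \<le> x \<Longrightarrow> x \<le> b \<Longrightarrow> c' \<le> \<phi> x \<and> \<phi> x \<le> d" for a' c'
    using that
  proof (induction I arbitrary: a' c')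
    case (Cons st I)
    obtain s t where st: "st = (s,t)" by force
    with Cons.prems have *: "a' \<le> s" "s \<le> t" "t \<le> b" "chain t b I" by (auto simp: chain_Cons)
    have "chain (\<phi> t) d (map (map_prod \<phi> \<phi>) I)"
      using * Cons.prems assms(2) by (intro Cons.IH[of t]) (fastforce intro: order_trans)+
    then show ?case using * Cons.prems assms(2)[of s t] by (simp add: st chain_Cons)
  qed simp
  from this[of a c] assms show ?thesis by simp
qed

text \<open>An interval containing \<open>x\<close> is cut there by the triangle inequality; one
  lying on a single side becomes the degenerate pair \<open>(x, x)\<close> in the other list and
  contributes 0. This avoids inserting \<open>x\<close> into the list.\<close>

lemma vsum_clamp:
  "vsum g I \<le> vsum g (map (map_prod (\<lambda>y. min y x) (\<lambda>y. min y x)) I)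
     + vsum g (map (map_prod (\<lambda>y. max y x) (\<lambda>y. max y x)) I)"
proof (induction I)
  case (Cons st I)
  obtain s t where st: "st = (s,t)" by force
  have "g t - g s = (g (min t x) - g (min s x)) + (g (max t x) - g (max s x))"
    by (simp add: min_def max_def)
  then have "cmod (g t - g s) \<le> cmod (g (min t x) - g (min s x)) + cmod (g (max t x) - g (max s x))"
    by (metis norm_triangle_ineq)
  with Cons.IH show ?case by (simp add: st)
qed simp

text \<open>An absolutely continuous function has bounded variation: with \<open>\<delta>\<close>
  belonging to the tolerance 1, the interval is cut into \<open>n\<close> pieces shorter than
  \<open>\<delta>\<close>, and each contributes less than 1.\<close>

lemma abs_cont_vsum_bounded:
  assumes "abs_cont a b g" "a \<le> b"
  obtains C where "\<And>I. chain a b I \<Longrightarrow> vsum g I \<le> C"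
proof -
  obtain \<delta> where \<delta>: "\<delta> > 0" "\<And>I. chain a b I \<Longrightarrow> chain_len I < \<delta> \<Longrightarrow> vsum g I < 1"
    using assms(1) unfolding abs_cont_chain by (metis zero_less_one)
  have *: "vsum g I \<le> real n" if "a \<le> y" "y \<le> b" "y - a \<le> real n * (\<delta>/2)" "chain a y I" for n y I
    using that
  proof (induction n arbitrary: y I)
    case 0
    then have "y = a" by simp
    with 0 show ?case
    proof (induction I)
      case (Cons st I)
      obtain s t where st: "st = (s,t)" by force
      with Cons.prems have 1: "a \<le> s" "s \<le> t" "t \<le> a" "chain t a I" by (auto simp: chain_Cons)
      then have 2: "s = a" "t = a" by linarith+
      with 1 Cons show ?case by (simp add: st)
    qed simp
  next
    case (Suc n)
    \<comment> \<open>Half of \<open>\<delta>\<close> makes the last piece strictly shorter than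
      \<open>\<delta>\<close>; the maximum keeps the cut inside the interval when \<open>y\<close>
      is close to \<open>a\<close>.\<close>
    define x where "x = max a (y - \<delta>/2)"
    have x: "a \<le> x" "x \<le> y" "x - a \<le> real n * (\<delta>/2)" "y - x \<le> \<delta>/2"
      using Suc.prems \<delta> by (auto simp: x_def max_def field_simps)
    have "vsum g (map (map_prod (\<lambda>y. min y x) (\<lambda>y. min y x)) I) \<le> n"
      using x Suc.prems by (intro Suc.IH[of x] chain_map[of a y]) auto
    moreover
    have ch: "chain x y (map (map_prod (\<lambda>y. max y x) (\<lambda>y. max y x)) I)"
      using x Suc.prems by (intro chain_map[of a y]) auto
    have "vsum g (map (map_prod (\<lambda>y. max y x) (\<lambda>y. max y x)) I) < 1"
      using chain_len_le[OF ch] x \<delta>(1) Suc.prems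
      by (intro \<delta>(2) chain_mono[OF ch]) auto
    ultimately show ?case using vsum_clamp[of g I x] by simp
  qed
  obtain n where "b - a \<le> real n * (\<delta>/2)"
    using \<delta>(1) by (metis half_gt_zero_iff mult.commute ex_less_of_nat_mult less_imp_le)
  with * assms that show thesis by (metis order_refl)
qed

locale abs_cont_on =
  fixes a b :: real and g :: "real \<Rightarrow> complex"
  assumes ab: "a \<le> b" and ac: "abs_cont a b g"
begin

lemma bdd_above_vsum:
  assumes xy: "a \<le> x" "y \<le> b"
  shows "bdd_above (vsum g ` {I. chain x y I})"
proof -
  obtain C where C: "\<And>I. chain a b I \<Longrightarrow> vsum g I \<le> C" using abs_cont_vsum_bounded[OF ac ab] by blast
  show ?thesis using chain_mono[of x y _ a b] xy C by (intro bdd_aboveI[of _ C]) auto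
qed

lemma vsum_le_variation: "a \<le> x \<Longrightarrow> y \<le> b \<Longrightarrow> chain x y I \<Longrightarrow> vsum g I \<le> variation g x y"
  unfolding variation_def by (intro cSup_upper bdd_above_vsum) auto

lemma variation_least: "(\<And>I. chain x y I \<Longrightarrow> vsum g I \<le> C) \<Longrightarrow> variation g x y \<le> C"
  unfolding variation_def by (rule cSup_least) (auto intro: exI[of _ "[]"])

lemma variation_step:
  assumes "a \<le> x" "x \<le> y" "y \<le> b"
  shows "variation g a x + cmod (g y - g x) \<le> variation g a y"
proof -
  have "variation g a x \<le> variation g a y - cmod (g y - g x)"
  proof (rule variation_least)
    fix I assume "chain a x I"
    then have "chain a y (I @ [(x,y)])"
      using assms by (intro chain_append[of a x]) (auto simp: chain_Cons)
    from vsum_le_variation[OF _ _ this] show "vsum g I \<le> variation g a y - cmod (g y - g x)"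
      using assms by simp
  qed
  then show ?thesis by simp
qed

lemma variation_triangle:
  assumes "a \<le> x" "x \<le> y" "y \<le> b"
  shows "variation g a y \<le> variation g a x + variation g x y"
proof (rule variation_least)
  fix I assume I: "chain a y I"
  have "vsum g (map (map_prod (\<lambda>y. min y x) (\<lambda>y. min y x)) I) \<le> variation g a x"
    using assms I by (intro vsum_le_variation chain_map[OF I]) auto
  moreover have "vsum g (map (map_prod (\<lambda>y. max y x) (\<lambda>y. max y x)) I) \<le> variation g x y"
    using assms I by (intro vsum_le_variation chain_map[OF I]) auto
  ultimately show "vsum g I \<le> variation g a x + variation g x y"
    using vsum_clamp[of g I x] by simp
qed

lemma variation_approx:
  fixes \<eta> :: real
  assumes "0 < \<eta>"
  obtains I where "chain x y I" "variation g x y \<le> vsum g I + \<eta>"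
proof -
  have "\<not> (\<forall>I. chain x y I \<longrightarrow> vsum g I \<le> variation g x y - \<eta>)"
    using variation_least[of x y "variation g x y - \<eta>"] assms by force
  then show thesis using that by force
qed

text \<open>Every interval of \<open>I\<close> is replaced by a nearly optimal chain inside it, at a
  loss of \<open>\<eta>\<close> each. The total length does not grow, so a \<open>\<delta>\<close>
  that works for \<open>g\<close> also works for its variation function.\<close>

lemma variation_chain:
  fixes \<eta> :: real
  assumes "chain c b I" "a \<le> c" "0 < \<eta>"
  shows "\<exists>J. chain c b J \<and> chain_len J \<le> chain_len I
      \<and> vsum (\<lambda>x. of_real (variation g a x)) I \<le> vsum g J + \<eta> * length I"
  using assms
proof (induction I arbitrary: c)
  case Nil
  then show ?case by (intro exI[of _ "[]"]) simp
next
  case (Cons st I)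
  obtain s t where st: "st = (s,t)" by force
  with Cons.prems have *: "c \<le> s" "s \<le> t" "t \<le> b" "chain t b I" by (auto simp: chain_Cons)
  obtain J where J: "chain t b J" "chain_len J \<le> chain_len I"
      "vsum (\<lambda>x. of_real (variation g a x)) I \<le> vsum g J + \<eta> * length I"
    using Cons.IH[of t] * Cons.prems by auto
  obtain J0 where J0: "chain s t J0" "variation g s t \<le> vsum g J0 + \<eta>"
    using variation_approx[OF \<open>0 < \<eta>\<close>] by metis
  have "0 \<le> variation g a t - variation g a s"
    using variation_step[of s t] * Cons.prems norm_ge_zero[of "g t - g s"] by linarith
  then have "cmod (of_real (variation g a t) - of_real (variation g a s)) \<le> variation g s t"
    using variation_triangle[of s t] * Cons.prems by (simp flip: of_real_diff)
  then have "vsum (\<lambda>x. of_real (variation g a x)) (st # I) \<le> vsum g (J0 @ J) + \<eta> * length (st # I)"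
    using J J0 by (simp add: st algebra_simps)
  moreover have "chain c b (J0 @ J)"
    using J J0 * by (intro chain_append[of c t]) (auto intro: chain_mono)
  moreover have "chain_len (J0 @ J) \<le> chain_len (st # I)"
    using J chain_len_le[OF J0(1)] * by (simp add: st)
  ultimately show ?case by blast
qed

lemma abs_cont_variation: "abs_cont a b (\<lambda>x. of_real (variation g a x))"
  unfolding abs_cont_chain
proof (intro allI impI)
  fix \<epsilon> :: real assume "0 < \<epsilon>"
  then obtain \<delta> where \<delta>: "\<delta> > 0" "\<And>I. chain a b I \<Longrightarrow> chain_len I < \<delta> \<Longrightarrow> vsum g I < \<epsilon>/2"
    using ac unfolding abs_cont_chain by (metis half_gt_zero_iff)
  have "vsum (\<lambda>x. of_real (variation g a x)) I < \<epsilon>" if I: "chain a b I" "chain_len I < \<delta>" for I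
  proof -
    \<comment> \<open>The losses of all intervals together stay below \<open>\<epsilon>/2\<close>;
      the summand 1 covers the empty chain.\<close>
    define \<eta> where "\<eta> = \<epsilon> / (2 * (length I + 1))"
    have \<eta>: "\<eta> > 0" "\<eta> * length I \<le> \<epsilon>/2"
      using \<open>0 < \<epsilon>\<close> by (auto simp: \<eta>_def field_simps)
    obtain J where "chain a b J" "chain_len J \<le> chain_len I"
      "vsum (\<lambda>x. of_real (variation g a x)) I \<le> vsum g J + \<eta> * length I"
      using variation_chain[OF I(1) order_refl \<eta>(1)] by blast
    with \<delta>(2)[of J] I \<eta> show ?thesis by simp
  qed
  then show "\<exists>\<delta>>0. \<forall>I. chain a b I \<and> chain_len I < \<delta> \<longrightarrow> vsum (\<lambda>x. of_real (variation g a x)) I < \<epsilon>"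
    using \<delta>(1) by blast
qed

end

section \<open>Closure properties of absolute continuity\<close>

lemma abs_cont_dominated:
  assumes "abs_cont a b f" "abs_cont a b g" "0 \<le> C"
    and "\<And>s t. a \<le> s \<Longrightarrow> s \<le> t \<Longrightarrow> t \<le> b \<Longrightarrow> cmod (h t - h s) \<le> C * (cmod (f t - f s) + cmod (g t - g s))"
  shows "abs_cont a b h"
proof -
  have *: "vsum h I \<le> C * (vsum f I + vsum g I)" if "chain a' b I" "a \<le> a'" for a' I
    using that
  proof (induction I arbitrary: a')
    case (Cons st I)
    obtain s t where st: "st = (s,t)" by force
    with Cons.prems have 1: "a' \<le> s" "s \<le> t" "t \<le> b" "chain t b I" by (auto simp: chain_Cons)
    have "vsum h I \<le> C * (vsum f I + vsum g I)"
      using Cons.IH[of t] 1 Cons.prems by auto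
    with assms(4)[of s t] 1 Cons.prems show ?case by (simp add: st algebra_simps)
  qed simp
  show ?thesis
    unfolding abs_cont_chain
  proof (intro allI impI)
    fix \<epsilon> :: real assume "0 < \<epsilon>"
    define e where "e = \<epsilon> / (2 * (C + 1))"
    have e: "e > 0" "C * (2 * e) < \<epsilon>" using \<open>0 < \<epsilon>\<close> \<open>0 \<le> C\<close> by (auto simp: e_def field_simps)
    obtain \<delta>1 where 1: "\<delta>1 > 0" "\<And>I. chain a b I \<Longrightarrow> chain_len I < \<delta>1 \<Longrightarrow> vsum f I < e"
      using assms(1) e unfolding abs_cont_chain by metis
    obtain \<delta>2 where 2: "\<delta>2 > 0" "\<And>I. chain a b I \<Longrightarrow> chain_len I < \<delta>2 \<Longrightarrow> vsum g I < e"
      using assms(2) e unfolding abs_cont_chain by metis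
    have "vsum h I < \<epsilon>" if "chain a b I" "chain_len I < min \<delta>1 \<delta>2" for I
    proof -
      have "vsum h I \<le> C * (vsum f I + vsum g I)" using * that by simp
      also have "\<dots> \<le> C * (2 * e)"
        using 1(2)[of I] 2(2)[of I] that \<open>0 \<le> C\<close> by (intro mult_left_mono) auto
      finally show ?thesis using e by simp
    qed
    then show "\<exists>\<delta>>0. \<forall>I. chain a b I \<and> chain_len I < \<delta> \<longrightarrow> vsum h I < \<epsilon>"
      using 1(1) 2(1) by (intro exI[of _ "min \<delta>1 \<delta>2"]) auto
  qed
qed

lemma abs_cont_dominated1:
  assumes "abs_cont a b f" "0 \<le> C"
    and "\<And>s t. a \<le> s \<Longrightarrow> s \<le> t \<Longrightarrow> t \<le> b \<Longrightarrow> cmod (h t - h s) \<le> C * cmod (f t - f s)"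
  shows "abs_cont a b h"
  by (rule abs_cont_dominated[OF assms(1,1,2)])
     (smt (verit, best) assms(2,3) distrib_left mult_nonneg_nonneg norm_ge_zero)

lemma abs_cont_continuous:
  assumes "abs_cont a b g"
  shows "continuous_on {a..b} g"
  unfolding continuous_on_iff
proof (intro ballI allI impI)
  fix x e assume "x \<in> {a..b}" "(0::real) < e"
  then obtain \<delta> where \<delta>: "\<delta> > 0" "\<And>I. chain a b I \<Longrightarrow> chain_len I < \<delta> \<Longrightarrow> vsum g I < e"
    using assms unfolding abs_cont_chain by metis
  have "dist (g y) (g x) < e" if "y \<in> {a..b}" "dist y x < \<delta>" for y
    using \<delta>(2)[of "[(min x y, max x y)]"] that \<open>x \<in> {a..b}\<close>
    by (cases "x \<le> y") (auto simp: chain_Cons dist_norm norm_minus_commute)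
  then show "\<exists>d>0. \<forall>x'\<in>{a..b}. dist x' x < d \<longrightarrow> dist (g x') (g x) < e" using \<delta>(1) by blast
qed

lemma abs_cont_bounded:
  assumes "abs_cont a b g"
  obtains C where "0 \<le> C" "\<And>x. x \<in> {a..b} \<Longrightarrow> cmod (g x) \<le> C"
proof -
  have "compact (g ` {a..b})"
    by (intro compact_continuous_image abs_cont_continuous assms) auto
  then obtain C where "\<And>x. x \<in> {a..b} \<Longrightarrow> cmod (g x) \<le> C"
    by (meson bounded_iff compact_imp_bounded imageI)
  then show thesis using that[of "max C 0"] by fastforce
qed

lemma abs_cont_const: "abs_cont a b (\<lambda>_. c)"
proof -
  have "vsum (\<lambda>_. c) I = 0" for I by (induction I) auto
  then show ?thesis unfolding abs_cont_chain by (auto intro: exI[of _ 1])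
qed

lemma abs_cont_add:
  assumes "abs_cont a b f" "abs_cont a b g" shows "abs_cont a b (\<lambda>x. f x + g x)"
proof (rule abs_cont_dominated[OF assms, of 1])
  fix s t
  have "f t + g t - (f s + g s) = (f t - f s) + (g t - g s)" by simp
  then show "cmod (f t + g t - (f s + g s)) \<le> 1 * (cmod (f t - f s) + cmod (g t - g s))"
    by (metis norm_triangle_ineq mult_1)
qed simp

lemma abs_cont_cmult:
  assumes "abs_cont a b f" shows "abs_cont a b (\<lambda>x. c * f x)"
  by (rule abs_cont_dominated1[OF assms, of "cmod c"]) (auto simp flip: right_diff_distrib simp: norm_mult)

lemma abs_cont_diff:
  assumes "abs_cont a b f" "abs_cont a b g" shows "abs_cont a b (\<lambda>x. f x - g x)"
  using abs_cont_add[OF assms(1) abs_cont_cmult[OF assms(2), of "-1"]] by simp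

lemma abs_cont_cnj: "abs_cont a b f \<Longrightarrow> abs_cont a b (\<lambda>x. cnj (f x))"
  by (rule abs_cont_dominated1[of _ _ f 1]) (auto simp flip: complex_cnj_diff)

lemma abs_cont_mult:
  assumes "abs_cont a b f" "abs_cont a b g" shows "abs_cont a b (\<lambda>x. f x * g x)"
proof -
  obtain C1 where C1: "0 \<le> C1" "\<And>x. x \<in> {a..b} \<Longrightarrow> cmod (f x) \<le> C1" using abs_cont_bounded[OF assms(1)] by blast
  obtain C2 where C2: "0 \<le> C2" "\<And>x. x \<in> {a..b} \<Longrightarrow> cmod (g x) \<le> C2" using abs_cont_bounded[OF assms(2)] by blast
  show ?thesis
  proof (rule abs_cont_dominated[OF assms, of "C1 + C2"])
    fix s t assume st: "a \<le> s" "s \<le> t" "t \<le> b"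
    have "f t * g t - f s * g s = f t * (g t - g s) + g s * (f t - f s)" by (simp add: algebra_simps)
    then have "cmod (f t * g t - f s * g s) \<le> cmod (f t) * cmod (g t - g s) + cmod (g s) * cmod (f t - f s)"
      by (metis norm_mult norm_triangle_ineq)
    also have "\<dots> \<le> (C1 + C2) * cmod (g t - g s) + (C1 + C2) * cmod (f t - f s)"
      using C1(1) C2(1) C1(2)[of t] C2(2)[of s] st by (intro add_mono mult_right_mono) simp_all
    finally show "cmod (f t * g t - f s * g s) \<le> (C1 + C2) * (cmod (f t - f s) + cmod (g t - g s))"
      by (simp add: algebra_simps)
  qed (use C1 C2 in auto)
qed

lemma abs_cont_cong:
  assumes "\<And>x. x \<in> {a..b} \<Longrightarrow> f x = g x" "abs_cont a b f" shows "abs_cont a b g"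
  by (rule abs_cont_dominated1[OF assms(2), of 1]) (use assms(1) in auto)

section \<open>The fundamental theorem of calculus for absolutely continuous functions\<close>

lemma set_integrable_integrable:
  fixes f :: "'a \<Rightarrow> 'b::{banach, second_countable_topology}"
  shows "integrable M f \<Longrightarrow> A \<in> sets M \<Longrightarrow> set_integrable M A f"
  unfolding set_integrable_def by (rule integrable_mult_indicator)

section \<open>Indefinite integrals\<close>

lemma LINT_Icc_combine:
  fixes f :: "real \<Rightarrow> 'a::euclidean_space"
  assumes "integrable lborel f" "c \<le> d" "d \<le> e"
  shows "(LINT x:{c..e}|lborel. f x) = (LINT x:{c..d}|lborel. f x) + (LINT x:{d..e}|lborel. f x)"
proof -
  have si: "set_integrable lborel {x..y} f" for x y
    using assms(1) by (intro set_integrable_integrable) auto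
  show ?thesis
    using assms si by (simp add: set_borel_integral_eq_integral Henstock_Kurzweil_Integration.integral_combine)
qed

lemma AE_lborel_negligible:
  assumes "negligible N" shows "AE x in lborel. x \<notin> N"
proof -
  have "AE x in lebesgue. x \<notin> N"
    using assms by (simp add: negligible_iff_null_sets AE_not_in)
  then show ?thesis by (simp add: AE_completion_iff)
qed

text \<open>Lebesgue differentiation is available for averages over \<open>[x, x + k]\<close> only,
  which gives the right derivative. Left averages are right averages of the reflected function
  \<open>h (-x)\<close>, at the price of a second exceptional set that is reflected back. The
  condition \<open>a < x\<close> keeps left neighbours in the range of integration.\<close>

lemma indefinite_integral_has_vector_derivative_AE:
  fixes h :: "real \<Rightarrow> complex"
  assumes h: "integrable lborel h"
  shows "AE x in lborel. a < x \<longrightarrow> ((\<lambda>t. LINT s:{a..t}|lborel. h s) has_vector_derivative h x) (at x)"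
proof -
  have si: "set_integrable lborel {x..y} h" for x y
    using h by (intro set_integrable_integrable) auto
  have io: "h integrable_on {x..y}" for x y using set_borel_integral_eq_integral(1)[OF si] .
  have io': "(\<lambda>x. h (-x)) integrable_on {x..y}" for x y
    using io[of "-y" "-x"] Henstock_Kurzweil_Integration.integrable_reflect_real[where f = h and a = "-y" and b = "-x"] by simp
  obtain N1 where N1: "negligible N1" "\<And>x e. \<lbrakk>x \<notin> N1; 0 < e\<rbrakk> \<Longrightarrow> \<exists>d>0. \<forall>k. 0 < k \<and> k < d \<longrightarrow>
       norm(integral (cbox x (x + k *\<^sub>R One)) h /\<^sub>R k ^ DIM(real) - h x) < e"
    using integrable_ccontinuous_explicit[of h] io by (metis cbox_interval)
  obtain N2 where N2: "negligible N2" "\<And>x e. \<lbrakk>x \<notin> N2; 0 < e\<rbrakk> \<Longrightarrow> \<exists>d>0. \<forall>k. 0 < k \<and> k < d \<longrightarrow>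
       norm(integral (cbox x (x + k *\<^sub>R One)) (\<lambda>x. h (-x)) /\<^sub>R k ^ DIM(real) - h (-x)) < e"
    using integrable_ccontinuous_explicit[of "\<lambda>x. h (-x)"] io' by (metis cbox_interval)
  have "linear (uminus :: real \<Rightarrow> real)" by (simp add: linear_uminus)
  then have N3: "negligible (uminus ` N2)"
    using N2(1) by (intro negligible_differentiable_image_negligible linear_imp_differentiable_on) auto
  define F where "F t = (LINT s:{a..t}|lborel. h s)" for t
  have Fd: "F y - F x = integral {x..y} h" if "a \<le> x" "x \<le> y" for x y
    using LINT_Icc_combine[OF h that] unfolding F_def by (simp add: set_borel_integral_eq_integral(2)[OF si])
  have D: "(F has_vector_derivative h x) (at x)" if x: "x \<notin> N1" "x \<notin> uminus ` N2" "a < x" for x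
    unfolding has_vector_derivative_def has_derivative_at_alt
  proof (intro conjI allI impI)
    show "bounded_linear (\<lambda>k. k *\<^sub>R h x)" by (rule bounded_linear_scaleR_left)
    fix e :: real assume "0 < e"
    obtain d1 where d1: "d1 > 0" "\<And>k. 0 < k \<Longrightarrow> k < d1 \<Longrightarrow> norm (integral {x..x+k} h /\<^sub>R k - h x) < e"
      using N1(2)[OF x(1) \<open>0 < e\<close>] by auto
    have "-x \<notin> N2" using x(2) by (metis image_eqI minus_minus)
    from N2(2)[OF this \<open>0 < e\<close>]
    obtain d2 where d2: "d2 > 0" "\<And>k. 0 < k \<Longrightarrow> k < d2 \<Longrightarrow>
        norm (integral {-x..-x+k} (\<lambda>x. h (-x)) /\<^sub>R k - h x) < e"
      by auto
    have d2': "norm (integral {x-k..x} h /\<^sub>R k - h x) < e" if "0 < k" "k < d2" for k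
      using d2(2)[OF that] Henstock_Kurzweil_Integration.integral_reflect_real[where f = h and a = "x - k" and b = x] by (simp add: add.commute)
    have scale: "norm (v - k *\<^sub>R h x) \<le> e * k" if "norm (v /\<^sub>R k - h x) < e" "0 < k" for v k
    proof -
      have "v - k *\<^sub>R h x = k *\<^sub>R (v /\<^sub>R k - h x)" using that by (simp add: algebra_simps)
      then have "norm (v - k *\<^sub>R h x) = k * norm (v /\<^sub>R k - h x)" using that by simp
      then show ?thesis using that by (simp add: mult.commute)
    qed
    have "norm (F y - F x - (y - x) *\<^sub>R h x) \<le> e * norm (y - x)"
      if y: "norm (y - x) < min (min d1 d2) (x - a)" for y
    proof (cases x y rule: linorder_cases)
      case less
      then show ?thesis
        using scale[OF d1(2)[of "y - x"]] y Fd[of x y] \<open>a < x\<close> by simp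
    next
      case greater
      then have "F x - F y = integral {y..x} h" using y by (intro Fd) auto
      moreover have "norm (integral {y..x} h - (x - y) *\<^sub>R h x) \<le> e * (x - y)"
        using scale[OF d2'[of "x - y"]] greater y by simp
      moreover have "F y - F x - (y - x) *\<^sub>R h x = - ((F x - F y) - (x - y) *\<^sub>R h x)"
        by (simp add: algebra_simps)
      ultimately show ?thesis using greater by (metis norm_minus_cancel real_norm_def abs_minus_commute abs_of_pos diff_gt_0_iff_gt)
    qed simp
    then show "\<exists>d>0. \<forall>y. norm (y - x) < d \<longrightarrow> norm (F y - F x - (y - x) *\<^sub>R h x) \<le> e * norm (y - x)"
      using d1(1) d2(1) \<open>a < x\<close> by (intro exI[of _ "min (min d1 d2) (x - a)"]) auto
  qed
  show ?thesis
    using AE_lborel_negligible[OF N1(1)] AE_lborel_negligible[OF N3] unfolding F_def[symmetric]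
    by eventually_elim (use D in blast)
qed

text \<open>Uniform integrability: \<open>|h|\<close> is at most the cap \<open>n\<close> plus the
  excess \<open>\<psi> n\<close>, and the integral of the excess tends to 0 by dominated
  convergence. First \<open>n\<close> is chosen, then \<open>\<delta>\<close> in terms of
  \<open>n\<close>.\<close>

lemma abs_cont_indefinite_integral:
  fixes h :: "real \<Rightarrow> complex"
  assumes h: "integrable lborel h"
  shows "abs_cont a b (\<lambda>t. LINT s:{a..t}|lborel. h s)"
  unfolding abs_cont_chain
proof (intro allI impI)
  fix \<epsilon> :: real assume "0 < \<epsilon>"
  define \<psi> where "\<psi> n x = max 0 (norm (h x) - real n)" for n x
  have hm [measurable]: "h \<in> borel_measurable borel" using borel_measurable_integrable[OF h] by simp
  have \<psi>m [measurable]: "\<psi> n \<in> borel_measurable borel" for n unfolding \<psi>_def by measurable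
  have \<psi>i: "integrable lborel (\<psi> n)" for n
    by (rule Bochner_Integration.integrable_bound[OF integrable_norm[OF h]]) (auto simp: \<psi>_def)
  have "(\<lambda>n. LINT x|lborel. \<psi> n x) \<longlonglongrightarrow> (LINT x|lborel. (\<lambda>_::real. 0::real) x)"
  proof (rule Bochner_Integration.integral_dominated_convergence[where s = \<psi> and f = "\<lambda>_. 0" and w = "\<lambda>x. norm (h x)"])
    show "AE x in lborel. (\<lambda>n. \<psi> n x) \<longlonglongrightarrow> 0"
    proof (rule AE_I2)
      fix x
      obtain n0 where "norm (h x) \<le> real n0" using real_arch_simple by blast
      then have "\<forall>n\<ge>n0. \<psi> n x = 0" unfolding \<psi>_def by (auto simp: max_def)
      then show "(\<lambda>n. \<psi> n x) \<longlonglongrightarrow> 0"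
        by (intro tendsto_eventually) (auto simp: eventually_sequentially)
    qed
  qed (use h in \<open>auto simp: \<psi>_def\<close>)
  then have "eventually (\<lambda>n. (LINT x|lborel. \<psi> n x) < \<epsilon>/2) sequentially"
    using \<open>0 < \<epsilon>\<close> by (auto dest!: order_tendstoD(2)[of _ _ _ "\<epsilon>/2"])
  then obtain n where n: "(LINT x|lborel. \<psi> n x) < \<epsilon>/2"
    using eventually_happens'[OF sequentially_bot] by blast
  define F where "F t = (LINT s:{a..t}|lborel. h s)" for t
  define P where "P s t = (LINT x:{s..t}|lborel. \<psi> n x)" for s t
  have P0: "0 \<le> P s t" for s t unfolding P_def set_lebesgue_integral_def
    by (intro integral_nonneg_AE AE_I2) (auto simp: \<psi>_def)
  have si: "set_integrable lborel {s..t} h" for s t using h by (intro set_integrable_integrable) auto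
  have one: "cmod (F t - F s) \<le> real n * (t - s) + P s t" if "a \<le> s" "s \<le> t" for s t
  proof -
    have "F t - F s = (LINT x:{s..t}|lborel. h x)"
      using LINT_Icc_combine[OF h that] unfolding F_def by simp
    also have "cmod \<dots> \<le> (LINT x:{s..t}|lborel. norm (h x))"
      by (rule set_integral_norm_bound[OF si])
    also have "\<dots> \<le> (LINT x:{s..t}|lborel. (real n + \<psi> n x))"
    proof (rule set_integral_mono)
      show "set_integrable lborel {s..t} (\<lambda>x. real n + \<psi> n x)"
        by (intro set_integral_add set_integrable_integrable[OF \<psi>i] borel_integrable_atLeastAtMost')
           (auto intro!: continuous_intros)
    qed (auto intro!: set_integrable_norm si simp: \<psi>_def)
    also have "\<dots> = real n * (t - s) + P s t"
    proof -
      have "(LINT x:{s..t}|lborel. (real n + \<psi> n x)) = (LINT x:{s..t}|lborel. real n) + P s t"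
        unfolding P_def
        by (intro set_integral_add set_integrable_integrable[OF \<psi>i] borel_integrable_atLeastAtMost')
           (auto intro!: continuous_intros)
      then show ?thesis using that by (simp add: set_lebesgue_integral_def)
    qed
    finally show ?thesis .
  qed
  have main: "vsum F I \<le> real n * chain_len I + P c b" if "chain c b I" "a \<le> c" for c I
    using that
  proof (induction I arbitrary: c)
    case (Cons st I)
    obtain s t where st: "st = (s,t)" by force
    with Cons.prems have 1: "c \<le> s" "s \<le> t" "t \<le> b" "chain t b I" by (auto simp: chain_Cons)
    have "P c b = P c s + (P s t + P t b)"
      unfolding P_def using 1 LINT_Icc_combine[OF \<psi>i] by (metis order_trans)
    moreover have "vsum F I \<le> real n * chain_len I + P t b" using Cons 1 by simp
    ultimately show ?case using one[of s t] P0[of c s] 1 Cons.prems by (simp add: st algebra_simps)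
  qed (simp add: P0)
  \<comment> \<open>The cap contributes at most \<open>\<epsilon>/2\<close> and the excess less than
    \<open>\<epsilon>/2\<close>; the summand 1 covers \<open>n = 0\<close>.\<close>
  have "vsum F I < \<epsilon>" if I: "chain a b I" "chain_len I < \<epsilon> / (2 * (real n + 1))" for I
  proof -
    have "P a b \<le> (LINT x|lborel. \<psi> n x)"
      unfolding P_def set_lebesgue_integral_def
      by (rule integral_mono[OF integrable_mult_indicator[OF _ \<psi>i] \<psi>i]) (auto simp: \<psi>_def indicator_def)
    moreover have "real n * chain_len I \<le> real n * (\<epsilon> / (2 * (real n + 1)))"
      using I by (intro mult_left_mono) auto
    moreover have "\<dots> \<le> \<epsilon>/2" using \<open>0 < \<epsilon>\<close> by (simp add: field_simps)
    ultimately show ?thesis using main[OF I(1)] n by linarith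
  qed
  then show "\<exists>\<delta>>0. \<forall>I. chain a b I \<and> chain_len I < \<delta> \<longrightarrow> vsum (\<lambda>t. LINT s:{a..t}|lborel. h s) I < \<epsilon>"
    unfolding F_def[symmetric] using \<open>0 < \<epsilon>\<close> by (intro exI[of _ "\<epsilon> / (2 * (real n + 1))"]) auto
qed

section \<open>Null sets of Stieltjes measures\<close>

text \<open>Absolute continuity is stated for lists ordered from left to right, whereas the covering
  lemma below returns an unordered family of cells.\<close>

lemma sorted_nonoverlapping:
  fixes l r :: "'a \<Rightarrow> real"
  assumes "finite E" "\<And>K. K \<in> E \<Longrightarrow> l K < r K"
    and "\<And>K K'. K \<in> E \<Longrightarrow> K' \<in> E \<Longrightarrow> K \<noteq> K' \<Longrightarrow> {l K<..<r K} \<inter> {l K'<..<r K'} = {}"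
  obtains Ks where "distinct Ks" "set Ks = E" "sorted_wrt (\<lambda>K K'. r K \<le> l K') Ks"
proof -
  obtain xs where xs: "set xs = E" "distinct xs" using finite_distinct_list[OF assms(1)] by blast
  define Ks where "Ks = sort_key l xs"
  have Ks: "distinct Ks" "set Ks = E" using xs by (simp_all add: Ks_def)
  have "sorted (map l Ks)" by (simp add: Ks_def)
  then have srt: "l (Ks ! i) \<le> l (Ks ! j)" if "i < j" "j < length Ks" for i j
    using that by (auto simp: sorted_wrt_iff_nth_less)
  have "sorted_wrt (\<lambda>K K'. r K \<le> l K') Ks"
    unfolding sorted_wrt_iff_nth_less
  proof (intro allI impI)
    fix i j assume ij: "i < j" "j < length Ks"
    define K K' where "K = Ks ! i" and "K' = Ks ! j"
    have K: "K \<in> E" "K' \<in> E" "K \<noteq> K'" "l K \<le> l K'"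
      using ij Ks srt[OF ij] unfolding K_def K'_def by (auto simp: nth_eq_iff_index_eq dest: nth_mem)
    show "r K \<le> l K'"
    proof (rule ccontr)
      assume "\<not> r K \<le> l K'"
      \<comment> \<open>If \<open>K\<close> reached beyond the left end of \<open>K'\<close>, this
        midpoint would be interior to both.\<close>
      then have "(l K' + min (r K) (r K')) / 2 \<in> {l K<..<r K} \<inter> {l K'<..<r K'}"
        using K assms(2)[of K'] by (auto simp: min_def field_simps)
      then show False using assms(3)[OF K(1-3)] by blast
    qed
  qed
  with Ks that show thesis by blast
qed

text \<open>A null set lies in an open set of measure below \<open>\<delta>\<close> and is covered
  by nonoverlapping cells inside that set. Their total length is then below \<open>\<delta>\<close>,
  so by absolute continuity the increments of \<open>G\<close> over them sum to less than
  \<open>e\<close>.\<close>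

lemma abs_cont_interval_measure_null:
  fixes G :: "real \<Rightarrow> real"
  assumes mono: "\<And>x y. x \<le> y \<Longrightarrow> G x \<le> G y" and cont: "continuous_on UNIV G"
    and ac: "\<And>e. 0 < e \<Longrightarrow> \<exists>\<delta>>0. \<forall>c d I. chain c d I \<and> chain_len I < \<delta> \<longrightarrow> vsum (\<lambda>x. of_real (G x)) I < e"
    and N: "N \<in> null_sets lborel"
  shows "emeasure (interval_measure G) N = 0"
proof -
  let ?\<mu> = "interval_measure G"
  have [measurable]: "N \<in> sets borel" using N by auto
  have Icc: "emeasure ?\<mu> {c..d} = ennreal (G d - G c)" if "c \<le> d" for c d
    using emeasure_interval_measure_Icc[OF that mono cont] by simp
  \<comment> \<open>The covering lemma works in a bounded box, hence the intersection with
    \<open>[-m, m]\<close>.\<close>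
  have small: "emeasure ?\<mu> (N \<inter> {-real m..real m}) \<le> ennreal e" if "0 < e" "0 < m" for m :: nat and e :: real
  proof -
    obtain \<delta> where \<delta>: "\<delta> > 0" "\<And>c d I. chain c d I \<Longrightarrow> chain_len I < \<delta> \<Longrightarrow> vsum (\<lambda>x. of_real (G x)) I < e"
      using ac[OF \<open>0 < e\<close>] by blast
    obtain U where U: "open U" "N \<subseteq> U" "emeasure lborel (U - N) < ennreal \<delta>"
      using outer_regular_lborel[OF _ \<delta>(1), of N] by (metis \<open>N \<in> sets borel\<close>)
    have "emeasure lborel U \<le> emeasure lborel ((U - N) \<union> N)"
      using U(1) by (intro emeasure_mono) auto
    also have "\<dots> \<le> emeasure lborel (U - N) + emeasure lborel N"
      using U(1) by (intro emeasure_subadditive) auto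
    finally have Um: "emeasure lborel U < ennreal \<delta>" using U(3) N by (auto simp: null_sets_def)
    define S where "S = N \<inter> {-real m..real m}"
    \<comment> \<open>Every cell has a tag in \<open>S\<close>, hence in \<open>U\<close>, and the
      gauge \<open>U\<close> there forces the whole cell into \<open>U\<close>.\<close>
    define g where "g x = (if x \<in> U then U else UNIV)" for x
    have "gauge g" using U(1) by (auto simp: gauge_def g_def)
    moreover have "S \<subseteq> cbox (-real m) (real m)" "box (-real m) (real m) \<noteq> {}"
      using \<open>0 < m\<close> by (auto simp: S_def box_real)
    ultimately obtain D where D: "countable D" "\<Union>D \<subseteq> cbox (-real m) (real m)"
      "\<And>K. K \<in> D \<Longrightarrow> interior K \<noteq> {} \<and> (\<exists>c d. K = cbox c d)"
      "pairwise (\<lambda>A B. interior A \<inter> interior B = {}) D"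
      "\<And>K. K \<in> D \<Longrightarrow> \<exists>x \<in> S \<inter> K. K \<subseteq> g x" "S \<subseteq> \<Union>D"
      using covering_lemma[of S "-real m" "real m" g] by metis
    have "\<forall>K\<in>D. \<exists>l r. K = {l..r} \<and> l < r"
      using D(3) by (metis cbox_interval interior_atLeastAtMost_real greaterThanLessThan_empty_iff not_le)
    then obtain l r where lr: "\<And>K. K \<in> D \<Longrightarrow> K = {l K..r K}" "\<And>K. K \<in> D \<Longrightarrow> l K < r K"
      by metis
    have KU: "K \<subseteq> U" if "K \<in> D" for K
      using D(5)[OF that] U(2) by (auto simp: g_def S_def split: if_splits)
    have disj: "{l K<..<r K} \<inter> {l K'<..<r K'} = {}" if "K \<in> D" "K' \<in> D" "K \<noteq> K'" for K K'
      using D(4) that lr(1) unfolding pairwise_def by (metis interior_atLeastAtMost_real)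
    \<comment> \<open>A chain is finite, so absolute continuity speaks about finite subfamilies; the
      countable family follows by continuity of the measure from below.\<close>
    have fin: "emeasure ?\<mu> (\<Union>E) \<le> ennreal e" if E: "finite E" "E \<subseteq> D" for E
    proof -
      obtain Ks where Ks: "distinct Ks" "set Ks = E" "sorted_wrt (\<lambda>K K'. r K \<le> l K') Ks"
        using sorted_nonoverlapping[OF E(1), of l r] lr(2) disj E(2) by (metis subsetD)
      define I where "I = map (\<lambda>K. (l K, r K)) Ks"
      have Kb: "-real m \<le> l K \<and> l K \<le> r K \<and> r K \<le> real m" if "K \<in> E" for K
      proof -
        have "K \<in> D" using that E(2) by blast
        then have "l K < r K" "K \<subseteq> {-real m..real m}" using lr(2) D(2) by (auto simp: cbox_interval)
        with lr(1)[OF \<open>K \<in> D\<close>] have "l K < r K" "{l K..r K} \<subseteq> {-real m..real m}" by metis+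
        then show ?thesis by auto
      qed
      have ch: "chain (-real m) (real m) I"
        unfolding chain_def I_def using Kb Ks by (auto simp: sorted_wrt_map)
      have "chain_len I = (\<Sum>K\<in>E. r K - l K)"
        unfolding chain_len_def I_def using Ks by (simp add: comp_def sum_list_distinct_conv_sum_set)
      moreover have "ennreal (\<Sum>K\<in>E. r K - l K) = (\<Sum>K\<in>E. emeasure lborel {l K<..<r K})"
        using Kb by (subst sum_ennreal[symmetric]) auto
      moreover have "\<dots> = emeasure lborel (\<Union>K\<in>E. {l K<..<r K})"
        using disj E by (intro sum_emeasure) (auto simp: disjoint_family_on_def subset_iff)
      moreover have "\<dots> \<le> emeasure lborel U"
        using KU lr(1) E(2) U(1) by (intro emeasure_mono) fastforce+
      ultimately have "ennreal (chain_len I) < ennreal \<delta>" using Um by simp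
      then have len: "chain_len I < \<delta>"
        using \<delta>(1) ennreal_less_iff leI not_le by (metis ennreal_lessI order_less_asym linorder_neq_iff)
      have "emeasure ?\<mu> (\<Union>E) = emeasure ?\<mu> (\<Union>K\<in>E. {l K..r K})"
        using lr(1) E(2) by (intro arg_cong[where f = "emeasure ?\<mu>"]) (auto simp: subset_iff)
      also have "\<dots> \<le> (\<Sum>K\<in>E. emeasure ?\<mu> {l K..r K})"
        using E(1) by (intro emeasure_subadditive_finite) auto
      also have "\<dots> = (\<Sum>K\<in>E. ennreal (G (r K) - G (l K)))"
        using Kb by (intro sum.cong refl Icc) auto
      also have "\<dots> = ennreal (\<Sum>K\<in>E. G (r K) - G (l K))"
        using Kb mono by (intro sum_ennreal) auto
      also have "(\<Sum>K\<in>E. G (r K) - G (l K)) = vsum (\<lambda>x. of_real (G x)) I"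
        unfolding vsum_def I_def using Ks Kb mono
        by (auto simp: comp_def sum_list_distinct_conv_sum_set simp flip: of_real_diff intro!: sum.cong)
      also have "ennreal \<dots> \<le> ennreal e" using \<delta>(2)[OF ch len] by (intro ennreal_leI) simp
      finally show ?thesis .
    qed
    have "emeasure ?\<mu> (\<Union>D) \<le> ennreal e"
    proof (cases "D = {}")
      case False
      define A where "A i = \<Union>(from_nat_into D ` {..i})" for i :: nat
      have Ds: "K \<in> sets borel" if "K \<in> D" for K using lr(1)[OF that] by (metis atLeastAtMost_borel)
      have sub: "from_nat_into D ` {..i} \<subseteq> D" for i using False by (auto intro: from_nat_into)
      have "\<Union>D \<subseteq> (\<Union>i. A i)"
      proof
        fix y assume "y \<in> \<Union>D"
        then obtain K where K: "K \<in> D" "y \<in> K" by blast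
        obtain i where "from_nat_into D i = K" using from_nat_into_surj[OF D(1) K(1)] by blast
        then have "y \<in> A i" using K(2) unfolding A_def by blast
        then show "y \<in> (\<Union>i. A i)" by blast
      qed
      moreover have "(\<Union>i. A i) \<subseteq> \<Union>D" unfolding A_def using sub by blast
      ultimately have "\<Union>D = (\<Union>i. A i)" by (rule subset_antisym)
      moreover have "(SUP i. emeasure ?\<mu> (A i)) = emeasure ?\<mu> (\<Union>i. A i)"
      proof (rule SUP_emeasure_incseq)
        show "range A \<subseteq> sets ?\<mu>" using sub Ds unfolding A_def
          by (auto intro!: sets.finite_Union)
        show "incseq A" unfolding incseq_def A_def by (auto intro: order_trans)
      qed
      moreover have "(SUP i. emeasure ?\<mu> (A i)) \<le> ennreal e"
        unfolding A_def by (intro SUP_least fin sub) auto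
      ultimately show ?thesis by simp
    qed simp
    moreover have "emeasure ?\<mu> S \<le> emeasure ?\<mu> (\<Union>D)"
    proof (rule emeasure_mono[OF D(6)])
      have "K \<in> sets borel" if "K \<in> D" for K using lr(1)[OF that] by (metis atLeastAtMost_borel)
      then show "\<Union>D \<in> sets ?\<mu>" using D(1) by (auto intro!: sets.countable_Union)
    qed
    ultimately show ?thesis unfolding S_def by simp
  qed
  have z: "emeasure ?\<mu> (N \<inter> {-real (Suc m)..real (Suc m)}) = 0" for m
  proof -
    have "emeasure ?\<mu> (N \<inter> {-real (Suc m)..real (Suc m)}) \<le> 0"
      by (rule ennreal_le_epsilon) (use small[of _ "Suc m"] in simp)
    then show ?thesis by simp
  qed
  have "N = (\<Union>m. N \<inter> {-real (Suc m)..real (Suc m)})"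
  proof -
    have "\<exists>m. -real (Suc m) \<le> x \<and> x \<le> real (Suc m)" for x :: real
    proof -
      obtain m where "\<bar>x\<bar> \<le> real m" using real_arch_simple by blast
      then show ?thesis by (intro exI[of _ m]) (auto simp: abs_le_iff)
    qed
    then show ?thesis by auto
  qed
  moreover have "emeasure ?\<mu> (\<Union>m. N \<inter> {-real (Suc m)..real (Suc m)}) = 0"
    using z by (intro emeasure_UN_eq_0) auto
  ultimately show ?thesis by simp
qed

section \<open>Densities of absolutely continuous functions\<close>

lemma mono_abs_cont_density:
  fixes F :: "real \<Rightarrow> real"
  assumes "a < b" and mono: "\<And>x y. a \<le> x \<Longrightarrow> x \<le> y \<Longrightarrow> y \<le> b \<Longrightarrow> F x \<le> F y"
    and ac: "abs_cont a b (\<lambda>x. of_real (F x))"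
  obtains h :: "real \<Rightarrow> real" where
    "\<And>x. x \<in> {a..b} \<Longrightarrow> has_bochner_integral lborel (\<lambda>t. indicator {a..x} t *\<^sub>R h t) (F x - F a)"
proof -
  \<comment> \<open>A Stieltjes measure needs a function on the whole line, so \<open>F\<close> is
    continued by constants. The clamp is monotone and does not lengthen intervals, so chains stay
    chains and absolute continuity is inherited.\<close>
  define cl where "cl x = max a (min b x)" for x
  define G where "G x = F (cl x)" for x
  have clm: "cl x \<le> cl y" if "x \<le> y" for x y using that by (auto simp: cl_def)
  have clb: "a \<le> cl x" "cl x \<le> b" for x using \<open>a < b\<close> by (auto simp: cl_def)
  have Gm: "G x \<le> G y" if "x \<le> y" for x y
    unfolding G_def using clm[OF that] clb by (intro mono) auto
  have "continuous_on {a..b} (\<lambda>x. Re (of_real (F x)))"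
    by (intro continuous_on_Re abs_cont_continuous[OF ac])
  then have Fc: "continuous_on {a..b} F" by simp
  have "continuous_on UNIV cl" unfolding cl_def by (intro continuous_intros)
  then have Gc: "continuous_on UNIV G"
    unfolding G_def using clb by (intro continuous_on_compose2[OF Fc]) auto
  have Gac: "\<exists>\<delta>>0. \<forall>c d I. chain c d I \<and> chain_len I < \<delta> \<longrightarrow> vsum (\<lambda>x. of_real (G x)) I < e" if e: "0 < e" for e
  proof -
    obtain \<delta> where \<delta>: "\<delta> > 0" "\<And>I. chain a b I \<Longrightarrow> chain_len I < \<delta> \<Longrightarrow> vsum (\<lambda>x. of_real (F x)) I < e"
      using ac e unfolding abs_cont_chain by metis
    have "vsum (\<lambda>x. of_real (G x)) I < e" if I: "chain c d I" "chain_len I < \<delta>" for c d I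
    proof -
      have "chain a b (map (map_prod cl cl) I)"
        using I(1) by (rule chain_map) (use clm clb in auto)
      moreover have "chain_len (map (map_prod cl cl) I) \<le> chain_len I"
        using I(1)
      proof (induction I arbitrary: c)
        case (Cons st I)
        obtain s t where st: "st = (s,t)" by force
        with Cons.prems have 1: "s \<le> t" "chain t d I" by (auto simp: chain_Cons)
        moreover have "cl t - cl s \<le> t - s" using 1 by (auto simp: cl_def)
        ultimately show ?case using Cons.IH[of t] by (simp add: st)
      qed simp
      ultimately have "vsum (\<lambda>x. of_real (F x)) (map (map_prod cl cl) I) < e" using I(2) by (intro \<delta>) auto
      moreover have "vsum (\<lambda>x. of_real (F x)) (map (map_prod cl cl) I) = vsum (\<lambda>x. of_real (G x)) I"
        unfolding vsum_def G_def by (simp add: comp_def case_prod_unfold)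
      ultimately show ?thesis by simp
    qed
    with \<delta>(1) show ?thesis by blast
  qed
  have "absolutely_continuous lborel (interval_measure G)"
    unfolding absolutely_continuous_def
  proof
    fix N :: "real set" assume "N \<in> null_sets lborel"
    with abs_cont_interval_measure_null[OF Gm Gc Gac this] show "N \<in> null_sets (interval_measure G)"
      by (auto simp: null_sets_def)
  qed
  then obtain f where f: "f \<in> borel_measurable lborel" "density lborel f = interval_measure G"
    using sigma_finite_measure.Radon_Nikodym[OF sigma_finite_lborel, of "interval_measure G"] by auto
  have nn: "(\<integral>\<^sup>+t. f t * indicator {a..x} t \<partial>lborel) = ennreal (F x - F a)" if "x \<in> {a..b}" for x
  proof -
    have "(\<integral>\<^sup>+t. f t * indicator {a..x} t \<partial>lborel) = emeasure (density lborel f) {a..x}"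
      using f(1) by (subst emeasure_density) auto
    also have "\<dots> = ennreal (G x - G a)"
      using emeasure_interval_measure_Icc[of a x, OF _ Gm Gc] that f(2) by simp
    finally show ?thesis using that \<open>a < b\<close> by (simp add: G_def cl_def)
  qed
  \<comment> \<open>The Radon-Nikodym density may take the value infinity; its integral over the
    interval is finite, so \<open>enn2real\<close> changes it there only on a null set.\<close>
  have fin: "AE t in lborel. f t * indicator {a..b} t \<noteq> \<infinity>"
    using nn[of b] \<open>a < b\<close> f(1) by (intro nn_integral_PInf_AE) auto
  define h where "h t = enn2real (f t)" for t
  have "has_bochner_integral lborel (\<lambda>t. indicator {a..x} t *\<^sub>R h t) (F x - F a)" if x: "x \<in> {a..b}" for x
  proof (rule has_bochner_integral_nn_integral)
    show "(\<lambda>t. indicator {a..x} t *\<^sub>R h t) \<in> borel_measurable lborel"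
      unfolding h_def using f(1) by measurable
    show "AE t in lborel. 0 \<le> indicator {a..x} t *\<^sub>R h t" by (auto simp: h_def)
    show "0 \<le> F x - F a" using mono[of a x] x by auto
    have "(\<integral>\<^sup>+t. ennreal (indicator {a..x} t *\<^sub>R h t) \<partial>lborel) = (\<integral>\<^sup>+t. f t * indicator {a..x} t \<partial>lborel)"
    proof (rule nn_integral_cong_AE)
      show "AE t in lborel. ennreal (indicator {a..x} t *\<^sub>R h t) = f t * indicator {a..x} t"
        using fin
      proof eventually_elim
        case (elim t)
        then show ?case using x by (auto simp: h_def indicator_def less_top split: if_splits)
      qed
    qed
    then show "(\<integral>\<^sup>+t. ennreal (indicator {a..x} t *\<^sub>R h t) \<partial>lborel) = ennreal (F x - F a)"
      using nn[OF x] by simp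
  qed
  then show thesis by (rule that)
qed

lemma abs_cont_density_real:
  fixes f :: "real \<Rightarrow> real"
  assumes "a < b" and ac: "abs_cont a b (\<lambda>x. of_real (f x))"
  obtains h :: "real \<Rightarrow> real" where
    "\<And>x. x \<in> {a..b} \<Longrightarrow> has_bochner_integral lborel (\<lambda>t. indicator {a..x} t *\<^sub>R h t) (f x - f a)"
proof -
  interpret abs_cont_on a b "\<lambda>x. of_real (f x)" using assms by unfold_locales auto
  define V where "V = variation (\<lambda>x. complex_of_real (f x)) a"
  have st: "V x + \<bar>f y - f x\<bar> \<le> V y" if "a \<le> x" "x \<le> y" "y \<le> b" for x y
    using variation_step[OF that] by (simp add: V_def flip: of_real_diff)
  have V1: "V x \<le> V y" if "a \<le> x" "x \<le> y" "y \<le> b" for x y using st[OF that] by simp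
  have V2: "V x - f x \<le> V y - f y" if "a \<le> x" "x \<le> y" "y \<le> b" for x y using st[OF that] by simp
  have acV: "abs_cont a b (\<lambda>x. of_real (V x))" using abs_cont_variation unfolding V_def .
  have acW: "abs_cont a b (\<lambda>x. of_real (V x - f x))" using abs_cont_diff[OF acV ac] by simp
  obtain h1 where h1: "\<And>x. x \<in> {a..b} \<Longrightarrow> has_bochner_integral lborel (\<lambda>t. indicator {a..x} t *\<^sub>R h1 t) (V x - V a)"
    using mono_abs_cont_density[OF \<open>a < b\<close> V1 acV] by blast
  obtain h2 where h2: "\<And>x. x \<in> {a..b} \<Longrightarrow> has_bochner_integral lborel (\<lambda>t. indicator {a..x} t *\<^sub>R h2 t) ((V x - f x) - (V a - f a))"
    using mono_abs_cont_density[OF \<open>a < b\<close> V2 acW] by blast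
  have "has_bochner_integral lborel (\<lambda>t. indicator {a..x} t *\<^sub>R (h1 t - h2 t)) (f x - f a)" if "x \<in> {a..b}" for x
    using has_bochner_integral_diff[OF h1[OF that] h2[OF that]] by (simp add: right_diff_distrib)
  then show thesis by (rule that)
qed

lemma abs_cont_density:
  assumes "a < b" and ac: "abs_cont a b f"
  obtains h where "integrable lborel h" "\<And>t. t \<notin> {a..b} \<Longrightarrow> h t = 0"
    "\<And>x. x \<in> {a..b} \<Longrightarrow> f x = f a + (LINT t:{a..x}|lborel. h t)"
proof -
  have "abs_cont a b (\<lambda>x. of_real (Re (f x)))" "abs_cont a b (\<lambda>x. of_real (Im (f x)))"
    by (rule abs_cont_dominated1[OF ac, of 1],
        simp_all flip: of_real_diff minus_complex.sel add: abs_Re_le_cmod abs_Im_le_cmod del: minus_complex.sel)+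
  note ri = abs_cont_density_real[OF \<open>a < b\<close> this(1)] abs_cont_density_real[OF \<open>a < b\<close> this(2)]
  obtain h1 where h1: "\<And>x. x \<in> {a..b} \<Longrightarrow> has_bochner_integral lborel (\<lambda>t. indicator {a..x} t *\<^sub>R h1 t) (Re (f x) - Re (f a))"
    using ri(1) by blast
  obtain h2 where h2: "\<And>x. x \<in> {a..b} \<Longrightarrow> has_bochner_integral lborel (\<lambda>t. indicator {a..x} t *\<^sub>R h2 t) (Im (f x) - Im (f a))"
    using ri(2) by blast
  define h where "h t = indicator {a..b} t *\<^sub>R Complex (h1 t) (h2 t)" for t
  have hb: "has_bochner_integral lborel (\<lambda>t. indicator {a..x} t *\<^sub>R h t) (f x - f a)" if x: "x \<in> {a..b}" for x
  proof -
    have "has_bochner_integral lborel (\<lambda>t. of_real (indicator {a..x} t *\<^sub>R h1 t) + \<i> * of_real (indicator {a..x} t *\<^sub>R h2 t))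
        (of_real (Re (f x) - Re (f a)) + \<i> * of_real (Im (f x) - Im (f a)))"
      by (intro has_bochner_integral_add has_bochner_integral_mult_right has_bochner_integral_of_real h1 h2 x)
    moreover have "(\<lambda>t. of_real (indicator {a..x} t *\<^sub>R h1 t) + \<i> * of_real (indicator {a..x} t *\<^sub>R h2 t)) = (\<lambda>t. indicator {a..x} t *\<^sub>R h t)"
      using x by (auto simp: fun_eq_iff h_def indicator_def complex_eq_iff)
    moreover have "of_real (Re (f x) - Re (f a)) + \<i> * of_real (Im (f x) - Im (f a)) = f x - f a"
      by (simp add: complex_eq_iff)
    ultimately show ?thesis by simp
  qed
  have "(\<lambda>t. indicator {a..b} t *\<^sub>R h t) = h" by (auto simp: h_def indicator_def)
  then have "integrable lborel h"
    using hb[of b] \<open>a < b\<close> by (auto dest: integrable.intros)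
  then show thesis
    using that[of h] hb by (auto simp: h_def has_bochner_integral_iff set_lebesgue_integral_def)
qed

lemma indefinite_integral_abs_cont:
  fixes h f :: "real \<Rightarrow> complex"
  assumes h: "set_integrable lborel {a..b} h"
    and f: "\<And>x. x \<in> {a..b} \<Longrightarrow> f x = f a + (LINT t:{a..x}|lborel. h t)"
  shows "abs_cont a b f" "AE x in lborel. x \<in> {a..b} \<longrightarrow> (f has_vector_derivative h x) (at x)"
proof -
  define k where "k t = indicator {a..b} t *\<^sub>R h t" for t
  have k: "integrable lborel k" using h unfolding k_def set_integrable_def .
  have f': "f x = f a + (LINT t:{a..x}|lborel. k t)" if "x \<in> {a..b}" for x
  proof -
    have "(LINT t:{a..x}|lborel. h t) = (LINT t:{a..x}|lborel. k t)"
      unfolding set_lebesgue_integral_def using that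
      by (intro Bochner_Integration.integral_cong) (auto simp: k_def indicator_def)
    with f[OF that] show ?thesis by simp
  qed
  show "abs_cont a b f"
    by (rule abs_cont_cong[OF _ abs_cont_add[OF abs_cont_const[of a b "f a"] abs_cont_indefinite_integral[OF k]]])
       (simp add: f'[symmetric])
  show "AE x in lborel. x \<in> {a..b} \<longrightarrow> (f has_vector_derivative h x) (at x)"
    \<comment> \<open>The endpoints are discarded as null: there a two-sided derivative would depend
      on values of \<open>f\<close> outside the interval.\<close>
    using indefinite_integral_has_vector_derivative_AE[OF k, of a] AE_lborel_singleton[of a] AE_lborel_singleton[of b]
  proof eventually_elim
    case (elim x)
    show ?case
    proof
      assume x: "x \<in> {a..b}"
      with elim have x': "a < x" "x < b" by auto
      have "((\<lambda>t. f a + (LINT s:{a..t}|lborel. k s)) has_vector_derivative k x) (at x)"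
        using elim x' by (auto intro!: derivative_eq_intros)
      then have "(f has_vector_derivative k x) (at x)"
        by (rule has_vector_derivative_transform_within_open[of _ _ _ "{a<..<b}"]) (use x' in \<open>auto simp: f'[symmetric]\<close>)
      then show "(f has_vector_derivative h x) (at x)" using x by (simp add: k_def)
    qed
  qed
qed

lemma set_integrable_cong_AE_measurable:
  fixes f g :: "real \<Rightarrow> 'a::{banach, second_countable_topology}"
  assumes "set_integrable lborel A f" "(\<lambda>x. indicator A x *\<^sub>R g x) \<in> borel_measurable lborel"
    and "AE x in lborel. x \<in> A \<longrightarrow> f x = g x"
  shows "set_integrable lborel A g"
  unfolding set_integrable_def
  by (rule integrable_cong_AE_imp[OF assms(1)[unfolded set_integrable_def] assms(2)])
     (use assms(3) in \<open>auto elim!: eventually_mono simp: indicator_def\<close>)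

lemma set_integral_cong_AE_lborel:
  fixes f g :: "real \<Rightarrow> 'a::{banach, second_countable_topology}"
  assumes "(\<lambda>x. indicator A x *\<^sub>R f x) \<in> borel_measurable lborel"
    "(\<lambda>x. indicator A x *\<^sub>R g x) \<in> borel_measurable lborel"
    and "AE x in lborel. x \<in> A \<longrightarrow> f x = g x"
  shows "(LINT x:A|lborel. f x) = (LINT x:A|lborel. g x)"
  unfolding set_lebesgue_integral_def
  by (rule integral_cong_AE[OF assms(1,2)])
     (use assms(3) in \<open>auto elim!: eventually_mono simp: indicator_def\<close>)

section \<open>Borel measurability of the pointwise derivative\<close>

lemma vector_derivative_eqI:
  fixes f :: "real \<Rightarrow> 'a::real_normed_vector"
  assumes "\<And>d. (f has_vector_derivative d) F \<longleftrightarrow> (g has_vector_derivative d) F"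
  shows "vector_derivative f F = vector_derivative g F"
  unfolding vector_derivative_def using assms by simp

text \<open>Restricting the Cauchy criterion for difference quotients to rational increments
  exhibits the set of differentiability as a countable combination of measurable conditions. The way
  back to real increments uses that the quotient is continuous at every nonzero increment, because
  \<open>f\<close> is.\<close>

lemma differentiable_iff_rational_Cauchy:
  fixes f :: "real \<Rightarrow> complex"
  assumes f: "continuous_on UNIV f"
  defines "Q \<equiv> \<lambda>h x. (f (x + h) - f x) /\<^sub>R h"
  shows "f differentiable (at x) \<longleftrightarrow> (\<forall>n::nat. \<exists>m::nat. \<forall>h k :: rat. 0 < \<bar>h\<bar> \<and> \<bar>h\<bar> < inverse (of_nat (Suc m))
      \<and> 0 < \<bar>k\<bar> \<and> \<bar>k\<bar> < inverse (of_nat (Suc m)) \<longrightarrow>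
      norm (Q (of_rat h) x - Q (of_rat k) x) \<le> inverse (real (Suc n)))" (is "_ \<longleftrightarrow> ?R")
proof
  assume "f differentiable (at x)"
  then obtain D where "(f has_vector_derivative D) (at x)"
    by (auto simp: vector_derivative_works)
  then have D: "\<And>e. 0 < e \<Longrightarrow> \<exists>d>0. \<forall>y. norm (y - x) < d \<longrightarrow> norm (f y - f x - (y - x) *\<^sub>R D) \<le> e * norm (y - x)"
    unfolding has_vector_derivative_def has_derivative_at_alt by blast
  show ?R
  proof
    fix n :: nat
    obtain d where d: "d > 0" "\<And>y. norm (y - x) < d \<Longrightarrow> norm (f y - f x - (y - x) *\<^sub>R D) \<le> inverse (real (Suc n)) / 2 * norm (y - x)"
      using D[of "inverse (real (Suc n)) / 2"] by auto
    have 1: "norm (Q h x - D) \<le> inverse (real (Suc n)) / 2" if "0 < \<bar>h\<bar>" "\<bar>h\<bar> < d" for h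
    proof -
      have "Q h x - D = (f (x + h) - f x - h *\<^sub>R D) /\<^sub>R h"
        using that by (simp add: Q_def algebra_simps)
      then have "norm (Q h x - D) = norm (f (x + h) - f x - h *\<^sub>R D) / \<bar>h\<bar>"
        by (simp add: divide_inverse mult.commute)
      also have "\<dots> \<le> (inverse (real (Suc n)) / 2 * \<bar>h\<bar>) / \<bar>h\<bar>"
        using d(2)[of "x + h"] that by (intro divide_right_mono) auto
      finally show ?thesis using that by simp
    qed
    obtain m where m: "inverse (real (Suc m)) < d" using reals_Archimedean[OF d(1)] by auto
    have "norm (Q (of_rat h) x - Q (of_rat k) x) \<le> inverse (real (Suc n))"
      if "0 < \<bar>h\<bar>" "\<bar>h\<bar> < inverse (of_nat (Suc m))" "0 < \<bar>k\<bar>" "\<bar>k\<bar> < inverse (of_nat (Suc m))" for h k :: rat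
    proof -
      have r: "\<bar>of_rat q\<bar> < d" if "\<bar>q\<bar> < inverse (of_nat (Suc m))" for q :: rat
      proof -
        have "of_rat \<bar>q\<bar> < (of_rat (inverse (of_nat (Suc m))) :: real)" using that by (simp only: of_rat_less)
        then have "\<bar>of_rat q\<bar> < inverse (real (Suc m))" by (simp add: of_rat_inverse abs_if of_rat_minus del: of_nat_Suc split: if_splits)
        then show ?thesis using m by simp
      qed
      have "norm (Q (of_rat h) x - D) \<le> inverse (real (Suc n)) / 2" "norm (Q (of_rat k) x - D) \<le> inverse (real (Suc n)) / 2"
        using 1[OF _ r, of h] 1[OF _ r, of k] that by simp_all
      moreover have "Q (of_rat h) x - Q (of_rat k) x = (Q (of_rat h) x - D) - (Q (of_rat k) x - D)" by simp
      ultimately show ?thesis using norm_triangle_ineq4[of "Q (of_rat h) x - D" "Q (of_rat k) x - D"] by simp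
    qed
    then show "\<exists>m::nat. \<forall>h k :: rat. 0 < \<bar>h\<bar> \<and> \<bar>h\<bar> < inverse (of_nat (Suc m))
      \<and> 0 < \<bar>k\<bar> \<and> \<bar>k\<bar> < inverse (of_nat (Suc m)) \<longrightarrow>
      norm (Q (of_rat h) x - Q (of_rat k) x) \<le> inverse (real (Suc n))" by blast
  qed
next
  assume R: ?R
  have real: "\<exists>r>0. \<forall>h k. 0 < \<bar>h\<bar> \<and> \<bar>h\<bar> < r \<and> 0 < \<bar>k\<bar> \<and> \<bar>k\<bar> < r \<longrightarrow> norm (Q h x - Q k x) \<le> e" if e: "0 < e" for e
  proof -
    obtain n where n: "inverse (real (Suc n)) < e" using reals_Archimedean[OF e] by auto
    obtain m where m: "\<And>h k :: rat. 0 < \<bar>h\<bar> \<Longrightarrow> \<bar>h\<bar> < inverse (of_nat (Suc m))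
      \<Longrightarrow> 0 < \<bar>k\<bar> \<Longrightarrow> \<bar>k\<bar> < inverse (of_nat (Suc m)) \<Longrightarrow>
      norm (Q (of_rat h) x - Q (of_rat k) x) \<le> inverse (real (Suc n))" using R by blast
    define r where "r = inverse (real (Suc m))"
    have r: "r > 0" by (simp add: r_def)
    have isC: "isCont (\<lambda>h. Q h x) h" if "h \<noteq> 0" for h
    proof -
      have "continuous_on UNIV (\<lambda>h. f (x + h))"
        by (intro continuous_on_compose2[OF f] continuous_intros) auto
      then have "isCont (\<lambda>h. f (x + h)) h" by (simp add: continuous_on_eq_continuous_at)
      then show ?thesis unfolding Q_def using that by (intro continuous_intros) auto
    qed
    have near: "\<exists>q::rat. 0 < \<bar>q\<bar> \<and> \<bar>q\<bar> < inverse (of_nat (Suc m)) \<and> norm (Q (of_rat q) x - Q h x) < \<eta>"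
      if h: "0 < \<bar>h\<bar>" "\<bar>h\<bar> < r" and "0 < \<eta>" for h \<eta> :: real
    proof -
      have "\<forall>\<^sub>F y in nhds h. y \<noteq> h \<longrightarrow> norm (Q y x - Q h x) < \<eta>"
        using isC[of h] h \<open>0 < \<eta>\<close> by (simp add: isCont_def tendsto_iff dist_norm eventually_at_filter)
      then have "\<forall>\<^sub>F y in nhds h. norm (Q y x - Q h x) < \<eta>"
        by (rule eventually_mono) (use \<open>0 < \<eta>\<close> in \<open>metis norm_zero diff_self\<close>)
      moreover have "\<forall>\<^sub>F y in nhds h. 0 < \<bar>y\<bar>" "\<forall>\<^sub>F y in nhds h. \<bar>y\<bar> < r"
        using order_tendstoD[OF tendsto_rabs[OF filterlim_ident]] h by blast+
      ultimately have "\<forall>\<^sub>F y in nhds h. norm (Q y x - Q h x) < \<eta> \<and> 0 < \<bar>y\<bar> \<and> \<bar>y\<bar> < r"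
        by eventually_elim auto
      then obtain d where d: "d > 0" "\<And>y. dist y h < d \<Longrightarrow> norm (Q y x - Q h x) < \<eta> \<and> 0 < \<bar>y\<bar> \<and> \<bar>y\<bar> < r"
        by (auto simp: eventually_nhds_metric)
      obtain q :: rat where q: "h < of_rat q" "of_rat q < h + d" using of_rat_dense[of h "h + d"] d(1) by auto
      have "0 < \<bar>real_of_rat q\<bar>" "\<bar>real_of_rat q\<bar> < r" "norm (Q (of_rat q) x - Q h x) < \<eta>"
        using d(2)[of "of_rat q"] q by (auto simp: dist_real_def)
      moreover from this(2) have "of_rat \<bar>q\<bar> < (of_rat (inverse (of_nat (Suc m))) :: real)"
        by (simp add: r_def of_rat_inverse abs_if of_rat_minus del: of_nat_Suc split: if_splits)
      then have "\<bar>q\<bar> < inverse (of_nat (Suc m))" by (simp only: of_rat_less)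
      ultimately show ?thesis by auto
    qed
    have "norm (Q h x - Q k x) \<le> e" if hk: "0 < \<bar>h\<bar>" "\<bar>h\<bar> < r" "0 < \<bar>k\<bar>" "\<bar>k\<bar> < r" for h k
    proof (rule field_le_epsilon)
      fix \<eta> :: real assume "0 < \<eta>"
      then have "0 < \<eta>/2" by simp
      obtain q1 :: rat where q1: "0 < \<bar>q1\<bar>" "\<bar>q1\<bar> < inverse (of_nat (Suc m))" "norm (Q (of_rat q1) x - Q h x) < \<eta>/2"
        using near[OF hk(1,2) \<open>0 < \<eta>/2\<close>] by blast
      obtain q2 :: rat where q2: "0 < \<bar>q2\<bar>" "\<bar>q2\<bar> < inverse (of_nat (Suc m))" "norm (Q (of_rat q2) x - Q k x) < \<eta>/2"
        using near[OF hk(3,4) \<open>0 < \<eta>/2\<close>] by blast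
      have "norm (Q (of_rat q1) x - Q (of_rat q2) x) \<le> inverse (real (Suc n))" by (rule m[OF q1(1,2) q2(1,2)])
      with q1(3) q2(3) n show "norm (Q h x - Q k x) \<le> e + \<eta>"
        by norm
    qed
    with r show ?thesis by blast
  qed
  \<comment> \<open>The limit along the increments \<open>1/(i+1)\<close> supplies the candidate for
    the derivative; the estimate for real increments then compares every quotient with it.\<close>
  have "Cauchy (\<lambda>i. Q (inverse (real (Suc i))) x)"
  proof (rule metric_CauchyI)
    fix e :: real assume "0 < e"
    then obtain r where r: "r > 0" "\<And>h k. 0 < \<bar>h\<bar> \<Longrightarrow> \<bar>h\<bar> < r \<Longrightarrow> 0 < \<bar>k\<bar> \<Longrightarrow> \<bar>k\<bar> < r \<Longrightarrow> norm (Q h x - Q k x) \<le> e/2"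
      using real[of "e/2"] by auto
    obtain N where N: "inverse (real (Suc N)) < r" using reals_Archimedean[OF r(1)] by auto
    have "inverse (real (Suc i)) < r" if "N \<le> i" for i
    proof -
      have "inverse (real (Suc i)) \<le> inverse (real (Suc N))" using that by (simp add: le_imp_inverse_le)
      with N show ?thesis by linarith
    qed
    then have "\<forall>i\<ge>N. \<forall>j\<ge>N. dist (Q (inverse (real (Suc i))) x) (Q (inverse (real (Suc j))) x) < e"
      using r(2) \<open>0 < e\<close> by (smt (verit) dist_norm field_sum_of_halves inverse_positive_iff_positive of_nat_0_less_iff zero_less_Suc)
    then show "\<exists>M. \<forall>m\<ge>M. \<forall>n\<ge>M. dist (Q (inverse (real (Suc m))) x) (Q (inverse (real (Suc n))) x) < e" by blast
  qed
  then obtain L where L: "(\<lambda>i. Q (inverse (real (Suc i))) x) \<longlonglongrightarrow> L"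
    using Cauchy_convergent convergent_def by blast
  have "(f has_vector_derivative L) (at x)"
    unfolding has_vector_derivative_def has_derivative_at_alt
  proof (intro conjI allI impI)
    show "bounded_linear (\<lambda>k. k *\<^sub>R L)" by (rule bounded_linear_scaleR_left)
    fix e :: real assume "0 < e"
    then obtain r where r: "r > 0" "\<And>h k. 0 < \<bar>h\<bar> \<Longrightarrow> \<bar>h\<bar> < r \<Longrightarrow> 0 < \<bar>k\<bar> \<Longrightarrow> \<bar>k\<bar> < r \<Longrightarrow> norm (Q h x - Q k x) \<le> e"
      using real[of e] by auto
    have "norm (f y - f x - (y - x) *\<^sub>R L) \<le> e * norm (y - x)" if y: "norm (y - x) < r" for y
    proof (cases "y = x")
      case False
      define h where "h = y - x"
      have h: "0 < \<bar>h\<bar>" "\<bar>h\<bar> < r" using y False by (auto simp: h_def)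
      have "norm (Q h x - L) \<le> e"
      proof (rule Lim_norm_ubound[OF sequentially_bot tendsto_diff[OF tendsto_const L]])
        have "eventually (\<lambda>i. inverse (real (Suc i)) < r) sequentially"
          using LIMSEQ_inverse_real_of_nat r(1) by (rule order_tendstoD)
        then show "\<forall>\<^sub>F i in sequentially. norm (Q h x - Q (inverse (real (Suc i))) x) \<le> e"
          by eventually_elim (use r(2) h in auto)
      qed
      moreover have "f y - f x - (y - x) *\<^sub>R L = h *\<^sub>R (Q h x - L)"
      proof -
        have "h *\<^sub>R Q h x = f y - f x" unfolding Q_def using h by (simp add: h_def)
        then show ?thesis by (simp add: scaleR_diff_right flip: h_def)
      qed
      ultimately show ?thesis using h by (simp add: h_def mult.commute mult_left_mono)
    qed simp
    with r(1) show "\<exists>d>0. \<forall>y. norm (y - x) < d \<longrightarrow> norm (f y - f x - (y - x) *\<^sub>R L) \<le> e * norm (y - x)" by blast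
  qed
  then show "f differentiable (at x)" by (rule differentiableI_vector)
qed

text \<open>On the measurable set of differentiability the derivative is a pointwise limit of
  difference quotients; elsewhere \<open>vector_derivative\<close> is a choice from the empty set,
  hence one fixed constant.\<close>

lemma borel_measurable_vector_derivative:
  fixes f :: "real \<Rightarrow> complex"
  assumes f: "continuous_on UNIV f"
  shows "(\<lambda>x. vector_derivative f (at x)) \<in> borel_measurable borel"
proof -
  define Q where "Q h x = (f (x + h) - f x) /\<^sub>R h" for h x
  have [measurable]: "f \<in> borel_measurable borel" using f by (rule borel_measurable_continuous_onI)
  have [measurable]: "Q h \<in> borel_measurable borel" for h unfolding Q_def by measurable
  have D [measurable]: "Measurable.pred borel (\<lambda>x. f differentiable (at x))"
    unfolding differentiable_iff_rational_Cauchy[OF f] Q_def[symmetric] by measurable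
  have "vector_derivative f (at x) = (if f differentiable (at x) then lim (\<lambda>i. Q (inverse (real (Suc i))) x) else (SOME d. False))" for x
  proof (cases "f differentiable (at x)")
    case True
    define D where "D = vector_derivative f (at x)"
    have "(f has_vector_derivative D) (at x)" using True unfolding D_def by (simp add: vector_derivative_works)
    then have d: "\<And>e. 0 < e \<Longrightarrow> \<exists>d>0. \<forall>y. norm (y - x) < d \<longrightarrow> norm (f y - f x - (y - x) *\<^sub>R D) \<le> e * norm (y - x)"
      unfolding has_vector_derivative_def has_derivative_at_alt by blast
    have "(\<lambda>i. Q (inverse (real (Suc i))) x) \<longlonglongrightarrow> D"
    proof (rule metric_LIMSEQ_I)
      fix e :: real assume "0 < e"
      then obtain r where r: "r > 0" "\<And>y. norm (y - x) < r \<Longrightarrow> norm (f y - f x - (y - x) *\<^sub>R D) \<le> e/2 * norm (y - x)"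
        using d[of "e/2"] by auto
      obtain N where N: "inverse (real (Suc N)) < r" using reals_Archimedean[OF r(1)] by auto
      have "dist (Q (inverse (real (Suc i))) x) D < e" if "N \<le> i" for i
      proof -
        define h where "h = inverse (real (Suc i))"
        have "h \<le> inverse (real (Suc N))" using that by (simp add: h_def le_imp_inverse_le)
        then have "h < r" using N by linarith
        moreover have "0 < h" by (simp add: h_def)
        ultimately have h: "0 < h" "h < r" by simp_all
        have "Q h x - D = (f (x + h) - f x - h *\<^sub>R D) /\<^sub>R h" using h by (simp add: Q_def algebra_simps)
        then have "norm (Q h x - D) = norm (f (x + h) - f x - h *\<^sub>R D) / h"
          using h by (simp add: divide_inverse mult.commute)
        also have "\<dots> \<le> (e/2 * h) / h"
          using r(2)[of "x + h"] h by (intro divide_right_mono) auto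
        finally have "norm (Q h x - D) < e" using h \<open>0 < e\<close> by simp
        then show ?thesis unfolding h_def dist_norm .
      qed
      then show "\<exists>N. \<forall>i\<ge>N. dist (Q (inverse (real (Suc i))) x) D < e" by blast
    qed
    then show ?thesis using True D_def limI by metis
  next
    case False
    then have "\<And>d. \<not> (f has_vector_derivative d) (at x)" using differentiableI_vector by blast
    then show ?thesis using False unfolding vector_derivative_def by simp
  qed
  moreover have "(\<lambda>x. if f differentiable (at x) then lim (\<lambda>i. Q (inverse (real (Suc i))) x) else (SOME d. False)) \<in> borel_measurable borel"
    by measurable
  ultimately show ?thesis by simp
qed

lemma borel_measurable_vector_derivative_Icc:
  fixes f :: "real \<Rightarrow> complex"
  assumes f: "continuous_on {a..b} f"
  shows "(\<lambda>x. indicator {a..b} x *\<^sub>R vector_derivative f (at x)) \<in> borel_measurable borel"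
proof (cases "a \<le> b")
  case True
  \<comment> \<open>Clamping the argument continues \<open>f\<close> to a continuous function on the
    line without changing its derivative inside the interval.\<close>
  define g where "g x = f (max a (min b x))" for x
  have "continuous_on UNIV g"
    unfolding g_def using True by (intro continuous_on_compose2[OF f] continuous_intros) auto
  then have [measurable]: "(\<lambda>x. vector_derivative g (at x)) \<in> borel_measurable borel"
    by (rule borel_measurable_vector_derivative)
  have eq: "vector_derivative f (at x) = vector_derivative g (at x)" if x: "x \<in> {a<..<b}" for x
  proof (rule vector_derivative_eqI)
    fix d
    show "(f has_vector_derivative d) (at x) \<longleftrightarrow> (g has_vector_derivative d) (at x)"
      using has_vector_derivative_transform_within_open[of f d x "{a<..<b}" g]
        has_vector_derivative_transform_within_open[of g d x "{a<..<b}" f] x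
      by (auto simp: g_def)
  qed
  \<comment> \<open>The two endpoints are listed separately, since the derivatives of
    \<open>f\<close> and of its continuation may differ there.\<close>
  have "(\<lambda>x. indicator {a..b} x *\<^sub>R vector_derivative f (at x)) =
     (\<lambda>x. if x = a then vector_derivative f (at a) else if x = b then vector_derivative f (at b)
        else indicator {a<..<b} x *\<^sub>R vector_derivative g (at x))"
    using True eq by (auto simp: fun_eq_iff indicator_def)
  then show ?thesis by simp
qed simp

text \<open>A density \<open>h\<close> exists, it is a.e. the derivative of \<open>f\<close>, and
  measurability of the pointwise derivative lets the latter take the place of \<open>h\<close>. The
  pointwise form is what \<open>Hop\<close> refers to.\<close>

theorem abs_cont_FTC:
  assumes "a < b" "abs_cont a b f"
  shows "set_integrable lborel {a..b} (\<lambda>x. vector_derivative f (at x))"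
    and "\<And>x. x \<in> {a..b} \<Longrightarrow> f x = f a + (LINT t:{a..x}|lborel. vector_derivative f (at t))"
    and "AE x in lborel. x \<in> {a..b} \<longrightarrow> (f has_vector_derivative vector_derivative f (at x)) (at x)"
proof -
  obtain h where h: "integrable lborel h" "\<And>t. t \<notin> {a..b} \<Longrightarrow> h t = 0"
    "\<And>x. x \<in> {a..b} \<Longrightarrow> f x = f a + (LINT t:{a..x}|lborel. h t)"
    using abs_cont_density[OF assms] by blast
  have hi: "set_integrable lborel {a..b} h" using h(1) by (rule set_integrable_integrable) simp
  have AE: "AE x in lborel. x \<in> {a..b} \<longrightarrow> (f has_vector_derivative h x) (at x)"
    using indefinite_integral_abs_cont(2)[OF hi h(3)] by simp
  then have AE2: "AE x in lborel. x \<in> {a..b} \<longrightarrow> h x = vector_derivative f (at x)"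
    by eventually_elim (auto simp: vector_derivative_at)
  show "AE x in lborel. x \<in> {a..b} \<longrightarrow> (f has_vector_derivative vector_derivative f (at x)) (at x)"
    using AE AE2 by eventually_elim auto
  have m: "(\<lambda>x. indicator {a..b} x *\<^sub>R vector_derivative f (at x)) \<in> borel_measurable borel"
    by (intro borel_measurable_vector_derivative_Icc abs_cont_continuous assms)
  show int: "set_integrable lborel {a..b} (\<lambda>x. vector_derivative f (at x))"
    by (rule set_integrable_cong_AE_measurable[OF hi _ AE2]) (use m in simp)
  show "f x = f a + (LINT t:{a..x}|lborel. vector_derivative f (at t))" if "x \<in> {a..b}" for x
  proof -
    have "(LINT t:{a..x}|lborel. h t) = (LINT t:{a..x}|lborel. vector_derivative f (at t))"
    proof (rule set_integral_cong_AE_lborel)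
      have "set_integrable lborel {a..x} h" "set_integrable lborel {a..x} (\<lambda>x. vector_derivative f (at x))"
        using that by (auto intro: set_integrable_subset[OF hi] set_integrable_subset[OF int])
      then show "(\<lambda>x'. indicator {a..x} x' *\<^sub>R h x') \<in> borel_measurable lborel"
        "(\<lambda>x'. indicator {a..x} x' *\<^sub>R vector_derivative f (at x')) \<in> borel_measurable lborel"
        by (auto simp: set_integrable_def dest: borel_measurable_integrable)
      show "AE t in lborel. t \<in> {a..x} \<longrightarrow> h t = vector_derivative f (at t)"
        using AE2 by eventually_elim (use that in auto)
    qed
    with h(3)[OF that] show ?thesis by simp
  qed
qed

section \<open>Linear systems with integrable coefficients\<close>

lemma integrable_mult_bounded:
  fixes A u :: "real \<Rightarrow> complex"
  assumes "integrable lborel A" "u \<in> borel_measurable borel" "\<And>t. cmod (u t) \<le> C"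
  shows "integrable lborel (\<lambda>t. A t * u t)"
proof (rule Bochner_Integration.integrable_bound)
  show "integrable lborel (\<lambda>t. C * norm (A t))" using assms(1) by simp
  show "(\<lambda>t. A t * u t) \<in> borel_measurable lborel"
    using borel_measurable_integrable[OF assms(1)] assms(2) by simp
  show "AE t in lborel. norm (A t * u t) \<le> norm (C * norm (A t))"
  proof (rule AE_I2)
    fix t
    have "norm (A t * u t) \<le> C * norm (A t)"
      using mult_right_mono[OF assms(3)[of t] norm_ge_zero[of "A t"]] by (simp add: norm_mult mult.commute)
    then show "norm (A t * u t) \<le> norm (C * norm (A t))" by simp
  qed
qed

lemma norm_fst: "norm (fst u) \<le> norm u" and norm_snd: "norm (snd u) \<le> norm u"
  by (metis norm_fst_le prod.collapse) (metis norm_snd_le prod.collapse)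

text \<open>The integrand is a.e. half the derivative of \<open>exp (2 * G)\<close>; dropping the
  positive value at the left end gives the bound. It supplies the contraction constant 1/2 in the
  existence proof for linear systems, whatever the length of the interval.\<close>

lemma exp_indefinite_integral:
  fixes g :: "real \<Rightarrow> real"
  assumes "v < l" and g: "integrable lborel g" "\<And>t. 0 \<le> g t"
  defines "G \<equiv> \<lambda>x. LINT t:{v..x}|lborel. g t"
  assumes x: "x \<in> {v..l}"
  shows "(LINT t:{v..x}|lborel. g t * exp (2 * G t)) \<le> exp (2 * G x) / 2"
proof -
  have cG: "complex_of_real (G x) = (LINT t:{v..x}|lborel. complex_of_real (g t))" for x
    unfolding G_def by (simp add: set_integral_complex_of_real)
  have gi: "integrable lborel (\<lambda>t. complex_of_real (g t))" using g(1) by simp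
  have mono: "G s \<le> G t" if "v \<le> s" "s \<le> t" for s t
  proof -
    have "0 \<le> (LINT x:{s..t}|lborel. g x)"
      unfolding set_lebesgue_integral_def using g(2) by (intro integral_nonneg_AE AE_I2) auto
    with LINT_Icc_combine[OF g(1) that] show ?thesis unfolding G_def by simp
  qed
  have acG: "abs_cont v l (\<lambda>x. complex_of_real (G x))"
    using abs_cont_indefinite_integral[OF gi] unfolding cG .
  define E where "E t = complex_of_real (exp (2 * G t))" for t
  have acE: "abs_cont v l E"
  \<comment> \<open>The constant is a Lipschitz constant of \<open>exp (2 * _)\<close> on the range
    of \<open>G\<close>, obtained from the tangent inequality
    \<open>1 + y \<le> exp y\<close>.\<close>
  proof (rule abs_cont_dominated1[OF acG, of "2 * exp (2 * G l)"])
    fix s t assume st: "v \<le> s" "s \<le> t" "t \<le> l"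
    have "exp (2 * G t) - exp (2 * G s) = exp (2 * G t) * (1 - exp (2 * (G s - G t)))"
      by (simp add: algebra_simps flip: exp_add)
    also have "1 - exp (2 * (G s - G t)) \<le> 2 * (G t - G s)"
      using exp_ge_add_one_self[of "2 * (G s - G t)"] by (simp add: algebra_simps)
    also have "exp (2 * G t) * (2 * (G t - G s)) \<le> exp (2 * G l) * (2 * (G t - G s))"
      using mono[of s t] mono[of t l] st by (intro mult_right_mono) auto
    finally have *: "exp (2 * G t) - exp (2 * G s) \<le> 2 * exp (2 * G l) * (G t - G s)"
      by (simp add: algebra_simps)
    have "exp (2 * G s) \<le> exp (2 * G t)" using mono[of s t] st by simp
    with * mono[of s t] st show "cmod (E t - E s) \<le> 2 * exp (2 * G l) * cmod (complex_of_real (G t) - complex_of_real (G s))"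
      unfolding E_def by (simp flip: of_real_diff)
  qed simp
  have "AE t in lborel. v < t \<longrightarrow> ((\<lambda>x. complex_of_real (G x)) has_vector_derivative complex_of_real (g t)) (at t)"
    using indefinite_integral_has_vector_derivative_AE[OF gi, of v] unfolding cG .
  then have AE: "AE t in lborel. t \<in> {v..x} \<longrightarrow> vector_derivative E (at t) = complex_of_real (2 * (g t * exp (2 * G t)))"
    using AE_lborel_singleton[of v]
  proof eventually_elim
    case (elim t)
    show ?case
    proof
      assume t: "t \<in> {v..x}"
      have "((\<lambda>x. Re (complex_of_real (G x))) has_vector_derivative Re (complex_of_real (g t))) (at t)"
        using elim t by (intro bounded_linear.has_vector_derivative[OF bounded_linear_Re]) auto
      then have "(G has_real_derivative g t) (at t)" by (simp add: has_real_derivative_iff_has_vector_derivative)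
      then have "((\<lambda>x. exp (2 * G x)) has_real_derivative 2 * (g t * exp (2 * G t))) (at t)"
        by (auto intro!: derivative_eq_intros)
      then have "(E has_vector_derivative complex_of_real (2 * (g t * exp (2 * G t)))) (at t)"
        unfolding E_def has_real_derivative_iff_has_vector_derivative
        by (rule bounded_linear.has_vector_derivative[OF bounded_linear_of_real])
      then show "vector_derivative E (at t) = complex_of_real (2 * (g t * exp (2 * G t)))"
        by (rule vector_derivative_at)
    qed
  qed
  note FTC = abs_cont_FTC[OF \<open>v < l\<close> acE]
  have [measurable]: "g \<in> borel_measurable borel" using borel_measurable_integrable[OF g(1)] by simp
  have "continuous_on {v..l} (\<lambda>t. Re (complex_of_real (G t)))" by (intro continuous_on_Re abs_cont_continuous[OF acG])
  then have c: "continuous_on {v..x} G" using x by (auto intro: continuous_on_subset)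
  have Gm: "(\<lambda>t. indicator {v..x} t * (g t * exp (2 * G t))) \<in> borel_measurable borel"
  proof -
    have "(\<lambda>t. indicator {v..x} t *\<^sub>R exp (2 * G t)) \<in> borel_measurable borel"
      by (rule borel_measurable_continuous_on_indicator) (auto intro!: continuous_intros c)
    then have "(\<lambda>t. g t * (indicator {v..x} t *\<^sub>R exp (2 * G t))) \<in> borel_measurable borel" by simp
    then show ?thesis by (simp add: ac_simps)
  qed
  have "E x = E v + (LINT t:{v..x}|lborel. vector_derivative E (at t))" by (rule FTC(2)[OF x])
  also have "(LINT t:{v..x}|lborel. vector_derivative E (at t)) = (LINT t:{v..x}|lborel. complex_of_real (2 * (g t * exp (2 * G t))))"
  proof (rule set_integral_cong_AE_lborel[OF _ _ AE])
    have "set_integrable lborel {v..x} (\<lambda>x. vector_derivative E (at x))"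
      using x by (intro set_integrable_subset[OF FTC(1)]) auto
    then show "(\<lambda>t. indicator {v..x} t *\<^sub>R vector_derivative E (at t)) \<in> borel_measurable lborel"
      by (auto simp: set_integrable_def dest: borel_measurable_integrable)
    have "(\<lambda>t. complex_of_real (2 * (indicator {v..x} t * (g t * exp (2 * G t))))) \<in> borel_measurable borel"
      using Gm by measurable
    then show "(\<lambda>t. indicator {v..x} t *\<^sub>R complex_of_real (2 * (g t * exp (2 * G t)))) \<in> borel_measurable lborel"
      by (simp add: scaleR_conv_of_real ac_simps)
  qed
  also have "\<dots> = complex_of_real (2 * (LINT t:{v..x}|lborel. g t * exp (2 * G t)))"
    by (simp only: set_integral_complex_of_real set_integral_mult_right)
  finally have "complex_of_real (exp (2 * G x)) = complex_of_real (exp (2 * G v) + 2 * (LINT t:{v..x}|lborel. g t * exp (2 * G t)))"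
    unfolding E_def by simp
  then have "exp (2 * G x) = exp (2 * G v) + 2 * (LINT t:{v..x}|lborel. g t * exp (2 * G t))"
    using of_real_eq_iff by blast
  then show ?thesis using exp_gt_zero[of "2 * G v"] by simp
qed

text \<open>Picard's argument for merely integrable coefficients. Weighting the supremum norm with
  \<open>exp (-2 * G)\<close>, where \<open>G\<close> integrates the sizes of all coefficients,
  makes the integral operator a contraction on the whole interval at once, so no solutions have to
  be glued.\<close>

lemma linear_ode_exists:
  fixes A B C D :: "real \<Rightarrow> complex"
  assumes vl: "v < l" and int: "integrable lborel A" "integrable lborel B" "integrable lborel C" "integrable lborel D"
  obtains y1 y2 where "continuous_on {v..l} y1" "continuous_on {v..l} y2"
    "\<And>x. x \<in> {v..l} \<Longrightarrow> y1 x = c1 + (LINT t:{v..x}|lborel. A t * y1 t + B t * y2 t)"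
    "\<And>x. x \<in> {v..l} \<Longrightarrow> y2 x = c2 + (LINT t:{v..x}|lborel. C t * y1 t + D t * y2 t)"
proof -
  define g where "g t = cmod (A t) + cmod (B t) + cmod (C t) + cmod (D t)" for t
  have g: "integrable lborel g" "\<And>t. 0 \<le> g t" unfolding g_def using int by auto
  define G where "G x = (LINT t:{v..x}|lborel. g t)" for x
  \<comment> \<open>The clamp turns functions on the interval into bounded continuous functions on
    the line, the complete space in which the fixed point is sought.\<close>
  define cl where "cl x = max v (min l x)" for x
  have cl: "cl x \<in> {v..l}" "x \<in> {v..l} \<Longrightarrow> cl x = x" for x using vl by (auto simp: cl_def)
  have clc: "continuous_on UNIV cl" unfolding cl_def by (intro continuous_intros)
  have Gc: "continuous_on {v..l} G"
  proof -
    have "complex_of_real (G x) = (LINT t:{v..x}|lborel. complex_of_real (g t))" for x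
      unfolding G_def by (simp add: set_integral_complex_of_real)
    then have "abs_cont v l (\<lambda>x. complex_of_real (G x))"
      using abs_cont_indefinite_integral[of "\<lambda>t. complex_of_real (g t)" v l] g(1) by simp
    then have "continuous_on {v..l} (\<lambda>t. Re (complex_of_real (G t)))" by (intro continuous_on_Re abs_cont_continuous)
    then show ?thesis by simp
  qed
  define H where "H x = G (cl x)" for x
  have Hc: "continuous_on UNIV H" unfolding H_def using cl by (intro continuous_on_compose2[OF Gc clc]) auto
  have Hm [measurable]: "H \<in> borel_measurable borel" using Hc by (rule borel_measurable_continuous_onI)
  obtain K where K: "\<And>x. exp (2 * H x) \<le> K"
  proof -
    have "compact ((\<lambda>x. exp (2 * G x)) ` {v..l})"
      by (intro compact_continuous_image continuous_intros Gc) auto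
    then obtain K where "\<And>x. x \<in> {v..l} \<Longrightarrow> norm (exp (2 * G x)) \<le> K"
      by (meson bounded_iff compact_imp_bounded imageI)
    with cl that show thesis unfolding H_def by (metis abs_exp_cancel real_norm_def)
  qed
  define I1 where "I1 u x = (LINT t:{v..x}|lborel. complex_of_real (exp (2 * H t)) * (A t * fst (u t) + B t * snd (u t)))" for u x
  define I2 where "I2 u x = (LINT t:{v..x}|lborel. complex_of_real (exp (2 * H t)) * (C t * fst (u t) + D t * snd (u t)))" for u x
  have ib: "integrable lborel (\<lambda>t. complex_of_real (exp (2 * H t)) * (P t * fst (u t) + Q t * snd (u t)))"
    if PQ: "integrable lborel P" "integrable lborel Q" and u: "continuous_on UNIV u" "bounded (range u)" for P Q :: "real \<Rightarrow> complex" and u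
  proof -
    obtain M where M: "\<And>t. norm (u t) \<le> M" using u(2) by (auto simp: bounded_iff)
    have M0: "0 \<le> M" using M[of 0] norm_ge_zero order_trans by blast
    have um: "(\<lambda>t. fst (u t)) \<in> borel_measurable borel" "(\<lambda>t. snd (u t)) \<in> borel_measurable borel"
      using u(1) by (auto intro!: borel_measurable_continuous_onI continuous_intros)
    have b: "cmod (complex_of_real (exp (2 * H t)) * w) \<le> K * M" if "cmod w \<le> M" for t and w :: complex
      using K[of t] that M0 by (simp add: norm_mult mult_mono' order_trans[OF _ K])
    have "integrable lborel (\<lambda>t. P t * (complex_of_real (exp (2 * H t)) * fst (u t)) + Q t * (complex_of_real (exp (2 * H t)) * snd (u t)))"
      using um by (intro Bochner_Integration.integrable_add integrable_mult_bounded[where C = "K * M"] PQ b)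
         (auto intro: order_trans[OF norm_fst M] order_trans[OF norm_snd M])
    then show ?thesis by (simp add: algebra_simps)
  qed
  \<comment> \<open>The unknown is the weighted solution \<open>u = exp (-2 * H) y\<close>, so the
    ordinary supremum distance of \<open>u\<close> is the weighted one of \<open>y\<close>; the
    factor \<open>exp (2 * H t)\<close> inside the integrals undoes the weight.\<close>
  define \<Phi> where "\<Phi> u x = exp (- 2 * H x) *\<^sub>R (c1 + I1 u (cl x), c2 + I2 u (cl x))" for u x
  have \<Phi>: "\<Phi> u \<in> bcontfun" if "u \<in> bcontfun" for u
  proof -
    have u: "continuous_on UNIV u" "bounded (range u)" using that by (auto simp: bcontfun_def)
    have ac: "abs_cont v l (I1 u)" "abs_cont v l (I2 u)"
      unfolding I1_def I2_def using u int by (auto intro!: abs_cont_indefinite_integral ib)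
    have c: "continuous_on {v..l} (\<lambda>x. exp (- 2 * G x) *\<^sub>R (c1 + I1 u x, c2 + I2 u x))"
      by (intro continuous_intros Gc abs_cont_continuous ac)
    have eq: "\<Phi> u = (\<lambda>x. (\<lambda>x. exp (- 2 * G x) *\<^sub>R (c1 + I1 u x, c2 + I2 u x)) (cl x))"
      by (auto simp: \<Phi>_def H_def fun_eq_iff)
    have "continuous_on UNIV (\<Phi> u)"
      unfolding eq using cl by (intro continuous_on_compose2[OF c clc]) auto
    moreover have "bounded (range (\<Phi> u))"
    proof (rule bounded_subset)
      show "bounded ((\<lambda>x. exp (- 2 * G x) *\<^sub>R (c1 + I1 u x, c2 + I2 u x)) ` {v..l})"
        by (intro compact_imp_bounded compact_continuous_image c) auto
      show "range (\<Phi> u) \<subseteq> (\<lambda>x. exp (- 2 * G x) *\<^sub>R (c1 + I1 u x, c2 + I2 u x)) ` {v..l}"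
        unfolding eq using cl by auto
    qed
    ultimately show ?thesis by (simp add: bcontfun_def)
  qed
  define T where "T u = Bcontfun (\<Phi> (apply_bcontfun u))" for u
  have T: "apply_bcontfun (T u) = \<Phi> (apply_bcontfun u)" for u
    unfolding T_def using \<Phi>[OF apply_bcontfun[of u]] by (simp add: Bcontfun_inverse)
  have contr: "dist (T u) (T w) \<le> 1/2 * dist u w" for u w
  proof (rule dist_bound)
    fix x
    define d where "d = dist u w"
    have d: "0 \<le> d" "\<And>t. norm (apply_bcontfun u t - apply_bcontfun w t) \<le> d"
      using dist_bounded[of u _ w] by (auto simp: d_def dist_norm)
    define X where "X = cl x"
    have X: "X \<in> {v..l}" using cl by (simp add: X_def)
    have ub: "continuous_on UNIV (apply_bcontfun u)" "bounded (range (apply_bcontfun u))" for u :: "real \<Rightarrow>\<^sub>C (complex \<times> complex)"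
      using apply_bcontfun[of u] by (auto simp: bcontfun_def)
    let ?u = "apply_bcontfun u" and ?w = "apply_bcontfun w"
    have est: "cmod ((LINT t:{v..X}|lborel. complex_of_real (exp (2 * H t)) * (P t * fst (?u t) + Q t * snd (?u t)))
        - (LINT t:{v..X}|lborel. complex_of_real (exp (2 * H t)) * (P t * fst (?w t) + Q t * snd (?w t))))
        \<le> (LINT t:{v..X}|lborel. (cmod (P t) + cmod (Q t)) * exp (2 * H t)) * d"
      if PQ: "integrable lborel P" "integrable lborel Q" for P Q
    proof -
      have i: "set_integrable lborel {v..X} (\<lambda>t. complex_of_real (exp (2 * H t)) * (P t * fst (apply_bcontfun u t) + Q t * snd (apply_bcontfun u t)))" for u :: "real \<Rightarrow>\<^sub>C (complex \<times> complex)"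
        by (intro set_integrable_integrable ib PQ ub) simp
      have i3: "integrable lborel (\<lambda>t. complex_of_real (cmod (P t) + cmod (Q t)) * complex_of_real (exp (2 * H t)))"
        using PQ K by (intro integrable_mult_bounded[where C = K]) auto
      have i2: "integrable lborel (\<lambda>t. (cmod (P t) + cmod (Q t)) * exp (2 * H t))"
        using integrable_Re[OF i3] by simp
      define f where "f u t = complex_of_real (exp (2 * H t)) * (P t * fst (apply_bcontfun u t) + Q t * snd (apply_bcontfun u t))" for u t
      have fi: "set_integrable lborel {v..X} (f u)" for u unfolding f_def by (rule i)
      have "(LINT t:{v..X}|lborel. f u t) - (LINT t:{v..X}|lborel. f w t) = (LINT t:{v..X}|lborel. f u t - f w t)"
        by (rule set_integral_diff(2)[symmetric]) (rule fi)+
      then have "cmod ((LINT t:{v..X}|lborel. f u t) - (LINT t:{v..X}|lborel. f w t)) \<le> (LINT t:{v..X}|lborel. cmod (f u t - f w t))"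
        using set_integral_norm_bound[OF set_integral_diff(1)[OF fi[of u] fi[of w]]] by simp
      also have "\<dots> \<le> (LINT t:{v..X}|lborel. ((cmod (P t) + cmod (Q t)) * exp (2 * H t)) * d)"
      proof (rule set_integral_mono)
        show "set_integrable lborel {v..X} (\<lambda>t. cmod (f u t - f w t))"
          by (intro set_integrable_norm set_integral_diff(1) fi)
        show "set_integrable lborel {v..X} (\<lambda>t. ((cmod (P t) + cmod (Q t)) * exp (2 * H t)) * d)"
          using i2 by (intro set_integrable_integrable) auto
        fix t
        define \<delta> where "\<delta> = ?u t - ?w t"
        have \<delta>: "cmod (fst \<delta>) \<le> d" "cmod (snd \<delta>) \<le> d"
          using norm_fst[of \<delta>] norm_snd[of \<delta>] d(2)[of t] unfolding \<delta>_def by linarith+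
        have "f u t - f w t = complex_of_real (exp (2 * H t)) * (P t * fst \<delta> + Q t * snd \<delta>)"
          by (simp add: f_def \<delta>_def algebra_simps)
        then have "cmod (f u t - f w t) = exp (2 * H t) * cmod (P t * fst \<delta> + Q t * snd \<delta>)"
          by (simp add: norm_mult)
        also have "\<dots> \<le> exp (2 * H t) * (cmod (P t) * d + cmod (Q t) * d)"
          using \<delta> by (intro mult_left_mono norm_triangle_le add_mono) (auto simp: norm_mult mult_left_mono)
        finally show "cmod (f u t - f w t) \<le> ((cmod (P t) + cmod (Q t)) * exp (2 * H t)) * d"
          by (simp add: algebra_simps)
      qed
      finally show ?thesis unfolding f_def by simp
    qed
    have gK: "integrable lborel (\<lambda>t. complex_of_real (cmod (P t) + cmod (Q t)) * complex_of_real (exp (2 * H t)))"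
      if "integrable lborel P" "integrable lborel Q" for P Q :: "real \<Rightarrow> complex"
      using that K by (intro integrable_mult_bounded[where C = K]) auto
    have gK': "set_integrable lborel {v..X} (\<lambda>t. (cmod (P t) + cmod (Q t)) * exp (2 * H t))"
      if "integrable lborel P" "integrable lborel Q" for P Q :: "real \<Rightarrow> complex"
      using integrable_Re[OF gK[OF that]] by (intro set_integrable_integrable) auto
    have "norm (\<Phi> ?u x - \<Phi> ?w x) = exp (- 2 * H x) * norm (I1 ?u X - I1 ?w X, I2 ?u X - I2 ?w X)"
    proof -
      have "\<Phi> ?u x - \<Phi> ?w x = exp (- 2 * H x) *\<^sub>R (I1 ?u X - I1 ?w X, I2 ?u X - I2 ?w X)"
        unfolding \<Phi>_def X_def by (simp add: scaleR_diff_right scaleR_add_right)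
      then show ?thesis by (simp del: scaleR_Pair)
    qed
    also have "\<dots> \<le> exp (- 2 * H x) * (norm (I1 ?u X - I1 ?w X) + norm (I2 ?u X - I2 ?w X))"
      by (intro mult_left_mono norm_Pair_le) simp
    also have "\<dots> \<le> exp (- 2 * H x) * ((LINT t:{v..X}|lborel. (cmod (A t) + cmod (B t)) * exp (2 * H t)) * d + (LINT t:{v..X}|lborel. (cmod (C t) + cmod (D t)) * exp (2 * H t)) * d)"
      unfolding I1_def I2_def using int by (intro mult_left_mono add_mono est) auto
    also have "\<dots> = exp (- 2 * H x) * ((LINT t:{v..X}|lborel. g t * exp (2 * H t)) * d)"
    proof -
      have "(LINT t:{v..X}|lborel. g t * exp (2 * H t)) = (LINT t:{v..X}|lborel. (cmod (A t) + cmod (B t)) * exp (2 * H t) + (cmod (C t) + cmod (D t)) * exp (2 * H t))"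
        unfolding g_def by (simp add: algebra_simps)
      also have "\<dots> = (LINT t:{v..X}|lborel. (cmod (A t) + cmod (B t)) * exp (2 * H t)) + (LINT t:{v..X}|lborel. (cmod (C t) + cmod (D t)) * exp (2 * H t))"
        by (intro set_integral_add(2) gK' int)
      finally show ?thesis by (simp add: algebra_simps)
    qed
    also have "(LINT t:{v..X}|lborel. g t * exp (2 * H t)) = (LINT t:{v..X}|lborel. g t * exp (2 * G t))"
      unfolding set_lebesgue_integral_def using X cl(2)
      by (intro Bochner_Integration.integral_cong) (auto simp: H_def indicator_def)
    also have "exp (- 2 * H x) * ((LINT t:{v..X}|lborel. g t * exp (2 * G t)) * d) \<le> exp (- 2 * H x) * ((exp (2 * G X) / 2) * d)"
      using exp_indefinite_integral[OF vl g X] d(1) unfolding G_def by (intro mult_left_mono mult_right_mono) auto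
    also have "\<dots> = 1/2 * d" by (simp add: H_def X_def exp_minus field_simps)
    finally show "dist (T u x) (T w x) \<le> 1/2 * dist u w" by (simp add: T dist_norm d_def)
  qed
  have "\<exists>!u. T u = u"
    by (rule banach_fix_type[of "1/2"]) (use contr in auto)
  then obtain u where u: "T u = u" by blast
  have ub: "continuous_on UNIV u" "bounded (range u)"
    using apply_bcontfun[of u] by (auto simp: bcontfun_def)
  define y1 where "y1 x = complex_of_real (exp (2 * H x)) * fst (apply_bcontfun u x)" for x
  define y2 where "y2 x = complex_of_real (exp (2 * H x)) * snd (apply_bcontfun u x)" for x
  have ux: "apply_bcontfun u x = exp (- 2 * H x) *\<^sub>R (c1 + I1 (apply_bcontfun u) (cl x), c2 + I2 (apply_bcontfun u) (cl x))" for x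
    using T[of u] unfolding u \<Phi>_def by metis
  have e1: "complex_of_real (exp (2 * H x)) * complex_of_real (exp (- (2 * H x))) = 1" for x
    by (simp flip: of_real_mult exp_add)
  have y1: "y1 x = c1 + I1 (apply_bcontfun u) (cl x)" for x
    unfolding y1_def by (subst ux) (simp add: scaleR_conv_of_real e1 flip: mult.assoc)
  have y2: "y2 x = c2 + I2 (apply_bcontfun u) (cl x)" for x
    unfolding y2_def by (subst ux) (simp add: scaleR_conv_of_real e1 flip: mult.assoc)
  show thesis
  proof (rule that)
    show "continuous_on {v..l} y1" "continuous_on {v..l} y2"
      unfolding y1_def y2_def
      using continuous_on_subset[OF Hc subset_UNIV] continuous_on_subset[OF ub(1) subset_UNIV]
      by (auto intro!: continuous_intros)
    show "y1 x = c1 + (LINT t:{v..x}|lborel. A t * y1 t + B t * y2 t)" if "x \<in> {v..l}" for x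
      using y1[of x] cl(2)[OF that] unfolding I1_def by (simp add: y1_def y2_def algebra_simps)
    show "y2 x = c2 + (LINT t:{v..x}|lborel. C t * y1 t + D t * y2 t)" if "x \<in> {v..l}" for x
      using y2[of x] cl(2)[OF that] unfolding I2_def by (simp add: y1_def y2_def algebra_simps)
  qed
qed

section \<open>The fundamental matrix and variation of constants\<close>

text \<open>Differential equations hold almost everywhere only; in this form their right-hand side
  may be integrated in place of the pointwise derivative.\<close>

lemma abs_cont_FTC_AE:
  assumes "a < b" "abs_cont a b f"
    and D: "AE x in lborel. x \<in> {a..b} \<longrightarrow> (f has_vector_derivative h x) (at x)"
    and m: "(\<lambda>x. indicator {a..b} x *\<^sub>R h x) \<in> borel_measurable lborel"
  shows "set_integrable lborel {a..b} h"
    and "\<And>x. x \<in> {a..b} \<Longrightarrow> f x = f a + (LINT t:{a..x}|lborel. h t)"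
proof -
  have AE: "AE x in lborel. x \<in> {a..b} \<longrightarrow> vector_derivative f (at x) = h x"
    using D by eventually_elim (auto intro: vector_derivative_at)
  note FTC = abs_cont_FTC[OF assms(1,2)]
  show hi: "set_integrable lborel {a..b} h"
    by (rule set_integrable_cong_AE_measurable[OF FTC(1) m AE])
  show "f x = f a + (LINT t:{a..x}|lborel. h t)" if x: "x \<in> {a..b}" for x
  proof -
    have "(LINT t:{a..x}|lborel. vector_derivative f (at t)) = (LINT t:{a..x}|lborel. h t)"
    proof (rule set_integral_cong_AE_lborel)
      have "set_integrable lborel {a..x} h" "set_integrable lborel {a..x} (\<lambda>x. vector_derivative f (at x))"
        using x by (auto intro: set_integrable_subset[OF hi] set_integrable_subset[OF FTC(1)])
      then show "(\<lambda>t. indicator {a..x} t *\<^sub>R h t) \<in> borel_measurable lborel"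
        "(\<lambda>t. indicator {a..x} t *\<^sub>R vector_derivative f (at t)) \<in> borel_measurable lborel"
        by (auto simp: set_integrable_def dest: borel_measurable_integrable)
      show "AE t in lborel. t \<in> {a..x} \<longrightarrow> vector_derivative f (at t) = h t"
        using AE by eventually_elim (use x in auto)
    qed
    with FTC(2)[OF x] show ?thesis by simp
  qed
qed

lemma set_integrable_measurable:
  fixes h :: "real \<Rightarrow> 'a::{banach, second_countable_topology}"
  shows "set_integrable lborel A h \<Longrightarrow> (\<lambda>x. indicator A x *\<^sub>R h x) \<in> borel_measurable lborel"
  by (auto simp: set_integrable_def dest: borel_measurable_integrable)

lemma set_integrable_continuous_mult:
  fixes f k :: "real \<Rightarrow> complex"
  assumes "continuous_on {a..b} f" "set_integrable lborel {a..b} k"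
  shows "set_integrable lborel {a..b} (\<lambda>x. f x * k x)"
proof -
  have "compact (f ` {a..b})" using assms(1) by (intro compact_continuous_image) auto
  then obtain C where C: "\<And>x. x \<in> {a..b} \<Longrightarrow> cmod (f x) \<le> C"
    by (meson bounded_iff compact_imp_bounded imageI)
  have "integrable lborel (\<lambda>t. (indicator {a..b} t *\<^sub>R k t) * (indicator {a..b} t *\<^sub>R f t))"
  proof (rule integrable_mult_bounded[where C = "max C 0"])
    show "(\<lambda>t. indicator {a..b} t *\<^sub>R f t) \<in> borel_measurable borel"
      using assms(1) by (intro borel_measurable_continuous_on_indicator) auto
    show "cmod (indicator {a..b} t *\<^sub>R f t) \<le> max C 0" for t
      using C[of t] by (auto simp: indicator_def)
  qed (use assms(2) in \<open>simp add: set_integrable_def\<close>)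
  moreover have "(\<lambda>t. (indicator {a..b} t *\<^sub>R k t) * (indicator {a..b} t *\<^sub>R f t)) = (\<lambda>t. indicator {a..b} t *\<^sub>R (f t * k t))"
    by (auto simp: indicator_def fun_eq_iff)
  ultimately show ?thesis by (simp add: set_integrable_def)
qed

text \<open>Bilinear, without conjugation, so that integrals against solutions stay holomorphic in
  the spectral parameter.\<close>

definition dotp :: "complex \<times> complex \<Rightarrow> complex \<times> complex \<Rightarrow> complex" where
  "dotp u w = fst u * fst w + snd u * snd w"

definition wronski :: "complex \<times> complex \<Rightarrow> complex \<times> complex \<Rightarrow> complex" where
  "wronski u w = fst u * snd w - snd u * fst w"

definition lincomb :: "complex \<Rightarrow> complex \<times> complex \<Rightarrow> complex \<Rightarrow> complex \<times> complex \<Rightarrow> complex \<times> complex" where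
  "lincomb a u b w = (a * fst u + b * fst w, a * snd u + b * snd w)"

text \<open>Cramer's rule for a basis of determinant 1.\<close>

lemma wronski_expand:
  assumes "wronski u w = 1"
  shows "f = lincomb (- wronski w f) u (wronski u f) w"
proof -
  have "lincomb (- wronski w f) u (wronski u f) w = (fst f * wronski u w, snd f * wronski u w)"
    by (simp add: lincomb_def wronski_def algebra_simps)
  with assms show ?thesis by simp
qed

lemma LINT_singleton [simp]: "(LINT t:{c::real}|lborel. h t) = (0::'a::{banach, second_countable_topology})"
proof -
  have "AE t in lborel. indicator {c} t *\<^sub>R h t = 0"
    using AE_lborel_singleton[of c] by eventually_elim simp
  then show ?thesis unfolding set_lebesgue_integral_def by (rule integral_eq_zero_AE)
qed

locale star =
  fixes v :: real and vj :: "'n::finite \<Rightarrow> real"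
    and p q :: "'n \<Rightarrow> real \<Rightarrow> real" and \<alpha> :: "'n \<Rightarrow> real"
  assumes edges: "\<And>j. v < vj j"
    and p_L1: "\<And>j. set_integrable lborel {v..vj j} (p j)"
    and q_L1: "\<And>j. set_integrable lborel {v..vj j} (q j)"
begin

definition lint :: "'n \<Rightarrow> (real \<Rightarrow> complex \<times> complex) \<Rightarrow> bool" where
  "lint j k \<longleftrightarrow> set_integrable lborel {v..vj j} (\<lambda>x. fst (k x)) \<and> set_integrable lborel {v..vj j} (\<lambda>x. snd (k x))"

definition ac2 :: "'n \<Rightarrow> (real \<Rightarrow> complex \<times> complex) \<Rightarrow> bool" where
  "ac2 j f \<longleftrightarrow> abs_cont v (vj j) (\<lambda>x. fst (f x)) \<and> abs_cont v (vj j) (\<lambda>x. snd (f x))"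

text \<open>The equation \<open>H f = z f + k\<close> solved for the derivatives. Using
  \<open>has_vector_derivative\<close> also asserts that they exist a.e., which an equation between
  values of \<open>vector_derivative\<close> does not.\<close>

definition sol :: "'n \<Rightarrow> complex \<Rightarrow> (real \<Rightarrow> complex \<times> complex) \<Rightarrow> (real \<Rightarrow> complex \<times> complex) \<Rightarrow> bool" where
  "sol j z k f \<longleftrightarrow> ac2 j f \<and>
    (AE x in lborel. x \<in> {v..vj j} \<longrightarrow>
      ((\<lambda>t. fst (f t)) has_vector_derivative
        (of_real (q j x) * fst (f x) - (of_real (p j x) + z) * snd (f x) - snd (k x))) (at x) \<and>
      ((\<lambda>t. snd (f t)) has_vector_derivative
        ((z - of_real (p j x)) * fst (f x) - of_real (q j x) * snd (f x) + fst (k x))) (at x))"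

lemma lint_0 [simp]: "lint j (\<lambda>_. 0)"
  by (simp add: lint_def set_integrable_def)

lemma ac2_cont: "ac2 j f \<Longrightarrow> continuous_on {v..vj j} (\<lambda>x. fst (f x))" "ac2 j f \<Longrightarrow> continuous_on {v..vj j} (\<lambda>x. snd (f x))"
  by (auto simp: ac2_def intro: abs_cont_continuous)

lemma integrable_dotp:
  assumes "ac2 j u" "lint j k"
  shows "set_integrable lborel {v..vj j} (\<lambda>x. dotp (u x) (k x))"
  unfolding dotp_def using assms ac2_cont[OF assms(1)]
  by (intro set_integral_add set_integrable_continuous_mult) (auto simp: lint_def)

text \<open>The coefficient matrix of the first-order system has trace zero, so in the derivative of
  the Wronskian all terms with \<open>p\<close>, \<open>q\<close> and \<open>z\<close> cancel and
  only the inhomogeneity remains.\<close>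

lemma sol_wronski:
  assumes u: "sol j z (\<lambda>_. 0) u" and f: "sol j z k f" and k: "lint j k" and x: "x \<in> {v..vj j}"
  shows "wronski (u x) (f x) = wronski (u v) (f v) + (LINT t:{v..x}|lborel. dotp (u t) (k t))"
proof (rule abs_cont_FTC_AE(2)[OF edges[of j] _ _ _ x])
  have ac: "ac2 j u" "ac2 j f" using u f by (auto simp: sol_def)
  then show "abs_cont v (vj j) (\<lambda>x. wronski (u x) (f x))"
    unfolding wronski_def ac2_def by (intro abs_cont_diff abs_cont_mult) auto
  show "(\<lambda>x. indicator {v..vj j} x *\<^sub>R dotp (u x) (k x)) \<in> borel_measurable lborel"
    by (intro set_integrable_measurable integrable_dotp ac k)
  have "AE x in lborel. x \<in> {v..vj j} \<longrightarrow> ((\<lambda>t. fst (u t)) has_vector_derivative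
        (of_real (q j x) * fst (u x) - (of_real (p j x) + z) * snd (u x))) (at x) \<and>
      ((\<lambda>t. snd (u t)) has_vector_derivative
        ((z - of_real (p j x)) * fst (u x) - of_real (q j x) * snd (u x))) (at x)"
    using u by (simp add: sol_def)
  moreover have "AE x in lborel. x \<in> {v..vj j} \<longrightarrow>
      ((\<lambda>t. fst (f t)) has_vector_derivative
        (of_real (q j x) * fst (f x) - (of_real (p j x) + z) * snd (f x) - snd (k x))) (at x) \<and>
      ((\<lambda>t. snd (f t)) has_vector_derivative
        ((z - of_real (p j x)) * fst (f x) - of_real (q j x) * snd (f x) + fst (k x))) (at x)"
    using f by (simp add: sol_def)
  ultimately show "AE x in lborel. x \<in> {v..vj j} \<longrightarrow> ((\<lambda>x. wronski (u x) (f x)) has_vector_derivative dotp (u x) (k x)) (at x)"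
  proof eventually_elim
    case (elim x)
    show ?case
    proof
      assume x: "x \<in> {v..vj j}"
      show "((\<lambda>x. wronski (u x) (f x)) has_vector_derivative dotp (u x) (k x)) (at x)"
        unfolding wronski_def
        by (rule has_vector_derivative_eq_rhs, rule has_vector_derivative_diff;
            (rule has_vector_derivative_mult)?; (use elim x in blast)?)
           (simp add: dotp_def algebra_simps)
    qed
  qed
qed

lemma lint_coeff:
  "integrable lborel (\<lambda>t. indicator {v..vj j} t *\<^sub>R (complex_of_real (a * p j t + b * q j t) + c))"
proof -
  have "set_integrable lborel {v..vj j} (\<lambda>t. a * p j t + b * q j t)"
    using p_L1[of j] q_L1[of j] by (intro set_integral_add) auto
  then have "set_integrable lborel {v..vj j} (\<lambda>t. complex_of_real (a * p j t + b * q j t))"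
    unfolding set_integrable_def by (auto dest: integrable_of_real[where 'a = complex] simp: scaleR_conv_of_real simp del: of_real_add)
  then have "set_integrable lborel {v..vj j} (\<lambda>t. complex_of_real (a * p j t + b * q j t) + c)"
    by (rule set_integral_add(1)) (intro borel_integrable_atLeastAtMost' continuous_intros)
  then show ?thesis by (simp add: set_integrable_def)
qed

lemma sol_exists:
  obtains f where "sol j z (\<lambda>_. 0) f" "f v = c"
proof -
  let ?I = "\<lambda>t. indicator {v..vj j} t :: real"
  define A B C D where "A t = ?I t *\<^sub>R complex_of_real (q j t)" and "B t = ?I t *\<^sub>R (- (complex_of_real (p j t) + z))"
    and "C t = ?I t *\<^sub>R (z - complex_of_real (p j t))" and "D t = ?I t *\<^sub>R (- complex_of_real (q j t))" for t
  have int: "integrable lborel A" "integrable lborel B" "integrable lborel C" "integrable lborel D"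
    unfolding A_def B_def C_def D_def
    using lint_coeff[of j 0 1 0] lint_coeff[of j "-1" 0 "-z"] lint_coeff[of j "-1" 0 z] lint_coeff[of j 0 "-1" 0]
    by (simp_all add: algebra_simps)
  obtain y1 y2 where y: "continuous_on {v..vj j} y1" "continuous_on {v..vj j} y2"
    "\<And>x. x \<in> {v..vj j} \<Longrightarrow> y1 x = fst c + (LINT t:{v..x}|lborel. A t * y1 t + B t * y2 t)"
    "\<And>x. x \<in> {v..vj j} \<Longrightarrow> y2 x = snd c + (LINT t:{v..x}|lborel. C t * y1 t + D t * y2 t)"
    using linear_ode_exists[OF edges[of j] int] by blast
  have i: "set_integrable lborel {v..vj j} (\<lambda>t. P t * y1 t + Q t * y2 t)"
    if "integrable lborel P" "integrable lborel Q" for P Q :: "real \<Rightarrow> complex"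
    using set_integrable_continuous_mult[OF y(1) set_integrable_integrable[OF that(1)]]
      set_integrable_continuous_mult[OF y(2) set_integrable_integrable[OF that(2)]]
    by (intro set_integral_add) (auto simp: mult.commute)
  have y0: "y1 v = fst c" "y2 v = snd c" using y(3)[of v] y(4)[of v] edges[of j] by auto
  have e: "\<And>x. x \<in> {v..vj j} \<Longrightarrow> y1 x = y1 v + (LINT t:{v..x}|lborel. A t * y1 t + B t * y2 t)"
    "\<And>x. x \<in> {v..vj j} \<Longrightarrow> y2 x = y2 v + (LINT t:{v..x}|lborel. C t * y1 t + D t * y2 t)"
    using y(3,4) unfolding y0 by auto
  have 1: "abs_cont v (vj j) y1" "AE x in lborel. x \<in> {v..vj j} \<longrightarrow> (y1 has_vector_derivative A x * y1 x + B x * y2 x) (at x)"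
    by (rule indefinite_integral_abs_cont[OF i[OF int(1,2)]], erule e)+
  have 2: "abs_cont v (vj j) y2" "AE x in lborel. x \<in> {v..vj j} \<longrightarrow> (y2 has_vector_derivative C x * y1 x + D x * y2 x) (at x)"
    by (rule indefinite_integral_abs_cont[OF i[OF int(3,4)]], erule e)+
  have "sol j z (\<lambda>_. 0) (\<lambda>x. (y1 x, y2 x))"
    unfolding sol_def ac2_def
  proof (intro conjI)
    show "AE x in lborel. x \<in> {v..vj j} \<longrightarrow>
      ((\<lambda>t. fst (y1 t, y2 t)) has_vector_derivative
        (of_real (q j x) * fst (y1 x, y2 x) - (of_real (p j x) + z) * snd (y1 x, y2 x) - snd (0::complex \<times> complex))) (at x) \<and>
      ((\<lambda>t. snd (y1 t, y2 t)) has_vector_derivative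
        ((z - of_real (p j x)) * fst (y1 x, y2 x) - of_real (q j x) * snd (y1 x, y2 x) + fst (0::complex \<times> complex))) (at x)"
      using 1(2) 2(2)
    proof eventually_elim
      case (elim x)
      then show ?case by (auto simp: A_def B_def C_def D_def algebra_simps)
    qed
  qed (use 1(1) 2(1) in simp_all)
  then show thesis using that[of "\<lambda>x. (y1 x, y2 x)"] y0 by simp
qed

text \<open>The coefficients of \<open>f\<close> in the basis \<open>u\<close>, \<open>w\<close> are
  Wronskians, and these are already integrated by \<open>sol_wronski\<close>. The formula contains
  uniqueness. It is stated for arbitrary \<open>u\<close>, \<open>w\<close> because the fundamental
  matrix is a definite description whose uniqueness is derived from it.\<close>

lemma variation_of_constants_gen:
  assumes u: "sol j z (\<lambda>_. 0) u" "u v = (1, 0)" and w: "sol j z (\<lambda>_. 0) w" "w v = (0, 1)"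
    and f: "sol j z k f" and k: "lint j k" and x: "x \<in> {v..vj j}"
  shows "f x = lincomb (fst (f v) - (LINT t:{v..x}|lborel. dotp (w t) (k t))) (u x)
     (snd (f v) + (LINT t:{v..x}|lborel. dotp (u t) (k t))) (w x)"
proof -
  have "wronski (u x) (w x) = 1"
    using sol_wronski[OF u(1) w(1) lint_0 x] u(2) w(2) by (simp add: wronski_def dotp_def set_lebesgue_integral_def)
  from wronski_expand[OF this, of "f x"] show ?thesis
    using u(2) w(2) unfolding sol_wronski[OF u(1) f k x] sol_wronski[OF w(1) f k x]
    by (simp add: wronski_def)
qed

section \<open>Existence and uniqueness of the fundamental matrix\<close>

text \<open>The predicate under the definite description in \<open>Yfun\<close>.\<close>

definition isY :: "'n \<Rightarrow> complex \<Rightarrow> (real \<Rightarrow> complex^2^2) \<Rightarrow> bool" where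
  "isY j z Y \<longleftrightarrow> Y v = mat 1
      \<and> (\<forall>x. x \<notin> {v..vj j} \<longrightarrow> Y x = 0)
      \<and> (\<forall>a b. abs_cont v (vj j) (\<lambda>x. Y x $ a $ b))
      \<and> (AE x in lborel. x \<in> {v..vj j} \<longrightarrow>
           (\<forall>a b. (\<lambda>t. Y t $ a $ b) differentiable (at x))
         \<and> (\<forall>b. vector_derivative (\<lambda>t. Y t $ 2 $ b) (at x)
                  + of_real (p j x) * Y x $ 1 $ b + of_real (q j x) * Y x $ 2 $ b = z * Y x $ 1 $ b
              \<and> - vector_derivative (\<lambda>t. Y t $ 1 $ b) (at x)
                  + of_real (q j x) * Y x $ 1 $ b - of_real (p j x) * Y x $ 2 $ b = z * Y x $ 2 $ b))"

lemma isY_sol: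
  assumes "isY j z Y"
  shows "sol j z (\<lambda>_. 0) (\<lambda>x. (Y x $ 1 $ b, Y x $ 2 $ b))"
proof -
  have "AE x in lborel. x \<in> {v..vj j} \<longrightarrow>
           (\<forall>a b. (\<lambda>t. Y t $ a $ b) differentiable (at x))
         \<and> (\<forall>b. vector_derivative (\<lambda>t. Y t $ 2 $ b) (at x)
                  + of_real (p j x) * Y x $ 1 $ b + of_real (q j x) * Y x $ 2 $ b = z * Y x $ 1 $ b
              \<and> - vector_derivative (\<lambda>t. Y t $ 1 $ b) (at x)
                  + of_real (q j x) * Y x $ 1 $ b - of_real (p j x) * Y x $ 2 $ b = z * Y x $ 2 $ b)"
    using assms unfolding isY_def by blast
  then have "AE x in lborel. x \<in> {v..vj j} \<longrightarrow>
      ((\<lambda>t. Y t $ 1 $ b) has_vector_derivative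
        (of_real (q j x) * Y x $ 1 $ b - (of_real (p j x) + z) * Y x $ 2 $ b)) (at x) \<and>
      ((\<lambda>t. Y t $ 2 $ b) has_vector_derivative
        ((z - of_real (p j x)) * Y x $ 1 $ b - of_real (q j x) * Y x $ 2 $ b)) (at x)"
  proof eventually_elim
    case (elim x)
    show ?case
    proof (intro impI conjI)
      assume x: "x \<in> {v..vj j}"
      have d: "((\<lambda>t. Y t $ a $ b) has_vector_derivative vector_derivative (\<lambda>t. Y t $ a $ b) (at x)) (at x)" for a
        using elim x by (simp add: vector_derivative_works)
      have "vector_derivative (\<lambda>t. Y t $ 1 $ b) (at x) = of_real (q j x) * Y x $ 1 $ b - (of_real (p j x) + z) * Y x $ 2 $ b"
        "vector_derivative (\<lambda>t. Y t $ 2 $ b) (at x) = (z - of_real (p j x)) * Y x $ 1 $ b - of_real (q j x) * Y x $ 2 $ b"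
        using elim x by (auto simp: algebra_simps add_eq_0_iff)
      with d[of 1] d[of 2] show "((\<lambda>t. Y t $ 1 $ b) has_vector_derivative
        (of_real (q j x) * Y x $ 1 $ b - (of_real (p j x) + z) * Y x $ 2 $ b)) (at x)"
        "((\<lambda>t. Y t $ 2 $ b) has_vector_derivative
        ((z - of_real (p j x)) * Y x $ 1 $ b - of_real (q j x) * Y x $ 2 $ b)) (at x)" by simp_all
    qed
  qed
  then show ?thesis using assms by (simp add: sol_def ac2_def isY_def)
qed

lemma isY_init: "isY j z Y \<Longrightarrow> (Y v $ 1 $ 1, Y v $ 2 $ 1) = (1, 0)" "isY j z Y \<Longrightarrow> (Y v $ 1 $ 2, Y v $ 2 $ 2) = (0, 1)"
  by (simp_all add: isY_def mat_def)

text \<open>The columns of both candidates are expanded in the columns of the first, with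
  coefficients given by the initial values, which agree.\<close>

lemma isY_unique: "isY j z Y \<Longrightarrow> isY j z Y' \<Longrightarrow> Y = Y'"
proof
  fix x assume Y: "isY j z Y" "isY j z Y'"
  show "Y x = Y' x"
  proof (cases "x \<in> {v..vj j}")
    case False
    then show ?thesis using Y by (simp add: isY_def)
  next
    case True
    have *: "(Y' x $ 1 $ b, Y' x $ 2 $ b) = (Y x $ 1 $ b, Y x $ 2 $ b)" for b
    proof -
      have "(Y' x $ 1 $ b, Y' x $ 2 $ b) = lincomb (Y' v $ 1 $ b) (Y x $ 1 $ 1, Y x $ 2 $ 1) (Y' v $ 2 $ b) (Y x $ 1 $ 2, Y x $ 2 $ 2)"
        if "isY j z Y'" for Y'
        using variation_of_constants_gen[OF isY_sol[OF Y(1)] isY_init(1)[OF Y(1)] isY_sol[OF Y(1)] isY_init(2)[OF Y(1)] isY_sol[OF that, of b] lint_0 True]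
        by (simp add: dotp_def set_lebesgue_integral_def)
      from this[OF Y(1)] this[OF Y(2)] show ?thesis using Y by (simp add: isY_def)
    qed
    show ?thesis using *[of 1] *[of 2] by (simp add: vec_eq_iff forall_2)
  qed
qed

lemma isY_exists: "\<exists>Y. isY j z Y"
proof -
  obtain u where u: "sol j z (\<lambda>_. 0) u" "u v = (1, 0)" by (rule sol_exists)
  obtain w where w: "sol j z (\<lambda>_. 0) w" "w v = (0, 1)" by (rule sol_exists)
  define Y :: "real \<Rightarrow> complex^2^2" where "Y x = (if x \<in> {v..vj j} then
     (\<chi> a b. (if a = 1 then fst else snd) ((if b = 1 then u else w) x)) else 0)" for x
  have Yx: "Y x $ a $ b = (if a = 1 then fst else snd) ((if b = 1 then u else w) x)" if "x \<in> {v..vj j}" for x a b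
    using that by (simp add: Y_def)
  \<comment> \<open>\<open>Y\<close> is cut off to 0 outside the edge, so two-sided derivatives
    carry over in the open interval only; the endpoints are removed as null sets below.\<close>
  have D: "((\<lambda>t. Y t $ a $ b) has_vector_derivative d) (at x)"
    if "x \<in> {v<..<vj j}" "((\<lambda>t. (if a = 1 then fst else snd) ((if b = 1 then u else w) t)) has_vector_derivative d) (at x)" for x a b d
    by (rule has_vector_derivative_transform_within_open[OF that(2), of "{v<..<vj j}"]) (use that(1) Yx in auto)
  have "isY j z Y"
    unfolding isY_def
  proof (intro conjI allI impI)
    show "Y v = mat 1"
      using Yx[of v] edges[of j] u(2) w(2) by (auto simp: vec_eq_iff mat_def forall_2)
    show "abs_cont v (vj j) (\<lambda>x. Y x $ a $ b)" for a b
      by (rule abs_cont_cong[of _ _ "\<lambda>x. (if a = 1 then fst else snd) ((if b = 1 then u else w) x)"])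
         (use Yx u w in \<open>auto simp: sol_def ac2_def\<close>)
    have "AE x in lborel. x \<in> {v..vj j} \<longrightarrow> (\<forall>b.
      ((\<lambda>t. fst ((if b then u else w) t)) has_vector_derivative
        (of_real (q j x) * fst ((if b then u else w) x) - (of_real (p j x) + z) * snd ((if b then u else w) x))) (at x) \<and>
      ((\<lambda>t. snd ((if b then u else w) t)) has_vector_derivative
        ((z - of_real (p j x)) * fst ((if b then u else w) x) - of_real (q j x) * snd ((if b then u else w) x))) (at x))"
      using u(1)[unfolded sol_def, THEN conjunct2] w(1)[unfolded sol_def, THEN conjunct2]
      by eventually_elim (auto split: if_splits)
    then show "AE x in lborel. x \<in> {v..vj j} \<longrightarrow>
           (\<forall>a b. (\<lambda>t. Y t $ a $ b) differentiable (at x))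
         \<and> (\<forall>b. vector_derivative (\<lambda>t. Y t $ 2 $ b) (at x)
                  + of_real (p j x) * Y x $ 1 $ b + of_real (q j x) * Y x $ 2 $ b = z * Y x $ 1 $ b
              \<and> - vector_derivative (\<lambda>t. Y t $ 1 $ b) (at x)
                  + of_real (q j x) * Y x $ 1 $ b - of_real (p j x) * Y x $ 2 $ b = z * Y x $ 2 $ b)"
      using AE_lborel_singleton[of v] AE_lborel_singleton[of "vj j"]
    proof eventually_elim
      case (elim x)
      show ?case
      proof
        assume "x \<in> {v..vj j}"
        with elim have x: "x \<in> {v<..<vj j}" "x \<in> {v..vj j}" by auto
        have 1: "((\<lambda>t. Y t $ 1 $ b) has_vector_derivative (of_real (q j x) * Y x $ 1 $ b - (of_real (p j x) + z) * Y x $ 2 $ b)) (at x)" for b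
          using elim x(2) spec[where x = "b = 1"] by (intro D x(1)) (auto simp: Yx[OF x(2)])
        have 2: "((\<lambda>t. Y t $ 2 $ b) has_vector_derivative ((z - of_real (p j x)) * Y x $ 1 $ b - of_real (q j x) * Y x $ 2 $ b)) (at x)" for b
          using elim x(2) spec[where x = "b = 1"] by (intro D x(1)) (auto simp: Yx[OF x(2)])
        have "(\<lambda>t. Y t $ a $ b) differentiable (at x)" for a b
          using exhaust_2[of a] differentiableI_vector[OF 1[of b]] differentiableI_vector[OF 2[of b]] by auto
        then show "(\<forall>a b. (\<lambda>t. Y t $ a $ b) differentiable (at x))
         \<and> (\<forall>b. vector_derivative (\<lambda>t. Y t $ 2 $ b) (at x)
                  + of_real (p j x) * Y x $ 1 $ b + of_real (q j x) * Y x $ 2 $ b = z * Y x $ 1 $ b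
              \<and> - vector_derivative (\<lambda>t. Y t $ 1 $ b) (at x)
                  + of_real (q j x) * Y x $ 1 $ b - of_real (p j x) * Y x $ 2 $ b = z * Y x $ 2 $ b)"
          using vector_derivative_at[OF 1] vector_derivative_at[OF 2] by (simp add: algebra_simps)
      qed
    qed
  qed (auto simp: Y_def)
  then show ?thesis by blast
qed

abbreviation Y where "Y \<equiv> Yfun v vj p q"

definition col :: "'n \<Rightarrow> complex \<Rightarrow> 2 \<Rightarrow> real \<Rightarrow> complex \<times> complex" where
  "col j z b x = (Y j z x $ 1 $ b, Y j z x $ 2 $ b)"

lemma isY_Y: "isY j z (Y j z)"
proof -
  have "Y j z = (THE Y. isY j z Y)" unfolding Yfun_def isY_def ..
  moreover have "\<exists>!Y. isY j z Y" using isY_exists isY_unique by blast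
  ultimately show ?thesis by (metis theI')
qed

lemma sol_col: "sol j z (\<lambda>_. 0) (col j z b)"
  using isY_sol[OF isY_Y] by (simp add: col_def[abs_def])

lemma col_v [simp]: "col j z 1 v = (1, 0)" "col j z 2 v = (0, 1)"
  using isY_init[OF isY_Y] by (simp_all add: col_def)

lemma ac2_col: "ac2 j (col j z b)"
  using sol_col by (simp add: sol_def)

lemma wronski_col: "x \<in> {v..vj j} \<Longrightarrow> wronski (col j z 1 x) (col j z 2 x) = 1"
  using sol_wronski[OF sol_col sol_col lint_0] by (simp add: wronski_def dotp_def set_lebesgue_integral_def)

text \<open>The fundamental matrix has determinant 1, so its inverse is written with its own entries
  and no quotient appears; for fixed \<open>\<xi>\<close> and \<open>k\<close> the formula is
  therefore entire in \<open>z\<close>.\<close>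

definition SolE :: "'n \<Rightarrow> complex \<Rightarrow> complex \<times> complex \<Rightarrow> (real \<Rightarrow> complex \<times> complex) \<Rightarrow> real \<Rightarrow> complex \<times> complex" where
  "SolE j z \<xi> k x = lincomb (fst \<xi> - (LINT t:{v..x}|lborel. dotp (col j z 2 t) (k t))) (col j z 1 x)
     (snd \<xi> + (LINT t:{v..x}|lborel. dotp (col j z 1 t) (k t))) (col j z 2 x)"

lemma variation_of_constants:
  assumes "sol j z k f" "lint j k" "x \<in> {v..vj j}"
  shows "f x = SolE j z (f v) k x"
  unfolding SolE_def by (rule variation_of_constants_gen[OF sol_col _ sol_col _ assms]) simp_all

end

section \<open>Square integrable functions and Green's formula\<close>

lemma sqint_imp_measurable: "sqint a b f \<Longrightarrow> (\<lambda>x. indicator {a..b} x *\<^sub>R f x) \<in> borel_measurable lborel"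
  by (simp add: sqint_def)

lemma sqint_integrable2: "sqint a b f \<Longrightarrow> set_integrable lborel {a..b} (\<lambda>x. (cmod (f x))\<^sup>2)"
  by (simp add: sqint_def)

lemma set_integrable_bound_lborel:
  fixes f :: "real \<Rightarrow> 'a::{banach, second_countable_topology}" and g :: "real \<Rightarrow> real"
  assumes "set_integrable lborel A g" "(\<lambda>x. indicator A x *\<^sub>R f x) \<in> borel_measurable lborel"
    and "\<And>x. x \<in> A \<Longrightarrow> norm (f x) \<le> g x"
  shows "set_integrable lborel A f"
  unfolding set_integrable_def
proof (rule Bochner_Integration.integrable_bound[OF assms(1)[unfolded set_integrable_def] assms(2)])
  show "AE x in lborel. norm (indicator A x *\<^sub>R f x) \<le> norm (indicator A x *\<^sub>R g x)"
    using assms(3) by (intro AE_I2) (force simp: indicator_def)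
qed

lemma indicator_mult_measurable:
  fixes f g :: "real \<Rightarrow> complex"
  assumes "(\<lambda>x. indicator A x *\<^sub>R f x) \<in> borel_measurable lborel" "(\<lambda>x. indicator A x *\<^sub>R g x) \<in> borel_measurable lborel"
  shows "(\<lambda>x. indicator A x *\<^sub>R (f x * g x)) \<in> borel_measurable lborel"
proof -
  have "(\<lambda>x. indicator A x *\<^sub>R (f x * g x)) = (\<lambda>x. (indicator A x *\<^sub>R f x) * (indicator A x *\<^sub>R g x))"
    by (auto simp: indicator_def)
  with borel_measurable_times[OF assms] show ?thesis by simp
qed

lemma indicator_cnj_measurable:
  fixes f :: "real \<Rightarrow> complex"
  assumes "(\<lambda>x. indicator A x *\<^sub>R f x) \<in> borel_measurable lborel"
  shows "(\<lambda>x. indicator A x *\<^sub>R cnj (f x)) \<in> borel_measurable lborel"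
proof -
  have "(\<lambda>x. cnj (indicator A x *\<^sub>R f x)) \<in> borel_measurable lborel"
    by (rule borel_measurable_continuous_on[OF _ assms, where f = cnj]) (intro continuous_intros)
  then show ?thesis by simp
qed

lemma sqint_mult_integrable:
  assumes "sqint a b f" "sqint a b g"
  shows "set_integrable lborel {a..b} (\<lambda>x. f x * g x)"
proof (rule set_integrable_bound_lborel)
  show "set_integrable lborel {a..b} (\<lambda>x. (cmod (f x))\<^sup>2 + (cmod (g x))\<^sup>2)"
    using assms by (intro set_integral_add) (auto simp: sqint_def)
  show "(\<lambda>x. indicator {a..b} x *\<^sub>R (f x * g x)) \<in> borel_measurable lborel"
    using assms by (intro indicator_mult_measurable sqint_imp_measurable)
  fix x
  have "0 \<le> (cmod (f x) - cmod (g x))\<^sup>2" "0 \<le> (cmod (f x))\<^sup>2" "0 \<le> (cmod (g x))\<^sup>2" by simp_all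
  then show "norm (f x * g x) \<le> (cmod (f x))\<^sup>2 + (cmod (g x))\<^sup>2"
    unfolding norm_mult power2_diff by linarith
qed

lemma sqint_cnj: "sqint a b f \<Longrightarrow> sqint a b (\<lambda>x. cnj (f x))"
  unfolding sqint_def using indicator_cnj_measurable by auto

lemma continuous_imp_sqint:
  assumes "continuous_on {a..b} f" shows "sqint a b f"
  unfolding sqint_def
proof
  show "(\<lambda>x. indicator {a..b} x *\<^sub>R f x) \<in> borel_measurable lborel"
    using borel_measurable_continuous_on_indicator[OF _ assms] by simp
  show "set_integrable lborel {a..b} (\<lambda>x. (cmod (f x))\<^sup>2)"
    by (intro borel_integrable_atLeastAtMost' continuous_intros assms)
qed

lemma sqint_integrable: "sqint a b f \<Longrightarrow> set_integrable lborel {a..b} f"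
  using sqint_mult_integrable[OF _ continuous_imp_sqint[OF continuous_on_const[of _ 1]], of a b f] by simp

lemma sqint_lincomb:
  assumes "sqint a b f" "sqint a b g"
  shows "sqint a b (\<lambda>x. c * f x + d * g x)"
  unfolding sqint_def
proof
  have "(\<lambda>x. c * (indicator {a..b} x *\<^sub>R f x) + d * (indicator {a..b} x *\<^sub>R g x)) \<in> borel_measurable lborel"
    using assms by (intro borel_measurable_add borel_measurable_times sqint_imp_measurable) auto
  moreover have "(\<lambda>x. c * (indicator {a..b} x *\<^sub>R f x) + d * (indicator {a..b} x *\<^sub>R g x)) = (\<lambda>x. indicator {a..b} x *\<^sub>R (c * f x + d * g x))"
    by (auto simp: indicator_def)
  ultimately show m: "(\<lambda>x. indicator {a..b} x *\<^sub>R (c * f x + d * g x)) \<in> borel_measurable lborel" by simp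
  show "set_integrable lborel {a..b} (\<lambda>x. (cmod (c * f x + d * g x))\<^sup>2)"
  proof (rule set_integrable_bound_lborel)
    show "set_integrable lborel {a..b} (\<lambda>x. 2 * (cmod c)\<^sup>2 * (cmod (f x))\<^sup>2 + 2 * (cmod d)\<^sup>2 * (cmod (g x))\<^sup>2)"
      using assms by (intro set_integral_add set_integrable_mult_right) (auto simp: sqint_def)
    have "(\<lambda>x. (cmod (indicator {a..b} x *\<^sub>R (c * f x + d * g x)))\<^sup>2) \<in> borel_measurable lborel"
      using m by measurable
    moreover have "(\<lambda>x. (cmod (indicator {a..b} x *\<^sub>R (c * f x + d * g x)))\<^sup>2) = (\<lambda>x. indicator {a..b} x *\<^sub>R (cmod (c * f x + d * g x))\<^sup>2)"
      by (auto simp: indicator_def)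
    ultimately show "(\<lambda>x. indicator {a..b} x *\<^sub>R (cmod (c * f x + d * g x))\<^sup>2) \<in> borel_measurable lborel" by simp
    fix x
    have "(cmod (c * f x + d * g x))\<^sup>2 \<le> (cmod c * cmod (f x) + cmod d * cmod (g x))\<^sup>2"
      by (intro power_mono) (auto simp: norm_mult intro: norm_triangle_le)
    also have "\<dots> \<le> 2 * (cmod c)\<^sup>2 * (cmod (f x))\<^sup>2 + 2 * (cmod d)\<^sup>2 * (cmod (g x))\<^sup>2"
      using sum_squares_bound[of "cmod c * cmod (f x)" "cmod d * cmod (g x)"]
      by (simp add: power2_sum power_mult_distrib)
    finally show "norm ((cmod (c * f x + d * g x))\<^sup>2) \<le> 2 * (cmod c)\<^sup>2 * (cmod (f x))\<^sup>2 + 2 * (cmod d)\<^sup>2 * (cmod (g x))\<^sup>2" by simp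
  qed
qed

lemma sqint_cong_AE:
  assumes "sqint a b f" "(\<lambda>x. indicator {a..b} x *\<^sub>R g x) \<in> borel_measurable lborel"
    "AE x in lborel. x \<in> {a..b} \<longrightarrow> f x = g x"
  shows "sqint a b g"
  unfolding sqint_def
proof
  show "set_integrable lborel {a..b} (\<lambda>x. (cmod (g x))\<^sup>2)"
  proof (rule set_integrable_cong_AE_measurable[OF sqint_integrable2[OF assms(1)]])
    have "(\<lambda>x. (cmod (indicator {a..b} x *\<^sub>R g x))\<^sup>2) \<in> borel_measurable lborel"
      using assms(2) by measurable
    moreover have "(\<lambda>x. (cmod (indicator {a..b} x *\<^sub>R g x))\<^sup>2) = (\<lambda>x. indicator {a..b} x *\<^sub>R (cmod (g x))\<^sup>2)"
      by (auto simp: indicator_def)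
    ultimately show "(\<lambda>x. indicator {a..b} x *\<^sub>R (cmod (g x))\<^sup>2) \<in> borel_measurable lborel" by simp
    show "AE x in lborel. x \<in> {a..b} \<longrightarrow> (cmod (f x))\<^sup>2 = (cmod (g x))\<^sup>2"
      using assms(3) by eventually_elim auto
  qed
qed (rule assms)

section \<open>Equality almost everywhere on the graph\<close>

lemma eqG_refl: "eqG v vj f f" by (simp add: eqG_def)

lemma eqG_sym: "eqG v vj f g \<Longrightarrow> eqG v vj g f"
  unfolding eqG_def by (simp add: eq_commute)

lemma eqG_trans: "eqG v vj f g \<Longrightarrow> eqG v vj g h \<Longrightarrow> eqG v vj f h"
  unfolding eqG_def
proof
  fix j assume "\<forall>j. AE x in lborel. x \<in> {v..vj j} \<longrightarrow> f j x = g j x" "\<forall>j. AE x in lborel. x \<in> {v..vj j} \<longrightarrow> g j x = h j x"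
  then have "AE x in lborel. x \<in> {v..vj j} \<longrightarrow> f j x = g j x" "AE x in lborel. x \<in> {v..vj j} \<longrightarrow> g j x = h j x" by auto
  then show "AE x in lborel. x \<in> {v..vj j} \<longrightarrow> f j x = h j x" by eventually_elim auto
qed

lemma eqG_I: "(\<And>j x. x \<in> {v..vj j} \<Longrightarrow> f j x = g j x) \<Longrightarrow> eqG v vj f g"
  unfolding eqG_def by (intro allI AE_I2) auto

lemma eqG_addp_cs: "eqG v vj f f' \<Longrightarrow> eqG v vj g g' \<Longrightarrow>
    eqG v vj (\<lambda>j x. addp (f j x) (cs z (g j x))) (\<lambda>j x. addp (f' j x) (cs z (g' j x)))"
  unfolding eqG_def
proof
  fix j assume "\<forall>j. AE x in lborel. x \<in> {v..vj j} \<longrightarrow> f j x = f' j x" "\<forall>j. AE x in lborel. x \<in> {v..vj j} \<longrightarrow> g j x = g' j x"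
  then have "AE x in lborel. x \<in> {v..vj j} \<longrightarrow> f j x = f' j x" "AE x in lborel. x \<in> {v..vj j} \<longrightarrow> g j x = g' j x" by auto
  then show "AE x in lborel. x \<in> {v..vj j} \<longrightarrow> addp (f j x) (cs z (g j x)) = addp (f' j x) (cs z (g' j x))"
    by eventually_elim auto
qed

lemma L2G_addp_cs:
  assumes "L2G v vj f" "L2G v vj g"
  shows "L2G v vj (\<lambda>j x. addp (f j x) (cs z (g j x)))"
  using assms sqint_lincomb[of v _ _ _ 1 z] unfolding L2G_def addp_def cs_def by simp

lemma innerG_cong:
  assumes "L2G v vj f" "L2G v vj g" "L2G v vj f'" "L2G v vj g'" "eqG v vj f f'" "eqG v vj g g'"
  shows "innerG v vj f g = innerG v vj f' g'"
  unfolding innerG_def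
proof (rule sum.cong[OF refl])
  fix j
  have m: "(\<lambda>x. indicator {v..vj j} x *\<^sub>R (fst (f j x) * cnj (fst (g j x)) + snd (f j x) * cnj (snd (g j x)))) \<in> borel_measurable lborel"
    if "L2G v vj f" "L2G v vj g" for f g :: "'a gfun"
  proof -
    have "set_integrable lborel {v..vj j} (\<lambda>x. fst (f j x) * cnj (fst (g j x)) + snd (f j x) * cnj (snd (g j x)))"
      using that by (intro set_integral_add sqint_mult_integrable sqint_cnj) (auto simp: L2G_def)
    then show ?thesis by (rule set_integrable_measurable)
  qed
  have "AE x in lborel. x \<in> {v..vj j} \<longrightarrow> f j x = f' j x" "AE x in lborel. x \<in> {v..vj j} \<longrightarrow> g j x = g' j x"
    using assms by (auto simp: eqG_def)
  then have "AE x in lborel. x \<in> {v..vj j} \<longrightarrow> fst (f j x) * cnj (fst (g j x)) + snd (f j x) * cnj (snd (g j x))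
      = fst (f' j x) * cnj (fst (g' j x)) + snd (f' j x) * cnj (snd (g' j x))"
    by eventually_elim auto
  then show "(LINT x:{v..vj j}|lborel. fst (f j x) * cnj (fst (g j x)) + snd (f j x) * cnj (snd (g j x)))
    = (LINT x:{v..vj j}|lborel. fst (f' j x) * cnj (fst (g' j x)) + snd (f' j x) * cnj (snd (g' j x)))"
    by (rule set_integral_cong_AE_lborel[OF m m, OF assms(1-4)])
qed

section \<open>The inhomogeneous equation and the maximal domain\<close>

context star
begin

lemma sol_SolE:
  assumes k: "lint j k"
  shows "sol j z k (SolE j z \<xi> k)"
proof -
  let ?u = "col j z 1" and ?w = "col j z 2"
  define a where "a x = fst \<xi> - (LINT t:{v..x}|lborel. dotp (?w t) (k t))" for x
  define b where "b x = snd \<xi> + (LINT t:{v..x}|lborel. dotp (?u t) (k t))" for x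
  have iu: "set_integrable lborel {v..vj j} (\<lambda>t. dotp (?u t) (k t))"
    and iw: "set_integrable lborel {v..vj j} (\<lambda>t. - dotp (?w t) (k t))"
    using integrable_dotp[OF ac2_col k] by (auto simp: set_integrable_def)
  have neg: "(LINT t:A|lborel. - f t) = - (LINT t:A|lborel. f t)" for A and f :: "real \<Rightarrow> complex"
    by (simp add: set_lebesgue_integral_def)
  have "a x = a v + (LINT t:{v..x}|lborel. - dotp (?w t) (k t))" "b x = b v + (LINT t:{v..x}|lborel. dotp (?u t) (k t))" for x
    by (simp_all add: a_def b_def neg)
  note A = indefinite_integral_abs_cont[OF iw this(1)] and B = indefinite_integral_abs_cont[OF iu this(2)]
  have S: "SolE j z \<xi> k = (\<lambda>x. lincomb (a x) (?u x) (b x) (?w x))"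
    by (simp add: fun_eq_iff SolE_def a_def b_def)
  have "ac2 j (SolE j z \<xi> k)"
    using A(1) B(1) ac2_col[of j z 1] ac2_col[of j z 2]
    unfolding S ac2_def lincomb_def by (auto intro!: abs_cont_add abs_cont_mult)
  moreover have "AE x in lborel. x \<in> {v..vj j} \<longrightarrow>
      ((\<lambda>t. fst (SolE j z \<xi> k t)) has_vector_derivative
        (of_real (q j x) * fst (SolE j z \<xi> k x) - (of_real (p j x) + z) * snd (SolE j z \<xi> k x) - snd (k x))) (at x) \<and>
      ((\<lambda>t. snd (SolE j z \<xi> k t)) has_vector_derivative
        ((z - of_real (p j x)) * fst (SolE j z \<xi> k x) - of_real (q j x) * snd (SolE j z \<xi> k x) + fst (k x))) (at x)"
    using A(2) B(2) sol_col[of j z 1, unfolded sol_def, THEN conjunct2] sol_col[of j z 2, unfolded sol_def, THEN conjunct2]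
  proof eventually_elim
    case (elim x)
    show ?case
    proof (intro impI conjI)
      assume x: "x \<in> {v..vj j}"
      have W: "fst (?u x) * snd (?w x) - snd (?u x) * fst (?w x) = 1"
        using wronski_col[OF x] by (simp add: wronski_def)
      show "((\<lambda>t. fst (SolE j z \<xi> k t)) has_vector_derivative
        (of_real (q j x) * fst (SolE j z \<xi> k x) - (of_real (p j x) + z) * snd (SolE j z \<xi> k x) - snd (k x))) (at x)"
        unfolding S lincomb_def fst_conv snd_conv
      proof (rule has_vector_derivative_eq_rhs, rule has_vector_derivative_add; (rule has_vector_derivative_mult)?; (use elim x in blast)?)
        \<comment> \<open>The product rule leaves the inhomogeneity multiplied by the Wronskian of
          the two columns; writing that factor into the goal turns it into a polynomial
          identity.\<close>
        have "snd (k x) = snd (k x) * (fst (?u x) * snd (?w x) - snd (?u x) * fst (?w x))" unfolding W by simp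
        then show "a x * (of_real (q j x) * fst (?u x) - (of_real (p j x) + z) * snd (?u x) - snd 0) + (- dotp (?w x) (k x)) * fst (?u x)
          + (b x * (of_real (q j x) * fst (?w x) - (of_real (p j x) + z) * snd (?w x) - snd 0) + dotp (?u x) (k x) * fst (?w x))
          = of_real (q j x) * (a x * fst (?u x) + b x * fst (?w x)) - (of_real (p j x) + z) * (a x * snd (?u x) + b x * snd (?w x)) - snd (k x)"
          by (simp add: dotp_def algebra_simps)
      qed
      show "((\<lambda>t. snd (SolE j z \<xi> k t)) has_vector_derivative
        ((z - of_real (p j x)) * fst (SolE j z \<xi> k x) - of_real (q j x) * snd (SolE j z \<xi> k x) + fst (k x))) (at x)"
        unfolding S lincomb_def fst_conv snd_conv
      proof (rule has_vector_derivative_eq_rhs, rule has_vector_derivative_add; (rule has_vector_derivative_mult)?; (use elim x in blast)?)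
        have "fst (k x) = fst (k x) * (fst (?u x) * snd (?w x) - snd (?u x) * fst (?w x))" unfolding W by simp
        then show "a x * ((z - of_real (p j x)) * fst (?u x) - of_real (q j x) * snd (?u x) + fst 0) + (- dotp (?w x) (k x)) * snd (?u x)
          + (b x * ((z - of_real (p j x)) * fst (?w x) - of_real (q j x) * snd (?w x) + fst 0) + dotp (?u x) (k x) * snd (?w x))
          = (z - of_real (p j x)) * (a x * fst (?u x) + b x * fst (?w x)) - of_real (q j x) * (a x * snd (?u x) + b x * snd (?w x)) + fst (k x)"
          by (simp add: dotp_def algebra_simps)
      qed
    qed
  qed
  ultimately show ?thesis by (simp add: sol_def)
qed

text \<open>\<open>p\<close>, \<open>q\<close> and the initial matrix are real, so the conjugate of
  a solution at \<open>cnj z\<close> solves the equation at \<open>z\<close> with the same initial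
  value, and uniqueness applies.\<close>

lemma Y_cnj: "cnj (Y j (cnj z) x $ a $ b) = Y j z x $ a $ b"
proof (cases "x \<in> {v..vj j}")
  case False
  then show ?thesis using isY_Y[of j z] isY_Y[of j "cnj z"] by (simp add: isY_def)
next
  case True
  define f where "f x = (cnj (fst (col j (cnj z) b x)), cnj (snd (col j (cnj z) b x)))" for x
  have "ac2 j f" using ac2_col[of j "cnj z" b] by (simp add: ac2_def f_def abs_cont_cnj)
  moreover have "AE x in lborel. x \<in> {v..vj j} \<longrightarrow>
      ((\<lambda>t. fst (f t)) has_vector_derivative
        (of_real (q j x) * fst (f x) - (of_real (p j x) + z) * snd (f x) - snd (0::complex \<times> complex))) (at x) \<and>
      ((\<lambda>t. snd (f t)) has_vector_derivative
        ((z - of_real (p j x)) * fst (f x) - of_real (q j x) * snd (f x) + fst (0::complex \<times> complex))) (at x)"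
    using sol_col[of j "cnj z" b, unfolded sol_def, THEN conjunct2]
  proof eventually_elim
    case (elim x)
    show ?case
    proof (intro impI conjI)
      assume x: "x \<in> {v..vj j}"
      note d = elim[rule_format, OF x, THEN conjunct1] elim[rule_format, OF x, THEN conjunct2]
      show "((\<lambda>t. fst (f t)) has_vector_derivative
        (of_real (q j x) * fst (f x) - (of_real (p j x) + z) * snd (f x) - snd (0::complex \<times> complex))) (at x)"
        using bounded_linear.has_vector_derivative[OF bounded_linear_cnj d(1)] by (simp add: f_def)
      show "((\<lambda>t. snd (f t)) has_vector_derivative
        ((z - of_real (p j x)) * fst (f x) - of_real (q j x) * snd (f x) + fst (0::complex \<times> complex))) (at x)"
        using bounded_linear.has_vector_derivative[OF bounded_linear_cnj d(2)] by (simp add: f_def)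
    qed
  qed
  ultimately have "sol j z (\<lambda>_. 0) f" by (simp add: sol_def)
  from variation_of_constants[OF this lint_0 True] variation_of_constants[OF sol_col[of j z b] lint_0 True]
  have "f x = col j z b x"
    using exhaust_2[of b] by (auto simp: f_def)
  then show ?thesis using exhaust_2[of a] by (auto simp: f_def col_def)
qed

lemma col_cnj: "fst (col j (cnj z) b x) = cnj (fst (col j z b x))" "snd (col j (cnj z) b x) = cnj (snd (col j z b x))"
  using Y_cnj[of j z x] by (auto simp: col_def) (metis complex_cnj_cnj)+

lemma sol_Hop:
  assumes "sol j z k (f j)"
  shows "AE x in lborel. x \<in> {v..vj j} \<longrightarrow> Hop p q f j x = addp (k x) (cs z (f j x))"
  using assms[unfolded sol_def, THEN conjunct2]
proof eventually_elim
  case (elim x)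
  show ?case
  proof
    assume x: "x \<in> {v..vj j}"
    note d = elim[rule_format, OF x, THEN conjunct1, THEN vector_derivative_at] elim[rule_format, OF x, THEN conjunct2, THEN vector_derivative_at]
    show "Hop p q f j x = addp (k x) (cs z (f j x))"
      by (simp add: Hop_def d addp_def cs_def algebra_simps)
  qed
qed

text \<open>\<open>Hop\<close> by itself does not say that the derivatives exist; absolute
  continuity provides them a.e.\<close>

lemma Hop_sol:
  assumes ac: "ac2 j (f j)" and H: "AE x in lborel. x \<in> {v..vj j} \<longrightarrow> Hop p q f j x = addp (k x) (cs z (f j x))"
  shows "sol j z k (f j)"
  unfolding sol_def
proof
  have ac': "abs_cont v (vj j) (\<lambda>x. fst (f j x))" "abs_cont v (vj j) (\<lambda>x. snd (f j x))" using ac by (auto simp: ac2_def)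
  show "AE x in lborel. x \<in> {v..vj j} \<longrightarrow>
      ((\<lambda>t. fst (f j t)) has_vector_derivative
        (of_real (q j x) * fst (f j x) - (of_real (p j x) + z) * snd (f j x) - snd (k x))) (at x) \<and>
      ((\<lambda>t. snd (f j t)) has_vector_derivative
        ((z - of_real (p j x)) * fst (f j x) - of_real (q j x) * snd (f j x) + fst (k x))) (at x)"
    using H abs_cont_FTC(3)[OF edges ac'(1)] abs_cont_FTC(3)[OF edges ac'(2)]
  proof eventually_elim
    case (elim x)
    show ?case
    proof
      assume x: "x \<in> {v..vj j}"
      from elim(1) x have "vector_derivative (\<lambda>t. fst (f j t)) (at x) = of_real (q j x) * fst (f j x) - (of_real (p j x) + z) * snd (f j x) - snd (k x)"
        "vector_derivative (\<lambda>t. snd (f j t)) (at x) = (z - of_real (p j x)) * fst (f j x) - of_real (q j x) * snd (f j x) + fst (k x)"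
        by (simp_all add: Hop_def addp_def cs_def algebra_simps)
      with elim(2,3) x show "((\<lambda>t. fst (f j t)) has_vector_derivative
        (of_real (q j x) * fst (f j x) - (of_real (p j x) + z) * snd (f j x) - snd (k x))) (at x) \<and>
      ((\<lambda>t. snd (f j t)) has_vector_derivative
        ((z - of_real (p j x)) * fst (f j x) - of_real (q j x) * snd (f j x) + fst (k x))) (at x)" by simp
    qed
  qed
qed (rule ac)

text \<open>\<open>lborel\<close> is not complete, so a.e. equality with a square integrable
  function does not make \<open>Hop p q f\<close> Borel measurable, as \<open>L2G\<close> requires;
  this comes from the pointwise derivative instead.\<close>

lemma Hop_measurable:
  assumes "ac2 j (f j)"
  shows "(\<lambda>x. indicator {v..vj j} x *\<^sub>R fst (Hop p q f j x)) \<in> borel_measurable lborel"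
    "(\<lambda>x. indicator {v..vj j} x *\<^sub>R snd (Hop p q f j x)) \<in> borel_measurable lborel"
proof -
  let ?I = "\<lambda>x. indicator {v..vj j} x :: real"
  note c = ac2_cont[OF assms]
  have m: "(\<lambda>x. ?I x *\<^sub>R vector_derivative (\<lambda>t. fst (f j t)) (at x)) \<in> borel_measurable lborel"
    "(\<lambda>x. ?I x *\<^sub>R vector_derivative (\<lambda>t. snd (f j t)) (at x)) \<in> borel_measurable lborel"
    using borel_measurable_vector_derivative_Icc[OF c(1)] borel_measurable_vector_derivative_Icc[OF c(2)] by simp_all
  have fm: "(\<lambda>x. ?I x *\<^sub>R fst (f j x)) \<in> borel_measurable lborel" "(\<lambda>x. ?I x *\<^sub>R snd (f j x)) \<in> borel_measurable lborel"
    by (intro sqint_imp_measurable continuous_imp_sqint c)+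
  have "(\<lambda>x. ?I x *\<^sub>R p j x) \<in> borel_measurable lborel" "(\<lambda>x. ?I x *\<^sub>R q j x) \<in> borel_measurable lborel"
    using p_L1 q_L1 set_integrable_measurable by blast+
  then have "(\<lambda>x. complex_of_real (?I x *\<^sub>R p j x)) \<in> borel_measurable lborel" "(\<lambda>x. complex_of_real (?I x *\<^sub>R q j x)) \<in> borel_measurable lborel"
    by measurable
  then have pm: "(\<lambda>x. ?I x *\<^sub>R complex_of_real (p j x)) \<in> borel_measurable lborel" "(\<lambda>x. ?I x *\<^sub>R complex_of_real (q j x)) \<in> borel_measurable lborel"
    by (simp_all add: scaleR_conv_of_real)
  note pf = indicator_mult_measurable[OF pm(1) fm(1)] indicator_mult_measurable[OF pm(1) fm(2)]
    indicator_mult_measurable[OF pm(2) fm(1)] indicator_mult_measurable[OF pm(2) fm(2)]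
  show "(\<lambda>x. ?I x *\<^sub>R fst (Hop p q f j x)) \<in> borel_measurable lborel"
    unfolding Hop_def fst_conv scaleR_add_right by (intro borel_measurable_add m pf)
  show "(\<lambda>x. ?I x *\<^sub>R snd (Hop p q f j x)) \<in> borel_measurable lborel"
    unfolding Hop_def snd_conv scaleR_add_right scaleR_diff_right scaleR_minus_right
    by (intro borel_measurable_add borel_measurable_diff borel_measurable_uminus m pf)
qed

lemma L2G_lint: "L2G v vj k \<Longrightarrow> lint j (k j)"
  by (simp add: L2G_def lint_def sqint_integrable)

lemma ac2_L2G: "(\<And>j. ac2 j (f j)) \<Longrightarrow> L2G v vj f"
  using ac2_cont by (auto simp: L2G_def intro!: continuous_imp_sqint)

lemma L2G_cong:
  assumes "L2G v vj f" "eqG v vj f g" "\<And>j. (\<lambda>x. indicator {v..vj j} x *\<^sub>R fst (g j x)) \<in> borel_measurable lborel"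
    "\<And>j. (\<lambda>x. indicator {v..vj j} x *\<^sub>R snd (g j x)) \<in> borel_measurable lborel"
  shows "L2G v vj g"
  unfolding L2G_def
proof (intro allI conjI)
  fix j
  have AE: "AE x in lborel. x \<in> {v..vj j} \<longrightarrow> f j x = g j x" using assms(2) by (simp add: eqG_def)
  have "AE x in lborel. x \<in> {v..vj j} \<longrightarrow> fst (f j x) = fst (g j x)" using AE by eventually_elim auto
  then show "sqint v (vj j) (\<lambda>x. fst (g j x))"
    using sqint_cong_AE[OF _ assms(3)[of j]] assms(1) by (auto simp: L2G_def)
  have "AE x in lborel. x \<in> {v..vj j} \<longrightarrow> snd (f j x) = snd (g j x)" using AE by eventually_elim auto
  then show "sqint v (vj j) (\<lambda>x. snd (g j x))"
    using sqint_cong_AE[OF _ assms(4)[of j]] assms(1) by (auto simp: L2G_def)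
qed

definition SolG :: "complex \<Rightarrow> ('n \<Rightarrow> complex \<times> complex) \<Rightarrow> 'n gfun \<Rightarrow> 'n gfun" where
  "SolG z \<xi> k j x = SolE j z (\<xi> j) (k j) x"

lemma sol_SolG: "L2G v vj k \<Longrightarrow> sol j z (k j) (SolG z \<xi> k j)"
  using sol_SolE[OF L2G_lint] by (simp add: SolG_def[abs_def])

lemma ac2_SolG: "L2G v vj k \<Longrightarrow> ac2 j (SolG z \<xi> k j)"
  using sol_SolG by (simp add: sol_def)

lemma SolG_v [simp]: "SolG z \<xi> k j v = \<xi> j"
  by (simp add: SolG_def SolE_def lincomb_def)

lemma eqG_Hop_SolG:
  "L2G v vj k \<Longrightarrow> eqG v vj (Hop p q (SolG z \<xi> k)) (\<lambda>j x. addp (k j x) (cs z (SolG z \<xi> k j x)))"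
  unfolding eqG_def by (intro allI sol_Hop[where f = "SolG z \<xi> k"] sol_SolG)

lemma L2G_SolG: "L2G v vj k \<Longrightarrow> L2G v vj (SolG z \<xi> k)"
  by (rule ac2_L2G) (rule ac2_SolG)

lemma L2G_Hop_SolG:
  assumes "L2G v vj k" shows "L2G v vj (Hop p q (SolG z \<xi> k))"
  by (rule L2G_cong[OF L2G_addp_cs[OF assms L2G_SolG[OF assms]] eqG_sym[OF eqG_Hop_SolG[OF assms]]])
     (intro Hop_measurable ac2_SolG assms)+

definition bc :: "'n \<Rightarrow> complex \<times> complex \<Rightarrow> complex" where
  "bc j u = of_real (cos (\<alpha> j)) * fst u + of_real (sin (\<alpha> j)) * snd u"

abbreviation "bf \<equiv> bfun v vj p q \<alpha>"
abbreviation "cf \<equiv> cfun v vj p q \<alpha>"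

lemma bc_col: "bc j (col j z 1 (vj j)) = bf j z" "bc j (col j z 2 (vj j)) = cf j z"
  by (simp_all add: bc_def col_def bfun_def cfun_def mult.commute)

abbreviation "Dm \<equiv> Dmax v vj p q \<alpha>"

lemma Dmax_iff: "f \<in> Dm \<longleftrightarrow> (\<forall>j. ac2 j (f j)) \<and> L2G v vj (Hop p q f) \<and> (\<forall>j. bc j (f j (vj j)) = 0)"
  using ac2_L2G[of f] by (auto simp: Dmax_def ac2_def bc_def)

text \<open>By \<open>Y_cnj\<close> the adjoint of the fundamental matrix at \<open>cnj z\<close> is
  its plain transpose at \<open>z\<close>; hence this is entry \<open>b\<close> of I(g, z) on edge
  \<open>j\<close>.\<close>

definition Ib :: "2 \<Rightarrow> complex \<Rightarrow> 'n gfun \<Rightarrow> 'n \<Rightarrow> complex" where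
  "Ib b z k j = (LINT t:{v..vj j}|lborel. dotp (col j z b t) (k j t))"

lemma bc_SolG: "bc j (SolG z \<xi> k j (vj j)) = (fst (\<xi> j) - Ib 2 z k j) * bf j z + (snd (\<xi> j) + Ib 1 z k j) * cf j z"
  unfolding SolG_def SolE_def Ib_def by (simp add: bc_def lincomb_def algebra_simps flip: bc_col)

text \<open>For solutions of the equation the only remaining condition is the one at the outer
  vertex, a scalar equation per edge in the initial values. Through it the adjoint, eigenvectors and
  resolvents become linear algebra.\<close>

lemma SolG_Dmax: "L2G v vj k \<Longrightarrow>
  SolG z \<xi> k \<in> Dm \<longleftrightarrow> (\<forall>j. (fst (\<xi> j) - Ib 2 z k j) * bf j z + (snd (\<xi> j) + Ib 1 z k j) * cf j z = 0)"
  using ac2_SolG L2G_Hop_SolG by (simp add: Dmax_iff bc_SolG)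

lemma Dmax_L2G: "f \<in> Dm \<Longrightarrow> L2G v vj f" "f \<in> Dm \<Longrightarrow> L2G v vj (Hop p q f)"
  by (auto simp: Dmax_def)

lemma Dmax_SolG:
  assumes f: "f \<in> Dm" and k: "L2G v vj k" and H: "eqG v vj (Hop p q f) (\<lambda>j x. addp (k j x) (cs z (f j x)))" and x: "x \<in> {v..vj j}"
  shows "f j x = SolG z (\<lambda>j. f j v) k j x"
proof -
  have "sol j z (k j) (f j)"
    using f H by (intro Hop_sol) (auto simp: Dmax_iff eqG_def)
  from variation_of_constants[OF this L2G_lint[OF k] x] show ?thesis by (simp add: SolG_def)
qed

section \<open>Green's formula\<close>

definition omega :: "('n \<Rightarrow> complex \<times> complex) \<Rightarrow> ('n \<Rightarrow> complex \<times> complex) \<Rightarrow> complex" where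
  "omega x y = (\<Sum>j\<in>UNIV. fst (x j) * cnj (snd (y j)) - snd (x j) * cnj (fst (y j)))"

text \<open>Rotating by \<open>\<alpha> j\<close> preserves the determinant and turns the boundary
  condition, which is real and so also holds for the conjugate, into the vanishing of one coordinate
  of both vectors.\<close>

lemma bc_zero_wronski:
  assumes "bc j u = 0" "bc j w = 0"
  shows "snd u * cnj (fst w) - fst u * cnj (snd w) = 0"
proof -
  define c s where "c = complex_of_real (cos (\<alpha> j))" and "s = complex_of_real (sin (\<alpha> j))"
  have cs: "c * c + s * s = 1"
  proof -
    have "c * c + s * s = complex_of_real ((cos (\<alpha> j))\<^sup>2 + (sin (\<alpha> j))\<^sup>2)"
      by (simp only: c_def s_def power2_eq_square of_real_add of_real_mult)
    then show ?thesis by simp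
  qed
  have 1: "c * fst u + s * snd u = 0" using assms(1) by (simp add: bc_def c_def s_def)
  have "cnj (c * fst w + s * snd w) = 0" using assms(2) by (simp add: bc_def c_def s_def)
  then have 2: "c * cnj (fst w) + s * cnj (snd w) = 0" by (simp add: c_def s_def)
  have "snd u * cnj (fst w) - fst u * cnj (snd w) = (c * c + s * s) * (snd u * cnj (fst w) - fst u * cnj (snd w))"
    by (simp add: cs)
  also have "\<dots> = (c * snd u - s * fst u) * (c * cnj (fst w) + s * cnj (snd w)) - (c * fst u + s * snd u) * (c * cnj (snd w) - s * cnj (fst w))"
    by (simp add: algebra_simps)
  finally show ?thesis using 1 2 by simp
qed

text \<open>The potential is real and symmetric, so it drops out and the difference of the
  integrands is the derivative of the boundary form. The single-edge version is kept because
  positivity is needed for every m-function separately.\<close>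

lemma edge_green:
  assumes f: "ac2 j (f j)" and g: "ac2 j (g j)" and Hf: "L2G v vj (Hop p q f)" and Hg: "L2G v vj (Hop p q g)"
  shows "(LINT x:{v..vj j}|lborel. fst (Hop p q f j x) * cnj (fst (g j x)) + snd (Hop p q f j x) * cnj (snd (g j x)))
    - (LINT x:{v..vj j}|lborel. fst (f j x) * cnj (fst (Hop p q g j x)) + snd (f j x) * cnj (snd (Hop p q g j x)))
    = (snd (f j (vj j)) * cnj (fst (g j (vj j))) - fst (f j (vj j)) * cnj (snd (g j (vj j))))
      - (snd (f j v) * cnj (fst (g j v)) - fst (f j v) * cnj (snd (g j v)))"
proof -
  have sf: "sqint v (vj j) (\<lambda>x. fst (f j x))" "sqint v (vj j) (\<lambda>x. snd (f j x))"
    "sqint v (vj j) (\<lambda>x. fst (g j x))" "sqint v (vj j) (\<lambda>x. snd (g j x))"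
    using ac2_cont[OF f] ac2_cont[OF g] by (auto intro: continuous_imp_sqint)
  have sH: "sqint v (vj j) (\<lambda>x. fst (Hop p q f j x))" "sqint v (vj j) (\<lambda>x. snd (Hop p q f j x))"
    "sqint v (vj j) (\<lambda>x. fst (Hop p q g j x))" "sqint v (vj j) (\<lambda>x. snd (Hop p q g j x))"
    using Hf Hg by (auto simp: L2G_def)
  let ?a = "\<lambda>x. fst (Hop p q f j x) * cnj (fst (g j x)) + snd (Hop p q f j x) * cnj (snd (g j x))"
  let ?b = "\<lambda>x. fst (f j x) * cnj (fst (Hop p q g j x)) + snd (f j x) * cnj (snd (Hop p q g j x))"
  have ia: "set_integrable lborel {v..vj j} ?a" "set_integrable lborel {v..vj j} ?b"
    by (intro set_integral_add sqint_mult_integrable sqint_cnj sf sH)+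
  have iab: "set_integrable lborel {v..vj j} (\<lambda>x. ?a x - ?b x)" by (intro set_integral_diff ia)
  let ?w = "\<lambda>x. snd (f j x) * cnj (fst (g j x)) - fst (f j x) * cnj (snd (g j x))"
  have ac: "abs_cont v (vj j) (\<lambda>x. fst (f j x))" "abs_cont v (vj j) (\<lambda>x. snd (f j x))"
    "abs_cont v (vj j) (\<lambda>x. fst (g j x))" "abs_cont v (vj j) (\<lambda>x. snd (g j x))"
    using f g by (auto simp: ac2_def)
  have "?w (vj j) = ?w v + (LINT x:{v..vj j}|lborel. ?a x - ?b x)"
  proof (rule abs_cont_FTC_AE(2)[OF edges[of j], where f = ?w and h = "\<lambda>x. ?a x - ?b x"])
    show "abs_cont v (vj j) ?w" by (intro abs_cont_diff abs_cont_mult abs_cont_cnj ac)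
    show "(\<lambda>x. indicator {v..vj j} x *\<^sub>R (?a x - ?b x)) \<in> borel_measurable lborel"
      by (rule set_integrable_measurable[OF iab])
    show "AE x in lborel. x \<in> {v..vj j} \<longrightarrow> (?w has_vector_derivative (?a x - ?b x)) (at x)"
      using abs_cont_FTC(3)[OF edges ac(1)] abs_cont_FTC(3)[OF edges ac(2)] abs_cont_FTC(3)[OF edges ac(3)] abs_cont_FTC(3)[OF edges ac(4)]
    proof eventually_elim
      case (elim x)
      show ?case
      proof
        assume x: "x \<in> {v..vj j}"
        note d = elim[rule_format, OF x]
        note e = bounded_linear.has_vector_derivative[OF bounded_linear_cnj d(3)] bounded_linear.has_vector_derivative[OF bounded_linear_cnj d(4)]
        show "(?w has_vector_derivative (?a x - ?b x)) (at x)"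
          by (rule has_vector_derivative_eq_rhs[OF has_vector_derivative_diff[OF
              has_vector_derivative_mult[OF d(2) e(1)] has_vector_derivative_mult[OF d(1) e(2)]]])
             (simp add: Hop_def algebra_simps)
      qed
    qed
  qed (use edges[of j] in auto)
  then show ?thesis by (simp add: set_integral_diff(2)[OF ia])
qed

lemma green:
  assumes "f \<in> Dm" "g \<in> Dm"
  shows "innerG v vj (Hop p q f) g - innerG v vj f (Hop p q g) = omega (\<lambda>j. f j v) (\<lambda>j. g j v)"
proof -
  have "innerG v vj (Hop p q f) g - innerG v vj f (Hop p q g) = (\<Sum>j\<in>UNIV. - (snd (f j v) * cnj (fst (g j v)) - fst (f j v) * cnj (snd (g j v))))"
    unfolding innerG_def sum_subtractf[symmetric]
  proof (rule sum.cong[OF refl])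
    fix j
    show "(LINT x:{v..vj j}|lborel. fst (Hop p q f j x) * cnj (fst (g j x)) + snd (Hop p q f j x) * cnj (snd (g j x)))
    - (LINT x:{v..vj j}|lborel. fst (f j x) * cnj (fst (Hop p q g j x)) + snd (f j x) * cnj (snd (Hop p q g j x)))
    = - (snd (f j v) * cnj (fst (g j v)) - fst (f j v) * cnj (snd (g j v)))"
      using edge_green[of j f g] bc_zero_wronski[of j "f j (vj j)" "g j (vj j)"] assms by (simp add: Dmax_iff)
  qed
  then show ?thesis by (simp add: omega_def)
qed

end

section \<open>The adjoint of the minimal relation\<close>

context star
begin

definition einner :: "'n \<Rightarrow> (real \<Rightarrow> complex \<times> complex) \<Rightarrow> (real \<Rightarrow> complex \<times> complex) \<Rightarrow> complex" where
  "einner j f g = (LINT x:{v..vj j}|lborel. fst (f x) * cnj (fst (g x)) + snd (f x) * cnj (snd (g x)))"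

definition sqint2 :: "'n \<Rightarrow> (real \<Rightarrow> complex \<times> complex) \<Rightarrow> bool" where
  "sqint2 j f \<longleftrightarrow> sqint v (vj j) (\<lambda>x. fst (f x)) \<and> sqint v (vj j) (\<lambda>x. snd (f x))"

lemma L2G_sqint2: "L2G v vj f \<longleftrightarrow> (\<forall>j. sqint2 j (f j))"
  by (simp add: L2G_def sqint2_def)

lemma innerG_einner: "innerG v vj f g = (\<Sum>j\<in>UNIV. einner j (f j) (g j))"
  by (simp add: innerG_def einner_def)

lemma ac2_sqint2: "ac2 j f \<Longrightarrow> sqint2 j f"
  using ac2_cont by (auto simp: sqint2_def intro: continuous_imp_sqint)

lemma sqint2_lint: "sqint2 j f \<Longrightarrow> lint j f"
  by (simp add: sqint2_def lint_def sqint_integrable)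

lemma einner_integrable: "sqint2 j f \<Longrightarrow> sqint2 j g \<Longrightarrow>
    set_integrable lborel {v..vj j} (\<lambda>x. fst (f x) * cnj (fst (g x)) + snd (f x) * cnj (snd (g x)))"
  by (intro set_integral_add sqint_mult_integrable sqint_cnj) (auto simp: sqint2_def)

lemma sqint2_subp_cs: "sqint2 j f \<Longrightarrow> sqint2 j g \<Longrightarrow> sqint2 j (\<lambda>x. subp (f x) (cs c (g x)))"
  using sqint_lincomb[of v "vj j" _ _ 1 "-c"] by (simp add: sqint2_def subp_def cs_def)

lemma einner_right:
  assumes "sqint2 j f" "sqint2 j g" "sqint2 j h"
  shows "einner j f (\<lambda>x. subp (g x) (cs c (h x))) = einner j f g - cnj c * einner j f h"
proof -
  have "einner j f (\<lambda>x. subp (g x) (cs c (h x))) = (LINT x:{v..vj j}|lborel.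
     (fst (f x) * cnj (fst (g x)) + snd (f x) * cnj (snd (g x))) - cnj c * (fst (f x) * cnj (fst (h x)) + snd (f x) * cnj (snd (h x))))"
    by (simp add: einner_def subp_def cs_def algebra_simps)
  also have "\<dots> = (LINT x:{v..vj j}|lborel. fst (f x) * cnj (fst (g x)) + snd (f x) * cnj (snd (g x)))
     - (LINT x:{v..vj j}|lborel. cnj c * (fst (f x) * cnj (fst (h x)) + snd (f x) * cnj (snd (h x))))"
    using assms by (intro set_integral_diff(2) set_integrable_mult_right einner_integrable)
  finally show ?thesis by (simp add: einner_def)
qed

lemma einner_left:
  assumes "sqint2 j f" "sqint2 j g" "sqint2 j h"
  shows "einner j (\<lambda>x. subp (g x) (cs c (h x))) f = einner j g f - c * einner j h f"
proof -
  have "einner j (\<lambda>x. subp (g x) (cs c (h x))) f = (LINT x:{v..vj j}|lborel.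
     (fst (g x) * cnj (fst (f x)) + snd (g x) * cnj (snd (f x))) - c * (fst (h x) * cnj (fst (f x)) + snd (h x) * cnj (snd (f x))))"
    by (simp add: einner_def subp_def cs_def algebra_simps)
  also have "\<dots> = (LINT x:{v..vj j}|lborel. fst (g x) * cnj (fst (f x)) + snd (g x) * cnj (snd (f x)))
     - (LINT x:{v..vj j}|lborel. c * (fst (h x) * cnj (fst (f x)) + snd (h x) * cnj (snd (f x))))"
    using assms by (intro set_integral_diff(2) set_integrable_mult_right einner_integrable)
  finally show ?thesis by (simp add: einner_def)
qed

lemma einner_self:
  "einner j f f = of_real (LINT x:{v..vj j}|lborel. (cmod (fst (f x)))\<^sup>2 + (cmod (snd (f x)))\<^sup>2)"
  unfolding einner_def set_integral_complex_of_real[symmetric] of_real_add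
  by (simp only: complex_norm_square)

lemma einner_self_nonneg: "0 \<le> Re (einner j f f)"
  unfolding einner_self set_lebesgue_integral_def Re_complex_of_real by (intro integral_nonneg_AE AE_I2) auto

lemma einner_self_zero:
  assumes "sqint2 j f" "einner j f f = 0"
  shows "AE x in lborel. x \<in> {v..vj j} \<longrightarrow> f x = 0"
proof -
  have i: "set_integrable lborel {v..vj j} (\<lambda>x. (cmod (fst (f x)))\<^sup>2 + (cmod (snd (f x)))\<^sup>2)"
    using assms(1) by (intro set_integral_add) (auto simp: sqint2_def sqint_def)
  have "(LINT x:{v..vj j}|lborel. (cmod (fst (f x)))\<^sup>2 + (cmod (snd (f x)))\<^sup>2) = 0"
    using assms(2) by (simp add: einner_self)
  then have "AE x in lborel. indicator {v..vj j} x *\<^sub>R ((cmod (fst (f x)))\<^sup>2 + (cmod (snd (f x)))\<^sup>2) = 0"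
    unfolding set_lebesgue_integral_def using i[unfolded set_integrable_def]
    by (subst (asm) integral_nonneg_eq_0_iff_AE) auto
  then show ?thesis
    by eventually_elim (auto simp: indicator_def sum_power2_eq_zero_iff prod_eq_iff split: if_splits)
qed

text \<open>A continuous representative of the zero class vanishes everywhere, in particular at the
  central vertex, so vanishing of a norm can be passed on to boundary values.\<close>

lemma einner_self_zero_cont:
  assumes "ac2 j f" "einner j f f = 0"
  shows "f v = 0"
proof -
  note c = ac2_cont[OF assms(1)]
  let ?h = "\<lambda>x. (cmod (fst (f x)))\<^sup>2 + (cmod (snd (f x)))\<^sup>2"
  have hc: "continuous_on {v..vj j} ?h" by (intro continuous_intros c)
  have "integral {v..vj j} ?h = (LINT x:{v..vj j}|lborel. ?h x)"
    by (rule set_borel_integral_eq_integral(2)[symmetric, OF borel_integrable_atLeastAtMost'[OF hc]])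
  also have "\<dots> = 0" using assms(2) by (simp add: einner_self)
  finally have "?h v = 0"
    using integral_eq_0_iff[OF hc edges] edges[of j] by auto
  then show ?thesis by (simp add: sum_power2_eq_zero_iff prod_eq_iff)
qed

lemma bf_cnj: "bf j (cnj z) = cnj (bf j z)" and cf_cnj: "cf j (cnj z) = cnj (cf j z)"
  by (simp_all add: bc_def col_cnj flip: bc_col)

text \<open>The two numbers are the nonzero row \<open>(cos, sin)\<close> times the invertible
  fundamental matrix at the outer vertex.\<close>

lemma bf_cf_nonzero: "bf j z \<noteq> 0 \<or> cf j z \<noteq> 0"
proof (rule ccontr)
  assume neg: "\<not> (bf j z \<noteq> 0 \<or> cf j z \<noteq> 0)"
  define c s where "c = complex_of_real (cos (\<alpha> j))" and "s = complex_of_real (sin (\<alpha> j))"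
  define u w where "u = col j z 1 (vj j)" and "w = col j z 2 (vj j)"
  have 1: "c * fst u + s * snd u = 0" "c * fst w + s * snd w = 0"
    using neg unfolding bc_col[symmetric] bc_def c_def s_def u_def w_def by auto
  have 2: "fst u * snd w - snd u * fst w = 1"
    using wronski_col[of "vj j" j z] edges[of j] by (simp add: wronski_def u_def w_def)
  have "c = c * (fst u * snd w - snd u * fst w)" "s = s * (fst u * snd w - snd u * fst w)" unfolding 2 by simp_all
  moreover have "c * (fst u * snd w - snd u * fst w) = (c * fst u + s * snd u) * snd w - snd u * (c * fst w + s * snd w)"
    "s * (fst u * snd w - snd u * fst w) = fst u * (c * fst w + s * snd w) - fst w * (c * fst u + s * snd u)"
    by (simp_all add: algebra_simps)
  ultimately have "c = 0" "s = 0" unfolding 1 by simp_all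
  then show False using sin_cos_squared_add[of "\<alpha> j"] by (simp add: c_def s_def)
qed

text \<open>The real solution at spectral parameter 0 that satisfies the boundary condition at the outer vertex.\<close>
definition bc_sol :: "'n \<Rightarrow> real \<Rightarrow> complex \<times> complex" where
  "bc_sol j x = lincomb (- cf j 0) (col j 0 1 x) (bf j 0) (col j 0 2 x)"

lemma bc_sol_real: "cnj (fst (bc_sol j x)) = fst (bc_sol j x)" "cnj (snd (bc_sol j x)) = snd (bc_sol j x)"
  using bf_cnj[of j 0] cf_cnj[of j 0] col_cnj[of j 0] by (simp_all add: bc_sol_def lincomb_def)

lemma ac2_bc_sol: "ac2 j (bc_sol j)"
  using ac2_col[of j 0 1] ac2_col[of j 0 2] unfolding ac2_def bc_sol_def lincomb_def fst_conv snd_conv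
  by (auto intro!: abs_cont_diff abs_cont_cmult)

lemma einner_bc_sol: "einner j f (bc_sol j) = (LINT x:{v..vj j}|lborel. dotp (bc_sol j x) (f x))"
  by (simp add: einner_def bc_sol_real dotp_def mult.commute)

lemma einner_bc_sol_nonzero: "einner j (bc_sol j) (bc_sol j) \<noteq> 0"
proof
  assume "einner j (bc_sol j) (bc_sol j) = 0"
  from einner_self_zero_cont[OF ac2_bc_sol this] have "cf j 0 = 0 \<and> bf j 0 = 0"
    by (simp add: bc_sol_def lincomb_def zero_prod_def)
  then show False using bf_cf_nonzero[of j 0] by simp
qed

text \<open>Up to sign this is the outer boundary value of the solution of \<open>H f = k\<close>
  with zero initial data. So \<open>k\<close> lies in the range of the minimal operator on the edge
  exactly when it is orthogonal to \<open>bc_sol\<close>.\<close>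

lemma einner_bc_sol_Ib:
  assumes "lint j (k j)"
  shows "einner j (k j) (bc_sol j) = bf j 0 * Ib 2 0 k j - cf j 0 * Ib 1 0 k j"
proof -
  have "einner j (k j) (bc_sol j) = (LINT x:{v..vj j}|lborel. bf j 0 * dotp (col j 0 2 x) (k j x) - cf j 0 * dotp (col j 0 1 x) (k j x))"
    unfolding einner_bc_sol by (simp add: bc_sol_def lincomb_def dotp_def algebra_simps)
  also have "\<dots> = (LINT x:{v..vj j}|lborel. bf j 0 * dotp (col j 0 2 x) (k j x)) - (LINT x:{v..vj j}|lborel. cf j 0 * dotp (col j 0 1 x) (k j x))"
    by (intro set_integral_diff(2) set_integrable_mult_right integrable_dotp ac2_col assms)
  finally show ?thesis by (simp add: Ib_def)
qed

text \<open>Prescribing both components at \<open>v\<close> leaves the outer condition to be met.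
  The inhomogeneity \<open>t * bc_sol\<close> moves the outer boundary value by a multiple of the
  nonzero squared norm of \<open>bc_sol\<close>, and \<open>t\<close> is determined by this.\<close>

lemma Dmax_boundary_surj: obtains f where "f \<in> Dm" "\<And>j. f j v = \<zeta> j"
proof -
  define t where "t j = (bf j 0 * fst (\<zeta> j) + cf j 0 * snd (\<zeta> j)) / einner j (bc_sol j) (bc_sol j)" for j
  define k where "k j x = cs (t j) (bc_sol j x)" for j x
  have k: "L2G v vj k"
    unfolding L2G_sqint2
  proof
    fix j
    have "ac2 j (k j)" using ac2_bc_sol[of j] unfolding ac2_def k_def cs_def by (auto intro: abs_cont_cmult)
    then show "sqint2 j (k j)" by (rule ac2_sqint2)
  qed
  have "einner j (k j) (bc_sol j) = t j * einner j (bc_sol j) (bc_sol j)" for j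
    by (simp add: einner_def k_def cs_def mult.assoc flip: distrib_left)
  then have "einner j (k j) (bc_sol j) = bf j 0 * fst (\<zeta> j) + cf j 0 * snd (\<zeta> j)" for j
    using einner_bc_sol_nonzero[of j] by (simp add: t_def)
  then have "(fst (\<zeta> j) - Ib 2 0 k j) * bf j 0 + (snd (\<zeta> j) + Ib 1 0 k j) * cf j 0 = 0" for j
    using einner_bc_sol_Ib[where k = k and j = j, OF L2G_lint[OF k]] by (simp add: algebra_simps)
  then have "SolG 0 \<zeta> k \<in> Dm" using SolG_Dmax[OF k] by blast
  then show thesis by (rule that) simp
qed

lemma addp_cs_0 [simp]: "addp u (cs 0 w) = u"
  by (simp add: addp_def cs_def)

text \<open>Subtracting a solution \<open>g0\<close> of \<open>H g0 = h\<close> leaves a function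
  orthogonal to the range of the minimal relation, hence on each edge a multiple of
  \<open>bc_sol\<close>, which can be absorbed into the initial values of \<open>g0\<close>.\<close>

lemma adjoint_Smin:
  assumes adj: "(g, h) \<in> adjG v vj (Smin v vj p q \<alpha>)"
  obtains g1 where "g1 \<in> Dm" "eqG v vj g g1" "eqG v vj h (Hop p q g1)"
proof -
  have L: "L2G v vj g" "L2G v vj h"
    and orth: "\<And>f k. (f, k) \<in> Smin v vj p q \<alpha> \<Longrightarrow> innerG v vj k g = innerG v vj f h"
    using adj by (auto simp: adjG_def)
  \<comment> \<open>With these initial values both brackets in the outer boundary condition
    vanish.\<close>
  define \<xi>0 where "\<xi>0 j = (Ib 2 0 h j, - Ib 1 0 h j)" for j
  define g0 where "g0 = SolG 0 \<xi>0 h"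
  have g0: "g0 \<in> Dm" unfolding g0_def SolG_Dmax[OF L(2)] by (simp add: \<xi>0_def)
  have Hg0: "eqG v vj (Hop p q g0) h" using eqG_Hop_SolG[OF L(2), of 0 \<xi>0] by (simp add: g0_def)
  have sq: "sqint2 j (g j)" "sqint2 j (h j)" "sqint2 j (g0 j)" "sqint2 j (bc_sol j)" for j
    using L Dmax_L2G(1)[OF g0] ac2_sqint2[OF ac2_bc_sol] by (auto simp: L2G_sqint2)
  define d where "d j x = subp (g j x) (cs 1 (g0 j x))" for j x
  have sd: "sqint2 j (d j)" for j unfolding d_def by (intro sqint2_subp_cs sq)
  define \<kappa> where "\<kappa> j = einner j (d j) (bc_sol j) / einner j (bc_sol j) (bc_sol j)" for j
  have key: "AE x in lborel. x \<in> {v..vj j} \<longrightarrow> subp (d j x) (cs (\<kappa> j) (bc_sol j x)) = 0" for j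
  proof -
    \<comment> \<open>The difference minus its projection onto \<open>bc_sol\<close> is an
      admissible right-hand side for the minimal relation. Green's formula makes it orthogonal to
      the difference itself, so its norm is zero.\<close>
    define kj where "kj x = subp (d j x) (cs (\<kappa> j) (bc_sol j x))" for x
    define k where "k i = (if i = j then kj else (\<lambda>_. 0))" for i
    have skj: "sqint2 j kj" unfolding kj_def by (intro sqint2_subp_cs sd sq)
    have k: "L2G v vj k"
      unfolding L2G_sqint2 k_def using skj by (auto simp: sqint2_def intro: continuous_imp_sqint)
    have kw: "einner j kj (bc_sol j) = 0"
      unfolding kj_def using einner_bc_sol_nonzero[of j] by (simp add: einner_left sd sq \<kappa>_def)
    define f where "f = SolG 0 (\<lambda>_. 0) k"
    have "(0 - Ib 2 0 k i) * bf i 0 + (0 + Ib 1 0 k i) * cf i 0 = 0" for i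
    proof (cases "i = j")
      case True
      then show ?thesis using kw einner_bc_sol_Ib[where k = k and j = j, OF L2G_lint[OF k]] by (simp add: k_def algebra_simps)
    next
      case False
      then have "Ib b 0 k i = 0" for b by (simp add: Ib_def k_def dotp_def set_lebesgue_integral_def)
      then show ?thesis by simp
    qed
    then have f: "f \<in> Dm" unfolding f_def using SolG_Dmax[OF k, of 0 "\<lambda>_. 0"] by simp
    have Hf: "eqG v vj (Hop p q f) k" using eqG_Hop_SolG[OF k, of 0 "\<lambda>_. 0"] by (simp add: f_def)
    have "f \<in> {f \<in> Dm. \<forall>j. fst (f j v) = 0 \<and> snd (f j v) = 0}" using f by (simp add: f_def)
    then have "(f, k) \<in> Smin v vj p q \<alpha>"
      unfolding Smin_def opRel_def using Dmax_L2G(1)[OF f] k eqG_refl eqG_sym[OF Hf] by blast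
    then have "innerG v vj k g = innerG v vj f h" by (rule orth)
    also have "\<dots> = innerG v vj f (Hop p q g0)"
      by (intro innerG_cong Dmax_L2G f g0 L eqG_refl eqG_sym[OF Hg0])
    also have "\<dots> = innerG v vj (Hop p q f) g0"
      using green[OF f g0] by (simp add: omega_def f_def)
    also have "\<dots> = innerG v vj k g0"
      by (intro innerG_cong Dmax_L2G f g0 k eqG_refl Hf)
    finally have eq: "innerG v vj k g = innerG v vj k g0" .
    have "innerG v vj k g = einner j kj (g j)" for g
    proof -
      have "innerG v vj k g = (\<Sum>i\<in>UNIV. if i = j then einner j kj (g j) else 0)"
        unfolding innerG_einner by (intro sum.cong refl) (auto simp: k_def einner_def set_lebesgue_integral_def)
      then show ?thesis by simp
    qed
    with eq have "einner j kj (d j) = 0"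
      unfolding d_def by (simp add: einner_right skj sq)
    then have "einner j kj kj = 0"
      unfolding kj_def[abs_def] using kw unfolding kj_def[abs_def]
      by (simp add: einner_right skj[unfolded kj_def[abs_def]] sd sq)
    from einner_self_zero[OF skj this] show ?thesis by (simp add: kj_def)
  qed
  \<comment> \<open>The added part is \<open>\<kappa>\<close> times the initial value
    \<open>(- cf, bf)\<close> of \<open>bc_sol\<close>.\<close>
  define \<xi>1 where "\<xi>1 j = (Ib 2 0 h j - \<kappa> j * cf j 0, - Ib 1 0 h j + \<kappa> j * bf j 0)" for j
  define g1 where "g1 = SolG 0 \<xi>1 h"
  show thesis
  proof (rule that)
    show "g1 \<in> Dm" unfolding g1_def SolG_Dmax[OF L(2)] by (simp add: \<xi>1_def)
    show "eqG v vj h (Hop p q g1)"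
      using eqG_sym[OF eqG_Hop_SolG[OF L(2), of 0 \<xi>1]] by (simp add: g1_def)
    have pt: "g1 j x = addp (g0 j x) (cs (\<kappa> j) (bc_sol j x))" for j x
      by (simp add: g1_def g0_def SolG_def SolE_def \<xi>1_def \<xi>0_def bc_sol_def lincomb_def addp_def cs_def algebra_simps)
    show "eqG v vj g g1"
      unfolding eqG_def
    proof
      fix j
      show "AE x in lborel. x \<in> {v..vj j} \<longrightarrow> g j x = g1 j x"
        using key[of j]
        by eventually_elim (auto simp: pt d_def subp_def cs_def addp_def prod_eq_iff algebra_simps)
    qed
  qed
qed

section \<open>Self-adjoint relations and boundary values\<close>

definition symp_compl :: "('n \<Rightarrow> complex \<times> complex) set \<Rightarrow> ('n \<Rightarrow> complex \<times> complex) set" where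
  "symp_compl L = {y. \<forall>x\<in>L. omega x y = 0}"

definition bvRel :: "('n \<Rightarrow> complex \<times> complex) set \<Rightarrow> ('n gfun \<times> 'n gfun) set" where
  "bvRel L = opRel v vj p q {f \<in> Dm. (\<lambda>j. f j v) \<in> L}"

lemma opRel_I: "f \<in> D \<Longrightarrow> D \<subseteq> Dm \<Longrightarrow> (f, Hop p q f) \<in> opRel v vj p q D"
  using Dmax_L2G eqG_refl unfolding opRel_def by blast

lemma inner_opRel:
  assumes "(f, k) \<in> opRel v vj p q D" "D \<subseteq> Dm" "g \<in> Dm" "L2G v vj g'" "L2G v vj h'" "eqG v vj g' g" "eqG v vj h' (Hop p q g)"
  obtains f0 where "f0 \<in> D" "eqG v vj f f0" "eqG v vj k (Hop p q f0)"
    "innerG v vj k g' - innerG v vj f h' = omega (\<lambda>j. f0 j v) (\<lambda>j. g j v)"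
proof -
  obtain f0 where f0: "f0 \<in> D" "eqG v vj f f0" "eqG v vj k (Hop p q f0)" and L: "L2G v vj f" "L2G v vj k"
    using assms(1) by (auto simp: opRel_def)
  have D: "f0 \<in> Dm" using f0 assms(2) by blast
  have "innerG v vj k g' = innerG v vj (Hop p q f0) g" "innerG v vj f h' = innerG v vj f0 (Hop p q g)"
    by (intro innerG_cong L assms(3-7) Dmax_L2G D f0)+
  with green[OF D assms(3)] f0 that show thesis by simp
qed

text \<open>Every element of the adjoint has a representative in the maximal domain, and since all
  boundary values occur, Green's formula turns orthogonality to the relation into
  \<open>omega\<close>-orthogonality to \<open>L\<close>.\<close>

lemma self_adjoint_bvRel:
  assumes L: "symp_compl L = L"
  shows "self_adjoint_ext v vj (Smin v vj p q \<alpha>) (bvRel L)"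
proof -
  let ?D = "{f \<in> Dm. (\<lambda>j. f j v) \<in> L}"
  have z: "(\<lambda>j. 0) \<in> L" using L by (auto simp: symp_compl_def omega_def)
  have sub: "Smin v vj p q \<alpha> \<subseteq> bvRel L"
  proof -
    have "(\<lambda>j. f j v) \<in> L" if "\<forall>j. fst (f j v) = 0 \<and> snd (f j v) = 0" for f :: "'n gfun"
    proof -
      have "(\<lambda>j. f j v) = (\<lambda>j. 0)" using that by (auto simp: prod_eq_iff fun_eq_iff)
      with z show ?thesis by simp
    qed
    then show ?thesis unfolding Smin_def bvRel_def opRel_def by blast
  qed
  have "adjG v vj (bvRel L) = bvRel L"
  proof (rule set_eqI, rule iffI)
    fix gh assume gh: "gh \<in> adjG v vj (bvRel L)"
    obtain g h where gh': "gh = (g, h)" by force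
    have "(g, h) \<in> adjG v vj (Smin v vj p q \<alpha>)" using gh sub unfolding gh' adjG_def by blast
    then obtain g1 where g1: "g1 \<in> Dm" "eqG v vj g g1" "eqG v vj h (Hop p q g1)" by (rule adjoint_Smin)
    have L2: "L2G v vj g" "L2G v vj h" using gh unfolding gh' adjG_def by auto
    have "(\<lambda>j. g1 j v) \<in> symp_compl L"
      unfolding symp_compl_def
    proof (intro CollectI ballI)
      fix \<zeta> assume \<zeta>: "\<zeta> \<in> L"
      obtain f where f: "f \<in> Dm" "\<And>j. f j v = \<zeta> j" using Dmax_boundary_surj by blast
      then have fv: "(\<lambda>j. f j v) = \<zeta>" by auto
      have "(f, Hop p q f) \<in> bvRel L" unfolding bvRel_def using f(1) \<zeta> fv by (intro opRel_I) auto
      then have "innerG v vj (Hop p q f) g = innerG v vj f h" using gh unfolding gh' adjG_def by blast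
      moreover have "innerG v vj (Hop p q f) g = innerG v vj (Hop p q f) g1" "innerG v vj f h = innerG v vj f (Hop p q g1)"
        by (intro innerG_cong Dmax_L2G f g1 L2 eqG_refl)+
      ultimately show "omega \<zeta> (\<lambda>j. g1 j v) = 0" using green[OF f(1) g1(1)] fv by simp
    qed
    then show "gh \<in> bvRel L" using L g1 L2 unfolding gh' bvRel_def opRel_def by blast
  next
    fix gh assume gh: "gh \<in> bvRel L"
    obtain g h where gh': "gh = (g, h)" by force
    obtain g1 where g1: "g1 \<in> Dm" "(\<lambda>j. g1 j v) \<in> L" "eqG v vj g g1" "eqG v vj h (Hop p q g1)" and L2: "L2G v vj g" "L2G v vj h"
      using gh unfolding gh' bvRel_def opRel_def by blast
    have "innerG v vj k g = innerG v vj f h" if fk: "(f, k) \<in> bvRel L" for f k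
    proof -
      obtain f0 where "f0 \<in> ?D" "innerG v vj k g - innerG v vj f h = omega (\<lambda>j. f0 j v) (\<lambda>j. g1 j v)"
        using inner_opRel[OF fk[unfolded bvRel_def] _ g1(1) L2 g1(3,4)] by blast
      moreover have "omega (\<lambda>j. f0 j v) (\<lambda>j. g1 j v) = 0" using calculation(1) g1(2) L unfolding symp_compl_def by blast
      ultimately show ?thesis by simp
    qed
    then show "gh \<in> adjG v vj (bvRel L)" using L2 unfolding gh' adjG_def by blast
  qed
  with sub show ?thesis by (simp add: self_adjoint_ext_def)
qed

text \<open>Taking adjoints reverses inclusions, so \<open>T\<close> lies between the minimal
  relation and its adjoint. By Green's formula it depends on a function only through the boundary
  values.\<close>

lemma self_adjoint_imp_bvRel:
  assumes "self_adjoint_ext v vj (Smin v vj p q \<alpha>) T"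
  obtains L where "symp_compl L = L" "T = bvRel L"
proof -
  have ST: "Smin v vj p q \<alpha> \<subseteq> T" and adj: "adjG v vj T = T" using assms by (auto simp: self_adjoint_ext_def)
  define L where "L = {\<zeta>. \<exists>f\<in>Dm. (f, Hop p q f) \<in> T \<and> \<zeta> = (\<lambda>j. f j v)}"
  \<comment> \<open>The representative is itself in \<open>T\<close>, because \<open>T\<close> is an
    adjoint and thus invariant under equality almost everywhere.\<close>
  have rep: "\<exists>f0\<in>Dm. eqG v vj f f0 \<and> eqG v vj k (Hop p q f0) \<and> (f0, Hop p q f0) \<in> T" if fk: "(f, k) \<in> T" for f k
  proof -
    have "(f, k) \<in> adjG v vj (Smin v vj p q \<alpha>)" using fk ST adj unfolding adjG_def by blast
    then obtain f0 where f0: "f0 \<in> Dm" "eqG v vj f f0" "eqG v vj k (Hop p q f0)" by (rule adjoint_Smin)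
    have L2: "L2G v vj f" "L2G v vj k" using fk adj unfolding adjG_def by auto
    have "innerG v vj k' f0 = innerG v vj f' (Hop p q f0)" if "(f', k') \<in> T" for f' k'
    proof -
      have L2': "L2G v vj f'" "L2G v vj k'" using that adj unfolding adjG_def by auto
      have "innerG v vj k' f = innerG v vj f' k" using that fk adj unfolding adjG_def by blast
      moreover have "innerG v vj k' f = innerG v vj k' f0" "innerG v vj f' k = innerG v vj f' (Hop p q f0)"
        by (intro innerG_cong L2 L2' Dmax_L2G f0 eqG_refl)+
      ultimately show ?thesis by simp
    qed
    then have "(f0, Hop p q f0) \<in> adjG v vj T" using Dmax_L2G[OF f0(1)] unfolding adjG_def by blast
    with adj f0 show ?thesis by auto
  qed
  \<comment> \<open>The right-hand side depends on the boundary values alone; applied to elements of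
    the maximal domain this gives both inclusions of \<open>symp_compl L = L\<close>.\<close>
  have mem: "(g, Hop p q g) \<in> T \<longleftrightarrow> (\<lambda>j. g j v) \<in> symp_compl L" if g: "g \<in> Dm" for g
  proof
    assume gT: "(g, Hop p q g) \<in> T"
    show "(\<lambda>j. g j v) \<in> symp_compl L"
      unfolding symp_compl_def
    proof (intro CollectI ballI)
      fix \<zeta> assume "\<zeta> \<in> L"
      then obtain f where f: "f \<in> Dm" "(f, Hop p q f) \<in> T" "\<zeta> = (\<lambda>j. f j v)" unfolding L_def by blast
      have "innerG v vj (Hop p q f) g = innerG v vj f (Hop p q g)" using f(2) gT adj unfolding adjG_def by blast
      then show "omega \<zeta> (\<lambda>j. g j v) = 0" using green[OF f(1) g] f(3) by simp
    qed
  next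
    assume gL: "(\<lambda>j. g j v) \<in> symp_compl L"
    have "innerG v vj k g = innerG v vj f (Hop p q g)" if fk: "(f, k) \<in> T" for f k
    proof -
      obtain f0 where f0: "f0 \<in> Dm" "eqG v vj f f0" "eqG v vj k (Hop p q f0)" "(f0, Hop p q f0) \<in> T" using rep[OF fk] by blast
      have "(\<lambda>j. f0 j v) \<in> L" unfolding L_def using f0 by blast
      then have "omega (\<lambda>j. f0 j v) (\<lambda>j. g j v) = 0" using gL unfolding symp_compl_def by blast
      then have "innerG v vj (Hop p q f0) g = innerG v vj f0 (Hop p q g)" using green[OF f0(1) g] by simp
      moreover have L2: "L2G v vj f" "L2G v vj k" using fk adj unfolding adjG_def by auto
      have "innerG v vj k g = innerG v vj (Hop p q f0) g" "innerG v vj f (Hop p q g) = innerG v vj f0 (Hop p q g)"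
        by (intro innerG_cong L2 Dmax_L2G f0 g eqG_refl)+
      ultimately show ?thesis by simp
    qed
    then have "(g, Hop p q g) \<in> adjG v vj T" using Dmax_L2G[OF g] unfolding adjG_def by blast
    with adj show "(g, Hop p q g) \<in> T" by simp
  qed
  have L1: "symp_compl L = L"
  proof (rule set_eqI, rule iffI)
    fix \<zeta> assume \<zeta>: "\<zeta> \<in> symp_compl L"
    obtain g where g: "g \<in> Dm" "\<And>j. g j v = \<zeta> j" using Dmax_boundary_surj by blast
    then have gv: "\<zeta> = (\<lambda>j. g j v)" by auto
    have "(g, Hop p q g) \<in> T" using mem[OF g(1)] \<zeta> gv by simp
    then show "\<zeta> \<in> L" unfolding L_def using g(1) gv by blast
  next
    fix \<zeta> assume "\<zeta> \<in> L"
    then obtain f where "f \<in> Dm" "(f, Hop p q f) \<in> T" "\<zeta> = (\<lambda>j. f j v)" unfolding L_def by blast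
    then show "\<zeta> \<in> symp_compl L" using mem by simp
  qed
  have "T = bvRel L"
  proof (rule set_eqI, rule iffI)
    fix fk assume "fk \<in> T"
    moreover obtain f k where fk': "fk = (f, k)" by force
    ultimately have fk: "(f, k) \<in> T" by simp
    obtain f0 where f0: "f0 \<in> Dm" "eqG v vj f f0" "eqG v vj k (Hop p q f0)" "(f0, Hop p q f0) \<in> T" using rep[OF fk] by blast
    have "(\<lambda>j. f0 j v) \<in> L" unfolding L_def using f0 by blast
    moreover have "L2G v vj f" "L2G v vj k" using fk adj unfolding adjG_def by auto
    ultimately show "fk \<in> bvRel L" unfolding bvRel_def opRel_def fk' using f0 by blast
  next
    fix fk assume fk0: "fk \<in> bvRel L"
    obtain f k where fk': "fk = (f, k)" by force
    obtain f0 where f0: "f0 \<in> Dm" "(\<lambda>j. f0 j v) \<in> L" "eqG v vj f f0" "eqG v vj k (Hop p q f0)"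
      and L2: "L2G v vj f" "L2G v vj k"
      using fk0 unfolding bvRel_def opRel_def fk' by blast
    have T0: "(f0, Hop p q f0) \<in> adjG v vj T" using mem[OF f0(1)] f0(2) L1 adj by simp
    have "innerG v vj k' f = innerG v vj f' k" if "(f', k') \<in> T" for f' k'
    proof -
      have L2': "L2G v vj f'" "L2G v vj k'" using that adj unfolding adjG_def by auto
      have "innerG v vj k' f0 = innerG v vj f' (Hop p q f0)" using that T0 unfolding adjG_def by blast
      moreover have "innerG v vj k' f = innerG v vj k' f0" "innerG v vj f' k = innerG v vj f' (Hop p q f0)"
        by (intro innerG_cong L2 L2' Dmax_L2G f0 eqG_refl)+
      ultimately show ?thesis by simp
    qed
    then have "(f, k) \<in> adjG v vj T" using L2 unfolding adjG_def by blast
    then show "fk \<in> T" using adj fk' by simp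
  qed
  with L1 show thesis by (rule that)
qed

end

section \<open>Lagrangian subspaces\<close>

definition cdot :: "complex^'n \<Rightarrow> complex^'n \<Rightarrow> complex" where
  "cdot x y = (\<Sum>i\<in>UNIV. x $ i * cnj (y $ i))"

lemma cdot_adjm: "cdot (adjm A *v x) y = cdot x (A *v y)"
proof -
  have "cdot (adjm A *v x) y = (\<Sum>i\<in>UNIV. \<Sum>k\<in>UNIV. cnj (A $ k $ i) * x $ k * cnj (y $ i))"
    by (simp add: cdot_def adjm_def matrix_vector_mult_def sum_distrib_right)
  also have "\<dots> = (\<Sum>k\<in>UNIV. \<Sum>i\<in>UNIV. cnj (A $ k $ i) * x $ k * cnj (y $ i))"
    by (rule sum.swap)
  also have "\<dots> = cdot x (A *v y)"
    by (simp add: cdot_def matrix_vector_mult_def sum_distrib_left ac_simps)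
  finally show ?thesis .
qed

lemma adjm_adjm [simp]: "adjm (adjm A) = A"
  by (simp add: adjm_def vec_eq_iff)

lemma adjm_mul: "adjm (A ** B) = adjm B ** adjm A"
  by (simp add: adjm_def matrix_matrix_mult_def vec_eq_iff mult.commute)

lemma adjm_simps: "adjm (A - B) = adjm A - adjm B" "adjm (A + B) = adjm A + adjm B" "adjm (- A) = - adjm A" "adjm (mat 1) = mat 1" "adjm 0 = 0"
  by (auto simp: adjm_def mat_def vec_eq_iff)

lemma matrix_minus_mul: "(- A) ** (B :: complex^'k^'m) = - (A ** B)" "C ** (- D) = - (C ** (D :: complex^'k^'m))"
  by (simp_all add: matrix_matrix_mult_def vec_eq_iff sum_negf)

lemma matrix_vector_minus: "(- A) *v x = - (A *v x)" for A :: "complex^'m^'n"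
  by (simp add: matrix_vector_mult_def vec_eq_iff sum_negf)

lemma cdot_self_zero: "cdot x x = 0 \<longleftrightarrow> x = 0"
proof
  assume "cdot x x = 0"
  then have "of_real (\<Sum>i\<in>UNIV. (cmod (x $ i))\<^sup>2) = (0::complex)"
    unfolding of_real_sum complex_norm_square by (simp add: cdot_def)
  then have "(\<Sum>i\<in>UNIV. (cmod (x $ i))\<^sup>2) = 0" by (simp only: of_real_eq_0_iff)
  then show "x = 0" by (simp add: sum_nonneg_eq_0_iff vec_eq_iff)
qed (simp add: cdot_def)

lemma cdot_self_sum_zero:
  assumes "cdot x x + cdot y y = 0"
  shows "x = 0" "y = 0"
proof -
  have nn: "cdot x x = of_real (\<Sum>i\<in>UNIV. (cmod (x $ i))\<^sup>2)" for x :: "complex^'m"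
    unfolding of_real_sum complex_norm_square by (simp add: cdot_def)
  have "(\<Sum>i\<in>UNIV. (cmod (x $ i))\<^sup>2) + (\<Sum>i\<in>UNIV. (cmod (y $ i))\<^sup>2) = 0"
    using assms unfolding nn of_real_add[symmetric] of_real_eq_0_iff .
  then have "(\<Sum>i\<in>UNIV. (cmod (x $ i))\<^sup>2) = 0" "(\<Sum>i\<in>UNIV. (cmod (y $ i))\<^sup>2) = 0"
    by (simp_all add: add_nonneg_eq_0_iff sum_nonneg)
  then show "x = 0" "y = 0" by (simp_all add: sum_nonneg_eq_0_iff vec_eq_iff)
qed

lemma cdot_right_zero: "(\<And>x. cdot x y = 0) \<Longrightarrow> y = 0"
  using cdot_self_zero by blast

lemma cdot_simps:
  "cdot (x + x') y = cdot x y + cdot x' y" "cdot x (y + y') = cdot x y + cdot x y'"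
  "cdot (x - x') y = cdot x y - cdot x' y" "cdot x (y - y') = cdot x y - cdot x y'"
  "cdot (- x) y = - cdot x y" "cdot x (- y) = - cdot x y"
  "cdot (c *s x) y = c * cdot x y" "cdot x (c *s y) = cnj c * cdot x y" "cdot 0 y = 0" "cdot x 0 = 0"
  by (auto simp: cdot_def algebra_simps sum.distrib sum_subtractf sum_negf sum_distrib_left)

section \<open>Rank conditions\<close>

text \<open>\<open>rank\<close> is the dimension spanned by the set \<open>rows H\<close>, and a set
  forgets repetitions; hence injectivity of the row indexing has to be obtained in both
  directions.\<close>

lemma rank_full_rows:
  fixes H :: "complex^'m^'n"
  shows "rank H = CARD('n) \<longleftrightarrow> (\<forall>c. (\<Sum>i\<in>UNIV. c i *s row i H) = 0 \<longrightarrow> (\<forall>i. c i = 0))"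
proof -
  have rows: "rows H = range (\<lambda>i. row i H)" by (auto simp: rows_def)
  have fin: "finite (rows H)" unfolding rows by simp
  show ?thesis
  proof
    assume r: "rank H = CARD('n)"
    then have d: "vec.dim (rows H) = CARD('n)" by (simp add: row_rank_def_gen)
    have "card (rows H) \<le> CARD('n)" unfolding rows by (rule card_image_le) simp
    moreover have "vec.dim (rows H) \<le> card (rows H)" by (rule vec.dim_le_card'[OF fin])
    ultimately have c: "card (rows H) = CARD('n)" using d by simp
    then have inj: "inj (\<lambda>i. row i H)" unfolding rows by (intro eq_card_imp_inj_on) simp_all
    have ind: "vec.independent (rows H)"
      by (rule vec.card_le_dim_spanning[of _ "rows H"]) (use c d fin vec.span_superset in auto)
    show "\<forall>c. (\<Sum>i\<in>UNIV. c i *s row i H) = 0 \<longrightarrow> (\<forall>i. c i = 0)"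
    proof (intro allI impI)
      fix c i assume s: "(\<Sum>i\<in>UNIV. c i *s row i H) = 0"
      define u where "u r = c (inv (\<lambda>i. row i H) r)" for r
      have "(\<Sum>r\<in>rows H. u r *s r) = (\<Sum>i\<in>UNIV. c i *s row i H)"
        unfolding rows by (subst sum.reindex[OF inj]) (simp add: u_def inv_f_f[OF inj])
      with s have "(\<Sum>r\<in>rows H. u r *s r) = 0" by simp
      from vec.independentD[OF ind fin order_refl this, of "row i H"]
      show "c i = 0" by (simp add: u_def inv_f_f[OF inj] rows)
    qed
  next
    assume z: "\<forall>c. (\<Sum>i\<in>UNIV. c i *s row i H) = 0 \<longrightarrow> (\<forall>i. c i = 0)"
    have inj: "inj (\<lambda>i. row i H)"
    proof (rule injI, rule ccontr)
      fix i k assume ik: "row i H = row k H" "i \<noteq> k"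
      \<comment> \<open>Coefficients 1 and -1 on two equal rows would be a forbidden linear
        relation.\<close>
      define c :: "'n \<Rightarrow> complex" where "c m = (if m = i then 1 else 0) - (if m = k then 1 else 0)" for m
      have "(\<Sum>m\<in>UNIV. c m *s row m H) = (\<Sum>m\<in>UNIV. (if m = i then row m H else 0) - (if m = k then row m H else 0))"
        by (rule sum.cong) (auto simp: c_def)
      also have "\<dots> = row i H - row k H" by (simp add: sum_subtractf)
      finally have "c i = 0" using z ik by auto
      then show False using ik by (simp add: c_def)
    qed
    have "vec.independent (rows H)"
    proof (rule vec.independent_if_scalars_zero[OF fin])
      fix f r assume s: "(\<Sum>x\<in>rows H. f x *s x) = 0" and r: "r \<in> rows H"
      have "(\<Sum>i\<in>UNIV. f (row i H) *s row i H) = 0"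
        using s unfolding rows by (subst (asm) sum.reindex[OF inj]) simp
      with z r show "f r = 0" unfolding rows by auto
    qed
    then have "vec.dim (rows H) = card (rows H)" by (rule vec.dim_eq_card_independent)
    also have "\<dots> = CARD('n)" unfolding rows by (rule card_image[OF inj])
    finally show "rank H = CARD('n)" by (simp add: row_rank_def_gen)
  qed
qed

text \<open>A linear relation between the rows of \<open>(A B)\<close> is, after conjugation, a
  common kernel vector of the two adjoints.\<close>

lemma rank_hcat:
  fixes A B :: "complex^'n^'n"
  shows "rank (hcat A B) = CARD('n) \<longleftrightarrow> (\<forall>c. adjm A *v c = 0 \<and> adjm B *v c = 0 \<longrightarrow> c = 0)"
proof -
  have *: "(\<Sum>i\<in>UNIV. c i *s row i (hcat A B)) = 0 \<longleftrightarrow>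
      adjm A *v (\<chi> i. cnj (c i)) = 0 \<and> adjm B *v (\<chi> i. cnj (c i)) = 0" for c
  proof -
    have 1: "(\<Sum>i\<in>UNIV. c i *s row i (hcat A B)) $ k = (case k of Inl a \<Rightarrow> cnj ((adjm A *v (\<chi> i. cnj (c i))) $ a)
      | Inr a \<Rightarrow> cnj ((adjm B *v (\<chi> i. cnj (c i))) $ a))" for k
      by (cases k) (simp_all add: row_def hcat_def adjm_def matrix_vector_mult_def mult.commute)
    show ?thesis
      unfolding vec_eq_iff 1 by (auto split: sum.split_asm sum.splits)
  qed
  show ?thesis
    unfolding rank_full_rows *
  proof safe
    fix c assume h: "\<forall>c. adjm A *v (\<chi> i. cnj (c i)) = 0 \<and> adjm B *v (\<chi> i. cnj (c i)) = 0 \<longrightarrow> (\<forall>i. c i = 0)"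
      and c: "adjm A *v c = 0" "adjm B *v c = 0"
    show "c = 0" using h[rule_format, of "\<lambda>i. cnj (c $ i)"] c by (simp add: vec_eq_iff)
  next
    fix c :: "'n \<Rightarrow> complex" and i assume h: "\<forall>c. adjm A *v c = 0 \<and> adjm B *v c = 0 \<longrightarrow> c = 0"
      and c: "adjm A *v (\<chi> i. cnj (c i)) = 0" "adjm B *v (\<chi> i. cnj (c i)) = 0"
    have "(\<chi> i. cnj (c i)) = 0" using h c by blast
    then have "(\<chi> i. cnj (c i)) $ i = 0" by simp
    then show "c i = 0" by simp
  qed
qed

text \<open>Both diagonal blocks of the decomposition are governed by the Gram matrix
  \<open>A ** adjm A + B ** adjm B\<close>: the relation between \<open>A\<close> and
  \<open>B\<close> removes the mixed terms, and full rank makes the Gram matrix injective.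
  Injectivity of the square block matrix gives surjectivity, which replaces counting
  dimensions.\<close>

lemma surjective_block:
  fixes A B :: "complex^'n^'n"
  assumes rk: "rank (hcat A B) = CARD('n)" and ab: "A ** adjm B = B ** adjm A"
  obtains c1 c2 where "x1 = - (adjm B *v c1) + adjm A *v c2" "x2 = adjm A *v c1 + adjm B *v c2"
proof -
  define l r :: "complex^('n+'n) \<Rightarrow> complex^'n" where "l u = (\<chi> a. u $ Inl a)" and "r u = (\<chi> a. u $ Inr a)" for u
  define P :: "complex^('n+'n)^('n+'n)" where "P = (\<chi> i k. case i of
     Inl a \<Rightarrow> (case k of Inl c \<Rightarrow> - adjm B $ a $ c | Inr c \<Rightarrow> adjm A $ a $ c)
   | Inr a \<Rightarrow> (case k of Inl c \<Rightarrow> adjm A $ a $ c | Inr c \<Rightarrow> adjm B $ a $ c))"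
  have split: "(\<Sum>k\<in>UNIV. f k) = (\<Sum>a\<in>UNIV. f (Inl a)) + (\<Sum>a\<in>UNIV. f (Inr a))" for f :: "'n + 'n \<Rightarrow> complex"
    by (simp add: UNIV_Plus_UNIV[symmetric] sum.Plus del: UNIV_Plus_UNIV)
  have Pl: "l (P *v u) = - (adjm B *v l u) + adjm A *v r u" and Pr: "r (P *v u) = adjm A *v l u + adjm B *v r u" for u
    by (simp_all add: l_def r_def P_def matrix_vector_mult_def vec_eq_iff split sum_negf)
  have lr: "u = w" if "l u = l w" "r u = r w" for u w
    unfolding vec_eq_iff
  proof
    fix i show "u $ i = w $ i" using that by (cases i) (auto simp: l_def r_def vec_eq_iff)
  qed
  \<comment> \<open>Pairing with \<open>c\<close> gives the sum of the squared norms of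
    \<open>adjm A *v c\<close> and \<open>adjm B *v c\<close>.\<close>
  have G: "c = 0" if "A *v (adjm A *v c) + B *v (adjm B *v c) = 0" for c
  proof -
    have "cdot (adjm A *v c) (adjm A *v c) + cdot (adjm B *v c) (adjm B *v c) = cdot c (A *v (adjm A *v c) + B *v (adjm B *v c))"
      by (simp add: cdot_adjm cdot_simps)
    also have "\<dots> = 0" using that by (simp add: cdot_simps)
    finally have s: "cdot (adjm A *v c) (adjm A *v c) + cdot (adjm B *v c) (adjm B *v c) = 0" .
    note cdot_self_sum_zero[OF s]
    with rk[unfolded rank_hcat] show ?thesis by blast
  qed
  have ab': "A *v (adjm B *v c) = B *v (adjm A *v c)" for c using ab by (simp add: matrix_vector_mul_assoc)
  have "inj ((*v) P)"
  proof (rule injI)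
    fix u w assume "P *v u = P *v w"
    then have 0: "P *v (u - w) = 0" by (simp add: matrix_vector_mult_diff_distrib)
    define c1 c2 where "c1 = l (u - w)" and "c2 = r (u - w)"
    have 1: "- (adjm B *v c1) + adjm A *v c2 = 0" "adjm A *v c1 + adjm B *v c2 = 0"
      using Pl[of "u - w"] Pr[of "u - w"] unfolding 0 c1_def c2_def by (simp_all add: l_def r_def vec_eq_iff)
    have "A *v (adjm A *v c2) + B *v (adjm B *v c2) = A *v (- (adjm B *v c1) + adjm A *v c2) + B *v (adjm A *v c1 + adjm B *v c2)"
      by (simp add: vec.add vec.neg vec.diff ab')
    also have "\<dots> = 0" unfolding 1 by simp
    finally have "c2 = 0" by (rule G)
    have "A *v (adjm A *v c1) + B *v (adjm B *v c1) = A *v (adjm A *v c1 + adjm B *v c2) - B *v (- (adjm B *v c1) + adjm A *v c2)"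
      by (simp add: vec.add vec.neg vec.diff ab')
    also have "\<dots> = 0" unfolding 1 by simp
    finally have "c1 = 0" by (rule G)
    with \<open>c2 = 0\<close> show "u = w" unfolding c1_def c2_def by (intro lr) (auto simp: l_def r_def vec_eq_iff)
  qed
  then obtain Q where "Q ** P = mat 1" using matrix_left_invertible_injective[of P] by blast
  then have PQ: "P ** Q = mat 1" by (simp add: matrix_left_right_inverse)
  define x :: "complex^('n+'n)" where "x = (\<chi> i. case i of Inl a \<Rightarrow> x1 $ a | Inr a \<Rightarrow> x2 $ a)"
  have "P *v (Q *v x) = x" using PQ by (simp add: matrix_vector_mul_assoc)
  then have "x1 = l (P *v (Q *v x))" "x2 = r (P *v (Q *v x))" by (simp_all add: x_def l_def r_def)
  with that show thesis unfolding Pl Pr by blast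
qed

lemma real_inner_cdot: "inner x y = Re (cdot x y)" for x y :: "complex^'n"
  by (simp add: inner_vec_def cdot_def inner_complex_def)

text \<open>A real orthogonal vector gives vanishing real parts; as \<open>V\<close> is stable under
  multiplication by the imaginary unit, the imaginary parts vanish as well.\<close>

lemma complex_orthogonal_exists:
  fixes V :: "(complex^'n) set"
  assumes add: "\<And>x y. x \<in> V \<Longrightarrow> y \<in> V \<Longrightarrow> x + y \<in> V" and sc: "\<And>c x. x \<in> V \<Longrightarrow> c *s x \<in> V" and "0 \<in> V" and "V \<noteq> UNIV"
  obtains u where "u \<noteq> 0" "\<And>x. x \<in> V \<Longrightarrow> cdot x u = 0"
proof -
  have scR: "a *\<^sub>R x = complex_of_real a *s x" for a and x :: "complex^'n"
    unfolding vec_eq_iff vector_scaleR_component vector_smult_component by (simp add: scaleR_conv_of_real)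
  have sub: "subspace V" unfolding subspace_def scR using assms by auto
  have "dim V < DIM(complex^'n)"
    using sub \<open>V \<noteq> UNIV\<close> by (metis dim_eq_full dim_subset_UNIV le_neq_implies_less span_eq_iff)
  then obtain u where u: "u \<noteq> 0" "\<And>y. y \<in> span V \<Longrightarrow> orthogonal u y"
    using orthogonal_to_subspace_exists by blast
  have re: "Re (cdot x u) = 0" if "x \<in> V" for x
  proof -
    have "inner x u = 0" using u(2)[OF span_base[OF that]] by (simp add: orthogonal_def inner_commute)
    then show ?thesis by (simp only: real_inner_cdot)
  qed
  have "cdot x u = 0" if x: "x \<in> V" for x
    using re[OF x] re[OF sc[OF x, of \<i>]] by (simp add: cdot_simps complex_eq_iff)
  with u(1) that show thesis by blast
qed

context star
begin

definition fst_vec :: "('n \<Rightarrow> complex \<times> complex) \<Rightarrow> complex^'n" where "fst_vec \<zeta> = (\<chi> j. fst (\<zeta> j))"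
definition snd_vec :: "('n \<Rightarrow> complex \<times> complex) \<Rightarrow> complex^'n" where "snd_vec \<zeta> = (\<chi> j. snd (\<zeta> j))"
definition vec_pair :: "complex^'n \<Rightarrow> complex^'n \<Rightarrow> 'n \<Rightarrow> complex \<times> complex" where "vec_pair x y j = (x $ j, y $ j)"

lemma v_vec_pair [simp]: "fst_vec (vec_pair x y) = x" "snd_vec (vec_pair x y) = y" "vec_pair (fst_vec \<zeta>) (snd_vec \<zeta>) = \<zeta>"
  by (auto simp: fst_vec_def snd_vec_def vec_pair_def)

lemma omega_cdot: "omega x y = cdot (fst_vec x) (snd_vec y) - cdot (snd_vec x) (fst_vec y)"
  by (simp add: omega_def cdot_def fst_vec_def snd_vec_def sum_subtractf)

definition LAB :: "complex^'n^'n \<Rightarrow> complex^'n^'n \<Rightarrow> ('n \<Rightarrow> complex \<times> complex) set" where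
  "LAB A B = {\<zeta>. A *v fst_vec \<zeta> + B *v snd_vec \<zeta> = 0}"

lemma TAB_bvRel: "TAB v vj p q \<alpha> A B = bvRel (LAB A B)"
  unfolding TAB_def bvRel_def LAB_def sharp1_def sharp2_def fst_vec_def snd_vec_def by simp

text \<open>Moving the adjoints across the inner product turns the boundary form against such a pair
  into minus the product of \<open>c\<close> with \<open>A y1 + B y2\<close>, where
  \<open>y1\<close>, \<open>y2\<close> are the component vectors of \<open>y\<close>.\<close>

lemma symp_compl_range: "symp_compl (range (\<lambda>c. vec_pair (- (adjm B *v c)) (adjm A *v c))) = LAB A B"
proof -
  have "omega (vec_pair (- (adjm B *v c)) (adjm A *v c)) y = - cdot c (A *v fst_vec y + B *v snd_vec y)" for c y
    by (simp add: omega_cdot cdot_simps cdot_adjm)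
  then show ?thesis
    unfolding symp_compl_def LAB_def
  proof (intro set_eqI)
    fix y assume h: "\<And>c y. omega (vec_pair (- (adjm B *v c)) (adjm A *v c)) y = - cdot c (A *v fst_vec y + B *v snd_vec y)"
    show "y \<in> {y. \<forall>x\<in>range (\<lambda>c. vec_pair (- (adjm B *v c)) (adjm A *v c)). omega x y = 0} \<longleftrightarrow> y \<in> {\<zeta>. A *v fst_vec \<zeta> + B *v snd_vec \<zeta> = 0}"
      using cdot_right_zero[of "A *v fst_vec y + B *v snd_vec y"] by (auto simp: h cdot_simps(10))
  qed
qed

text \<open>By \<open>surjective_block\<close> every boundary value has a part along
  \<open>(- adjm B, adjm A)\<close> and one along \<open>(adjm A, adjm B)\<close>; the condition
  defining \<open>LAB\<close> annihilates the second through the Gram matrix.\<close>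

lemma LAB_range:
  assumes rk: "rank (hcat A B) = CARD('n)" and ab: "A ** adjm B = B ** adjm A"
  shows "LAB A B = range (\<lambda>c. vec_pair (- (adjm B *v c)) (adjm A *v c))"
proof
  have ab': "A *v (adjm B *v c) = B *v (adjm A *v c)" for c using ab by (simp add: matrix_vector_mul_assoc)
  show "range (\<lambda>c. vec_pair (- (adjm B *v c)) (adjm A *v c)) \<subseteq> LAB A B"
    by (auto simp: LAB_def vec.neg ab')
  show "LAB A B \<subseteq> range (\<lambda>c. vec_pair (- (adjm B *v c)) (adjm A *v c))"
  proof
    fix \<zeta> assume \<zeta>: "\<zeta> \<in> LAB A B"
    obtain c1 c2 where c: "fst_vec \<zeta> = - (adjm B *v c1) + adjm A *v c2" "snd_vec \<zeta> = adjm A *v c1 + adjm B *v c2"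
      using surjective_block[OF rk ab] by blast
    have "A *v fst_vec \<zeta> + B *v snd_vec \<zeta> = 0" using \<zeta> by (simp add: LAB_def)
    then have "A *v (adjm A *v c2) + B *v (adjm B *v c2) = 0"
      unfolding c by (simp add: vec.add vec.neg vec.diff ab')
    then have "cdot c2 (A *v (adjm A *v c2)) + cdot c2 (B *v (adjm B *v c2)) = 0"
      by (simp add: cdot_simps flip: cdot_simps(2))
    then have s: "cdot (adjm A *v c2) (adjm A *v c2) + cdot (adjm B *v c2) (adjm B *v c2) = 0"
      by (simp add: cdot_adjm)
    have "adjm A *v c2 = 0" "adjm B *v c2 = 0" by (rule cdot_self_sum_zero[OF s])+
    then have "\<zeta> = vec_pair (- (adjm B *v c1)) (adjm A *v c1)"
      using c v_vec_pair(3)[of \<zeta>] by simp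
    then show "\<zeta> \<in> range (\<lambda>c. vec_pair (- (adjm B *v c)) (adjm A *v c))" by blast
  qed
qed

lemma symp_compl_LAB:
  assumes "rank (hcat A B) = CARD('n)" "A ** adjm B = B ** adjm A"
  shows "symp_compl (LAB A B) = LAB A B"
  using symp_compl_range[of B A] LAB_range[OF assms] by simp

text \<open>The map \<open>\<phi> x = x1 + i x2\<close> preserves norms on \<open>L\<close>, since
  its cross terms are a multiple of \<open>omega x x = 0\<close>, and it is onto because a vector
  orthogonal to the image would produce an element of \<open>L\<close> with nonzero
  \<open>omega y y\<close>. So \<open>L\<close> is parametrised linearly by the whole coordinate
  space, without a notion of dimension.\<close>

lemma lagrangian_LAB:
  assumes L: "symp_compl L = L"
  obtains A B :: "complex^'n^'n" where "rank (hcat A B) = CARD('n)" "A ** adjm B = B ** adjm A" "L = LAB A B"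
proof -
  have memL: "\<zeta> \<in> L \<longleftrightarrow> (\<forall>x\<in>L. omega x \<zeta> = 0)" for \<zeta> using L unfolding symp_compl_def by blast
  have add: "vec_pair (fst_vec x + fst_vec y) (snd_vec x + snd_vec y) \<in> L" if "x \<in> L" "y \<in> L" for x y
    unfolding memL[of "vec_pair (fst_vec x + fst_vec y) (snd_vec x + snd_vec y)"]
  proof
    fix w assume w: "w \<in> L"
    have "omega w (vec_pair (fst_vec x + fst_vec y) (snd_vec x + snd_vec y)) = omega w x + omega w y"
      by (simp add: omega_cdot cdot_simps)
    moreover have "omega w x = 0" "omega w y = 0" using that w memL[of x] memL[of y] by blast+
    ultimately show "omega w (vec_pair (fst_vec x + fst_vec y) (snd_vec x + snd_vec y)) = 0" by simp
  qed
  have sc: "vec_pair (c *s fst_vec x) (c *s snd_vec x) \<in> L" if "x \<in> L" for x c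
    unfolding memL[of "vec_pair (c *s fst_vec x) (c *s snd_vec x)"]
  proof
    fix w assume w: "w \<in> L"
    have "omega w (vec_pair (c *s fst_vec x) (c *s snd_vec x)) = cnj c * omega w x"
      by (simp add: omega_cdot cdot_simps right_diff_distrib)
    moreover have "omega w x = 0" using that w memL[of x] by blast
    ultimately show "omega w (vec_pair (c *s fst_vec x) (c *s snd_vec x)) = 0" by simp
  qed
  have z: "vec_pair 0 0 \<in> L" unfolding memL[of "vec_pair 0 0"] by (simp add: omega_cdot cdot_simps)
  define \<phi> where "\<phi> x = fst_vec x + \<i> *s snd_vec x" for x
  have norm\<phi>: "cdot (\<phi> x) (\<phi> x) = cdot (fst_vec x) (fst_vec x) + cdot (snd_vec x) (snd_vec x)" if "x \<in> L" for x
  proof -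
    have "cdot (fst_vec x) (snd_vec x) - cdot (snd_vec x) (fst_vec x) = 0" using that memL[of x] by (simp add: omega_cdot)
    then show ?thesis unfolding \<phi>_def by (simp add: cdot_simps algebra_simps)
  qed
  have inj: "x = vec_pair 0 0" if "x \<in> L" "\<phi> x = 0" for x
  proof -
    have "cdot (fst_vec x) (fst_vec x) + cdot (snd_vec x) (snd_vec x) = 0" using norm\<phi>[OF that(1)] that(2) by (simp add: cdot_simps)
    note cdot_self_sum_zero[OF this]
    then show ?thesis using v_vec_pair(3)[of x] by simp
  qed
  have surj: "\<phi> ` L = UNIV"
  proof (rule ccontr)
    assume ne: "\<phi> ` L \<noteq> UNIV"
    obtain u where u: "u \<noteq> 0" "\<And>y. y \<in> \<phi> ` L \<Longrightarrow> cdot y u = 0"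
    proof (rule complex_orthogonal_exists[OF _ _ _ ne])
      show "a + b \<in> \<phi> ` L" if "a \<in> \<phi> ` L" "b \<in> \<phi> ` L" for a b
      proof -
        obtain x y where xy: "x \<in> L" "y \<in> L" "a = \<phi> x" "b = \<phi> y" using \<open>a \<in> \<phi> ` L\<close> \<open>b \<in> \<phi> ` L\<close> by blast
        have "a + b = \<phi> (vec_pair (fst_vec x + fst_vec y) (snd_vec x + snd_vec y))" using xy by (simp add: \<phi>_def vec.scale_right_distrib)
        then show ?thesis using add[OF xy(1,2)] by blast
      qed
      show "c *s a \<in> \<phi> ` L" if "a \<in> \<phi> ` L" for c a
      proof -
        obtain x where x: "x \<in> L" "a = \<phi> x" using \<open>a \<in> \<phi> ` L\<close> by blast
        have "c *s a = \<phi> (vec_pair (c *s fst_vec x) (c *s snd_vec x))" using x by (simp add: \<phi>_def vec.scale_right_distrib mult.commute)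
        then show ?thesis using sc[OF x(1)] by blast
      qed
      have "\<phi> (vec_pair 0 0) = 0" by (simp add: \<phi>_def)
      then show "0 \<in> \<phi> ` L" using z by (metis image_eqI)
    qed blast
    \<comment> \<open>For this \<open>y\<close> the form \<open>omega x y\<close> is the imaginary
      unit times the product of \<open>\<phi> x\<close> with \<open>u\<close>, hence zero on
      \<open>L\<close>, whereas \<open>omega y y\<close> is a nonzero multiple of the squared norm
      of \<open>u\<close>.\<close>
    define y where "y = vec_pair u (- \<i> *s u)"
    have "omega x y = 0" if "x \<in> L" for x
    proof -
      have "omega x y = \<i> * cdot (\<phi> x) u" by (simp add: omega_cdot y_def \<phi>_def cdot_simps algebra_simps)
      then show ?thesis using u(2) that by simp
    qed
    then have "y \<in> L" using memL by blast
    then have "omega y y = 0" using memL by blast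
    then have "cdot u u = 0" by (simp add: omega_cdot y_def cdot_simps)
    then show False using u(1) cdot_self_zero by blast
  qed
  have "\<forall>k. \<exists>\<zeta>\<in>L. \<phi> \<zeta> = axis k 1" using surj by (metis imageE UNIV_I)
  then obtain e where e: "\<And>k. e k \<in> L" "\<And>k. \<phi> (e k) = axis k 1" by metis
  define X Z :: "complex^'n^'n" where "X = (\<chi> a k. fst_vec (e k) $ a)" and "Z = (\<chi> a k. snd_vec (e k) $ a)"
  have XZ: "X *v c = (\<Sum>k\<in>UNIV. c $ k *s fst_vec (e k))" "Z *v c = (\<Sum>k\<in>UNIV. c $ k *s snd_vec (e k))" for c
    by (simp_all add: X_def Z_def matrix_vector_mult_def vec_eq_iff mult.commute)
  have XZL: "vec_pair (X *v c) (Z *v c) \<in> L" for c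
  proof -
    have "vec_pair (\<Sum>k\<in>S. c $ k *s fst_vec (e k)) (\<Sum>k\<in>S. c $ k *s snd_vec (e k)) \<in> L" if "finite S" for S
      using that
    proof (induction S rule: finite_induct)
      case (insert k S)
      from add[OF sc[OF e(1)[of k], of "c $ k"] insert.IH] insert.hyps show ?case by simp
    qed (simp add: z)
    then show ?thesis unfolding XZ by simp
  qed
  have XZc: "X *v c + \<i> *s (Z *v c) = c" for c
  proof -
    have "X *v c + \<i> *s (Z *v c) = (\<Sum>k\<in>UNIV. c $ k *s \<phi> (e k))"
      unfolding XZ \<phi>_def by (simp add: vec_eq_iff sum_distrib_left algebra_simps sum.distrib)
    also have "\<dots> = c" unfolding e by (rule basis_expansion)
    finally show ?thesis .
  qed
  \<comment> \<open>Chosen such that the parametrisation \<open>(X c, Z c)\<close> of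
    \<open>L\<close> reads \<open>(- adjm B c, adjm A c)\<close>, the form treated by
    \<open>symp_compl_range\<close>.\<close>
  define A B where "A = adjm Z" and "B = - adjm X"
  have AB: "adjm A = Z" "adjm B = - X" unfolding A_def B_def by (simp_all add: adjm_simps)
  have "L = range (\<lambda>c. vec_pair (X *v c) (Z *v c))"
  proof
    show "range (\<lambda>c. vec_pair (X *v c) (Z *v c)) \<subseteq> L" using XZL by blast
    show "L \<subseteq> range (\<lambda>c. vec_pair (X *v c) (Z *v c))"
    proof
      fix \<zeta> assume \<zeta>: "\<zeta> \<in> L"
      define c where "c = \<phi> \<zeta>"
      define d where "d = vec_pair (fst_vec \<zeta> + (-1) *s (X *v c)) (snd_vec \<zeta> + (-1) *s (Z *v c))"
      have "d \<in> L" using add[OF \<zeta> sc[OF XZL[of c], of "-1"]] by (simp add: d_def)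
      moreover have "\<phi> d = \<phi> \<zeta> - (X *v c + \<i> *s (Z *v c))"
        by (simp add: \<phi>_def d_def vec_eq_iff algebra_simps)
      then have "\<phi> d = 0" by (simp add: XZc c_def)
      ultimately have "d = vec_pair 0 0" by (rule inj)
      then have "fst_vec d = 0" "snd_vec d = 0" by simp_all
      then have "fst_vec \<zeta> = X *v c" "snd_vec \<zeta> = Z *v c" by (simp_all add: d_def)
      then have "\<zeta> = vec_pair (X *v c) (Z *v c)" using v_vec_pair(3)[of \<zeta>] by simp
      then show "\<zeta> \<in> range (\<lambda>c. vec_pair (X *v c) (Z *v c))" by blast
    qed
  qed
  also have "\<dots> = range (\<lambda>c. vec_pair (- (adjm B *v c)) (adjm A *v c))"
    unfolding AB matrix_vector_minus by simp
  finally have LR: "L = range (\<lambda>c. vec_pair (- (adjm B *v c)) (adjm A *v c))" .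
  have "L = symp_compl L" using L by simp
  also have "\<dots> = LAB A B" by (subst LR) (rule symp_compl_range)
  finally have LL: "L = LAB A B" .
  have rk: "rank (hcat A B) = CARD('n)"
    unfolding rank_hcat AB
  proof (intro allI impI)
    fix c assume "Z *v c = 0 \<and> - X *v c = 0"
    then have "Z *v c = 0" "X *v c = 0" by (auto simp: matrix_vector_mult_def sum_negf vec_eq_iff)
    with XZc[of c] show "c = 0" by simp
  qed
  have "A *v (adjm B *v c) = B *v (adjm A *v c)" for c
  proof -
    have "vec_pair (- (adjm B *v c)) (adjm A *v c) \<in> LAB A B" using LR LL by blast
    then show ?thesis by (simp add: LAB_def vec.neg)
  qed
  then have "A ** adjm B = B ** adjm A" by (simp add: matrix_eq matrix_vector_mul_assoc)
  from that[OF rk this LL] show thesis .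
qed

theorem self_adjoint_ext_iff:
  "self_adjoint_ext v vj (Smin v vj p q \<alpha>) T \<longleftrightarrow>
     (\<exists>A B :: complex^'n^'n. rank (hcat A B) = CARD('n) \<and> A ** adjm B = B ** adjm A \<and> T = TAB v vj p q \<alpha> A B)"
proof
  assume "self_adjoint_ext v vj (Smin v vj p q \<alpha>) T"
  then obtain L where L: "symp_compl L = L" "T = bvRel L" by (rule self_adjoint_imp_bvRel)
  obtain A B :: "complex^'n^'n" where "rank (hcat A B) = CARD('n)" "A ** adjm B = B ** adjm A" "L = LAB A B"
    using lagrangian_LAB[OF L(1)] by blast
  then show "\<exists>A B :: complex^'n^'n. rank (hcat A B) = CARD('n) \<and> A ** adjm B = B ** adjm A \<and> T = TAB v vj p q \<alpha> A B"
    using L(2) TAB_bvRel by blast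
next
  assume "\<exists>A B :: complex^'n^'n. rank (hcat A B) = CARD('n) \<and> A ** adjm B = B ** adjm A \<and> T = TAB v vj p q \<alpha> A B"
  then show "self_adjoint_ext v vj (Smin v vj p q \<alpha>) T"
    using self_adjoint_bvRel[OF symp_compl_LAB] TAB_bvRel by auto
qed

end

section \<open>The resolvent\<close>

lemma matrix_inv_left: "invertible N \<Longrightarrow> matrix_inv N ** N = mat 1"
  and matrix_inv_right: "invertible N \<Longrightarrow> N ** matrix_inv N = mat 1" for N :: "complex^'n^'n"
  unfolding invertible_def matrix_inv_def by (rule someI2_ex, assumption, blast)+

context star
begin

abbreviation "mf \<equiv> mfun v vj p q \<alpha>"
abbreviation "MM \<equiv> Mmat v vj p q \<alpha>"

definition Iv :: "2 \<Rightarrow> complex \<Rightarrow> 'n gfun \<Rightarrow> complex^'n" where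
  "Iv b z g = (\<chi> j. Ib b z g j)"

lemma MM_vec: "(MM z *v x) $ j = mf j z * x $ j"
proof -
  have "(MM z *v x) $ j = (\<Sum>k\<in>UNIV. if k = j then mf j z * x $ k else 0)"
  proof -
    have "(MM z *v x) $ j = (\<Sum>k\<in>UNIV. (if j = k then mf j z else 0) * x $ k)"
      by (simp add: matrix_vector_mult_def Mmat_def)
    also have "\<dots> = (\<Sum>k\<in>UNIV. if k = j then mf j z * x $ k else 0)" by (rule sum.cong) auto
    finally show ?thesis .
  qed
  then show ?thesis by simp
qed

lemma mf_cnj: "mf j (cnj z) = cnj (mf j z)"
  by (simp add: mfun_def bf_cnj cf_cnj)

lemma innerG_self: "innerG v vj f f = of_real (\<Sum>j\<in>UNIV. Re (einner j (f j) (f j)))"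
  unfolding innerG_einner of_real_sum by (intro sum.cong refl) (simp add: einner_self)

lemma normG_sq: "(normG v vj f)\<^sup>2 = (\<Sum>j\<in>UNIV. Re (einner j (f j) (f j)))" and normG_nonneg: "0 \<le> normG v vj f"
  by (simp_all add: normG_def innerG_self sum_nonneg einner_self_nonneg)

lemma normG_zero: "normG v vj (\<lambda>_ _. 0) = 0"
  by (simp add: normG_def innerG_def set_lebesgue_integral_def)

lemma normG_le_0_cont:
  assumes "\<And>j. ac2 j (f j)" "normG v vj f \<le> 0"
  shows "f j v = 0"
proof -
  have "normG v vj f = 0" using assms(2) normG_nonneg[of f] by simp
  then have "(\<Sum>j\<in>UNIV. Re (einner j (f j) (f j))) = 0" using normG_sq[of f] by simp
  then have "Re (einner j (f j) (f j)) = 0" by (simp add: sum_nonneg_eq_0_iff einner_self_nonneg)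
  then have "einner j (f j) (f j) = 0" by (simp add: einner_self)
  with assms(1) show ?thesis by (rule einner_self_zero_cont)
qed

lemma L2G_0: "L2G v vj (\<lambda>_ _. 0)"
  by (simp add: L2G_def continuous_imp_sqint)

lemma Ib_0 [simp]: "Ib b z (\<lambda>_ _. 0) j = 0"
  by (simp add: Ib_def dotp_def set_lebesgue_integral_def)

lemma SolG_in_bvRel:
  assumes g: "L2G v vj g" and D: "SolG z \<xi> g \<in> Dm" and L: "\<xi> \<in> L" and f: "L2G v vj f" "eqG v vj f (SolG z \<xi> g)"
  shows "(f, \<lambda>j x. addp (g j x) (cs z (f j x))) \<in> bvRel L"
proof -
  have "eqG v vj (\<lambda>j x. addp (g j x) (cs z (f j x))) (\<lambda>j x. addp (g j x) (cs z (SolG z \<xi> g j x)))"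
    by (intro eqG_addp_cs eqG_refl f)
  then have "eqG v vj (\<lambda>j x. addp (g j x) (cs z (f j x))) (Hop p q (SolG z \<xi> g))"
    by (rule eqG_trans) (rule eqG_sym[OF eqG_Hop_SolG[OF g]])
  moreover have "(\<lambda>j. SolG z \<xi> g j v) \<in> L" using L by simp
  ultimately show ?thesis unfolding bvRel_def opRel_def using D f L2G_addp_cs[OF g f(1)] by blast
qed

lemma bvRel_SolG:
  assumes g: "L2G v vj g" and f: "(f, \<lambda>j x. addp (g j x) (cs z (f j x))) \<in> bvRel L"
  obtains \<zeta> where "\<zeta> \<in> L" "eqG v vj f (SolG z \<zeta> g)"
    "\<And>j. (fst (\<zeta> j) - Ib 2 z g j) * bf j z + (snd (\<zeta> j) + Ib 1 z g j) * cf j z = 0"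
proof -
  obtain f0 where f0: "f0 \<in> Dm" "(\<lambda>j. f0 j v) \<in> L" "eqG v vj f f0" "eqG v vj (\<lambda>j x. addp (g j x) (cs z (f j x))) (Hop p q f0)"
    using f unfolding bvRel_def opRel_def by blast
  have "eqG v vj (Hop p q f0) (\<lambda>j x. addp (g j x) (cs z (f0 j x)))"
    by (rule eqG_trans[OF eqG_sym[OF f0(4)]]) (intro eqG_addp_cs eqG_refl f0(3))
  note eq = Dmax_SolG[OF f0(1) g this]
  show thesis
  proof (rule that[of "\<lambda>j. f0 j v"])
    show "eqG v vj f (SolG z (\<lambda>j. f0 j v) g)"
      by (rule eqG_trans[OF f0(3)]) (rule eqG_I, rule eq)
    show "(fst (f0 j v) - Ib 2 z g j) * bf j z + (snd (f0 j v) + Ib 1 z g j) * cf j z = 0" for j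
    proof -
      have "bc j (f0 j (vj j)) = 0" using f0(1) by (simp add: Dmax_iff)
      moreover have "f0 j (vj j) = SolG z (\<lambda>j. f0 j v) g j (vj j)" using edges[of j] by (intro eq) simp
      ultimately show ?thesis using bc_SolG[of j z "\<lambda>j. f0 j v" g] by simp
    qed
  qed (rule f0)
qed

text \<open>The a priori bound of \<open>in_resolvent\<close> with right-hand side 0 forces the norm
  of the solution to be 0, and by continuity its boundary values vanish.\<close>

lemma in_resolvent_no_eigenvector:
  assumes r: "in_resolvent v vj (bvRel L) z" and \<xi>: "\<xi> \<in> L" "\<And>j. fst (\<xi> j) * bf j z + snd (\<xi> j) * cf j z = 0"
  shows "\<xi> j = 0"
proof -
  let ?f = "SolG z \<xi> (\<lambda>_ _. 0)"
  have "?f \<in> Dm" unfolding SolG_Dmax[OF L2G_0] using \<xi>(2) by simp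
  then have "(?f, \<lambda>j x. addp ((\<lambda>_ _. 0) j x) (cs z (?f j x))) \<in> bvRel L"
    using \<xi>(1) by (intro SolG_in_bvRel[OF L2G_0]) (auto intro: eqG_refl L2G_SolG L2G_0)
  moreover obtain C where C: "\<And>f g. (f, \<lambda>j x. addp (g j x) (cs z (f j x))) \<in> bvRel L \<Longrightarrow> normG v vj f \<le> C * normG v vj g"
    using r unfolding in_resolvent_def by blast
  ultimately have "normG v vj ?f \<le> C * normG v vj (\<lambda>(_::'n) (_::real). 0)"
    by (intro C[of ?f "\<lambda>_ _. 0"])
  then have "normG v vj ?f \<le> 0" by (simp add: normG_zero)
  from normG_le_0_cont[OF ac2_SolG[OF L2G_0] this, of j] show ?thesis by simp
qed

text \<open>\<open>xi1\<close> and \<open>xi2\<close> are the two boundary vectors at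
  \<open>v\<close> of the resolvent applied to \<open>g\<close>; they are the unknowns of the linear
  system that determines it.\<close>

definition xi1 :: "complex^'n^'n \<Rightarrow> complex^'n^'n \<Rightarrow> complex \<Rightarrow> 'n gfun \<Rightarrow> complex^'n" where
  "xi1 A B z g = matrix_inv (B ** MM z - A) *v (B *v (MM z *v Iv 2 z g - Iv 1 z g))"

definition xi2 :: "complex^'n^'n \<Rightarrow> complex^'n^'n \<Rightarrow> complex \<Rightarrow> 'n gfun \<Rightarrow> complex^'n" where
  "xi2 A B z g = - Iv 1 z g + MM z *v (Iv 2 z g - xi1 A B z g)"

text \<open>Dividing the outer conditions by \<open>cf\<close> expresses the second boundary vector
  through the first and the m-functions; inserting this into the condition at the central vertex
  leaves a system with matrix \<open>B ** MM z - A\<close>.\<close>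

lemma boundary_system:
  assumes c: "\<And>j. cf j z \<noteq> 0" and inv: "invertible (B ** MM z - A)"
  shows "\<zeta> \<in> LAB A B \<and> (\<forall>j. (fst (\<zeta> j) - Ib 2 z g j) * bf j z + (snd (\<zeta> j) + Ib 1 z g j) * cf j z = 0)
    \<longleftrightarrow> \<zeta> = vec_pair (xi1 A B z g) (xi2 A B z g)"
proof -
  let ?u = "Iv 1 z g" and ?w = "Iv 2 z g" and ?N = "B ** MM z - A"
  have "(fst (\<zeta> j) - Ib 2 z g j) * bf j z + (snd (\<zeta> j) + Ib 1 z g j) * cf j z = 0 \<longleftrightarrow>
      snd_vec \<zeta> $ j = (- ?u + MM z *v (?w - fst_vec \<zeta>)) $ j" for j
  proof -
    have "(fst (\<zeta> j) - Ib 2 z g j) * bf j z + (snd (\<zeta> j) + Ib 1 z g j) * cf j z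
      = cf j z * (snd_vec \<zeta> $ j - (- ?u + MM z *v (?w - fst_vec \<zeta>)) $ j)"
      using c[of j] by (simp add: fst_vec_def snd_vec_def Iv_def MM_vec mfun_def field_simps)
    then show ?thesis using c[of j] by simp
  qed
  then have 1: "(\<forall>j. (fst (\<zeta> j) - Ib 2 z g j) * bf j z + (snd (\<zeta> j) + Ib 1 z g j) * cf j z = 0) \<longleftrightarrow>
      snd_vec \<zeta> = - ?u + MM z *v (?w - fst_vec \<zeta>)" unfolding vec_eq_iff by blast
  have 2: "A *v fst_vec \<zeta> + B *v (- ?u + MM z *v (?w - fst_vec \<zeta>)) = B *v (MM z *v ?w - ?u) - ?N *v fst_vec \<zeta>"
    by (simp add: vec.add vec.neg vec.diff matrix_vector_mult_diff_rdistrib matrix_vector_mul_assoc)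
  have 3: "?N *v x = y \<longleftrightarrow> x = matrix_inv ?N *v y" for x y
    using matrix_inv_left[OF inv] matrix_inv_right[OF inv] by (metis matrix_vector_mul_assoc matrix_vector_mul_lid)
  have "\<zeta> \<in> LAB A B \<and> snd_vec \<zeta> = - ?u + MM z *v (?w - fst_vec \<zeta>) \<longleftrightarrow> fst_vec \<zeta> = xi1 A B z g \<and> snd_vec \<zeta> = xi2 A B z g"
  proof
    assume h: "\<zeta> \<in> LAB A B \<and> snd_vec \<zeta> = - ?u + MM z *v (?w - fst_vec \<zeta>)"
    then have h1: "A *v fst_vec \<zeta> + B *v snd_vec \<zeta> = 0" and h2: "snd_vec \<zeta> = - ?u + MM z *v (?w - fst_vec \<zeta>)"
      unfolding LAB_def by blast+
    have "B *v (MM z *v ?w - ?u) - ?N *v fst_vec \<zeta> = 0" using h1 unfolding h2 2 .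
    then have "fst_vec \<zeta> = xi1 A B z g" unfolding xi1_def 3[symmetric] by simp
    with h show "fst_vec \<zeta> = xi1 A B z g \<and> snd_vec \<zeta> = xi2 A B z g" by (simp add: xi2_def)
  next
    assume h: "fst_vec \<zeta> = xi1 A B z g \<and> snd_vec \<zeta> = xi2 A B z g"
    then have h2: "snd_vec \<zeta> = - ?u + MM z *v (?w - fst_vec \<zeta>)" by (simp add: xi2_def)
    have "?N *v fst_vec \<zeta> = B *v (MM z *v ?w - ?u)" using h 3 by (simp add: xi1_def)
    then have "A *v fst_vec \<zeta> + B *v snd_vec \<zeta> = 0" unfolding h2 2 by simp
    then show "\<zeta> \<in> LAB A B \<and> snd_vec \<zeta> = - ?u + MM z *v (?w - fst_vec \<zeta>)" using h2 by (simp add: LAB_def)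
  qed
  also have "\<dots> \<longleftrightarrow> \<zeta> = vec_pair (xi1 A B z g) (xi2 A B z g)"
    by (metis v_vec_pair)
  finally show ?thesis unfolding 1 .
qed

text \<open>\<open>resolv\<close> is a choice, but the boundary system admits one solution only, so
  the chosen function is determined up to equality a.e.\<close>

lemma resolv_SolG:
  assumes c: "\<And>j. cf j z \<noteq> 0" and inv: "invertible (B ** MM z - A)" and g: "L2G v vj g"
  shows "eqG v vj (resolv (TAB v vj p q \<alpha> A B) z g) (SolG z (vec_pair (xi1 A B z g) (xi2 A B z g)) g)"
proof -
  let ?\<xi> = "vec_pair (xi1 A B z g) (xi2 A B z g)"
  have \<xi>: "?\<xi> \<in> LAB A B" "\<And>j. (fst (?\<xi> j) - Ib 2 z g j) * bf j z + (snd (?\<xi> j) + Ib 1 z g j) * cf j z = 0"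
    using boundary_system[OF c inv, of ?\<xi> g] by auto
  have mem: "(SolG z ?\<xi> g, \<lambda>j x. addp (g j x) (cs z (SolG z ?\<xi> g j x))) \<in> TAB v vj p q \<alpha> A B"
    unfolding TAB_bvRel
    by (rule SolG_in_bvRel[OF g _ \<xi>(1) L2G_SolG[OF g] eqG_refl]) (use \<xi>(2) in \<open>simp add: SolG_Dmax[OF g]\<close>)
  have "(resolv (TAB v vj p q \<alpha> A B) z g, \<lambda>j x. addp (g j x) (cs z (resolv (TAB v vj p q \<alpha> A B) z g j x))) \<in> bvRel (LAB A B)"
    using someI[of "\<lambda>f. (f, \<lambda>j x. addp (g j x) (cs z (f j x))) \<in> TAB v vj p q \<alpha> A B", OF mem]
    unfolding resolv_def TAB_bvRel .
  then obtain \<zeta> where \<zeta>: "\<zeta> \<in> LAB A B" "eqG v vj (resolv (TAB v vj p q \<alpha> A B) z g) (SolG z \<zeta> g)"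
    "\<And>j. (fst (\<zeta> j) - Ib 2 z g j) * bf j z + (snd (\<zeta> j) + Ib 1 z g j) * cf j z = 0"
    using bvRel_SolG[OF g] by blast
  then have "\<zeta> = ?\<xi>" using boundary_system[OF c inv, of \<zeta> g] by blast
  with \<zeta>(2) show ?thesis by simp
qed

lemma invertible_injective:
  fixes N :: "complex^'n^'n"
  assumes "\<And>x. N *v x = 0 \<Longrightarrow> x = 0"
  shows "invertible N"
proof -
  have "inj ((*v) N)"
  proof (rule injI)
    fix x y assume "N *v x = N *v y"
    then have "N *v (x - y) = 0" by (simp add: vec.diff)
    from assms[OF this] show "x = y" by simp
  qed
  then obtain Q where "Q ** N = mat 1" using matrix_left_invertible_injective[of N] by blast
  then show ?thesis unfolding invertible_def by (metis matrix_left_right_inverse)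
qed

text \<open>At a zero of \<open>cf j\<close> the second column of the fundamental matrix on edge
  \<open>j\<close>, continued by 0, would be an eigenvector of the decoupled operator.\<close>

lemma in_resolvent_cf:
  assumes "in_resolvent v vj (TAB v vj p q \<alpha> (mat 1) 0) z"
  shows "cf j z \<noteq> 0"
proof
  assume c: "cf j z = 0"
  define \<xi> :: "'n \<Rightarrow> complex \<times> complex" where "\<xi> i = (if i = j then (0, 1) else 0)" for i
  have "fst_vec \<xi> = 0" by (auto simp: fst_vec_def \<xi>_def vec_eq_iff)
  then have "\<xi> \<in> LAB (mat 1) 0" by (simp add: LAB_def)
  moreover have "fst (\<xi> i) * bf i z + snd (\<xi> i) * cf i z = 0" for i using c by (simp add: \<xi>_def)
  ultimately have "\<xi> j = 0" by (rule in_resolvent_no_eigenvector[OF assms[unfolded TAB_bvRel]])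
  then show False by (simp add: \<xi>_def zero_prod_def)
qed

text \<open>A kernel vector \<open>x\<close> would give an eigenvector with boundary vectors
  \<open>x\<close> and \<open>- MM z *v x\<close>.\<close>

lemma in_resolvent_invertible:
  assumes c: "\<And>j. cf j z \<noteq> 0" and r: "in_resolvent v vj (TAB v vj p q \<alpha> A B) z"
  shows "invertible (B ** MM z - A)"
proof (rule invertible_injective)
  fix x assume "(B ** MM z - A) *v x = 0"
  then have "A *v x + B *v (- (MM z *v x)) = 0"
    by (simp add: matrix_vector_mult_diff_rdistrib vec.neg matrix_vector_mul_assoc)
  then have "vec_pair x (- (MM z *v x)) \<in> LAB A B" by (simp add: LAB_def)
  from in_resolvent_no_eigenvector[OF r[unfolded TAB_bvRel] this] have "vec_pair x (- (MM z *v x)) j = 0" for j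
    using c by (simp add: vec_pair_def MM_vec mfun_def)
  then show "x = 0" by (simp add: vec_pair_def vec_eq_iff zero_prod_def)
qed

section \<open>Krein's formula\<close>

lemma Ib_cnj:
  shows "(LINT x:{v..vj j}|lborel. dotp (col j (cnj z) b x) (cnj (fst (g j x)), cnj (snd (g j x)))) = cnj (Ib b z g j)"
proof -
  have "cnj (Ib b z g j) = (LINT x|lborel. cnj (indicator {v..vj j} x *\<^sub>R dotp (col j z b x) (g j x)))"
    unfolding Ib_def set_lebesgue_integral_def by (rule Bochner_Integration.integral_cnj[symmetric])
  also have "\<dots> = (LINT x:{v..vj j}|lborel. dotp (col j (cnj z) b x) (cnj (fst (g j x)), cnj (snd (g j x))))"
    unfolding set_lebesgue_integral_def by (simp add: dotp_def col_cnj)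
  finally show ?thesis ..
qed

text \<open>Conjugating the kernel at \<open>cnj z\<close> returns to \<open>z\<close>, so the
  adjoint consists of the bilinear integrals at \<open>z\<close>; nondegeneracy of
  \<open>cdot\<close> justifies the definite description.\<close>

lemma Gamma_adj_eq:
  assumes g: "L2G v vj g"
  shows "Gamma_adj v vj p q \<alpha> (cnj z) g = MM z *v Iv 2 z g - Iv 1 z g"
proof -
  let ?c = "MM z *v Iv 2 z g - Iv 1 z g"
  have gc: "lint j (\<lambda>x. (cnj (fst (g j x)), cnj (snd (g j x))))" for j
    using g by (auto simp: lint_def L2G_def intro!: sqint_integrable sqint_cnj)
  have main: "innerG v vj (GammaZ v vj p q \<alpha> (cnj z) d) g = (\<Sum>j\<in>UNIV. d $ j * cnj (?c $ j))" for d
    unfolding innerG_einner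
  proof (rule sum.cong[OF refl])
    fix j
    let ?k = "\<lambda>x. (cnj (fst (g j x)), cnj (snd (g j x)))"
    have "einner j (GammaZ v vj p q \<alpha> (cnj z) d j) (g j) =
      (LINT x:{v..vj j}|lborel. (d $ j * mf j (cnj z)) * dotp (col j (cnj z) 2 x) (?k x) - d $ j * dotp (col j (cnj z) 1 x) (?k x))"
      unfolding einner_def by (simp add: GammaZ_def dotp_def col_def algebra_simps)
    also have "\<dots> = (LINT x:{v..vj j}|lborel. (d $ j * mf j (cnj z)) * dotp (col j (cnj z) 2 x) (?k x)) - (LINT x:{v..vj j}|lborel. d $ j * dotp (col j (cnj z) 1 x) (?k x))"
      by (intro set_integral_diff(2) set_integrable_mult_right integrable_dotp ac2_col gc)
    also have "\<dots> = (d $ j * mf j (cnj z)) * cnj (Ib 2 z g j) - d $ j * cnj (Ib 1 z g j)"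
      by (simp add: Ib_cnj)
    also have "\<dots> = d $ j * cnj (?c $ j)"
      by (simp add: MM_vec Iv_def mf_cnj algebra_simps)
    finally show "einner j (GammaZ v vj p q \<alpha> (cnj z) d j) (g j) = d $ j * cnj (?c $ j)" .
  qed
  show ?thesis
    unfolding Gamma_adj_def
  proof (rule the_equality)
    show "\<forall>d. innerG v vj (GammaZ v vj p q \<alpha> (cnj z) d) g = (\<Sum>j\<in>UNIV. d $ j * cnj (?c $ j))" using main by blast
    fix c assume "\<forall>d. innerG v vj (GammaZ v vj p q \<alpha> (cnj z) d) g = (\<Sum>j\<in>UNIV. d $ j * cnj (c $ j))"
    then have "cdot d c = cdot d ?c" for d unfolding cdot_def using main by simp
    then have "cdot d (c - ?c) = 0" for d by (simp add: cdot_simps)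
    from cdot_right_zero[OF this] show "c = ?c" by simp
  qed
qed

text \<open>Both resolvents solve the same inhomogeneous equation, so they differ by a homogeneous
  solution. Since \<open>xi1\<close> vanishes for the decoupled operator, the difference has initial
  values \<open>xi1\<close> and \<open>- M xi1\<close>, which is the negative of
  \<open>GammaZ\<close> at \<open>xi1\<close>.\<close>

theorem krein_formula:
  assumes r0: "in_resolvent v vj (TAB v vj p q \<alpha> (mat 1) 0) z" and r: "in_resolvent v vj (TAB v vj p q \<alpha> A B) z"
    and g: "L2G v vj g"
  shows "eqG v vj (resolv (TAB v vj p q \<alpha> A B) z g)
     (\<lambda>j x. subp (resolv (TAB v vj p q \<alpha> (mat 1) 0) z g j x)
        (GammaZ v vj p q \<alpha> z ((matrix_inv (B ** MM z - A) ** B) *v Gamma_adj v vj p q \<alpha> (cnj z) g) j x))"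
proof -
  have c: "cf j z \<noteq> 0" for j by (rule in_resolvent_cf[OF r0])
  have inv: "invertible (B ** MM z - A)" by (rule in_resolvent_invertible[OF c r])
  \<comment> \<open>For the decoupled operator the matrix of the boundary system is minus the
    identity.\<close>
  have inv0: "invertible (0 ** MM z - mat 1 :: complex^'n^'n)"
    by (rule invertible_injective) (simp add: matrix_vector_minus)
  let ?R0 = "SolG z (vec_pair (xi1 (mat 1) 0 z g) (xi2 (mat 1) 0 z g)) g"
  have \<xi>: "(matrix_inv (B ** MM z - A) ** B) *v Gamma_adj v vj p q \<alpha> (cnj z) g = xi1 A B z g"
    by (simp add: Gamma_adj_eq[OF g] xi1_def matrix_vector_mul_assoc)
  have pt: "SolG z (vec_pair (xi1 A B z g) (xi2 A B z g)) g j x = subp (?R0 j x) (GammaZ v vj p q \<alpha> z (xi1 A B z g) j x)" for j x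
    by (simp add: SolG_def SolE_def lincomb_def subp_def GammaZ_def vec_pair_def col_def xi2_def MM_vec algebra_simps)
       (simp add: xi1_def)
  have "eqG v vj ?R0 (resolv (TAB v vj p q \<alpha> (mat 1) 0) z g)"
    by (rule eqG_sym[OF resolv_SolG[OF c inv0 g]])
  then have "eqG v vj (\<lambda>j x. subp (?R0 j x) (GammaZ v vj p q \<alpha> z (xi1 A B z g) j x))
      (\<lambda>j x. subp (resolv (TAB v vj p q \<alpha> (mat 1) 0) z g j x) (GammaZ v vj p q \<alpha> z (xi1 A B z g) j x))"
    unfolding eqG_def by (auto elim!: eventually_mono)
  with resolv_SolG[OF c inv g] show ?thesis
    unfolding \<xi> pt[symmetric, abs_def] by (rule eqG_trans)
qed

section \<open>Positivity off the real axis\<close>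

text \<open>Green's formula for a solution of \<open>H f = z f\<close> paired with itself; the outer
  end contributes nothing. Initial values \<open>(0, 1)\<close> exclude nonreal zeros of
  \<open>cf\<close>, and \<open>(-1, m)\<close> compute the imaginary part of the
  m-function.\<close>

lemma edge_energy:
  fixes \<xi> :: "'n \<Rightarrow> complex \<times> complex" and z :: complex
  defines "f \<equiv> SolG z \<xi> (\<lambda>_ _. 0)"
  assumes b: "fst (\<xi> j) * bf j z + snd (\<xi> j) * cf j z = 0"
  shows "(z - cnj z) * einner j (f j) (f j) = fst (\<xi> j) * cnj (snd (\<xi> j)) - snd (\<xi> j) * cnj (fst (\<xi> j))"
proof -
  have ac: "ac2 i (f i)" for i unfolding f_def by (rule ac2_SolG[OF L2G_0])
  have H: "L2G v vj (Hop p q f)" unfolding f_def by (rule L2G_Hop_SolG[OF L2G_0])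
  have AE: "AE x in lborel. x \<in> {v..vj j} \<longrightarrow> Hop p q f j x = cs z (f j x)"
  proof -
    have "AE x in lborel. x \<in> {v..vj j} \<longrightarrow> Hop p q f j x = addp 0 (cs z (f j x))"
      using eqG_Hop_SolG[OF L2G_0, of z \<xi>] unfolding eqG_def f_def by blast
    then show ?thesis by (simp add: addp_def)
  qed
  have sq: "sqint2 j (Hop p q f j)" "sqint2 j (f j)" "sqint2 j (\<lambda>x. cs z (f j x))"
    using H ac2_sqint2[OF ac] sqint_lincomb[of v "vj j" _ _ z 0] by (auto simp: L2G_sqint2 sqint2_def cs_def)
  have 1: "einner j (Hop p q f j) (f j) = einner j (\<lambda>x. cs z (f j x)) (f j)"
    unfolding einner_def
  proof (rule set_integral_cong_AE_lborel)
    show "AE x in lborel. x \<in> {v..vj j} \<longrightarrow> fst (Hop p q f j x) * cnj (fst (f j x)) + snd (Hop p q f j x) * cnj (snd (f j x))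
      = fst (cs z (f j x)) * cnj (fst (f j x)) + snd (cs z (f j x)) * cnj (snd (f j x))"
      using AE by eventually_elim auto
  qed (intro set_integrable_measurable einner_integrable sq)+
  have 2: "einner j (f j) (Hop p q f j) = einner j (f j) (\<lambda>x. cs z (f j x))"
    unfolding einner_def
  proof (rule set_integral_cong_AE_lborel)
    show "AE x in lborel. x \<in> {v..vj j} \<longrightarrow> fst (f j x) * cnj (fst (Hop p q f j x)) + snd (f j x) * cnj (snd (Hop p q f j x))
      = fst (f j x) * cnj (fst (cs z (f j x))) + snd (f j x) * cnj (snd (cs z (f j x)))"
      using AE by eventually_elim auto
  qed (intro set_integrable_measurable einner_integrable sq)+
  have 3: "einner j (\<lambda>x. cs z (f j x)) (f j) = z * einner j (f j) (f j)" "einner j (f j) (\<lambda>x. cs z (f j x)) = cnj z * einner j (f j) (f j)"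
    unfolding einner_def set_integral_mult_right[symmetric] by (simp_all add: cs_def algebra_simps)
  have bcf: "bc j (f j (vj j)) = 0" unfolding f_def bc_SolG using b by simp
  have "einner j (Hop p q f j) (f j) - einner j (f j) (Hop p q f j) = - (snd (\<xi> j) * cnj (fst (\<xi> j)) - fst (\<xi> j) * cnj (snd (\<xi> j)))"
    using edge_green[of j f f, OF ac ac H H] bc_zero_wronski[OF bcf bcf] unfolding einner_def f_def by simp
  then show ?thesis unfolding 1 2 3 by (simp add: algebra_simps)
qed

lemma cf_nonzero:
  assumes "Im z \<noteq> 0" shows "cf j z \<noteq> 0"
proof
  assume c: "cf j z = 0"
  let ?\<xi> = "\<lambda>_::'n. (0, 1) :: complex \<times> complex"
  have "(z - cnj z) * einner j (SolG z ?\<xi> (\<lambda>_ _. 0) j) (SolG z ?\<xi> (\<lambda>_ _. 0) j) = 0"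
    using edge_energy[of ?\<xi> j z] c by simp
  moreover have "z - cnj z \<noteq> 0" using assms by (simp add: complex_eq_iff)
  ultimately have "einner j (SolG z ?\<xi> (\<lambda>_ _. 0) j) (SolG z ?\<xi> (\<lambda>_ _. 0) j) = 0" by simp
  from einner_self_zero_cont[OF ac2_SolG[OF L2G_0] this] show False by (simp add: zero_prod_def)
qed

text \<open>The factor is the squared norm of the Weyl solution on the edge.\<close>

lemma Im_mf:
  assumes "Im z \<noteq> 0"
  obtains r where "0 < r" "Im (mf j z) = Im z * r"
proof -
  let ?\<xi> = "\<lambda>_::'n. (-1, mf j z)"
  let ?f = "SolG z ?\<xi> (\<lambda>_ _. 0) j"
  define r where "r = Re (einner j ?f ?f)"
  have e: "einner j ?f ?f = of_real r" by (simp add: r_def einner_self)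
  have "(z - cnj z) * einner j ?f ?f = mf j z - cnj (mf j z)"
    using edge_energy[of ?\<xi> j z] cf_nonzero[OF assms, of j] by (simp add: mfun_def)
  then have "Im ((z - cnj z) * of_real r) = Im (mf j z - cnj (mf j z))" unfolding e by simp
  then have "Im (mf j z) = Im z * r" by simp
  moreover have "r \<noteq> 0"
  proof
    assume "r = 0"
    then have "einner j ?f ?f = 0" using e by simp
    from einner_self_zero_cont[OF ac2_SolG[OF L2G_0] this] show False by (simp add: zero_prod_def)
  qed
  moreover have "0 \<le> r" unfolding r_def by (rule einner_self_nonneg)
  ultimately show thesis using that[of r] by simp
qed

text \<open>A kernel vector \<open>x\<close> puts \<open>(x, - M x)\<close> into a subspace on which
  \<open>omega\<close> vanishes, so the sum of \<open>Im m_j |x_j|^2\<close> is 0 while all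
  \<open>Im m_j\<close> have the strict sign of \<open>Im z\<close>.\<close>

lemma nonreal_invertible:
  fixes A B :: "complex^'n^'n"
  assumes rk: "rank (hcat A B) = CARD('n)" and ab: "A ** adjm B = B ** adjm A" and z: "Im z \<noteq> 0"
  shows "invertible (B ** MM z - A)"
proof (rule invertible_injective)
  fix x assume "(B ** MM z - A) *v x = 0"
  then have "A *v x + B *v (- (MM z *v x)) = 0"
    by (simp add: matrix_vector_mult_diff_rdistrib vec.neg matrix_vector_mul_assoc)
  then have "vec_pair x (- (MM z *v x)) \<in> LAB A B" by (simp add: LAB_def)
  then have "omega (vec_pair x (- (MM z *v x))) (vec_pair x (- (MM z *v x))) = 0"
    using symp_compl_LAB[OF rk ab] unfolding symp_compl_def by blast
  moreover have "omega (vec_pair x (- (MM z *v x))) (vec_pair x (- (MM z *v x))) = (\<Sum>j\<in>UNIV. (mf j z - cnj (mf j z)) * of_real ((cmod (x $ j))\<^sup>2))"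
    unfolding omega_def complex_norm_square by (intro sum.cong refl) (simp add: vec_pair_def MM_vec algebra_simps)
  ultimately have "Im (\<Sum>j\<in>UNIV. (mf j z - cnj (mf j z)) * of_real ((cmod (x $ j))\<^sup>2)) = 0" by simp
  then have s: "(\<Sum>j\<in>UNIV. 2 * Im (mf j z) * (cmod (x $ j))\<^sup>2) = 0" by (simp add: Im_sum)
  have "\<forall>j. \<exists>r. 0 < r \<and> Im (mf j z) = Im z * r" using Im_mf[OF z] by blast
  then obtain r where r: "\<And>j. 0 < r j" "\<And>j. Im (mf j z) = Im z * r j" by metis
  have "Im z * (\<Sum>j\<in>UNIV. r j * (cmod (x $ j))\<^sup>2) = 0"
    using s unfolding r(2) sum_distrib_left by (simp add: mult.assoc flip: sum_distrib_left)
  then have "(\<Sum>j\<in>UNIV. r j * (cmod (x $ j))\<^sup>2) = 0" using z by simp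
  then have "r j * (cmod (x $ j))\<^sup>2 = 0" for j
    using r(1) by (subst (asm) sum_nonneg_eq_0_iff) (auto simp: less_imp_le)
  then show "x = 0" using r(1) by (simp add: vec_eq_iff) (metis less_irrefl)
qed

end

section \<open>Dependence on the spectral parameter\<close>

lemma deriv_bound:
  assumes f: "f holomorphic_on UNIV" and "0 < r" and K: "\<And>w. w \<in> cball z0 r \<Longrightarrow> cmod (f w) \<le> K"
  shows "cmod (deriv f z0) \<le> K / r"
proof -
  have "norm ((deriv ^^ 1) f z0) \<le> fact 1 * K / r ^ 1"
    using f K \<open>0 < r\<close>
    by (intro Cauchy_inequality) (auto intro: holomorphic_on_subset holomorphic_on_imp_continuous_on simp: dist_norm)
  then show ?thesis by simp
qed

lemma taylor_bound:
  assumes f: "f holomorphic_on UNIV" and r: "0 < r" and K: "\<And>w. w \<in> cball z0 r \<Longrightarrow> cmod (f w) \<le> K"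
    and z: "cmod (z - z0) \<le> r/2"
  shows "cmod (f z - f z0 - (z - z0) * deriv f z0) \<le> 8 * K / r\<^sup>2 * (cmod (z - z0))\<^sup>2"
proof -
  have fc: "continuous_on S f" for S using f holomorphic_on_imp_continuous_on continuous_on_subset by blast
  have "cmod ((deriv ^^ 0) f z - (\<Sum>i\<le>1. (deriv ^^ i) f z0 * (z - z0) ^ i / fact i)) \<le> 8 * K / r\<^sup>2 * cmod (z - z0) ^ Suc 1 / fact 1"
  proof (rule complex_Taylor[where S = "cball z0 (r/2)" and f = "\<lambda>i. (deriv ^^ i) f"])
    show "((deriv ^^ i) f has_field_derivative (deriv ^^ Suc i) f x) (at x within cball z0 (r/2))" for i x
    proof -
      have "(deriv ^^ i) f holomorphic_on UNIV" using f by (intro holomorphic_higher_deriv) auto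
      then have "((deriv ^^ i) f has_field_derivative deriv ((deriv ^^ i) f) x) (at x)"
        by (intro holomorphic_derivI[of _ UNIV]) auto
      then show ?thesis by (simp add: has_field_derivative_at_within)
    qed
    show "cmod ((deriv ^^ Suc 1) f x) \<le> 8 * K / r\<^sup>2" if x: "x \<in> cball z0 (r/2)" for x
    proof -
      \<comment> \<open>Cauchy's inequality on the disc of radius \<open>r/2\<close> about
        \<open>x\<close>, which stays inside the big disc:
        \<open>2! K / (r/2)^2 = 8 K / r^2\<close>.\<close>
      have "norm ((deriv ^^ 2) f x) \<le> fact 2 * K / (r/2) ^ 2"
      proof (rule Cauchy_inequality)
        show "norm (f y) \<le> K" if "norm (x - y) = r/2" for y
        proof (rule K)
          have "dist z0 y \<le> dist z0 x + dist x y" by (rule dist_triangle)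
          then show "y \<in> cball z0 r" using x that by (simp add: dist_norm)
        qed
      qed (use f r fc in \<open>auto intro: holomorphic_on_subset\<close>)
      then show ?thesis by (simp add: numeral_2_eq_2 field_simps power2_eq_square)
    qed
  qed (use z r in \<open>auto simp: dist_norm norm_minus_commute\<close>)
  then show ?thesis by (simp add: power2_eq_square algebra_simps)
qed

lemma has_field_derivative_quadratic:
  fixes F :: "complex \<Rightarrow> complex"
  assumes "0 < d" and R: "\<And>z. cmod (z - z0) \<le> d \<Longrightarrow> cmod (F z - F z0 - (z - z0) * D) \<le> C * (cmod (z - z0))\<^sup>2"
  shows "(F has_field_derivative D) (at z0)"
  unfolding has_field_derivative_def has_derivative_at_alt
proof (intro conjI allI impI)
  show "bounded_linear ((*) D)" by (rule bounded_linear_mult_right)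
  fix e :: real assume "0 < e"
  define d' where "d' = min d (e / (\<bar>C\<bar> + 1))"
  have d': "d' > 0" using \<open>0 < d\<close> \<open>0 < e\<close> by (simp add: d'_def)
  have "norm (F y - F z0 - D * (y - z0)) \<le> e * norm (y - z0)" if y: "norm (y - z0) < d'" for y
  proof -
    have "norm (F y - F z0 - D * (y - z0)) \<le> C * (cmod (y - z0))\<^sup>2"
      using R[of y] y by (simp add: d'_def mult.commute)
    also have "\<dots> \<le> (\<bar>C\<bar> + 1) * (cmod (y - z0))\<^sup>2" by (intro mult_right_mono) auto
    also have "\<dots> = ((\<bar>C\<bar> + 1) * cmod (y - z0)) * cmod (y - z0)" by (simp add: power2_eq_square)
    also have "\<dots> \<le> e * cmod (y - z0)"
      using y by (intro mult_right_mono) (auto simp: d'_def field_simps)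
    finally show ?thesis .
  qed
  with d' show "\<exists>d>0. \<forall>y. norm (y - z0) < d \<longrightarrow> norm (F y - F z0 - D * (y - z0)) \<le> e * norm (y - z0)" by blast
qed

lemma LINT_bound:
  fixes \<phi> :: "real \<Rightarrow> complex"
  assumes "set_integrable lborel {a..x} \<phi>" "a \<le> x" "x \<le> b" "\<And>t. t \<in> {a..x} \<Longrightarrow> cmod (\<phi> t) \<le> M" "0 \<le> M"
  shows "cmod (LINT t:{a..x}|lborel. \<phi> t) \<le> (b - a) * M"
proof -
  have "cmod (LINT t:{a..x}|lborel. \<phi> t) \<le> (LINT t:{a..x}|lborel. cmod (\<phi> t))"
    by (rule set_integral_norm_bound[OF assms(1)])
  also have "\<dots> \<le> (LINT t:{a..x}|lborel. M)"
    by (rule set_integral_mono[OF set_integrable_norm[OF assms(1)] borel_integrable_atLeastAtMost']) (use assms in auto)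
  also have "\<dots> = (x - a) * M" using assms(2) by (simp add: set_lebesgue_integral_def)
  also have "\<dots> \<le> (b - a) * M" using assms by (intro mult_right_mono) auto
  finally show ?thesis .
qed

text \<open>The variance of \<open>cmod g\<close> about its mean \<open>m\<close> is
  nonnegative.\<close>

lemma LINT_cauchy_schwarz:
  fixes g :: "real \<Rightarrow> complex"
  assumes "a < b" "sqint a b g"
  shows "(LINT t:{a..b}|lborel. cmod (g t))\<^sup>2 \<le> (b - a) * (LINT t:{a..b}|lborel. (cmod (g t))\<^sup>2)"
proof -
  define I where "I = (LINT t:{a..b}|lborel. cmod (g t))"
  define J where "J = (LINT t:{a..b}|lborel. (cmod (g t))\<^sup>2)"
  define m where "m = I / (b - a)"
  have i1: "set_integrable lborel {a..b} (\<lambda>t. cmod (g t))" by (intro set_integrable_norm sqint_integrable assms)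
  have i2: "set_integrable lborel {a..b} (\<lambda>t. (cmod (g t))\<^sup>2)" by (rule sqint_integrable2[OF assms(2)])
  have i3: "set_integrable lborel {a..b} (\<lambda>t. m\<^sup>2)" by (intro borel_integrable_atLeastAtMost' continuous_intros)
  have "0 \<le> (LINT t:{a..b}|lborel. (cmod (g t) - m)\<^sup>2)"
    unfolding set_lebesgue_integral_def by (intro integral_nonneg_AE AE_I2) auto
  also have "\<dots> = (LINT t:{a..b}|lborel. ((cmod (g t))\<^sup>2 - 2 * m * cmod (g t)) + m\<^sup>2)"
    by (simp add: power2_diff algebra_simps)
  also have "\<dots> = (LINT t:{a..b}|lborel. (cmod (g t))\<^sup>2 - 2 * m * cmod (g t)) + (LINT t:{a..b}|lborel. m\<^sup>2)"
    by (intro set_integral_add set_integral_diff set_integrable_mult_right i1 i2 i3)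
  also have "(LINT t:{a..b}|lborel. (cmod (g t))\<^sup>2 - 2 * m * cmod (g t)) = J - 2 * m * I"
    using set_integral_diff(2)[OF i2 set_integrable_mult_right[of "2 * m", OF i1]] by (simp add: I_def J_def)
  also have "(LINT t:{a..b}|lborel. m\<^sup>2) = (b - a) * m\<^sup>2" using assms(1) by (simp add: set_lebesgue_integral_def)
  finally have "0 \<le> J - 2 * m * I + (b - a) * m\<^sup>2" .
  then have "0 \<le> (b - a) * (J - 2 * m * I + (b - a) * m\<^sup>2)" using assms(1) by simp
  also have "\<dots> = (b - a) * J - 2 * ((b - a) * m) * I + ((b - a) * m)\<^sup>2" by (simp add: algebra_simps power2_eq_square)
  also have "(b - a) * m = I" using assms(1) by (simp add: m_def)
  also have "(b - a) * J - 2 * I * I + I\<^sup>2 = (b - a) * J - I\<^sup>2" by (simp add: power2_eq_square)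
  finally show ?thesis unfolding I_def J_def by simp
qed

definition l1norm :: "complex \<times> complex \<Rightarrow> real" where "l1norm u = cmod (fst u) + cmod (snd u)"

lemma l1norm_nonneg: "0 \<le> l1norm u" and l1norm_fst: "cmod (fst u) \<le> l1norm u" and l1norm_snd: "cmod (snd u) \<le> l1norm u"
  by (simp_all add: l1norm_def)

lemma dotp_bound: "cmod (dotp u w) \<le> l1norm u * l1norm w"
proof -
  have "cmod (dotp u w) \<le> cmod (fst u) * cmod (fst w) + cmod (snd u) * cmod (snd w)"
    unfolding dotp_def by (metis norm_mult norm_triangle_ineq)
  also have "\<dots> \<le> l1norm u * l1norm w"
    unfolding l1norm_def by (simp add: algebra_simps)
  finally show ?thesis .
qed

lemma l1norm_lincomb: "l1norm (lincomb a u b w) \<le> cmod a * l1norm u + cmod b * l1norm w"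
  unfolding l1norm_def lincomb_def fst_conv snd_conv
  using norm_triangle_ineq[of "a * fst u" "b * fst w"] norm_triangle_ineq[of "a * snd u" "b * snd w"]
  by (simp add: norm_mult algebra_simps)

lemma l1norm_addp: "l1norm (addp u w) \<le> l1norm u + l1norm w"
  unfolding l1norm_def addp_def fst_conv snd_conv
  using norm_triangle_ineq[of "fst u" "fst w"] norm_triangle_ineq[of "snd u" "snd w"] by linarith

lemma l1norm_cs: "l1norm (cs c u) = cmod c * l1norm u"
  by (simp add: l1norm_def cs_def norm_mult algebra_simps)

context star
begin

lemma integrable_dotp_sub:
  assumes "ac2 j u" "lint j k" "x \<in> {v..vj j}"
  shows "set_integrable lborel {v..x} (\<lambda>t. dotp (u t) (k t))"
  using assms(3) by (intro set_integrable_subset[OF integrable_dotp[OF assms(1,2)]]) auto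

lemma ac2_lint: "ac2 j f \<Longrightarrow> lint j f"
  by (intro sqint2_lint ac2_sqint2)

text \<open>A solution at \<open>z\<close> solves the equation at \<open>z0\<close> with
  inhomogeneity \<open>(z - z0)\<close> times itself, and variation of constants at
  \<open>z0\<close> applies.\<close>

lemma col_difference:
  assumes x: "x \<in> {v..vj j}"
  shows "col j z b x = addp (col j z0 b x) (cs (z - z0)
    (lincomb (- (LINT t:{v..x}|lborel. dotp (col j z0 2 t) (col j z b t))) (col j z0 1 x)
       (LINT t:{v..x}|lborel. dotp (col j z0 1 t) (col j z b t)) (col j z0 2 x)))"
proof -
  let ?k = "\<lambda>t. cs (z - z0) (col j z b t)"
  have "sol j z0 ?k (col j z b)"
    unfolding sol_def
  proof
    show "AE x in lborel. x \<in> {v..vj j} \<longrightarrow>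
      ((\<lambda>t. fst (col j z b t)) has_vector_derivative
        (of_real (q j x) * fst (col j z b x) - (of_real (p j x) + z0) * snd (col j z b x) - snd (?k x))) (at x) \<and>
      ((\<lambda>t. snd (col j z b t)) has_vector_derivative
        ((z0 - of_real (p j x)) * fst (col j z b x) - of_real (q j x) * snd (col j z b x) + fst (?k x))) (at x)"
      using sol_col[of j z b, unfolded sol_def, THEN conjunct2]
      by eventually_elim (simp add: cs_def algebra_simps)
  qed (rule ac2_col)
  moreover have "ac2 j ?k" using ac2_col[of j z b] by (auto simp: ac2_def cs_def intro: abs_cont_cmult)
  then have "lint j ?k" by (rule ac2_lint)
  ultimately have 1: "col j z b x = SolE j z0 (col j z b v) ?k x" using x by (rule variation_of_constants)
  have 2: "(LINT t:{v..x}|lborel. dotp (col j z0 a t) (?k t)) = (z - z0) * (LINT t:{v..x}|lborel. dotp (col j z0 a t) (col j z b t))" for a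
  proof -
    have "(\<lambda>t. dotp (col j z0 a t) (?k t)) = (\<lambda>t. (z - z0) * dotp (col j z0 a t) (col j z b t))"
      by (simp add: dotp_def cs_def algebra_simps fun_eq_iff)
    then show ?thesis by simp
  qed
  have "SolE j z0 (col j z b v) ?k x = addp (col j z0 b x) (cs (z - z0)
    (lincomb (- (LINT t:{v..x}|lborel. dotp (col j z0 2 t) (col j z b t))) (col j z0 1 x)
       (LINT t:{v..x}|lborel. dotp (col j z0 1 t) (col j z b t)) (col j z0 2 x)))"
    unfolding SolE_def 2 using exhaust_2[of b]
    by (auto simp: lincomb_def addp_def cs_def algebra_simps)
  with 1 show ?thesis by simp
qed

lemma col_bound0: obtains K where "1 \<le> K" "\<And>b x. x \<in> {v..vj j} \<Longrightarrow> l1norm (col j z b x) \<le> K"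
proof -
  have "\<exists>C. \<forall>x\<in>{v..vj j}. l1norm (col j z b x) \<le> C" for b
  proof -
    have ac: "abs_cont v (vj j) (\<lambda>x. fst (col j z b x))" "abs_cont v (vj j) (\<lambda>x. snd (col j z b x))"
      using ac2_col by (auto simp: ac2_def)
    obtain C1 where C1: "\<And>x. x \<in> {v..vj j} \<Longrightarrow> cmod (fst (col j z b x)) \<le> C1" using abs_cont_bounded[OF ac(1)] by blast
    obtain C2 where C2: "\<And>x. x \<in> {v..vj j} \<Longrightarrow> cmod (snd (col j z b x)) \<le> C2" using abs_cont_bounded[OF ac(2)] by blast
    show ?thesis using add_mono[OF C1 C2] unfolding l1norm_def by blast
  qed
  then obtain C where C: "\<And>b x. x \<in> {v..vj j} \<Longrightarrow> l1norm (col j z b x) \<le> C b" by metis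
  show thesis
  proof (rule that[of "max 1 (max (C 1) (C 2))"])
    fix b x assume "x \<in> {v..vj j}"
    with C[of x b] show "l1norm (col j z b x) \<le> max 1 (max (C 1) (C 2))" using exhaust_2[of b] by auto
  qed simp
qed

text \<open>At a maximum point, with maximum \<open>S\<close>, \<open>col_difference\<close> gives
  \<open>S \<le> K0 + S/2\<close> as long as \<open>z\<close> is close to \<open>z0\<close>.
  Inserting the resulting bound into the same identity yields the Lipschitz estimate.\<close>

lemma col_local_bound:
  "\<exists>r>0. \<exists>K\<ge>1. \<forall>z\<in>cball z0 r. \<forall>x\<in>{v..vj j}. \<forall>b. l1norm (col j z b x) \<le> K
    \<and> l1norm (subp (col j z b x) (col j z0 b x)) \<le> K * cmod (z - z0)"
proof -
  obtain K0 where K0: "1 \<le> K0" "\<And>b x. x \<in> {v..vj j} \<Longrightarrow> l1norm (col j z0 b x) \<le> K0" using col_bound0 by blast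
  define l where "l = vj j - v"
  have l: "0 < l" using edges by (simp add: l_def)
  \<comment> \<open>Makes the factor \<open>r * 2 * l * K0^2\<close> of \<open>S\<close> equal to
    1/2.\<close>
  define r where "r = 1 / (4 * l * K0\<^sup>2)"
  have r: "0 < r" using l K0 by (simp add: r_def)
  have int: "cmod (LINT t:{v..x}|lborel. dotp (col j z0 a t) (col j z b t)) \<le> l * (K0 * S)"
    if x: "x \<in> {v..vj j}" and S: "\<And>t. t \<in> {v..vj j} \<Longrightarrow> l1norm (col j z b t) \<le> S" for a b z x S
    unfolding l_def
  proof (rule LINT_bound)
    show "set_integrable lborel {v..x} (\<lambda>t. dotp (col j z0 a t) (col j z b t))"
      by (rule integrable_dotp_sub[of j, OF ac2_col ac2_lint[OF ac2_col] x])
    show "cmod (dotp (col j z0 a t) (col j z b t)) \<le> K0 * S" if "t \<in> {v..x}" for t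
    proof -
      have t: "t \<in> {v..vj j}" using that x by auto
      have "cmod (dotp (col j z0 a t) (col j z b t)) \<le> l1norm (col j z0 a t) * l1norm (col j z b t)" by (rule dotp_bound)
      also have "\<dots> \<le> K0 * S" using K0(2)[OF t] S[OF t] K0(1) l1norm_nonneg by (intro mult_mono) auto
      finally show ?thesis .
    qed
    have "0 \<le> S" using S[of v] l1norm_nonneg[of "col j z b v"] edges[of j] by auto
    then show "0 \<le> K0 * S" using K0(1) by simp
  qed (use x in auto)
  have inc: "l1norm (lincomb (- (LINT t:{v..x}|lborel. dotp (col j z0 2 t) (col j z b t))) (col j z0 1 x)
       (LINT t:{v..x}|lborel. dotp (col j z0 1 t) (col j z b t)) (col j z0 2 x)) \<le> 2 * (l * (K0 * S)) * K0"
    if x: "x \<in> {v..vj j}" and S: "\<And>t. t \<in> {v..vj j} \<Longrightarrow> l1norm (col j z b t) \<le> S" for b z x S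
  proof -
    have "l1norm (lincomb (- (LINT t:{v..x}|lborel. dotp (col j z0 2 t) (col j z b t))) (col j z0 1 x)
       (LINT t:{v..x}|lborel. dotp (col j z0 1 t) (col j z b t)) (col j z0 2 x))
      \<le> cmod (- (LINT t:{v..x}|lborel. dotp (col j z0 2 t) (col j z b t))) * l1norm (col j z0 1 x)
        + cmod (LINT t:{v..x}|lborel. dotp (col j z0 1 t) (col j z b t)) * l1norm (col j z0 2 x)" by (rule l1norm_lincomb)
    also have "\<dots> \<le> (l * (K0 * S)) * K0 + (l * (K0 * S)) * K0"
    proof -
      have i: "cmod (LINT t:{v..x}|lborel. dotp (col j z0 a t) (col j z b t)) \<le> l * (K0 * S)" for a
        by (rule int[OF x S])
      have "0 \<le> l * (K0 * S)" using i[of 1] norm_ge_zero order_trans by blast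
      then show ?thesis using i K0(2)[OF x] l1norm_nonneg unfolding norm_minus_cancel
        by (intro add_mono mult_mono) auto
    qed
    finally show ?thesis by (simp add: algebra_simps)
  qed
  have bound: "l1norm (col j z b x) \<le> 2 * K0" if z: "z \<in> cball z0 r" and x: "x \<in> {v..vj j}" for z b x
  proof -
    have c: "continuous_on {v..vj j} (\<lambda>x. l1norm (col j z b x))"
      unfolding l1norm_def by (intro continuous_on_add continuous_on_norm ac2_cont[OF ac2_col])
    obtain y where y: "y \<in> {v..vj j}" "\<And>t. t \<in> {v..vj j} \<Longrightarrow> l1norm (col j z b t) \<le> l1norm (col j z b y)"
      using continuous_attains_sup[OF _ _ c] edges[of j] by auto
    define S where "S = l1norm (col j z b y)"
    have S: "l1norm (col j z b t) \<le> S" if "t \<in> {v..vj j}" for t using y(2)[OF that] by (simp add: S_def)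
    have "S \<le> l1norm (col j z0 b y) + cmod (z - z0) * l1norm (lincomb (- (LINT t:{v..y}|lborel. dotp (col j z0 2 t) (col j z b t))) (col j z0 1 y)
       (LINT t:{v..y}|lborel. dotp (col j z0 1 t) (col j z b t)) (col j z0 2 y))"
      unfolding S_def by (subst col_difference[OF y(1), of z b z0]) (metis l1norm_addp l1norm_cs)
    also have "\<dots> \<le> K0 + r * (2 * (l * (K0 * S)) * K0)"
      using K0(2)[OF y(1)] inc[OF y(1) S] z r l1norm_nonneg
      by (intro add_mono mult_mono) (auto simp: dist_norm norm_minus_commute)
    also have "r * (2 * (l * (K0 * S)) * K0) = S / 2"
      using l K0(1) by (simp add: r_def field_simps power2_eq_square)
    finally have "S \<le> 2 * K0" by simp
    with S[OF x] show ?thesis by simp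
  qed
  \<comment> \<open>The first entry bounds the columns; the second is the increment estimate with
    \<open>S = 2 * K0\<close>, a Lipschitz constant.\<close>
  define K where "K = max (2 * K0) (2 * (l * (K0 * (2 * K0))) * K0)"
  show ?thesis
  proof (rule exI[of _ r], rule conjI[OF r], rule exI[of _ K], intro conjI ballI allI)
    show "1 \<le> K" using K0(1) by (simp add: K_def)
    show "l1norm (col j z b x) \<le> K" if "z \<in> cball z0 r" "x \<in> {v..vj j}" for z b x
      using bound[OF that] by (simp add: K_def le_max_iff_disj)
    show "l1norm (subp (col j z b x) (col j z0 b x)) \<le> K * cmod (z - z0)" if z: "z \<in> cball z0 r" and x: "x \<in> {v..vj j}" for z b x
    proof -
      let ?L = "lincomb (- (LINT t:{v..x}|lborel. dotp (col j z0 2 t) (col j z b t))) (col j z0 1 x)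
       (LINT t:{v..x}|lborel. dotp (col j z0 1 t) (col j z b t)) (col j z0 2 x)"
      have "subp (col j z b x) (col j z0 b x) = cs (z - z0) ?L"
        by (subst col_difference[OF x, of z b z0]) (simp add: subp_def addp_def cs_def)
      then have "l1norm (subp (col j z b x) (col j z0 b x)) = cmod (z - z0) * l1norm ?L" by (simp add: l1norm_cs)
      also have "\<dots> \<le> cmod (z - z0) * K"
        using inc[OF x bound[OF z]] by (intro mult_left_mono) (auto simp: K_def le_max_iff_disj)
      finally show ?thesis by (simp add: mult.commute)
    qed
  qed
qed

text \<open>In \<open>col_difference\<close> the increment still contains the solution at
  \<open>z\<close>; replacing it by the one at \<open>z0\<close> gives the derivative
  \<open>D\<close>, and by the Lipschitz bound the error is quadratic in
  \<open>z - z0\<close>.\<close>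

lemma col_holomorphic:
  assumes x: "x \<in> {v..vj j}"
  shows "(\<lambda>z. fst (col j z b x)) holomorphic_on UNIV" "(\<lambda>z. snd (col j z b x)) holomorphic_on UNIV"
proof -
  have "\<exists>D. ((\<lambda>z. fst (col j z b x)) has_field_derivative fst D) (at z0) \<and> ((\<lambda>z. snd (col j z b x)) has_field_derivative snd D) (at z0)" for z0
  proof -
    obtain K r where K: "0 < r" "1 \<le> K" "\<And>z b x. z \<in> cball z0 r \<Longrightarrow> x \<in> {v..vj j} \<Longrightarrow> l1norm (col j z b x) \<le> K"
      "\<And>z b x. z \<in> cball z0 r \<Longrightarrow> x \<in> {v..vj j} \<Longrightarrow> l1norm (subp (col j z b x) (col j z0 b x)) \<le> K * cmod (z - z0)"
      using col_local_bound[of z0 j] by metis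
    define l where "l = vj j - v"
    have l: "0 < l" using edges by (simp add: l_def)
    define P where "P a z = (LINT t:{v..x}|lborel. dotp (col j z0 a t) (col j z b t))" for a z
    define D where "D = lincomb (- P 2 z0) (col j z0 1 x) (P 1 z0) (col j z0 2 x)"
    have Pd: "cmod (P a z - P a z0) \<le> l * (K * (K * cmod (z - z0)))" if z: "z \<in> cball z0 r" for a z
    proof -
      have acd: "ac2 j (\<lambda>t. subp (col j z b t) (col j z0 b t))"
        using ac2_col[of j z b] ac2_col[of j z0 b] by (auto simp: ac2_def subp_def intro: abs_cont_diff)
      have "P a z - P a z0 = (LINT t:{v..x}|lborel. dotp (col j z0 a t) (col j z b t) - dotp (col j z0 a t) (col j z0 b t))"
        unfolding P_def by (intro set_integral_diff(2)[symmetric] integrable_dotp_sub[of j, OF ac2_col ac2_lint[OF ac2_col] x])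
      also have "\<dots> = (LINT t:{v..x}|lborel. dotp (col j z0 a t) (subp (col j z b t) (col j z0 b t)))"
        by (simp add: dotp_def subp_def algebra_simps)
      finally have e: "P a z - P a z0 = (LINT t:{v..x}|lborel. dotp (col j z0 a t) (subp (col j z b t) (col j z0 b t)))" .
      show ?thesis
        unfolding e l_def
      proof (rule LINT_bound)
        show "set_integrable lborel {v..x} (\<lambda>t. dotp (col j z0 a t) (subp (col j z b t) (col j z0 b t)))"
          by (rule integrable_dotp_sub[of j, OF ac2_col ac2_lint[OF acd] x])
        show "cmod (dotp (col j z0 a t) (subp (col j z b t) (col j z0 b t))) \<le> K * (K * cmod (z - z0))" if "t \<in> {v..x}" for t
        proof -
          have t: "t \<in> {v..vj j}" using that x by auto
          have "cmod (dotp (col j z0 a t) (subp (col j z b t) (col j z0 b t))) \<le> l1norm (col j z0 a t) * l1norm (subp (col j z b t) (col j z0 b t))"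
            by (rule dotp_bound)
          also have "\<dots> \<le> K * (K * cmod (z - z0))"
            using K(3)[of z0 t a] K(4)[OF z t] K(1,2) t l1norm_nonneg by (intro mult_mono) auto
          finally show ?thesis .
        qed
      qed (use x K in auto)
    qed
    have rem: "l1norm (subp (subp (col j z b x) (col j z0 b x)) (cs (z - z0) D)) \<le> 2 * l * K ^ 3 * (cmod (z - z0))\<^sup>2"
      if z: "cmod (z - z0) \<le> r" for z
    proof -
      have z': "z \<in> cball z0 r" using z by (simp add: dist_norm norm_minus_commute)
      have "subp (subp (col j z b x) (col j z0 b x)) (cs (z - z0) D) =
        cs (z - z0) (lincomb (- (P 2 z - P 2 z0)) (col j z0 1 x) (P 1 z - P 1 z0) (col j z0 2 x))"
        by (subst col_difference[OF x, of z b z0])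
           (simp add: subp_def addp_def cs_def D_def P_def lincomb_def algebra_simps)
      then have "l1norm (subp (subp (col j z b x) (col j z0 b x)) (cs (z - z0) D))
        = cmod (z - z0) * l1norm (lincomb (- (P 2 z - P 2 z0)) (col j z0 1 x) (P 1 z - P 1 z0) (col j z0 2 x))" by (simp only: l1norm_cs)
      also have "\<dots> \<le> cmod (z - z0) * (cmod (- (P 2 z - P 2 z0)) * l1norm (col j z0 1 x) + cmod (P 1 z - P 1 z0) * l1norm (col j z0 2 x))"
        by (intro mult_left_mono l1norm_lincomb) simp
      also have "\<dots> \<le> cmod (z - z0) * ((l * (K * (K * cmod (z - z0)))) * K + (l * (K * (K * cmod (z - z0)))) * K)"
        using Pd[OF z', of 1] Pd[OF z', of 2] K(3)[of z0 x] K(1,2) l x l1norm_nonneg unfolding norm_minus_cancel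
        by (intro mult_left_mono add_mono mult_mono) auto
      also have "\<dots> = 2 * l * K ^ 3 * (cmod (z - z0))\<^sup>2" by (simp add: power2_eq_square power3_eq_cube)
      finally show ?thesis .
    qed
    have "((\<lambda>z. fst (col j z b x)) has_field_derivative fst D) (at z0)"
      by (rule has_field_derivative_quadratic[OF K(1)])
         (use order_trans[OF l1norm_fst rem] in \<open>simp add: subp_def cs_def\<close>)
    moreover have "((\<lambda>z. snd (col j z b x)) has_field_derivative snd D) (at z0)"
      by (rule has_field_derivative_quadratic[OF K(1)])
         (use order_trans[OF l1norm_snd rem] in \<open>simp add: subp_def cs_def\<close>)
    ultimately show ?thesis by blast
  qed
  then show "(\<lambda>z. fst (col j z b x)) holomorphic_on UNIV" "(\<lambda>z. snd (col j z b x)) holomorphic_on UNIV"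
    by (auto simp: holomorphic_on_open)
qed

lemma bf_holomorphic: "bf j holomorphic_on UNIV" and cf_holomorphic: "cf j holomorphic_on UNIV"
proof -
  have "vj j \<in> {v..vj j}" using edges[of j] by simp
  note h = col_holomorphic[OF this]
  show "bf j holomorphic_on UNIV"
    unfolding bc_col(1)[symmetric, abs_def] bc_def by (intro holomorphic_intros h)
  show "cf j holomorphic_on UNIV"
    unfolding bc_col(2)[symmetric, abs_def] bc_def by (intro holomorphic_intros h)
qed

end

section \<open>Entire families of operators\<close>

text \<open>The derivative in \<open>z\<close> is a pointwise limit of the difference quotients
  along \<open>1/(i+1)\<close>, which are continuous in \<open>x\<close>.\<close>

lemma deriv_measurable:
  fixes a b :: real
  assumes h: "\<And>x. x \<in> {a..b} \<Longrightarrow> (\<lambda>z. \<phi> z x) holomorphic_on UNIV" and c: "\<And>z. continuous_on {a..b} (\<phi> z)"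
  shows "(\<lambda>x. indicator {a..b} x *\<^sub>R deriv (\<lambda>z. \<phi> z x) z0) \<in> borel_measurable lborel"
proof (rule borel_measurable_LIMSEQ_metric)
  let ?h = "\<lambda>i. complex_of_real (inverse (real (Suc i)))"
  show "(\<lambda>x. indicator {a..b} x *\<^sub>R ((\<phi> (z0 + ?h i) x - \<phi> z0 x) / ?h i)) \<in> borel_measurable lborel" for i
  proof (rule sqint_imp_measurable[OF continuous_imp_sqint])
    show "continuous_on {a..b} (\<lambda>x. (\<phi> (z0 + ?h i) x - \<phi> z0 x) / ?h i)"
      by (intro continuous_on_divide continuous_on_diff c continuous_on_const) (simp del: of_nat_Suc)
  qed
  show "(\<lambda>i. indicator {a..b} x *\<^sub>R ((\<phi> (z0 + ?h i) x - \<phi> z0 x) / ?h i)) \<longlonglongrightarrow> indicator {a..b} x *\<^sub>R deriv (\<lambda>z. \<phi> z x) z0" for x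
  proof (cases "x \<in> {a..b}")
    case True
    have "((\<lambda>z. \<phi> z x) has_field_derivative deriv (\<lambda>z. \<phi> z x) z0) (at z0)"
      using holomorphic_derivI[OF h[OF True], of z0] by simp
    then have "((\<lambda>h. (\<phi> (z0 + h) x - \<phi> z0 x) / h) \<longlongrightarrow> deriv (\<lambda>z. \<phi> z x) z0) (at 0)" by (simp add: DERIV_def)
    moreover have "?h \<longlonglongrightarrow> 0" using tendsto_of_real[OF LIMSEQ_inverse_real_of_nat, where 'a = complex] by simp
    ultimately have "(\<lambda>i. (\<phi> (z0 + ?h i) x - \<phi> z0 x) / ?h i) \<longlonglongrightarrow> deriv (\<lambda>z. \<phi> z x) z0"
      unfolding tendsto_at_iff_sequentially comp_def by (auto simp del: of_nat_Suc)
    then show ?thesis using True by simp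
  qed simp
qed

lemma set_integral_mono_subset:
  fixes f :: "'a \<Rightarrow> real"
  assumes "set_integrable M B f" "A \<in> sets M" "A \<subseteq> B" "\<And>x. x \<in> B \<Longrightarrow> 0 \<le> f x"
  shows "(LINT x:A|M. f x) \<le> (LINT x:B|M. f x)"
  unfolding set_lebesgue_integral_def
proof (rule integral_mono)
  show "integrable M (\<lambda>x. indicator A x *\<^sub>R f x)"
    using set_integrable_subset[OF assms(1-3)] by (simp add: set_integrable_def)
  show "integrable M (\<lambda>x. indicator B x *\<^sub>R f x)" using assms(1) by (simp add: set_integrable_def)
  show "indicator A x *\<^sub>R f x \<le> indicator B x *\<^sub>R f x" for x
    using assms(3) assms(4)[of x] by (auto simp: indicator_def)
qed

lemma dotp_addp_cs: "dotp u (addp (cs a f) (cs c g)) = a * dotp u f + c * dotp u g"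
  by (simp add: dotp_def addp_def cs_def algebra_simps)

lemma finite_uniform_bound:
  fixes P :: "'n::finite \<Rightarrow> real \<Rightarrow> real \<Rightarrow> bool"
  assumes ex: "\<And>j. \<exists>r>0. \<exists>K\<ge>0. P j r K" and mono: "\<And>j r K r' K'. P j r K \<Longrightarrow> r' \<le> r \<Longrightarrow> K \<le> K' \<Longrightarrow> P j r' K'"
  shows "\<exists>r>0. \<exists>K\<ge>0. \<forall>j. P j r K"
proof -
  obtain r K where rK: "\<And>j. 0 < r j" "\<And>j. 0 \<le> K j" "\<And>j. P j (r j) (K j)" using ex by metis
  have "0 < Min (range r)" using rK(1) by simp
  moreover have "0 \<le> Max (range K)" using rK(2) by (meson Max_ge finite_class.finite_UNIV finite_imageI order_trans rangeI)
  moreover have "P j (Min (range r)) (Max (range K))" for j by (rule mono[OF rK(3)]) auto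
  ultimately show ?thesis by blast
qed

context star
begin

definition entire_mult :: "'n \<Rightarrow> (complex \<Rightarrow> real \<Rightarrow> complex) \<Rightarrow> bool" where
  "entire_mult j \<psi> \<longleftrightarrow> (\<forall>x\<in>{v..vj j}. (\<lambda>z. \<psi> z x) holomorphic_on UNIV) \<and> (\<forall>z. continuous_on {v..vj j} (\<psi> z))
     \<and> (\<forall>z0. \<exists>r>0. \<exists>K\<ge>0. \<forall>z\<in>cball z0 r. \<forall>x\<in>{v..vj j}. cmod (\<psi> z x) \<le> K)"

lemma entire_mult_col: "entire_mult j (\<lambda>z x. fst (col j z b x))" "entire_mult j (\<lambda>z x. snd (col j z b x))"
proof -
  have ex: "\<exists>r>0. \<exists>K\<ge>0. \<forall>z\<in>cball z0 r. \<forall>x\<in>{v..vj j}. l1norm (col j z b x) \<le> K" for z0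
  proof -
    obtain r K where "0 < r" "1 \<le> K" "\<And>z x. z \<in> cball z0 r \<Longrightarrow> x \<in> {v..vj j} \<Longrightarrow> l1norm (col j z b x) \<le> K"
      using col_local_bound[of z0 j] by metis
    then show ?thesis by (intro exI[of _ r] conjI exI[of _ K]) auto
  qed
  show "entire_mult j (\<lambda>z x. fst (col j z b x))"
    unfolding entire_mult_def using col_holomorphic ac2_cont[OF ac2_col] ex order_trans[OF l1norm_fst] by meson
  show "entire_mult j (\<lambda>z x. snd (col j z b x))"
    unfolding entire_mult_def using col_holomorphic ac2_cont[OF ac2_col] ex order_trans[OF l1norm_snd] by meson
qed

lemma set_integrable_mult_measurable_bounded:
  fixes \<phi> g :: "real \<Rightarrow> complex"
  assumes "set_integrable lborel A g" "(\<lambda>t. indicator A t *\<^sub>R \<phi> t) \<in> borel_measurable lborel" "\<And>t. t \<in> A \<Longrightarrow> cmod (\<phi> t) \<le> M" "0 \<le> M"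
  shows "set_integrable lborel A (\<lambda>t. \<phi> t * g t)"
proof -
  have "integrable lborel (\<lambda>t. (indicator A t *\<^sub>R g t) * (indicator A t *\<^sub>R \<phi> t))"
    using assms by (intro integrable_mult_bounded[where C = M]) (auto simp: set_integrable_def indicator_def)
  moreover have "(\<lambda>t. (indicator A t *\<^sub>R g t) * (indicator A t *\<^sub>R \<phi> t)) = (\<lambda>t. indicator A t *\<^sub>R (\<phi> t * g t))"
    by (auto simp: indicator_def)
  ultimately show ?thesis by (simp add: set_integrable_def)
qed

text \<open>Differentiation under the integral: the bound on \<open>\<psi>\<close> is uniform in
  \<open>t\<close>, so Cauchy's inequality gives a quadratic Taylor remainder with one constant for
  all \<open>t\<close>, and \<open>g\<close> is integrable.\<close>

lemma LINT_holomorphic: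
  assumes \<psi>: "entire_mult j \<psi>" and g: "set_integrable lborel {v..vj j} g" and x: "x \<in> {v..vj j}"
  shows "(\<lambda>z. LINT t:{v..x}|lborel. \<psi> z t * g t) holomorphic_on UNIV"
proof -
  have gx: "set_integrable lborel {v..x} g" using x by (intro set_integrable_subset[OF g]) auto
  have c: "continuous_on {v..x} (\<psi> z)" for z using \<psi> x unfolding entire_mult_def by (meson atLeastatMost_subset_iff continuous_on_subset atLeastAtMost_iff order_refl)
  have h: "(\<lambda>z. \<psi> z t) holomorphic_on UNIV" if "t \<in> {v..x}" for t using \<psi> that x unfolding entire_mult_def by auto
  have "\<exists>D. ((\<lambda>z. LINT t:{v..x}|lborel. \<psi> z t * g t) has_field_derivative D) (at z0)" for z0
  proof -
    obtain r K where r: "0 < r" "0 \<le> K" "\<And>z t. z \<in> cball z0 r \<Longrightarrow> t \<in> {v..vj j} \<Longrightarrow> cmod (\<psi> z t) \<le> K"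
      using \<psi> unfolding entire_mult_def by metis
    have K: "cmod (\<psi> z t) \<le> K" if "z \<in> cball z0 r" "t \<in> {v..x}" for z t using r(3)[of z t] that x by auto
    define D where "D t = deriv (\<lambda>z. \<psi> z t) z0" for t
    have Di: "set_integrable lborel {v..x} (\<lambda>t. D t * g t)"
      by (rule set_integrable_mult_measurable_bounded[OF gx, where M = "K / r"])
         (use deriv_measurable[OF h c] deriv_bound[OF h r(1) K] r(1,2) in \<open>auto simp: D_def\<close>)
    have \<psi>i: "set_integrable lborel {v..x} (\<lambda>t. \<psi> z t * g t)" for z by (intro set_integrable_continuous_mult c gx)
    define C where "C = 8 * K / r\<^sup>2"
    have C: "0 \<le> C" using r by (simp add: C_def)
    have "((\<lambda>z. LINT t:{v..x}|lborel. \<psi> z t * g t) has_field_derivative (LINT t:{v..x}|lborel. D t * g t)) (at z0)"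
    proof (rule has_field_derivative_quadratic[where d = "r/2" and C = "C * (LINT t:{v..x}|lborel. cmod (g t))"])
      fix z assume z: "cmod (z - z0) \<le> r/2"
      have pt: "cmod (\<psi> z t - \<psi> z0 t - (z - z0) * D t) \<le> C * (cmod (z - z0))\<^sup>2" if "t \<in> {v..x}" for t
        using taylor_bound[OF h[OF that] r(1) K[OF _ that] z] by (simp add: C_def D_def)
      have e1: "(LINT t:{v..x}|lborel. \<psi> z t * g t - \<psi> z0 t * g t) = (LINT t:{v..x}|lborel. \<psi> z t * g t) - (LINT t:{v..x}|lborel. \<psi> z0 t * g t)"
        by (intro set_integral_diff(2) \<psi>i)
      have e2: "(LINT t:{v..x}|lborel. (\<psi> z t * g t - \<psi> z0 t * g t) - (z - z0) * (D t * g t))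
        = (LINT t:{v..x}|lborel. \<psi> z t * g t - \<psi> z0 t * g t) - (LINT t:{v..x}|lborel. (z - z0) * (D t * g t))"
        by (intro set_integral_diff \<psi>i set_integrable_mult_right Di)
      have i: "set_integrable lborel {v..x} (\<lambda>t. (\<psi> z t * g t - \<psi> z0 t * g t) - (z - z0) * (D t * g t))"
        by (intro set_integral_diff \<psi>i set_integrable_mult_right Di)
      have "(LINT t:{v..x}|lborel. \<psi> z t * g t) - (LINT t:{v..x}|lborel. \<psi> z0 t * g t) - (z - z0) * (LINT t:{v..x}|lborel. D t * g t)
        = (LINT t:{v..x}|lborel. (\<psi> z t * g t - \<psi> z0 t * g t) - (z - z0) * (D t * g t))"
        unfolding e2 e1 by simp
      then have "cmod ((LINT t:{v..x}|lborel. \<psi> z t * g t) - (LINT t:{v..x}|lborel. \<psi> z0 t * g t) - (z - z0) * (LINT t:{v..x}|lborel. D t * g t))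
        \<le> (LINT t:{v..x}|lborel. cmod ((\<psi> z t * g t - \<psi> z0 t * g t) - (z - z0) * (D t * g t)))"
        using set_integral_norm_bound[OF i] by simp
      also have "\<dots> \<le> (LINT t:{v..x}|lborel. C * (cmod (z - z0))\<^sup>2 * cmod (g t))"
      proof (rule set_integral_mono[OF set_integrable_norm[OF i] set_integrable_mult_right[OF set_integrable_norm[OF gx]]])
        fix t assume t: "t \<in> {v..x}"
        have "(\<psi> z t * g t - \<psi> z0 t * g t) - (z - z0) * (D t * g t) = (\<psi> z t - \<psi> z0 t - (z - z0) * D t) * g t"
          by (simp add: algebra_simps)
        then show "cmod ((\<psi> z t * g t - \<psi> z0 t * g t) - (z - z0) * (D t * g t)) \<le> C * (cmod (z - z0))\<^sup>2 * cmod (g t)"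
          using pt[OF t] by (simp add: norm_mult mult_right_mono)
      qed
      finally show "cmod ((LINT t:{v..x}|lborel. \<psi> z t * g t) - (LINT t:{v..x}|lborel. \<psi> z0 t * g t) - (z - z0) * (LINT t:{v..x}|lborel. D t * g t))
        \<le> C * (LINT t:{v..x}|lborel. cmod (g t)) * (cmod (z - z0))\<^sup>2" by (simp add: algebra_simps)
    qed (use r in simp)
    then show ?thesis by blast
  qed
  then show ?thesis by (auto simp: holomorphic_on_open)
qed

text \<open>Holomorphy for every fixed argument and point, together with the locally uniform bound, yields
  differentiability in operator norm through Cauchy's inequality.\<close>
definition entire_comp :: "'n \<Rightarrow> (complex \<Rightarrow> 'n gfun \<Rightarrow> real \<Rightarrow> complex) \<Rightarrow> bool" where
  "entire_comp j \<Phi> \<longleftrightarrow>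
     (\<forall>f. L2G v vj f \<longrightarrow> (\<forall>x\<in>{v..vj j}. (\<lambda>z. \<Phi> z f x) holomorphic_on UNIV) \<and> (\<forall>z. continuous_on {v..vj j} (\<Phi> z f)))
   \<and> (\<forall>z f g a b. L2G v vj f \<longrightarrow> L2G v vj g \<longrightarrow> (\<forall>x\<in>{v..vj j}.
        \<Phi> z (\<lambda>i x. addp (cs a (f i x)) (cs b (g i x))) x = a * \<Phi> z f x + b * \<Phi> z g x))
   \<and> (\<forall>z f g. L2G v vj f \<longrightarrow> L2G v vj g \<longrightarrow> eqG v vj f g \<longrightarrow> (\<forall>x\<in>{v..vj j}. \<Phi> z f x = \<Phi> z g x))
   \<and> (\<forall>z0. \<exists>r>0. \<exists>K\<ge>0. \<forall>z\<in>cball z0 r. \<forall>f. L2G v vj f \<longrightarrow> (\<forall>x\<in>{v..vj j}. cmod (\<Phi> z f x) \<le> K * normG v vj f))"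

lemma entire_compI:
  assumes "\<And>f x. L2G v vj f \<Longrightarrow> x \<in> {v..vj j} \<Longrightarrow> (\<lambda>z. \<Phi> z f x) holomorphic_on UNIV"
    "\<And>f z. L2G v vj f \<Longrightarrow> continuous_on {v..vj j} (\<Phi> z f)"
    "\<And>z f g a b x. L2G v vj f \<Longrightarrow> L2G v vj g \<Longrightarrow> x \<in> {v..vj j} \<Longrightarrow>
        \<Phi> z (\<lambda>i x. addp (cs a (f i x)) (cs b (g i x))) x = a * \<Phi> z f x + b * \<Phi> z g x"
    "\<And>z f g x. L2G v vj f \<Longrightarrow> L2G v vj g \<Longrightarrow> eqG v vj f g \<Longrightarrow> x \<in> {v..vj j} \<Longrightarrow> \<Phi> z f x = \<Phi> z g x"
    "\<And>z0. \<exists>r>0. \<exists>K\<ge>0. \<forall>z\<in>cball z0 r. \<forall>f. L2G v vj f \<longrightarrow> (\<forall>x\<in>{v..vj j}. cmod (\<Phi> z f x) \<le> K * normG v vj f)"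
  shows "entire_comp j \<Phi>"
  unfolding entire_comp_def using assms by auto

lemma entire_compD:
  assumes "entire_comp j \<Phi>"
  shows "\<And>f x. L2G v vj f \<Longrightarrow> x \<in> {v..vj j} \<Longrightarrow> (\<lambda>z. \<Phi> z f x) holomorphic_on UNIV"
    "\<And>f z. L2G v vj f \<Longrightarrow> continuous_on {v..vj j} (\<Phi> z f)"
    "\<And>z f g a b x. L2G v vj f \<Longrightarrow> L2G v vj g \<Longrightarrow> x \<in> {v..vj j} \<Longrightarrow>
        \<Phi> z (\<lambda>i x. addp (cs a (f i x)) (cs b (g i x))) x = a * \<Phi> z f x + b * \<Phi> z g x"
    "\<And>z f g x. L2G v vj f \<Longrightarrow> L2G v vj g \<Longrightarrow> eqG v vj f g \<Longrightarrow> x \<in> {v..vj j} \<Longrightarrow> \<Phi> z f x = \<Phi> z g x"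
    "\<And>z0. \<exists>r>0. \<exists>K\<ge>0. \<forall>z\<in>cball z0 r. \<forall>f. L2G v vj f \<longrightarrow> (\<forall>x\<in>{v..vj j}. cmod (\<Phi> z f x) \<le> K * normG v vj f)"
  using assms unfolding entire_comp_def by auto

lemma entire_comp_mult:
  assumes \<psi>: "entire_mult j \<psi>" and \<Phi>: "entire_comp j \<Phi>"
  shows "entire_comp j (\<lambda>z f x. \<psi> z x * \<Phi> z f x)"
proof (rule entire_compI)
  show "(\<lambda>z. \<psi> z x * \<Phi> z f x) holomorphic_on UNIV" if "L2G v vj f" "x \<in> {v..vj j}" for f x
    using \<psi> that unfolding entire_mult_def by (intro holomorphic_intros entire_compD(1)[OF \<Phi>]) auto
  show "continuous_on {v..vj j} (\<lambda>x. \<psi> z x * \<Phi> z f x)" if "L2G v vj f" for f z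
    using \<psi> that unfolding entire_mult_def by (intro continuous_on_mult entire_compD(2)[OF \<Phi>]) auto
  show "\<psi> z x * \<Phi> z (\<lambda>i x. addp (cs a (f i x)) (cs b (g i x))) x = a * (\<psi> z x * \<Phi> z f x) + b * (\<psi> z x * \<Phi> z g x)"
    if "L2G v vj f" "L2G v vj g" "x \<in> {v..vj j}" for z f g a b x
    using entire_compD(3)[OF \<Phi> that] by (simp add: algebra_simps)
  show "\<psi> z x * \<Phi> z f x = \<psi> z x * \<Phi> z g x" if "L2G v vj f" "L2G v vj g" "eqG v vj f g" "x \<in> {v..vj j}" for z f g x
    using entire_compD(4)[OF \<Phi> that] by simp
  fix z0
  obtain r1 K1 where 1: "0 < r1" "0 \<le> K1" "\<And>z x. z \<in> cball z0 r1 \<Longrightarrow> x \<in> {v..vj j} \<Longrightarrow> cmod (\<psi> z x) \<le> K1"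
    using \<psi> unfolding entire_mult_def by metis
  obtain r2 K2 where 2: "0 < r2" "0 \<le> K2" "\<And>z f x. z \<in> cball z0 r2 \<Longrightarrow> L2G v vj f \<Longrightarrow> x \<in> {v..vj j} \<Longrightarrow> cmod (\<Phi> z f x) \<le> K2 * normG v vj f"
    using entire_compD(5)[OF \<Phi>, of z0] by metis
  have "cmod (\<psi> z x * \<Phi> z f x) \<le> (K1 * K2) * normG v vj f" if "z \<in> cball z0 (min r1 r2)" "L2G v vj f" "x \<in> {v..vj j}" for z f x
  proof -
    have "cmod (\<psi> z x * \<Phi> z f x) \<le> K1 * (K2 * normG v vj f)"
      unfolding norm_mult using that 1(2) 1(3)[of z x] 2(3)[of z f x] by (intro mult_mono) auto
    then show ?thesis by (simp add: mult.assoc)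
  qed
  then show "\<exists>r>0. \<exists>K\<ge>0. \<forall>z\<in>cball z0 r. \<forall>f. L2G v vj f \<longrightarrow> (\<forall>x\<in>{v..vj j}. cmod (\<psi> z x * \<Phi> z f x) \<le> K * normG v vj f)"
    using 1(1,2) 2(1,2) by (intro exI[of _ "min r1 r2"] conjI exI[of _ "K1 * K2"]) auto
qed

lemma entire_comp_cmult: "entire_comp j \<Phi> \<Longrightarrow> entire_comp j (\<lambda>z f x. c * \<Phi> z f x)"
proof (rule entire_comp_mult)
  have "\<exists>r>0. \<exists>K\<ge>0. \<forall>z\<in>cball z0 r. \<forall>x\<in>{v..vj j}. cmod c \<le> K" for z0 :: complex
    by (rule exI[of _ 1], rule conjI[OF zero_less_one], rule exI[of _ "cmod c"]) simp
  then show "entire_mult j (\<lambda>z x. c)" by (simp add: entire_mult_def)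
qed

lemma entire_comp_add:
  assumes 1: "entire_comp j \<Phi>" and 2: "entire_comp j \<Psi>"
  shows "entire_comp j (\<lambda>z f x. \<Phi> z f x + \<Psi> z f x)"
proof (rule entire_compI)
  show "(\<lambda>z. \<Phi> z f x + \<Psi> z f x) holomorphic_on UNIV" if "L2G v vj f" "x \<in> {v..vj j}" for f x
    using that by (intro holomorphic_intros entire_compD(1)[OF 1] entire_compD(1)[OF 2])
  show "continuous_on {v..vj j} (\<lambda>x. \<Phi> z f x + \<Psi> z f x)" if "L2G v vj f" for f z
    using that by (intro continuous_on_add entire_compD(2)[OF 1] entire_compD(2)[OF 2])
  show "\<Phi> z (\<lambda>i x. addp (cs a (f i x)) (cs b (g i x))) x + \<Psi> z (\<lambda>i x. addp (cs a (f i x)) (cs b (g i x))) x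
      = a * (\<Phi> z f x + \<Psi> z f x) + b * (\<Phi> z g x + \<Psi> z g x)"
    if "L2G v vj f" "L2G v vj g" "x \<in> {v..vj j}" for z f g a b x
    using entire_compD(3)[OF 1 that] entire_compD(3)[OF 2 that] by (simp add: algebra_simps)
  show "\<Phi> z f x + \<Psi> z f x = \<Phi> z g x + \<Psi> z g x" if "L2G v vj f" "L2G v vj g" "eqG v vj f g" "x \<in> {v..vj j}" for z f g x
    using entire_compD(4)[OF 1 that] entire_compD(4)[OF 2 that] by simp
  fix z0
  obtain r1 K1 where b1: "0 < r1" "0 \<le> K1" "\<And>z f x. z \<in> cball z0 r1 \<Longrightarrow> L2G v vj f \<Longrightarrow> x \<in> {v..vj j} \<Longrightarrow> cmod (\<Phi> z f x) \<le> K1 * normG v vj f"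
    using entire_compD(5)[OF 1, of z0] by metis
  obtain r2 K2 where b2: "0 < r2" "0 \<le> K2" "\<And>z f x. z \<in> cball z0 r2 \<Longrightarrow> L2G v vj f \<Longrightarrow> x \<in> {v..vj j} \<Longrightarrow> cmod (\<Psi> z f x) \<le> K2 * normG v vj f"
    using entire_compD(5)[OF 2, of z0] by metis
  have "cmod (\<Phi> z f x + \<Psi> z f x) \<le> (K1 + K2) * normG v vj f" if "z \<in> cball z0 (min r1 r2)" "L2G v vj f" "x \<in> {v..vj j}" for z f x
    using that b1(3)[of z f x] b2(3)[of z f x] norm_triangle_ineq[of "\<Phi> z f x" "\<Psi> z f x"] by (simp add: distrib_right)
  then show "\<exists>r>0. \<exists>K\<ge>0. \<forall>z\<in>cball z0 r. \<forall>f. L2G v vj f \<longrightarrow> (\<forall>x\<in>{v..vj j}. cmod (\<Phi> z f x + \<Psi> z f x) \<le> K * normG v vj f)"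
    using b1(1,2) b2(1,2) by (intro exI[of _ "min r1 r2"] conjI exI[of _ "K1 + K2"]) auto
qed

lemma entire_comp_zero: "entire_comp j (\<lambda>z f x. 0)"
proof (rule entire_compI)
  show "\<exists>r>0. \<exists>K\<ge>0. \<forall>z\<in>cball z0 r. \<forall>f. L2G v vj f \<longrightarrow> (\<forall>x\<in>{v..vj j}. cmod 0 \<le> K * normG v vj f)" for z0 :: complex
    by (rule exI[of _ 1], rule conjI[OF zero_less_one], rule exI[of _ 0]) simp
qed auto

lemma entire_comp_sum: "finite A \<Longrightarrow> (\<And>i. i \<in> A \<Longrightarrow> entire_comp j (\<Phi> i)) \<Longrightarrow> entire_comp j (\<lambda>z f x. \<Sum>i\<in>A. \<Phi> i z f x)"
  by (induction A rule: finite_induct) (auto intro: entire_comp_zero entire_comp_add)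

text \<open>Cauchy-Schwarz on a bounded edge; through it the pointwise bounds on integral operators
  come out in terms of the L2 norm of the argument.\<close>

lemma LINT_normG:
  assumes f: "L2G v vj f" and s: "s = fst \<or> s = snd"
  shows "(LINT t:{v..vj i}|lborel. cmod (s (f i t))) \<le> sqrt (vj i - v) * normG v vj f"
proof -
  have sq: "sqint v (vj i) (\<lambda>t. s (f i t))" using f s by (auto simp: L2G_def)
  have sqint2: "sqint v (vj i) (\<lambda>t. fst (f i t))" "sqint v (vj i) (\<lambda>t. snd (f i t))" using f by (auto simp: L2G_def)
  have "(LINT t:{v..vj i}|lborel. (cmod (s (f i t)))\<^sup>2) \<le> (LINT t:{v..vj i}|lborel. (cmod (fst (f i t)))\<^sup>2 + (cmod (snd (f i t)))\<^sup>2)"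
    using s by (intro set_integral_mono set_integral_add sqint_integrable2 sq sqint2) auto
  also have "\<dots> = Re (einner i (f i) (f i))" by (simp add: einner_self)
  also have "\<dots> \<le> (\<Sum>j\<in>UNIV. Re (einner j (f j) (f j)))" by (rule member_le_sum) (auto simp: einner_self_nonneg)
  also have "\<dots> = (normG v vj f)\<^sup>2" by (simp add: normG_sq)
  finally have "(LINT t:{v..vj i}|lborel. cmod (s (f i t)))\<^sup>2 \<le> (vj i - v) * (normG v vj f)\<^sup>2"
    using LINT_cauchy_schwarz[OF edges[of i] sq] edges[of i] by (meson diff_gt_0_iff_gt less_imp_le mult_left_mono order_trans)
  also have "\<dots> = (sqrt (vj i - v) * normG v vj f)\<^sup>2" using edges[of i] by (simp add: power_mult_distrib)
  finally show ?thesis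
    by (rule power2_le_imp_le) (use normG_nonneg edges[of i] in auto)
qed

text \<open>One statement for two uses: a constant \<open>y\<close> gives the complete integral over
  any edge \<open>i\<close>, and \<open>y x = x\<close> with \<open>i = j\<close> the running
  integral. Continuity in \<open>x\<close> has a different reason in each case and is therefore
  assumed.\<close>

lemma entire_comp_LINT:
  fixes b :: 2
  assumes xx: "\<And>x. x \<in> {v..vj j} \<Longrightarrow> y x \<in> {v..vj i}"
    and cont: "\<And>f z. L2G v vj f \<Longrightarrow> continuous_on {v..vj j} (\<lambda>x. LINT t:{v..y x}|lborel. dotp (col i z b t) (f i t))"
  shows "entire_comp j (\<lambda>z f x. LINT t:{v..y x}|lborel. dotp (col i z b t) (f i t))"
proof -
  define \<Phi> where "\<Phi> z f x = (LINT t:{v..y x}|lborel. dotp (col i z b t) (f i t))" for z and f :: "'n gfun" and x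
  have si: "set_integrable lborel {v..y x} (\<lambda>t. fst (col i z b t) * fst (f i t))" "set_integrable lborel {v..y x} (\<lambda>t. snd (col i z b t) * snd (f i t))"
    if "L2G v vj f" "x \<in> {v..vj j}" for f x z
  proof -
    have "set_integrable lborel {v..vj i} (\<lambda>t. fst (col i z b t) * fst (f i t))" "set_integrable lborel {v..vj i} (\<lambda>t. snd (col i z b t) * snd (f i t))"
      using that L2G_lint[OF that(1), of i] by (auto intro!: set_integrable_continuous_mult ac2_cont[OF ac2_col] simp: lint_def)
    then show "set_integrable lborel {v..y x} (\<lambda>t. fst (col i z b t) * fst (f i t))" "set_integrable lborel {v..y x} (\<lambda>t. snd (col i z b t) * snd (f i t))"
      using xx[OF that(2)] by (auto elim!: set_integrable_subset)
  qed
  have split: "(LINT t:{v..y x}|lborel. dotp (col i z b t) (f i t)) =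
     (LINT t:{v..y x}|lborel. fst (col i z b t) * fst (f i t)) + (LINT t:{v..y x}|lborel. snd (col i z b t) * snd (f i t))"
    if "L2G v vj f" "x \<in> {v..vj j}" for f x z
    unfolding dotp_def by (intro set_integral_add(2) si that)
  have di: "set_integrable lborel {v..y x} (\<lambda>t. dotp (col i z b t) (f i t))" if "L2G v vj f" "x \<in> {v..vj j}" for f x z
    by (rule integrable_dotp_sub[of i, OF ac2_col L2G_lint[OF that(1)] xx[OF that(2)]])
  have "entire_comp j \<Phi>"
  proof (rule entire_compI)
    show "(\<lambda>z. \<Phi> z f x) holomorphic_on UNIV" if f: "L2G v vj f" and x: "x \<in> {v..vj j}" for f x
      unfolding \<Phi>_def split[OF f x]
      using L2G_lint[OF f, of i] xx[OF x] by (intro holomorphic_on_add LINT_holomorphic[of i] entire_mult_col) (auto simp: lint_def)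
    show "continuous_on {v..vj j} (\<Phi> z f)" if "L2G v vj f" for f z
      using cont[OF that] by (simp add: \<Phi>_def[abs_def])
    show "\<Phi> z (\<lambda>i x. addp (cs a (f i x)) (cs c (g i x))) x = a * \<Phi> z f x + c * \<Phi> z g x"
      if f: "L2G v vj f" and g: "L2G v vj g" and x: "x \<in> {v..vj j}" for z f g a c x
    proof -
      have "(LINT t:{v..y x}|lborel. dotp (col i z b t) (addp (cs a (f i t)) (cs c (g i t)))) =
        (LINT t:{v..y x}|lborel. a * dotp (col i z b t) (f i t) + c * dotp (col i z b t) (g i t))"
        unfolding dotp_addp_cs ..
      also have "\<dots> = (LINT t:{v..y x}|lborel. a * dotp (col i z b t) (f i t)) + (LINT t:{v..y x}|lborel. c * dotp (col i z b t) (g i t))"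
        by (intro set_integral_add(2) set_integrable_mult_right di f g x)
      finally show ?thesis unfolding \<Phi>_def by simp
    qed
    show "\<Phi> z f x = \<Phi> z g x"
      if f: "L2G v vj f" and g: "L2G v vj g" and e: "eqG v vj f g" and x: "x \<in> {v..vj j}" for z f g x
      unfolding \<Phi>_def
    proof (rule set_integral_cong_AE_lborel[OF set_integrable_measurable[OF di[OF f x]] set_integrable_measurable[OF di[OF g x]]])
      have "AE t in lborel. t \<in> {v..vj i} \<longrightarrow> f i t = g i t" using e by (simp add: eqG_def)
      then show "AE t in lborel. t \<in> {v..y x} \<longrightarrow> dotp (col i z b t) (f i t) = dotp (col i z b t) (g i t)"
        by eventually_elim (use xx[OF x] in auto)
    qed
    fix z0
    obtain r K where r: "0 < r" "1 \<le> K" "\<And>z x. z \<in> cball z0 r \<Longrightarrow> x \<in> {v..vj i} \<Longrightarrow> l1norm (col i z b x) \<le> K"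
      using col_local_bound[of z0 i] by metis
    have "cmod (LINT t:{v..y x}|lborel. dotp (col i z b t) (f i t)) \<le> (K * (2 * sqrt (vj i - v))) * normG v vj f"
      if z: "z \<in> cball z0 r" and f: "L2G v vj f" and x: "x \<in> {v..vj j}" for z f x
    proof -
      have fi: "set_integrable lborel {v..vj i} (\<lambda>t. cmod (fst (f i t)))" "set_integrable lborel {v..vj i} (\<lambda>t. cmod (snd (f i t)))"
        using L2G_lint[OF f, of i] by (auto simp: lint_def intro: set_integrable_norm)
      have ni: "set_integrable lborel {v..vj i} (\<lambda>t. K * l1norm (f i t))"
        unfolding l1norm_def by (intro set_integrable_mult_right set_integral_add fi)
      have "cmod (LINT t:{v..y x}|lborel. dotp (col i z b t) (f i t)) \<le> (LINT t:{v..y x}|lborel. cmod (dotp (col i z b t) (f i t)))"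
        by (rule set_integral_norm_bound[OF di[OF f x]])
      also have "\<dots> \<le> (LINT t:{v..y x}|lborel. K * l1norm (f i t))"
      proof (rule set_integral_mono[OF set_integrable_norm[OF di[OF f x]]])
        show "set_integrable lborel {v..y x} (\<lambda>t. K * l1norm (f i t))" using xx[OF x] by (intro set_integrable_subset[OF ni]) auto
        show "cmod (dotp (col i z b t) (f i t)) \<le> K * l1norm (f i t)" if "t \<in> {v..y x}" for t
          using order_trans[OF dotp_bound mult_right_mono[OF r(3)[OF z, of t] l1norm_nonneg]] that xx[OF x] by auto
      qed
      also have "\<dots> \<le> (LINT t:{v..vj i}|lborel. K * l1norm (f i t))"
        using xx[OF x] r(2) l1norm_nonneg by (intro set_integral_mono_subset[OF ni]) auto
      also have "\<dots> = K * ((LINT t:{v..vj i}|lborel. cmod (fst (f i t))) + (LINT t:{v..vj i}|lborel. cmod (snd (f i t))))"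
        unfolding l1norm_def using set_integral_add(2)[OF fi] by simp
      also have "\<dots> \<le> K * (sqrt (vj i - v) * normG v vj f + sqrt (vj i - v) * normG v vj f)"
        using LINT_normG[OF f, of fst i] LINT_normG[OF f, of snd i] r(2) by (intro mult_left_mono add_mono) auto
      finally show ?thesis by (simp add: algebra_simps)
    qed
    then show "\<exists>r>0. \<exists>K\<ge>0. \<forall>z\<in>cball z0 r. \<forall>f. L2G v vj f \<longrightarrow> (\<forall>x\<in>{v..vj j}. cmod (\<Phi> z f x) \<le> K * normG v vj f)"
      unfolding \<Phi>_def
      using r(1,2) edges[of i] by (intro exI[of _ r] conjI exI[of _ "K * (2 * sqrt (vj i - v))"]) auto
  qed
  then show ?thesis unfolding \<Phi>_def[abs_def] .
qed

lemma entire_comp_Ib: "entire_comp j (\<lambda>z f x. Ib b z f i)"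
proof -
  have 1: "vj i \<in> {v..vj i}" using edges[of i] by simp
  show ?thesis unfolding Ib_def by (rule entire_comp_LINT[of j "\<lambda>_. vj i" i b, OF 1 continuous_on_const])
qed

lemma entire_comp_LINT_upto: "entire_comp j (\<lambda>z f x. LINT t:{v..x}|lborel. dotp (col j z b t) (f j t))"
proof -
  have c: "continuous_on {v..vj j} (\<lambda>x. LINT t:{v..x}|lborel. dotp (col j z b t) (f j t))" if f: "L2G v vj f" for f z
  proof -
    have i: "set_integrable lborel {v..vj j} (\<lambda>t. dotp (col j z b t) (f j t))"
      by (rule integrable_dotp[OF ac2_col L2G_lint[OF f]])
    have "abs_cont v (vj j) (\<lambda>x. LINT t:{v..x}|lborel. dotp (col j z b t) (f j t))"
      by (rule indefinite_integral_abs_cont(1)[OF i]) simp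
    then show "continuous_on {v..vj j} (\<lambda>x. LINT t:{v..x}|lborel. dotp (col j z b t) (f j t))"
      by (rule abs_cont_continuous)
  qed
  have 1: "\<And>x. x \<in> {v..vj j} \<Longrightarrow> x \<in> {v..vj j}" .
  show ?thesis
    by (rule entire_comp_LINT[of j "\<lambda>x. x" j b, OF 1]) (simp, rule c)
qed

end

section \<open>The function W\<close>

lemma matrix_diff_distribs:
  fixes A B :: "complex^'m^'n" and C D :: "complex^'k^'m"
  shows "(A - B) ** C = A ** C - B ** C" "A ** (C - D) = A ** C - A ** D"
  by (simp_all add: matrix_matrix_mult_def vec_eq_iff algebra_simps sum_subtractf)

lemma matrix_mult_diff_assoc:
  fixes P N R X :: "complex^'n^'n"
  shows "(P ** N - R) ** X = P ** (N ** X) - R ** X"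
  by (simp add: matrix_diff_distribs(1) matrix_mul_assoc)

definition block :: "complex^'n^'n \<Rightarrow> complex^'n^'n \<Rightarrow> complex^'n^'n \<Rightarrow> complex^'n^'n \<Rightarrow> complex^('n+'n)^('n+'n)" where
  "block A B C D = (\<chi> i k. case i of
     Inl a \<Rightarrow> (case k of Inl c \<Rightarrow> A $ a $ c | Inr c \<Rightarrow> B $ a $ c)
   | Inr a \<Rightarrow> (case k of Inl c \<Rightarrow> C $ a $ c | Inr c \<Rightarrow> D $ a $ c))"

lemma block_mult:
  fixes A B C D :: "complex^'n^'n"
  shows "block A B C D ** block A' B' C' D' = block (A ** A' + B ** C') (A ** B' + B ** D') (C ** A' + D ** C') (C ** B' + D ** D')"
proof -
  have split: "(\<Sum>k\<in>UNIV. f k) = (\<Sum>a\<in>UNIV. f (Inl a)) + (\<Sum>a\<in>UNIV. f (Inr a))" for f :: "'n + 'n \<Rightarrow> complex"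
    by (simp add: UNIV_Plus_UNIV[symmetric] sum.Plus del: UNIV_Plus_UNIV)
  show ?thesis
    by (simp add: block_def matrix_matrix_mult_def vec_eq_iff split split: sum.split)
qed

lemma block_one: "block (mat 1) 0 0 (mat 1) = mat 1"
  by (simp add: block_def mat_def vec_eq_iff split: sum.split)

lemma block_eq: "block A B C D = block A' B' C' D' \<Longrightarrow> A = A' \<and> B = B' \<and> C = C' \<and> D = D'"
proof -
  assume h: "block A B C D = block A' B' C' D'"
  have e: "block A B C D $ i $ k = block A' B' C' D' $ i $ k" for i k by (simp add: h)
  show ?thesis
    using e[of "Inl _" "Inl _"] e[of "Inl _" "Inr _"] e[of "Inr _" "Inl _"] e[of "Inr _" "Inr _"]
    by (simp add: block_def vec_eq_iff)
qed

text \<open>The relations on the rows say that the block matrix has an explicit right inverse; for a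
  square matrix this is also a left inverse, and the product in the other order contains the
  relations on the columns.\<close>

lemma symplectic_transpose:
  fixes A B C D :: "complex^'n^'n"
  assumes ab: "A ** adjm B = B ** adjm A" and cd: "C ** adjm D - D ** adjm C = 0" and bc: "B ** adjm C - A ** adjm D = mat 1"
  shows "adjm B ** D = adjm D ** B" "adjm A ** C = adjm C ** A" "adjm B ** C = adjm D ** A + mat 1" "adjm A ** D = adjm C ** B - mat 1"
proof -
  have "adjm (B ** adjm C - A ** adjm D) = adjm (mat 1)" using bc by simp
  then have bc': "C ** adjm B - D ** adjm A = mat 1" by (simp add: adjm_simps adjm_mul)
  have "block A B C D ** block (- adjm D) (adjm B) (adjm C) (- adjm A) = block (mat 1) 0 0 (mat 1)"
    unfolding block_mult using ab cd bc bc' by (simp add: matrix_minus_mul)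
  then have "block (- adjm D) (adjm B) (adjm C) (- adjm A) ** block A B C D = block (mat 1) 0 0 (mat 1)"
    unfolding block_one by (simp add: matrix_left_right_inverse)
  from block_eq[OF this[unfolded block_mult]]
  have "adjm B ** C - adjm D ** A = mat 1" "adjm B ** D - adjm D ** B = 0" "adjm C ** A - adjm A ** C = 0" "adjm C ** B - adjm A ** D = mat 1"
    by (simp_all add: matrix_minus_mul)
  then show "adjm B ** D = adjm D ** B" "adjm A ** C = adjm C ** A" "adjm B ** C = adjm D ** A + mat 1" "adjm A ** D = adjm C ** B - mat 1"
    by (simp_all add: algebra_simps)
qed

text \<open>The parameters \<open>M\<close> and \<open>P\<close> are independent for the sake of two
  uses with \<open>P\<close> the adjoint of the m-matrix: \<open>M\<close> equal to \<open>P\<close>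
  gives the symmetry of \<open>Wfun\<close> under conjugation, and \<open>M\<close> the m-matrix
  itself gives positivity.\<close>

lemma symplectic_identity:
  fixes A B C D M P :: "complex^'n^'n"
  assumes "A ** adjm B = B ** adjm A" "C ** adjm D - D ** adjm C = 0" "B ** adjm C - A ** adjm D = mat 1"
  shows "(P ** adjm B - adjm A) ** (D ** M - C) - (P ** adjm D - adjm C) ** (B ** M - A) = M - P"
proof -
  note r = symplectic_transpose[OF assms]
  have 1: "(P ** adjm B - adjm A) ** (D ** M - C) = P ** (adjm B ** D) ** M - P ** (adjm B ** C) - ((adjm A ** D) ** M - adjm A ** C)"
    by (simp add: matrix_diff_distribs matrix_mul_assoc)
  have 2: "(P ** adjm D - adjm C) ** (B ** M - A) = P ** (adjm D ** B) ** M - P ** (adjm D ** A) - ((adjm C ** B) ** M - adjm C ** A)"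
    by (simp add: matrix_diff_distribs matrix_mul_assoc)
  show ?thesis
    unfolding 1 2 r by (simp add: matrix_diff_distribs matrix_add_ldistrib)
qed

lemma matrix_inv_unique:
  fixes N X :: "complex^'n^'n"
  assumes "invertible N" "N ** X = mat 1"
  shows "X = matrix_inv N"
  by (metis assms matrix_inv_left matrix_mul_assoc matrix_mul_lid matrix_mul_rid)

lemma holomorphic_det:
  fixes P :: "complex \<Rightarrow> complex^'n^'n"
  assumes "\<And>i k. (\<lambda>z. P z $ i $ k) holomorphic_on S"
  shows "(\<lambda>z. det (P z)) holomorphic_on S"
  unfolding det_def by (intro holomorphic_intros assms)

context star
begin

section \<open>From pointwise bounds to operator norms\<close>

text \<open>The norm of the function whose components are all 1; it converts supremum bounds into
  norm bounds.\<close>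

definition edge_const :: real where "edge_const = sqrt (\<Sum>j\<in>UNIV. 2 * (vj j - v))"

lemma edge_const_nonneg: "0 \<le> edge_const"
  using edges by (simp add: edge_const_def sum_nonneg less_imp_le)

lemma normG_bound:
  assumes M: "0 \<le> M" and b: "\<And>j x. x \<in> {v..vj j} \<Longrightarrow> cmod (fst (h j x)) \<le> M \<and> cmod (snd (h j x)) \<le> M"
  shows "normG v vj h \<le> edge_const * M"
proof (rule power2_le_imp_le)
  have "Re (einner j (h j) (h j)) \<le> 2 * (vj j - v) * M\<^sup>2" for j
  proof (cases "set_integrable lborel {v..vj j} (\<lambda>x. (cmod (fst (h j x)))\<^sup>2 + (cmod (snd (h j x)))\<^sup>2)")
    case True
    have "(LINT x:{v..vj j}|lborel. (cmod (fst (h j x)))\<^sup>2 + (cmod (snd (h j x)))\<^sup>2) \<le> (LINT x:{v..vj j}|lborel. 2 * M\<^sup>2)"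
    proof (rule set_integral_mono[OF True])
      show "set_integrable lborel {v..vj j} (\<lambda>x. 2 * M\<^sup>2)" by (intro borel_integrable_atLeastAtMost' continuous_intros)
      show "(cmod (fst (h j x)))\<^sup>2 + (cmod (snd (h j x)))\<^sup>2 \<le> 2 * M\<^sup>2" if "x \<in> {v..vj j}" for x
        using b[OF that] power_mono[of "cmod (fst (h j x))" M 2] power_mono[of "cmod (snd (h j x))" M 2] by auto
    qed
    also have "\<dots> = 2 * (vj j - v) * M\<^sup>2" using edges[of j] by (simp add: set_lebesgue_integral_def)
    finally show ?thesis by (simp add: einner_self)
  next
    case False
    \<comment> \<open>A non-integrable integrand has integral 0 by convention, so the bound holds
      without any measurability of \<open>h\<close>.\<close>
    then have "Re (einner j (h j) (h j)) = 0"
      unfolding einner_self set_lebesgue_integral_def set_integrable_def by (simp add: not_integrable_integral_eq)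
    then show ?thesis using edges[of j] M by (simp add: less_imp_le)
  qed
  then have "(normG v vj h)\<^sup>2 \<le> (\<Sum>j\<in>UNIV. 2 * (vj j - v) * M\<^sup>2)" unfolding normG_sq by (intro sum_mono)
  also have "\<dots> = (\<Sum>j\<in>UNIV. 2 * (vj j - v)) * M\<^sup>2" by (simp only: sum_distrib_right)
  also have "\<dots> = (edge_const * M)\<^sup>2"
    using edges by (simp add: edge_const_def power_mult_distrib sum_nonneg less_imp_le)
  finally show "(normG v vj h)\<^sup>2 \<le> (edge_const * M)\<^sup>2" .
qed (use edge_const_nonneg M in auto)

lemma bdd_lin_op_I:
  assumes m: "\<And>f j. L2G v vj f \<Longrightarrow> (\<lambda>x. indicator {v..vj j} x *\<^sub>R fst (T f j x)) \<in> borel_measurable lborel"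
    "\<And>f j. L2G v vj f \<Longrightarrow> (\<lambda>x. indicator {v..vj j} x *\<^sub>R snd (T f j x)) \<in> borel_measurable lborel"
    and lin: "\<And>f g a b j x. L2G v vj f \<Longrightarrow> L2G v vj g \<Longrightarrow> x \<in> {v..vj j} \<Longrightarrow>
       T (\<lambda>i x. addp (cs a (f i x)) (cs b (g i x))) j x = addp (cs a (T f j x)) (cs b (T g j x))"
    and cong: "\<And>f g j x. L2G v vj f \<Longrightarrow> L2G v vj g \<Longrightarrow> eqG v vj f g \<Longrightarrow> x \<in> {v..vj j} \<Longrightarrow> T f j x = T g j x"
    and K: "0 \<le> K" "\<And>f j x. L2G v vj f \<Longrightarrow> x \<in> {v..vj j} \<Longrightarrow> cmod (fst (T f j x)) \<le> K * normG v vj f \<and> cmod (snd (T f j x)) \<le> K * normG v vj f"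
  shows "bdd_lin_op v vj T"
proof -
  have sq: "sqint v (vj j) h" if "(\<lambda>x. indicator {v..vj j} x *\<^sub>R h x) \<in> borel_measurable lborel" "\<And>x. x \<in> {v..vj j} \<Longrightarrow> cmod (h x) \<le> M" for j h M
    unfolding sqint_def
  proof
    show "set_integrable lborel {v..vj j} (\<lambda>x. (cmod (h x))\<^sup>2)"
    proof (rule set_integrable_bound_lborel)
      show "set_integrable lborel {v..vj j} (\<lambda>x. M\<^sup>2)" by (intro borel_integrable_atLeastAtMost' continuous_intros)
      have "(\<lambda>x. (cmod (indicator {v..vj j} x *\<^sub>R h x))\<^sup>2) \<in> borel_measurable lborel" using that(1) by measurable
      moreover have "(\<lambda>x. (cmod (indicator {v..vj j} x *\<^sub>R h x))\<^sup>2) = (\<lambda>x. indicator {v..vj j} x *\<^sub>R (cmod (h x))\<^sup>2)"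
        by (auto simp: indicator_def)
      ultimately show "(\<lambda>x. indicator {v..vj j} x *\<^sub>R (cmod (h x))\<^sup>2) \<in> borel_measurable lborel" by simp
      show "norm ((cmod (h x))\<^sup>2) \<le> M\<^sup>2" if "x \<in> {v..vj j}" for x
        using power_mono[OF \<open>\<And>x. x \<in> {v..vj j} \<Longrightarrow> cmod (h x) \<le> M\<close>[OF that], of 2] by simp
    qed
  qed (rule that)
  have "L2G v vj (T f)" if "L2G v vj f" for f
    unfolding L2G_def using m[OF that] K(2)[OF that] by (auto intro!: sq[where M = "K * normG v vj f"])
  moreover have "eqG v vj (T f) (T g)" if "L2G v vj f" "L2G v vj g" "eqG v vj f g" for f g
    using cong[OF that] by (intro eqG_I)
  moreover have "eqG v vj (T (\<lambda>j x. addp (cs a (f j x)) (cs b (g j x)))) (\<lambda>j x. addp (cs a (T f j x)) (cs b (T g j x)))"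
    if "L2G v vj f" "L2G v vj g" for f g a b
    using lin[OF that] by (intro eqG_I)
  moreover have "normG v vj (T f) \<le> (edge_const * K) * normG v vj f" if "L2G v vj f" for f
    using normG_bound[of "K * normG v vj f" "T f"] K(2)[OF that] K(1) normG_nonneg[of f] by (simp add: mult.assoc)
  ultimately show ?thesis unfolding bdd_lin_op_def by blast
qed

text \<open>The local bounds hold for all arguments simultaneously, with \<open>normG v vj f\<close>
  as a factor, so the Taylor remainder at each point is an operator norm estimate; taking
  derivatives pointwise gives the derivative of the operator family.\<close>

lemma entire_bdd_opfunI:
  assumes 1: "\<And>j. entire_comp j (\<Phi> j)" and 2: "\<And>j. entire_comp j (\<Psi> j)" and F: "\<And>z f j x. F z f j x = (\<Phi> j z f x, \<Psi> j z f x)"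
  shows "entire_bdd_opfun v vj F"
proof -
  have unif: "\<exists>r>0. \<exists>K\<ge>0. \<forall>j. \<forall>z\<in>cball z0 r. \<forall>f. L2G v vj f \<longrightarrow> (\<forall>x\<in>{v..vj j}. cmod (\<Phi> j z f x) \<le> K * normG v vj f \<and> cmod (\<Psi> j z f x) \<le> K * normG v vj f)" for z0
  proof (rule finite_uniform_bound)
    fix j
    obtain r1 K1 where b1: "0 < r1" "0 \<le> K1" "\<And>z f x. z \<in> cball z0 r1 \<Longrightarrow> L2G v vj f \<Longrightarrow> x \<in> {v..vj j} \<Longrightarrow> cmod (\<Phi> j z f x) \<le> K1 * normG v vj f"
      using entire_compD(5)[OF 1, of z0 j] by metis
    obtain r2 K2 where b2: "0 < r2" "0 \<le> K2" "\<And>z f x. z \<in> cball z0 r2 \<Longrightarrow> L2G v vj f \<Longrightarrow> x \<in> {v..vj j} \<Longrightarrow> cmod (\<Psi> j z f x) \<le> K2 * normG v vj f"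
      using entire_compD(5)[OF 2, of z0 j] by metis
    have "cmod (\<Phi> j z f x) \<le> (K1 + K2) * normG v vj f \<and> cmod (\<Psi> j z f x) \<le> (K1 + K2) * normG v vj f"
      if "z \<in> cball z0 (min r1 r2)" "L2G v vj f" "x \<in> {v..vj j}" for z f x
      using b1(3)[of z f x] b2(3)[of z f x] that mult_nonneg_nonneg[OF b1(2) normG_nonneg[of f]] mult_nonneg_nonneg[OF b2(2) normG_nonneg[of f]]
      by (simp add: distrib_right)
    moreover have "0 < min r1 r2" "0 \<le> K1 + K2" using b1 b2 by auto
    ultimately show "\<exists>r>0. \<exists>K\<ge>0. \<forall>z\<in>cball z0 r. \<forall>f. L2G v vj f \<longrightarrow> (\<forall>x\<in>{v..vj j}. cmod (\<Phi> j z f x) \<le> K * normG v vj f \<and> cmod (\<Psi> j z f x) \<le> K * normG v vj f)"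
      by blast
  next
    fix j r K r' K'
    assume h: "\<forall>z\<in>cball z0 r. \<forall>f. L2G v vj f \<longrightarrow> (\<forall>x\<in>{v..vj j}. cmod (\<Phi> j z f x) \<le> K * normG v vj f \<and> cmod (\<Psi> j z f x) \<le> K * normG v vj f)"
      and le: "r' \<le> r" "K \<le> K'"
    show "\<forall>z\<in>cball z0 r'. \<forall>f. L2G v vj f \<longrightarrow> (\<forall>x\<in>{v..vj j}. cmod (\<Phi> j z f x) \<le> K' * normG v vj f \<and> cmod (\<Psi> j z f x) \<le> K' * normG v vj f)"
    proof (intro ballI allI impI)
      fix z f x assume a: "z \<in> cball z0 r'" "L2G v vj f" "x \<in> {v..vj j}"
      have "z \<in> cball z0 r" using a(1) le(1) by simp
      then have "cmod (\<Phi> j z f x) \<le> K * normG v vj f \<and> cmod (\<Psi> j z f x) \<le> K * normG v vj f" using h a(2,3) by blast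
      moreover have "K * normG v vj f \<le> K' * normG v vj f" using le(2) normG_nonneg[of f] by (rule mult_right_mono)
      ultimately show "cmod (\<Phi> j z f x) \<le> K' * normG v vj f \<and> cmod (\<Psi> j z f x) \<le> K' * normG v vj f" by linarith
    qed
  qed
  have "bdd_lin_op v vj (F z)" for z
  proof -
    obtain r K where rK: "0 < r" "0 \<le> K" "\<And>j z' f x. z' \<in> cball z r \<Longrightarrow> L2G v vj f \<Longrightarrow> x \<in> {v..vj j} \<Longrightarrow>
        cmod (\<Phi> j z' f x) \<le> K * normG v vj f \<and> cmod (\<Psi> j z' f x) \<le> K * normG v vj f"
      using unif[of z] by metis
    show ?thesis
    proof (rule bdd_lin_op_I[where K = K])
      show "(\<lambda>x. indicator {v..vj j} x *\<^sub>R fst (F z f j x)) \<in> borel_measurable lborel" if "L2G v vj f" for f j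
        using sqint_imp_measurable[OF continuous_imp_sqint[OF entire_compD(2)[OF 1 that]]] by (simp add: F)
      show "(\<lambda>x. indicator {v..vj j} x *\<^sub>R snd (F z f j x)) \<in> borel_measurable lborel" if "L2G v vj f" for f j
        using sqint_imp_measurable[OF continuous_imp_sqint[OF entire_compD(2)[OF 2 that]]] by (simp add: F)
      show "F z (\<lambda>i x. addp (cs a (f i x)) (cs b (g i x))) j x = addp (cs a (F z f j x)) (cs b (F z g j x))"
        if "L2G v vj f" "L2G v vj g" "x \<in> {v..vj j}" for f g a b j x
        using entire_compD(3)[OF 1 that] entire_compD(3)[OF 2 that] by (simp add: F addp_def cs_def)
      show "F z f j x = F z g j x" if "L2G v vj f" "L2G v vj g" "eqG v vj f g" "x \<in> {v..vj j}" for f g j x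
        using entire_compD(4)[OF 1 that] entire_compD(4)[OF 2 that] by (simp add: F)
      show "cmod (fst (F z f j x)) \<le> K * normG v vj f \<and> cmod (snd (F z f j x)) \<le> K * normG v vj f" if "L2G v vj f" "x \<in> {v..vj j}" for f j x
        using rK(3)[of z f x j] rK(1) that by (simp add: F)
    qed (rule rK)
  qed
  moreover have "\<exists>F'. bdd_lin_op v vj F' \<and>
        (\<forall>\<epsilon>>0. \<exists>\<delta>>0. \<forall>z. z \<noteq> z0 \<and> cmod (z - z0) < \<delta> \<longrightarrow>
           (\<forall>f. L2G v vj f \<longrightarrow>
              normG v vj (\<lambda>j x. subp (cs (1 / (z - z0)) (subp (F z f j x) (F z0 f j x))) (F' f j x)) \<le> \<epsilon> * normG v vj f))" for z0
  proof -
    obtain r K where rK: "0 < r" "0 \<le> K" "\<And>j z f x. z \<in> cball z0 r \<Longrightarrow> L2G v vj f \<Longrightarrow> x \<in> {v..vj j} \<Longrightarrow>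
        cmod (\<Phi> j z f x) \<le> K * normG v vj f \<and> cmod (\<Psi> j z f x) \<le> K * normG v vj f"
      using unif[of z0] by metis
    define F' where "F' f j x = (deriv (\<lambda>z. \<Phi> j z f x) z0, deriv (\<lambda>z. \<Psi> j z f x) z0)" for f j x
    have lin: "deriv (\<lambda>z. X z (\<lambda>i x. addp (cs a (f i x)) (cs b (g i x))) x) z0 = a * deriv (\<lambda>z. X z f x) z0 + b * deriv (\<lambda>z. X z g x) z0"
      if X: "entire_comp j X" and fg: "L2G v vj f" "L2G v vj g" and x: "x \<in> {v..vj j}" for X f g a b j x
    proof -
      have "((\<lambda>z. a * X z f x + b * X z g x) has_field_derivative (a * deriv (\<lambda>z. X z f x) z0 + b * deriv (\<lambda>z. X z g x) z0)) (at z0)"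
        by (intro DERIV_add DERIV_cmult holomorphic_derivI[OF entire_compD(1)[OF X]] fg x) auto
      then show ?thesis unfolding entire_compD(3)[OF X fg x] by (rule DERIV_imp_deriv)
    qed
    have "bdd_lin_op v vj F'"
    proof (rule bdd_lin_op_I[where K = "K / r"])
      show "(\<lambda>x. indicator {v..vj j} x *\<^sub>R fst (F' f j x)) \<in> borel_measurable lborel" if "L2G v vj f" for f j
        unfolding F'_def fst_conv by (rule deriv_measurable) (use entire_compD(1,2)[OF 1 that] in auto)
      show "(\<lambda>x. indicator {v..vj j} x *\<^sub>R snd (F' f j x)) \<in> borel_measurable lborel" if "L2G v vj f" for f j
        unfolding F'_def snd_conv by (rule deriv_measurable) (use entire_compD(1,2)[OF 2 that] in auto)
      show "F' (\<lambda>i x. addp (cs a (f i x)) (cs b (g i x))) j x = addp (cs a (F' f j x)) (cs b (F' g j x))"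
        if "L2G v vj f" "L2G v vj g" "x \<in> {v..vj j}" for f g a b j x
        using lin[OF 1 that] lin[OF 2 that] by (simp add: F'_def addp_def cs_def)
      show "F' f j x = F' g j x" if "L2G v vj f" "L2G v vj g" "eqG v vj f g" "x \<in> {v..vj j}" for f g j x
        unfolding F'_def entire_compD(4)[OF 1 that] entire_compD(4)[OF 2 that] ..
      show "cmod (fst (F' f j x)) \<le> K / r * normG v vj f \<and> cmod (snd (F' f j x)) \<le> K / r * normG v vj f" if "L2G v vj f" "x \<in> {v..vj j}" for f j x
      proof
        have "cmod (deriv (\<lambda>z. \<Phi> j z f x) z0) \<le> (K * normG v vj f) / r"
          by (rule deriv_bound[OF entire_compD(1)[OF 1 that] rK(1)]) (use rK(3) that in blast)
        then show "cmod (fst (F' f j x)) \<le> K / r * normG v vj f" by (simp add: F'_def)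
        have "cmod (deriv (\<lambda>z. \<Psi> j z f x) z0) \<le> (K * normG v vj f) / r"
          by (rule deriv_bound[OF entire_compD(1)[OF 2 that] rK(1)]) (use rK(3) that in blast)
        then show "cmod (snd (F' f j x)) \<le> K / r * normG v vj f" by (simp add: F'_def)
      qed
    qed (use rK in simp)
    moreover have "\<forall>\<epsilon>>0. \<exists>\<delta>>0. \<forall>z. z \<noteq> z0 \<and> cmod (z - z0) < \<delta> \<longrightarrow>
           (\<forall>f. L2G v vj f \<longrightarrow>
              normG v vj (\<lambda>j x. subp (cs (1 / (z - z0)) (subp (F z f j x) (F z0 f j x))) (F' f j x)) \<le> \<epsilon> * normG v vj f)"
    proof (intro allI impI)
      fix \<epsilon> :: real assume \<epsilon>: "0 < \<epsilon>"
      define C where "C = edge_const * (8 * K / r\<^sup>2)"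
      have C: "0 \<le> C" using edge_const_nonneg rK by (simp add: C_def)
      \<comment> \<open>The Taylor bound needs distance at most \<open>r/2\<close>; the summand 1
        covers \<open>C = 0\<close>.\<close>
      define \<delta> where "\<delta> = min (r/2) (\<epsilon> / (C + 1))"
      have \<delta>: "0 < \<delta>" using rK(1) \<epsilon> C by (simp add: \<delta>_def)
      have quot: "cmod (1 / (z - z0) * (X z f x - X z0 f x) - deriv (\<lambda>z. X z f x) z0) \<le> 8 * (K * normG v vj f) / r\<^sup>2 * cmod (z - z0)"
        if X: "entire_comp j X" and b: "\<And>w. w \<in> cball z0 r \<Longrightarrow> cmod (X w f x) \<le> K * normG v vj f" and f: "L2G v vj f" and x: "x \<in> {v..vj j}"
          and z: "z \<noteq> z0" "cmod (z - z0) \<le> r/2" for X f x z j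
      proof -
        have h: "cmod (z - z0) > 0" using z(1) by simp
        have "1 / (z - z0) * (X z f x - X z0 f x) - deriv (\<lambda>z. X z f x) z0 = (X z f x - X z0 f x - (z - z0) * deriv (\<lambda>z. X z f x) z0) / (z - z0)"
          using z(1) by (simp add: field_simps)
        then have "cmod (1 / (z - z0) * (X z f x - X z0 f x) - deriv (\<lambda>z. X z f x) z0) = cmod (X z f x - X z0 f x - (z - z0) * deriv (\<lambda>z. X z f x) z0) / cmod (z - z0)"
          by (simp only: norm_divide)
        also have "\<dots> \<le> (8 * (K * normG v vj f) / r\<^sup>2 * (cmod (z - z0))\<^sup>2) / cmod (z - z0)"
          by (intro divide_right_mono taylor_bound[OF entire_compD(1)[OF X f x] rK(1) b z(2)]) simp_all
        also have "\<dots> = 8 * (K * normG v vj f) / r\<^sup>2 * cmod (z - z0)" using h by (simp add: power2_eq_square)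
        finally show ?thesis .
      qed
      have "normG v vj (\<lambda>j x. subp (cs (1 / (z - z0)) (subp (F z f j x) (F z0 f j x))) (F' f j x)) \<le> \<epsilon> * normG v vj f"
        if z: "z \<noteq> z0" "cmod (z - z0) < \<delta>" and f: "L2G v vj f" for z f
      proof -
        have zr: "cmod (z - z0) \<le> r/2" using z(2) by (simp add: \<delta>_def)
        define M where "M = 8 * (K * normG v vj f) / r\<^sup>2 * cmod (z - z0)"
        have M: "0 \<le> M" using rK normG_nonneg[of f] by (simp add: M_def)
        have "normG v vj (\<lambda>j x. subp (cs (1 / (z - z0)) (subp (F z f j x) (F z0 f j x))) (F' f j x)) \<le> edge_const * M"
        proof (rule normG_bound[OF M])
          fix j x assume x: "x \<in> {v..vj j}"
          have bb: "\<And>w. w \<in> cball z0 r \<Longrightarrow> cmod (\<Phi> j w f x) \<le> K * normG v vj f" "\<And>w. w \<in> cball z0 r \<Longrightarrow> cmod (\<Psi> j w f x) \<le> K * normG v vj f"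
            using rK(3)[OF _ f x] by auto
          show "cmod (fst (subp (cs (1 / (z - z0)) (subp (F z f j x) (F z0 f j x))) (F' f j x))) \<le> M
            \<and> cmod (snd (subp (cs (1 / (z - z0)) (subp (F z f j x) (F z0 f j x))) (F' f j x))) \<le> M"
            unfolding M_def subp_def cs_def F F'_def fst_conv snd_conv
            by (intro conjI quot[OF 1 bb(1) f x z(1) zr] quot[OF 2 bb(2) f x z(1) zr])
        qed
        also have "\<dots> = (C * cmod (z - z0)) * normG v vj f" by (simp add: M_def C_def)
        also have "\<dots> \<le> \<epsilon> * normG v vj f"
        proof (rule mult_right_mono[OF _ normG_nonneg])
          have "C * cmod (z - z0) \<le> (C + 1) * (\<epsilon> / (C + 1))"
            using z(2) C \<epsilon> by (intro mult_mono) (auto simp: \<delta>_def)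
          then show "C * cmod (z - z0) \<le> \<epsilon>" using C by simp
        qed
        finally show ?thesis .
      qed
      with \<delta> show "\<exists>\<delta>>0. \<forall>z. z \<noteq> z0 \<and> cmod (z - z0) < \<delta> \<longrightarrow>
           (\<forall>f. L2G v vj f \<longrightarrow>
              normG v vj (\<lambda>j x. subp (cs (1 / (z - z0)) (subp (F z f j x) (F z0 f j x))) (F' f j x)) \<le> \<epsilon> * normG v vj f)" by blast
    qed
    ultimately show ?thesis by blast
  qed
  ultimately show ?thesis unfolding entire_bdd_opfun_def by blast
qed

section \<open>The entire remainder\<close>

text \<open>The resolvent boundary vectors with \<open>X = matrix_inv (B ** MM z - A)\<close>
  replaced by \<open>adjm D\<close> and \<open>MM z ** X\<close> by \<open>adjm C\<close>: what is
  left after splitting off the W term. No m-function occurs any more.\<close>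

definition Wrest :: "complex^'n^'n \<Rightarrow> complex^'n^'n \<Rightarrow> complex^'n^'n \<Rightarrow> complex^'n^'n \<Rightarrow> complex \<Rightarrow> 'n gfun \<Rightarrow> 'n gfun" where
  "Wrest A B C D z g = SolG z (vec_pair (Iv 2 z g - adjm D *v (B *v Iv 1 z g - A *v Iv 2 z g))
      (- Iv 1 z g + adjm C *v (B *v Iv 1 z g - A *v Iv 2 z g))) g"

lemma entire_comp_matrix: "entire_comp j (\<lambda>z f x. (N *v Iv b z f) $ i)"
proof -
  have "entire_comp j (\<lambda>z f x. \<Sum>k\<in>UNIV. N $ i $ k * Ib b z f k)"
    by (intro entire_comp_sum entire_comp_cmult entire_comp_Ib) auto
  then show ?thesis by (simp add: matrix_vector_mult_def Iv_def)
qed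

lemma entire_Wrest: "entire_bdd_opfun v vj (Wrest A B C D)"
proof (rule entire_bdd_opfunI)
  let ?a = "\<lambda>j z f x. (Iv 2 z f - adjm D *v (B *v Iv 1 z f - A *v Iv 2 z f)) $ j - (LINT t:{v..x}|lborel. dotp (col j z 2 t) (f j t))"
  let ?b = "\<lambda>j z f x. (- Iv 1 z f + adjm C *v (B *v Iv 1 z f - A *v Iv 2 z f)) $ j + (LINT t:{v..x}|lborel. dotp (col j z 1 t) (f j t))"
  have a: "entire_comp j (?a j)" for j
  proof -
    have "entire_comp j (\<lambda>z f x. Ib 2 z f j + (-1) * ((adjm D ** B) *v Iv 1 z f) $ j + ((adjm D ** A) *v Iv 2 z f) $ j
       + (-1) * (LINT t:{v..x}|lborel. dotp (col j z 2 t) (f j t)))"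
      by (intro entire_comp_add entire_comp_cmult entire_comp_matrix entire_comp_Ib entire_comp_LINT_upto)
    moreover have "(\<lambda>z f x. Ib 2 z f j + (-1) * ((adjm D ** B) *v Iv 1 z f) $ j + ((adjm D ** A) *v Iv 2 z f) $ j
       + (-1) * (LINT t:{v..x}|lborel. dotp (col j z 2 t) (f j t))) = ?a j"
      by (simp add: fun_eq_iff vec.diff matrix_vector_mul_assoc Iv_def)
    ultimately show ?thesis by simp
  qed
  have b: "entire_comp j (?b j)" for j
  proof -
    have "entire_comp j (\<lambda>z f x. (-1) * Ib 1 z f j + ((adjm C ** B) *v Iv 1 z f) $ j + (-1) * ((adjm C ** A) *v Iv 2 z f) $ j
       + (LINT t:{v..x}|lborel. dotp (col j z 1 t) (f j t)))"
      by (intro entire_comp_add entire_comp_cmult entire_comp_matrix entire_comp_Ib entire_comp_LINT_upto)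
    moreover have "(\<lambda>z f x. (-1) * Ib 1 z f j + ((adjm C ** B) *v Iv 1 z f) $ j + (-1) * ((adjm C ** A) *v Iv 2 z f) $ j
       + (LINT t:{v..x}|lborel. dotp (col j z 1 t) (f j t))) = ?b j"
      by (simp add: fun_eq_iff vec.diff matrix_vector_mul_assoc Iv_def)
    ultimately show ?thesis by simp
  qed
  show "entire_comp j (\<lambda>z f x. fst (col j z 1 x) * ?a j z f x + fst (col j z 2 x) * ?b j z f x)" for j
    by (intro entire_comp_add entire_comp_mult entire_mult_col a b)
  show "entire_comp j (\<lambda>z f x. snd (col j z 1 x) * ?a j z f x + snd (col j z 2 x) * ?b j z f x)" for j
    by (intro entire_comp_add entire_comp_mult entire_mult_col a b)
  show "Wrest A B C D z f j x = (fst (col j z 1 x) * ?a j z f x + fst (col j z 2 x) * ?b j z f x, snd (col j z 1 x) * ?a j z f x + snd (col j z 2 x) * ?b j z f x)" for z f j x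
    by (simp add: Wrest_def SolG_def SolE_def vec_pair_def lincomb_def mult.commute)
qed

lemma Ivec_eq: "Ivec v vj p q z g j = (Ib 1 z g j, Ib 2 z g j)"
  by (simp add: Ivec_def Ib_def Y_cnj dotp_def col_def)

definition Wfun :: "complex^'n^'n \<Rightarrow> complex^'n^'n \<Rightarrow> complex^'n^'n \<Rightarrow> complex^'n^'n \<Rightarrow> complex \<Rightarrow> complex^'n^'n" where
  "Wfun A B C D z = (D ** MM z - C) ** matrix_inv (B ** MM z - A)"

lemma resolvent_Wfun:
  fixes A B C D :: "complex^'n^'n"
  assumes rk: "rank (hcat A B) = CARD('n)" and ab: "A ** adjm B = B ** adjm A"
    and cd: "C ** adjm D - D ** adjm C = 0" and bc: "B ** adjm C - A ** adjm D = mat 1" and z: "Im z \<noteq> 0" and g: "L2G v vj g"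
  shows "eqG v vj (resolv (TAB v vj p q \<alpha> A B) z g)
     (\<lambda>j x. addp (Wterm v vj p q A B (Wfun A B C D z) z g j x) (Wrest A B C D z g j x))"
proof -
  note r = symplectic_transpose[OF ab cd bc]
  let ?N = "B ** MM z - A"
  let ?X = "matrix_inv ?N"
  let ?u = "Iv 1 z g" and ?w = "Iv 2 z g"
  let ?y = "B *v ?u - A *v ?w"
  have inv: "invertible ?N" by (rule nonreal_invertible[OF rk ab z])
  have NX: "?N ** ?X = mat 1" "?X ** ?N = mat 1" using matrix_inv_right[OF inv] matrix_inv_left[OF inv] by auto
  \<comment> \<open>The column relations split off a left multiple of the denominator
    \<open>?N\<close>; multiplying by its inverse turns this multiple into the constant
    \<open>adjm D\<close> and leaves only \<open>?X\<close>.\<close>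
  have "adjm B ** (D ** MM z - C) = adjm D ** ?N - mat 1"
    by (simp add: matrix_diff_distribs matrix_mul_assoc r)
  then have "adjm B ** Wfun A B C D z = (adjm D ** ?N - mat 1) ** ?X" unfolding Wfun_def matrix_mul_assoc by simp
  then have BW: "adjm B ** Wfun A B C D z = adjm D - ?X"
    by (simp only: matrix_mult_diff_assoc[of "adjm D" ?N "mat 1" ?X] NX matrix_mul_rid matrix_mul_lid)
  have "adjm A ** (D ** MM z - C) = adjm C ** ?N - MM z"
    by (simp add: matrix_diff_distribs matrix_mul_assoc r)
  then have "adjm A ** Wfun A B C D z = (adjm C ** ?N - MM z) ** ?X" unfolding Wfun_def matrix_mul_assoc by simp
  then have AW: "adjm A ** Wfun A B C D z = adjm C - MM z ** ?X"
    by (simp only: matrix_mult_diff_assoc[of "adjm C" ?N "MM z" ?X] NX matrix_mul_rid)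
  \<comment> \<open>Writing the right-hand side of the boundary system through
    \<open>?N *v ?w\<close> lets the inverse cancel and leaves \<open>?X\<close> acting on the
    vector \<open>?y\<close>, on which W acts in the representation.\<close>
  have "B *v (MM z *v ?w - ?u) = ?N *v ?w - ?y"
    by (simp add: vec.diff matrix_vector_mult_diff_rdistrib matrix_vector_mul_assoc)
  then have "xi1 A B z g = ?X *v (?N *v ?w - ?y)" unfolding xi1_def by simp
  then have x1: "xi1 A B z g = ?w - ?X *v ?y" by (simp add: vec.diff matrix_vector_mul_assoc NX)
  have x2: "xi2 A B z g = - ?u + MM z *v (?X *v ?y)" unfolding xi2_def x1 by simp
  have e1: "xi1 A B z g = adjm B *v (Wfun A B C D z *v ?y) + (?w - adjm D *v ?y)"
    unfolding matrix_vector_mul_assoc BW x1 by (simp add: matrix_vector_mult_diff_rdistrib)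
  have e2: "xi2 A B z g = - (adjm A *v (Wfun A B C D z *v ?y)) + (- ?u + adjm C *v ?y)"
    unfolding matrix_vector_mul_assoc AW x2 by (simp add: matrix_vector_mult_diff_rdistrib matrix_vector_mul_assoc)
  have uw: "(\<chi> j. fst (Ivec v vj p q z g j)) = ?u" "(\<chi> j. snd (Ivec v vj p q z g j)) = ?w"
    by (simp_all add: Ivec_eq Iv_def)
  have pt: "SolG z (vec_pair (xi1 A B z g) (xi2 A B z g)) g j x = addp (Wterm v vj p q A B (Wfun A B C D z) z g j x) (Wrest A B C D z g j x)" for j x
    unfolding Wrest_def SolG_def SolE_def e1 e2 Wterm_def Let_def uw vec_pair_def
    by (simp add: addp_def lincomb_def col_def algebra_simps)
  show ?thesis
    by (rule eqG_trans[OF resolv_SolG[OF cf_nonzero[OF z] inv g]]) (rule eqG_I, rule pt)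
qed

section \<open>The Nevanlinna properties\<close>

lemma MM_cnj: "MM (cnj z) = adjm (MM z)"
  by (auto simp: Mmat_def adjm_def vec_eq_iff mf_cnj)

lemma Wfun_cnj:
  fixes A B C D :: "complex^'n^'n"
  assumes rk: "rank (hcat A B) = CARD('n)" and ab: "A ** adjm B = B ** adjm A"
    and cd: "C ** adjm D - D ** adjm C = 0" and bc: "B ** adjm C - A ** adjm D = mat 1" and z: "Im z \<noteq> 0"
  shows "Wfun A B C D (cnj z) = adjm (Wfun A B C D z)"
proof -
  let ?P = "adjm (MM z)"
  let ?N = "B ** MM z - A" and ?N' = "B ** ?P - A"
  let ?X = "matrix_inv ?N" and ?X' = "matrix_inv ?N'"
  have inv: "invertible ?N" by (rule nonreal_invertible[OF rk ab z])
  have inv': "invertible ?N'" using nonreal_invertible[OF rk ab, of "cnj z"] z by (simp add: MM_cnj)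
  \<comment> \<open>With both parameters equal the right-hand side of
    \<open>symplectic_identity\<close> is 0; multiplying by the two inverses gives the
    claim.\<close>
  have id: "adjm ?N ** (D ** ?P - C) = adjm (D ** MM z - C) ** ?N'"
    using symplectic_identity[OF ab cd bc, of ?P ?P] by (simp add: adjm_simps adjm_mul)
  have "adjm (?N ** ?X) = mat 1" using matrix_inv_right[OF inv] by (simp add: adjm_simps)
  then have XN: "adjm ?X ** adjm ?N = mat 1" by (simp add: adjm_mul)
  have "Wfun A B C D (cnj z) = adjm ?X ** adjm ?N ** (D ** ?P - C) ** ?X'"
    unfolding Wfun_def MM_cnj XN by simp
  also have "\<dots> = adjm ?X ** (adjm ?N ** (D ** ?P - C)) ** ?X'" by (simp only: matrix_mul_assoc)
  also have "\<dots> = adjm ?X ** (adjm (D ** MM z - C) ** ?N') ** ?X'" by (simp only: id)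
  also have "\<dots> = adjm ?X ** adjm (D ** MM z - C) ** (?N' ** ?X')" by (simp only: matrix_mul_assoc)
  also have "\<dots> = adjm (Wfun A B C D z)"
    unfolding matrix_inv_right[OF inv'] by (simp add: Wfun_def adjm_mul)
  finally show ?thesis .
qed

text \<open>Substituting \<open>x = N y\<close> removes the inverse: the difference of the two
  quadratic expressions in \<open>x\<close> becomes the form of \<open>M - adjm M\<close> at
  \<open>y\<close>, which is diagonal with entries controlled by \<open>Im_mf\<close>.\<close>

lemma Wfun_nonneg:
  fixes A B C D :: "complex^'n^'n" and x :: "complex^'n"
  assumes rk: "rank (hcat A B) = CARD('n)" and ab: "A ** adjm B = B ** adjm A"
    and cd: "C ** adjm D - D ** adjm C = 0" and bc: "B ** adjm C - A ** adjm D = mat 1" and z: "Im z \<noteq> 0"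
  obtains s where "0 \<le> s" "(\<Sum>i\<in>UNIV. \<Sum>k\<in>UNIV. cnj (x $ i) * (Wfun A B C D z $ i $ k - cnj (Wfun A B C D z $ k $ i)) * x $ k) = 2 * \<i> * of_real (Im z) * of_real s"
proof -
  let ?M = "MM z" and ?W = "Wfun A B C D z"
  let ?N = "B ** ?M - A" and ?Q = "D ** ?M - C"
  have inv: "invertible ?N" by (rule nonreal_invertible[OF rk ab z])
  define y where "y = matrix_inv ?N *v x"
  have xy: "x = ?N *v y" by (simp add: y_def matrix_vector_mul_assoc matrix_inv_right[OF inv])
  have Wx: "?W *v x = ?Q *v y" by (simp add: Wfun_def y_def matrix_vector_mul_assoc)
  have cd1: "cdot (adjm ?Q *v x) y = cdot x (?W *v x)"
    unfolding cdot_adjm Wx ..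
  have cd2: "cdot (adjm ?N *v (?Q *v y)) y = cdot (?W *v x) x"
    by (simp only: cdot_adjm Wx xy[symmetric])
  have 1: "(\<Sum>i\<in>UNIV. \<Sum>k\<in>UNIV. cnj (x $ i) * (?W $ i $ k - cnj (?W $ k $ i)) * x $ k) = cdot (?W *v x) x - cdot x (?W *v x)"
  proof -
    have "(\<Sum>i\<in>UNIV. \<Sum>k\<in>UNIV. cnj (x $ i) * (?W $ i $ k - cnj (?W $ k $ i)) * x $ k)
      = (\<Sum>i\<in>UNIV. \<Sum>k\<in>UNIV. cnj (x $ i) * ?W $ i $ k * x $ k) - (\<Sum>i\<in>UNIV. \<Sum>k\<in>UNIV. cnj (x $ i) * cnj (?W $ k $ i) * x $ k)"
      by (simp add: algebra_simps sum_subtractf)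
    also have "(\<Sum>i\<in>UNIV. \<Sum>k\<in>UNIV. cnj (x $ i) * ?W $ i $ k * x $ k) = cdot (?W *v x) x"
      by (simp add: cdot_def matrix_vector_mult_def sum_distrib_left ac_simps)
    also have "(\<Sum>i\<in>UNIV. \<Sum>k\<in>UNIV. cnj (x $ i) * cnj (?W $ k $ i) * x $ k) = cdot x (?W *v x)"
      by (subst sum.swap) (simp add: cdot_def matrix_vector_mult_def sum_distrib_left ac_simps)
    finally show ?thesis .
  qed
  have id: "adjm ?N ** ?Q - adjm ?Q ** ?N = ?M - adjm ?M"
    using symplectic_identity[OF ab cd bc, of "adjm ?M" ?M] by (simp add: adjm_simps adjm_mul)
  have "cdot (?W *v x) x - cdot x (?W *v x) = cdot ((adjm ?N ** ?Q - adjm ?Q ** ?N) *v y) y"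
  proof -
    have "(adjm ?N ** ?Q - adjm ?Q ** ?N) *v y = adjm ?N *v (?Q *v y) - adjm ?Q *v x"
      by (simp only: matrix_vector_mult_diff_rdistrib[of "adjm ?N ** ?Q" "adjm ?Q ** ?N" y] xy matrix_vector_mul_assoc)
    then show ?thesis by (simp only: cdot_simps(3) cd1 cd2)
  qed
  also have "\<dots> = (\<Sum>j\<in>UNIV. (mf j z - cnj (mf j z)) * of_real ((cmod (y $ j))\<^sup>2))"
    unfolding id matrix_vector_mult_diff_rdistrib MM_cnj[symmetric] cdot_def complex_norm_square
    by (intro sum.cong refl) (simp add: MM_vec mf_cnj algebra_simps)
  finally have 2: "cdot (?W *v x) x - cdot x (?W *v x) = (\<Sum>j\<in>UNIV. (mf j z - cnj (mf j z)) * of_real ((cmod (y $ j))\<^sup>2))" .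
  have "\<forall>j. \<exists>r. 0 < r \<and> Im (mf j z) = Im z * r" using Im_mf[OF z] by blast
  then obtain r where r: "\<And>j. 0 < r j" "\<And>j. Im (mf j z) = Im z * r j" by metis
  have 3: "mf j z - cnj (mf j z) = 2 * \<i> * of_real (Im z) * of_real (r j)" for j
    using r(2)[of j] by (simp add: complex_eq_iff)
  define s where "s = (\<Sum>j\<in>UNIV. r j * (cmod (y $ j))\<^sup>2)"
  have "0 \<le> s" unfolding s_def using r(1) by (intro sum_nonneg mult_nonneg_nonneg) (auto intro: less_imp_le)
  moreover have "(\<Sum>j\<in>UNIV. (mf j z - cnj (mf j z)) * of_real ((cmod (y $ j))\<^sup>2)) = 2 * \<i> * of_real (Im z) * of_real s"
    unfolding 3 s_def of_real_sum sum_distrib_left by (simp add: mult.assoc)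
  ultimately show thesis using that[of s] 1 2 by simp
qed

section \<open>Meromorphy by clearing denominators\<close>

definition diag_c :: "complex \<Rightarrow> complex^'n^'n" where "diag_c z = (\<chi> i k. if i = k then cf i z else 0)"

text \<open>\<open>B ** MM z - A\<close> with column \<open>k\<close> multiplied by
  \<open>cf k z\<close>: the denominators of the m-functions cancel and the entries are
  entire.\<close>

definition pencil :: "complex^'n^'n \<Rightarrow> complex^'n^'n \<Rightarrow> complex \<Rightarrow> complex^'n^'n" where
  "pencil A B z = (\<chi> i k. B $ i $ k * bf k z - A $ i $ k * cf k z)"

lemma diag_mult: "(N ** (\<chi> i k. if i = k then d i else 0)) $ i $ k = N $ i $ k * d k" for N :: "complex^'n^'n"
proof -
  have "(N ** (\<chi> i k. if i = k then d i else 0)) $ i $ k = (\<Sum>l\<in>UNIV. if l = k then N $ i $ l * d k else 0)"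
  proof -
    have "(N ** (\<chi> i k. if i = k then d i else 0)) $ i $ k = (\<Sum>l\<in>UNIV. N $ i $ l * (if l = k then d l else 0))"
      by (simp add: matrix_matrix_mult_def)
    also have "\<dots> = (\<Sum>l\<in>UNIV. if l = k then N $ i $ l * d k else 0)" by (rule sum.cong) auto
    finally show ?thesis .
  qed
  then show ?thesis by simp
qed

lemma pencil_eq:
  assumes c: "\<And>j. cf j z \<noteq> 0"
  shows "pencil A B z = (B ** MM z - A) ** diag_c z"
proof -
  have "((B ** MM z - A) ** diag_c z) $ i $ k = pencil A B z $ i $ k" for i k
    unfolding diag_c_def diag_mult Mmat_def vector_minus_component diag_mult pencil_def using c[of k]
    by (simp add: mfun_def field_simps)
  then show ?thesis by (simp add: vec_eq_iff)
qed

lemma pencil_holomorphic: "(\<lambda>z. pencil A B z $ i $ k) holomorphic_on UNIV"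
  unfolding pencil_def by (simp, intro holomorphic_intros bf_holomorphic cf_holomorphic)

text \<open>In the quotient defining \<open>Wfun\<close> the common right factor
  \<open>diag_c\<close> cancels, and Cramer's rule for the remaining inverse yields a quotient of
  entire functions.\<close>

lemma Wfun_formula:
  fixes A B C D :: "complex^'n^'n"
  assumes c: "\<And>j. cf j z \<noteq> 0" and d: "det (pencil A B z) \<noteq> 0"
  shows "Wfun A B C D z $ i $ k = (\<Sum>l\<in>UNIV. pencil C D z $ i $ l *
     det (\<chi> a b. if b = l then axis k 1 $ a else pencil A B z $ a $ b)) / det (pencil A B z)"
proof -
  let ?N = "B ** MM z - A"
  have dP: "det (pencil A B z) = det ?N * det (diag_c z)" unfolding pencil_eq[OF c] by (rule det_mul)
  then have "det ?N \<noteq> 0" "det (diag_c z) \<noteq> 0" using d by auto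
  then have inv: "invertible ?N" "invertible (pencil A B z)" "invertible (diag_c z)" using d by (simp_all add: invertible_det_nz)
  have "diag_c z ** matrix_inv (pencil A B z) = matrix_inv ?N"
  proof (rule matrix_inv_unique[OF inv(1)])
    show "?N ** (diag_c z ** matrix_inv (pencil A B z)) = mat 1"
      using matrix_inv_right[OF inv(2)] unfolding pencil_eq[OF c] by (simp add: matrix_mul_assoc)
  qed
  then have W: "Wfun A B C D z = pencil C D z ** matrix_inv (pencil A B z)"
    unfolding Wfun_def pencil_eq[OF c, of C D] by (metis matrix_mul_assoc)
  have col: "matrix_inv (pencil A B z) $ l $ k = det (\<chi> a b. if b = l then axis k 1 $ a else pencil A B z $ a $ b) / det (pencil A B z)" for l
  proof -
    have "pencil A B z *v (matrix_inv (pencil A B z) *v axis k 1) = axis k 1"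
      by (simp add: matrix_vector_mul_assoc matrix_inv_right[OF inv(2)])
    then have "matrix_inv (pencil A B z) *v axis k 1 = (\<chi> l. det (\<chi> a b. if b = l then axis k 1 $ a else pencil A B z $ a $ b) / det (pencil A B z))"
      unfolding cramer[OF d] .
    moreover have "(matrix_inv (pencil A B z) *v axis k 1) $ l = matrix_inv (pencil A B z) $ l $ k"
    proof -
      have "(matrix_inv (pencil A B z) *v axis k 1) $ l = (\<Sum>m\<in>UNIV. if m = k then matrix_inv (pencil A B z) $ l $ m else 0)"
      proof -
        have "(matrix_inv (pencil A B z) *v axis k 1) $ l = (\<Sum>m\<in>UNIV. matrix_inv (pencil A B z) $ l $ m * axis k 1 $ m)"
          by (simp only: matrix_vector_mult_def vec_lambda_beta)
        also have "\<dots> = (\<Sum>m\<in>UNIV. if m = k then matrix_inv (pencil A B z) $ l $ m else 0)"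
          by (rule sum.cong) (auto simp: axis_def)
        finally show ?thesis .
      qed
      then show ?thesis by simp
    qed
    ultimately show ?thesis by simp
  qed
  show ?thesis
    unfolding W by (simp add: matrix_matrix_mult_def col sum_divide_distrib)
qed

lemma det_pencil_nonzero:
  fixes A B :: "complex^'n^'n"
  assumes rk: "rank (hcat A B) = CARD('n)" and ab: "A ** adjm B = B ** adjm A" and z: "Im z \<noteq> 0"
  shows "det (pencil A B z) \<noteq> 0"
proof -
  have "det (diag_c z) = (\<Prod>i\<in>UNIV. diag_c z $ i $ i)" by (rule det_diagonal) (simp add: diag_c_def)
  then have "det (diag_c z) \<noteq> 0" using cf_nonzero[OF z] by (simp add: diag_c_def)
  moreover have "det (B ** MM z - A) \<noteq> 0" using nonreal_invertible[OF rk ab z] by (simp add: invertible_det_nz)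
  ultimately show ?thesis unfolding pencil_eq[OF cf_nonzero[OF z]] by (simp add: det_mul)
qed

lemma Wfun_mero_nevanlinna:
  fixes A B C D :: "complex^'n^'n"
  assumes rk: "rank (hcat A B) = CARD('n)" and ab: "A ** adjm B = B ** adjm A"
    and cd: "C ** adjm D - D ** adjm C = 0" and bc: "B ** adjm C - A ** adjm D = mat 1"
  shows "mero_nevanlinna (Wfun A B C D)"
  unfolding mero_nevanlinna_def
proof (intro conjI allI impI)
  define num where "num i k z = (\<Sum>l\<in>UNIV. pencil C D z $ i $ l *
     det (\<chi> a b. if b = l then axis k 1 $ a else pencil A B z $ a $ b))" for i k z
  define \<Delta> where "\<Delta> z = det (pencil A B z)" for z
  have num: "num i k holomorphic_on UNIV" for i k
  proof -
    have "(\<lambda>z. (\<chi> a b. if b = l then axis k 1 $ a else pencil A B z $ a $ b) $ i $ m) holomorphic_on UNIV" for l i m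
      using pencil_holomorphic by (cases "m = l") auto
    then show ?thesis unfolding num_def by (intro holomorphic_intros pencil_holomorphic holomorphic_det)
  qed
  have \<Delta>: "\<Delta> holomorphic_on UNIV" unfolding \<Delta>_def by (intro holomorphic_det pencil_holomorphic)
  have W: "Wfun A B C D z $ i $ k = num i k z / \<Delta> z" if "\<And>j. cf j z \<noteq> 0" "\<Delta> z \<noteq> 0" for z i k
    using Wfun_formula[of z A B C D i k] that unfolding num_def \<Delta>_def by blast
  have \<Delta>0: "\<Delta> z \<noteq> 0" if "Im z \<noteq> 0" for z unfolding \<Delta>_def by (rule det_pencil_nonzero[OF rk ab that])
  show "(\<lambda>z. Wfun A B C D z $ i $ k) meromorphic_on UNIV" for i k
  proof -
    \<comment> \<open>At a real point the conventions for division by zero and for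
      \<open>matrix_inv\<close> of a singular matrix may give \<open>Wfun\<close> a different value,
      so equality is claimed in punctured neighbourhoods. The exceptional points are isolated, since
      \<open>\<Delta>\<close> and every \<open>cf j\<close> are nonzero at the imaginary
      unit.\<close>
    have ev: "\<forall>\<^sub>F z in at z0. num i k z / \<Delta> z = Wfun A B C D z $ i $ k" for z0
    proof -
      have "\<forall>\<^sub>F z in at z0. \<Delta> z \<noteq> 0"
        using non_zero_neighbour_alt[OF \<Delta>, of z0 \<i>] \<Delta>0[of \<i>] by (auto elim: eventually_mono)
      moreover have "\<forall>\<^sub>F z in at z0. \<forall>j. cf j z \<noteq> 0"
      proof (rule eventually_all_finite)
        show "\<forall>\<^sub>F z in at z0. cf j z \<noteq> 0" for j
          using non_zero_neighbour_alt[OF cf_holomorphic, of z0 \<i> j] cf_nonzero[of \<i> j] by (auto elim: eventually_mono)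
      qed
      ultimately show ?thesis by eventually_elim (simp add: W)
    qed
    have "(\<lambda>z. num i k z / \<Delta> z) meromorphic_on UNIV"
      using num[of i k] \<Delta> by (intro meromorphic_on_divide analytic_on_imp_meromorphic_on) (auto simp: analytic_on_open)
    then show ?thesis using meromorphic_on_cong[OF ev refl] by blast
  qed
  show "(\<lambda>z. Wfun A B C D z $ i $ k) holomorphic_on {z. Im z \<noteq> 0}" for i k
  proof (rule holomorphic_transform)
    show "(\<lambda>z. num i k z / \<Delta> z) holomorphic_on {z. Im z \<noteq> 0}"
      using \<Delta>0 by (intro holomorphic_on_divide holomorphic_on_subset[OF num] holomorphic_on_subset[OF \<Delta>]) auto
    show "num i k z / \<Delta> z = Wfun A B C D z $ i $ k" if "z \<in> {z. Im z \<noteq> 0}" for z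
      using W[of z i k] \<Delta>0[of z] cf_nonzero[of z] that by simp
  qed
  show "Wfun A B C D (cnj z) = adjm (Wfun A B C D z)" if "Im z \<noteq> 0" for z by (rule Wfun_cnj[OF rk ab cd bc that])
  show "let r = (\<Sum>i\<in>UNIV. \<Sum>k\<in>UNIV. cnj (x $ i) * (Wfun A B C D z $ i $ k - cnj (Wfun A B C D z $ k $ i)) * x $ k) / (2 * \<i> * of_real (Im z))
         in Im r = 0 \<and> 0 \<le> Re r" if z: "Im z \<noteq> 0" for z x
  proof -
    obtain s where s: "0 \<le> s" "(\<Sum>i\<in>UNIV. \<Sum>k\<in>UNIV. cnj (x $ i) * (Wfun A B C D z $ i $ k - cnj (Wfun A B C D z $ k $ i)) * x $ k) = 2 * \<i> * of_real (Im z) * of_real s"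
      using Wfun_nonneg[OF rk ab cd bc z] by blast
    show ?thesis unfolding Let_def s(2) using z s(1) by simp
  qed
qed

end

theorem theorem4p4:
  fixes v :: real and vj :: "'n::finite \<Rightarrow> real"
    and p q :: "'n \<Rightarrow> real \<Rightarrow> real" and \<alpha> :: "'n \<Rightarrow> real"
  assumes edges: "\<And>j. v < vj j"
    and p_L1: "\<And>j. set_integrable lborel {v..vj j} (p j)"
    and q_L1: "\<And>j. set_integrable lborel {v..vj j} (q j)"
    and alpha: "\<And>j. 0 \<le> \<alpha> j \<and> \<alpha> j < pi"
  shows
    \<comment> \<open>(i) description of all self-adjoint extensions\<close>
    "(\<forall>T. self_adjoint_ext v vj (Smin v vj p q \<alpha>) T \<longleftrightarrow>
        (\<exists>A B :: complex^'n^'n. rank (hcat A B) = CARD('n) \<and> A ** adjm B = B ** adjm A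
            \<and> T = TAB v vj p q \<alpha> A B))
   \<and> \<comment> \<open>(ii) Krein-type resolvent formula\<close>
     (\<forall>A B :: complex^'n^'n. rank (hcat A B) = CARD('n) \<and> A ** adjm B = B ** adjm A \<longrightarrow>
       (\<forall>z. in_resolvent v vj (TAB v vj p q \<alpha> (mat 1) 0) z \<and> in_resolvent v vj (TAB v vj p q \<alpha> A B) z \<longrightarrow>
         (\<forall>g. L2G v vj g \<longrightarrow>
            eqG v vj (resolv (TAB v vj p q \<alpha> A B) z g)
              (\<lambda>j x. subp (resolv (TAB v vj p q \<alpha> (mat 1) 0) z g j x)
                 (GammaZ v vj p q \<alpha> z
                    ((matrix_inv (B ** Mmat v vj p q \<alpha> z - A) ** B) *v Gamma_adj v vj p q \<alpha> (cnj z) g) j x)))))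
   \<and> \<comment> \<open>(iii) the function W_{A,B} and the resolvent representation\<close>
     (\<forall>A B C D :: complex^'n^'n.
        rank (hcat A B) = CARD('n) \<and> A ** adjm B = B ** adjm A
        \<and> rank (hcat C D) = CARD('n) \<and> C ** adjm D - D ** adjm C = 0
        \<and> B ** adjm C - A ** adjm D = mat 1 \<longrightarrow>
       (let W = (\<lambda>z. (D ** Mmat v vj p q \<alpha> z - C) ** matrix_inv (B ** Mmat v vj p q \<alpha> z - A))
        in mero_nevanlinna W
           \<and> (\<exists>F. entire_bdd_opfun v vj F \<and>
                (\<forall>z g. Im z \<noteq> 0 \<longrightarrow> L2G v vj g \<longrightarrow>
                   eqG v vj (resolv (TAB v vj p q \<alpha> A B) z g)
                     (\<lambda>j x. addp (Wterm v vj p q A B (W z) z g j x) (F z g j x))))))"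
proof -
  interpret star v vj p q \<alpha> using edges p_L1 q_L1 by unfold_locales
  show ?thesis
  proof (intro conjI)
    show "\<forall>T. self_adjoint_ext v vj (Smin v vj p q \<alpha>) T \<longleftrightarrow>
        (\<exists>A B :: complex^'n^'n. rank (hcat A B) = CARD('n) \<and> A ** adjm B = B ** adjm A
            \<and> T = TAB v vj p q \<alpha> A B)"
      using self_adjoint_ext_iff by blast
    show "\<forall>A B :: complex^'n^'n. rank (hcat A B) = CARD('n) \<and> A ** adjm B = B ** adjm A \<longrightarrow>
       (\<forall>z. in_resolvent v vj (TAB v vj p q \<alpha> (mat 1) 0) z \<and> in_resolvent v vj (TAB v vj p q \<alpha> A B) z \<longrightarrow>
         (\<forall>g. L2G v vj g \<longrightarrow>
            eqG v vj (resolv (TAB v vj p q \<alpha> A B) z g)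
              (\<lambda>j x. subp (resolv (TAB v vj p q \<alpha> (mat 1) 0) z g j x)
                 (GammaZ v vj p q \<alpha> z
                    ((matrix_inv (B ** Mmat v vj p q \<alpha> z - A) ** B) *v Gamma_adj v vj p q \<alpha> (cnj z) g) j x))))"
      using krein_formula by blast
    show "\<forall>A B C D :: complex^'n^'n.
        rank (hcat A B) = CARD('n) \<and> A ** adjm B = B ** adjm A
        \<and> rank (hcat C D) = CARD('n) \<and> C ** adjm D - D ** adjm C = 0
        \<and> B ** adjm C - A ** adjm D = mat 1 \<longrightarrow>
       (let W = (\<lambda>z. (D ** Mmat v vj p q \<alpha> z - C) ** matrix_inv (B ** Mmat v vj p q \<alpha> z - A))
        in mero_nevanlinna W
           \<and> (\<exists>F. entire_bdd_opfun v vj F \<and>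
                (\<forall>z g. Im z \<noteq> 0 \<longrightarrow> L2G v vj g \<longrightarrow>
                   eqG v vj (resolv (TAB v vj p q \<alpha> A B) z g)
                     (\<lambda>j x. addp (Wterm v vj p q A B (W z) z g j x) (F z g j x)))))"
    proof (intro allI impI)
      fix A B C D :: "complex^'n^'n"
      assume h: "rank (hcat A B) = CARD('n) \<and> A ** adjm B = B ** adjm A
        \<and> rank (hcat C D) = CARD('n) \<and> C ** adjm D - D ** adjm C = 0
        \<and> B ** adjm C - A ** adjm D = mat 1"
      show "let W = (\<lambda>z. (D ** Mmat v vj p q \<alpha> z - C) ** matrix_inv (B ** Mmat v vj p q \<alpha> z - A))
        in mero_nevanlinna W
           \<and> (\<exists>F. entire_bdd_opfun v vj F \<and>
                (\<forall>z g. Im z \<noteq> 0 \<longrightarrow> L2G v vj g \<longrightarrow>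
                   eqG v vj (resolv (TAB v vj p q \<alpha> A B) z g)
                     (\<lambda>j x. addp (Wterm v vj p q A B (W z) z g j x) (F z g j x))))"
        unfolding Let_def Wfun_def[symmetric]
        using Wfun_mero_nevanlinna[of A B C D] entire_Wrest[of A B C D] resolvent_Wfun[of A B C D] h by blast
    qed
  qed
qed

end
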